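(* Let $M$ be a von Neumann algebra, let $E(M)$ be its central extension, let $t_c(M)$ be the topology on $E(M)$ generated by the center-valued norm, and let $t(M)$ be the topology on $E(M)$ induced from the topology of convergence locally in measure on $LS(M)$. The following conditions are equivalent: (i) $t(M)=t_c(M)$; (ii) $M$ does not have direct summands of type II.
   Context: $M$ is a von Neumann algebra on a complex Hilbert space $H$, with center $Z(M)$, projection lattice $P(M)$, operator norm $\|\cdot\|_M$ and identity $\mathbf 1$; $p^\perp=\mathbf 1-p$. A closed linear operator $x$ affiliated with $M$ is measurable if there are $p_n\in P(M)$ with $p_n\uparrow\mathbf 1$, $p_n(H)\subset\mathcal D(x)$ and $p_n^\perp$ finite in $M$ for all $n$; $S(M)$ is the set of measurable operators. A closed affiliated operator $x$ is locally measurable if there are central projections $z_n\uparrow\mathbf 1$ with $z_nx\in S(M)$ for all $n$; these form a $*$-algebra $LS(M)$ (with strong sum, strong product and adjoint). Central extension: $E(M)$ is the $*$-subalgebra of all $x\in LS(M)$ for which there is a family $\{z_i\}_{i\in I}$ of mutually orthogonal central projections with $\bigvee_i z_i=\mathbf 1$ and $z_ix\in M$ for all $i$. Identify $Z(M)$ with $L^\infty(\Omega,\Sigma,\mu)$, where $\mu$ has the direct sum property (there is a family $\{\Omega_i\}_{i\in J}\subset\Sigma$, $0<\mu(\Omega_i)<\infty$, such that each $A\in\Sigma$ with $\mu(A)<\infty$ equals $\bigcup_{i\in J_0}(A\cap\Omega_i)\cup B$ for some countable $J_0\subset J$ and null set $B$), and the center $S(Z(M))$ of $E(M)$ with $L^0(\Omega,\Sigma,\mu)$.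 For $\varepsilon,\delta>0$, $A\in\Sigma$, $\mu(A)<\infty$ let $W(A,\varepsilon,\delta)$ be the set of $f\in L^0(\Omega,\Sigma,\mu)$ for which there is $B\in\Sigma$, $B\subseteq A$, with $\mu(A\setminus B)\le\delta$, $f\chi_B\in L^\infty$ and $\|f\chi_B\|_{L^\infty}\le\varepsilon$. Center-valued norm: for $x\in E(M)$, $\|x\|=\inf\{f\in S(Z(M)): |x|\le f\}\in S(Z(M))$. Put $O(A,\varepsilon,\delta)=\{x\in E(M):\|x\|\in W(A,\varepsilon,\delta)\}$. The vector topology $t_c(M)$ on $E(M)$ is the one in which the sets $x+O(A,\varepsilon,\delta)$ ($\varepsilon,\delta>0$, $A\in\Sigma$, $\mu(A)<\infty$) form a base of neighborhoods of $x$. Dimension function: $L_+$ is the set of (classes of) measurable functions $\Omega\to[0,\infty]$, and $d:P(M)\to L_+$ is a map such that: $d(e)$ is finite (a.e.) iff $e$ is finite; $d(e+q)=d(e)+d(q)$ if $eq=0$; $d(uu^* )=d(u^*u)$ for every partial isometry $u\in M$; $d(ze)=z\,d(e)$ for $z\in P(Z(M))$, $e\in P(M)$; $e_\alpha\uparrow e$ implies $d(e)=\sup_\alpha d(e_\alpha)$; and $d(e)=0$ only if $e=0$. The topology of convergence locally in measure on $LS(M)$ has as base of neighborhoods of zero the sets $V(A,\varepsilon,\delta)$ of all $x\in LS(M)$ for which there exist $p\in P(M)$ and $z\in P(Z(M))$ with $xp\in M$, $\|xp\|_M\le\varepsilon$, $z^\perp\in W(A,\varepsilon,\delta)$, $d(zp^\perp)\le\varepsilon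 z$ ($\varepsilon,\delta>0$, $A\in\Sigma$, $\mu(A)<\infty$). On $E(M)$, $t(M)$ denotes the induced topology.
   Formalization: The measure μ is also assumed semifinite (each set of positive measure contains one of finite positive measure); otherwise, for a II₁ factor with Ω a single point of infinite measure, both topologies are indiscrete and the equivalence fails. *)

theory Defs
  imports "HOL-Analysis.Analysis"
begin

section \<open>Complex Hilbert spaces and bounded operators\<close>

class complex_hilbert_space = banach +
  fixes scaleC :: "complex \<Rightarrow> 'a \<Rightarrow> 'a" (infixr \<open>*\<^sub>C\<close> 75)
    and cinner :: "'a \<Rightarrow> 'a \<Rightarrow> complex"
  assumes scaleC_of_real: "complex_of_real r *\<^sub>C \<xi> = r *\<^sub>R \<xi>"
    and scaleC_add_right: "c *\<^sub>C (\<xi> + \<eta>) = c *\<^sub>C \<xi> + c *\<^sub>C \<eta>"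
    and scaleC_add_left: "(c + c') *\<^sub>C \<xi> = c *\<^sub>C \<xi> + c' *\<^sub>C \<xi>"
    and scaleC_scaleC: "c *\<^sub>C c' *\<^sub>C \<xi> = (c * c') *\<^sub>C \<xi>"
    and cinner_add_left: "cinner (\<xi> + \<eta>) \<zeta> = cinner \<xi> \<zeta> + cinner \<eta> \<zeta>"
    and cinner_scaleC_left: "cinner (c *\<^sub>C \<xi>) \<eta> = c * cinner \<xi> \<eta>"
    and cinner_commute: "cinner \<eta> \<xi> = cnj (cinner \<xi> \<eta>)"
    and cinner_norm: "cinner \<xi> \<xi> = complex_of_real ((norm \<xi>)\<^sup>2)"

text \<open>The library type of bounded linear maps only knows real linearity, so complex linearity is
  imposed separately. Its norm is the operator norm.\<close>

definition bounded_ops :: "('a::complex_hilbert_space \<Rightarrow>\<^sub>L 'a) set" where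
  "bounded_ops = {T :: 'a \<Rightarrow>\<^sub>L 'a. \<forall>c \<xi>. T (c *\<^sub>C \<xi>) = c *\<^sub>C T \<xi>}"

definition adj :: "('a::complex_hilbert_space \<Rightarrow>\<^sub>L 'a) \<Rightarrow> 'a \<Rightarrow>\<^sub>L 'a" where
  "adj T = (THE S. S \<in> bounded_ops \<and> (\<forall>\<xi> \<eta>. cinner (T \<xi>) \<eta> = cinner \<xi> (S \<eta>)))"

definition commutant ::
    "('a::complex_hilbert_space \<Rightarrow>\<^sub>L 'a) set \<Rightarrow> ('a \<Rightarrow>\<^sub>L 'a) set" where
  "commutant N = {T \<in> bounded_ops. \<forall>x\<in>N. T o\<^sub>L x = x o\<^sub>L T}"

definition von_neumann_algebra :: "('a::complex_hilbert_space \<Rightarrow>\<^sub>L 'a) set \<Rightarrow> bool" where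
  "von_neumann_algebra M \<longleftrightarrow>
     M \<subseteq> bounded_ops \<and> (\<forall>x\<in>M. adj x \<in> M) \<and> commutant (commutant M) = M"

definition center :: "('a::complex_hilbert_space \<Rightarrow>\<^sub>L 'a) set \<Rightarrow> ('a \<Rightarrow>\<^sub>L 'a) set" where
  "center N = {x \<in> N. \<forall>y\<in>N. x o\<^sub>L y = y o\<^sub>L x}"


section \<open>Projections and type II\<close>

text \<open>These notions are also applied to direct summands \<open>zM\<close>, i.e. to algebras whose unit is a
  projection different from the identity operator.\<close>

definition projections :: "('a::complex_hilbert_space \<Rightarrow>\<^sub>L 'a) set \<Rightarrow> ('a \<Rightarrow>\<^sub>L 'a) set" where
  "projections N = {p \<in> N. p o\<^sub>L p = p \<and> adj p = p}"

definition proj_le ::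
    "('a::complex_hilbert_space \<Rightarrow>\<^sub>L 'a) \<Rightarrow> ('a \<Rightarrow>\<^sub>L 'a) \<Rightarrow> bool" where
  "proj_le p q \<longleftrightarrow> q o\<^sub>L p = p"

definition is_proj_sup :: "('a::complex_hilbert_space \<Rightarrow>\<^sub>L 'a) set
    \<Rightarrow> ('a \<Rightarrow>\<^sub>L 'a) set \<Rightarrow> ('a \<Rightarrow>\<^sub>L 'a) \<Rightarrow> bool" where
  "is_proj_sup N D p \<longleftrightarrow> p \<in> projections N \<and> (\<forall>a\<in>D. proj_le a p) \<and>
     (\<forall>q\<in>projections N. (\<forall>a\<in>D. proj_le a q) \<longrightarrow> proj_le p q)"

abbreviation perp :: "('a::complex_hilbert_space \<Rightarrow>\<^sub>L 'a) \<Rightarrow> 'a \<Rightarrow>\<^sub>L 'a" where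
  "perp p \<equiv> id_blinfun - p"

definition proj_equiv :: "('a::complex_hilbert_space \<Rightarrow>\<^sub>L 'a) set
    \<Rightarrow> ('a \<Rightarrow>\<^sub>L 'a) \<Rightarrow> ('a \<Rightarrow>\<^sub>L 'a) \<Rightarrow> bool" where
  "proj_equiv N p q \<longleftrightarrow> (\<exists>u\<in>N. adj u o\<^sub>L u = p \<and> u o\<^sub>L adj u = q)"

definition finite_projection ::
    "('a::complex_hilbert_space \<Rightarrow>\<^sub>L 'a) set \<Rightarrow> ('a \<Rightarrow>\<^sub>L 'a) \<Rightarrow> bool" where
  "finite_projection N p \<longleftrightarrow> p \<in> projections N \<and>
     (\<forall>q\<in>projections N. proj_le q p \<and> proj_equiv N p q \<longrightarrow> q = p)"

definition abelian_projection ::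
    "('a::complex_hilbert_space \<Rightarrow>\<^sub>L 'a) set \<Rightarrow> ('a \<Rightarrow>\<^sub>L 'a) \<Rightarrow> bool" where
  "abelian_projection N e \<longleftrightarrow> e \<in> projections N \<and>
     (\<forall>x\<in>N. \<forall>y\<in>N. (e o\<^sub>L x o\<^sub>L e) o\<^sub>L (e o\<^sub>L y o\<^sub>L e) = (e o\<^sub>L y o\<^sub>L e) o\<^sub>L (e o\<^sub>L x o\<^sub>L e))"

definition type_II :: "('a::complex_hilbert_space \<Rightarrow>\<^sub>L 'a) set \<Rightarrow> bool" where
  "type_II N \<longleftrightarrow> (\<forall>e. abelian_projection N e \<longrightarrow> e = 0) \<and>
     (\<forall>z\<in>projections (center N). z \<noteq> 0 \<longrightarrow>
        (\<exists>e. finite_projection N e \<and> e \<noteq> 0 \<and> proj_le e z))"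

definition direct_summand :: "('a::complex_hilbert_space \<Rightarrow>\<^sub>L 'a) set
    \<Rightarrow> ('a \<Rightarrow>\<^sub>L 'a) \<Rightarrow> ('a \<Rightarrow>\<^sub>L 'a) set" where
  "direct_summand M z = (\<lambda>x. z o\<^sub>L x) ` M"

definition has_type_II_summand :: "('a::complex_hilbert_space \<Rightarrow>\<^sub>L 'a) set \<Rightarrow> bool" where
  "has_type_II_summand M \<longleftrightarrow>
     (\<exists>z\<in>projections (center M). z \<noteq> 0 \<and> type_II (direct_summand M z))"


section \<open>Unbounded operators\<close>

text \<open>A partially defined operator \<open>x\<close> is its graph: \<open>(\<xi>, \<eta>) \<in> x\<close> means that \<open>\<xi>\<close> is in the domain
  and \<open>x \<xi> = \<eta>\<close>. Its domain is \<^term>\<open>Domain x\<close>. Beware that the operator product \<open>x y\<close> is the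
  relational composite \<open>y O x\<close>.\<close>

type_synonym 'a operator = "('a \<times> 'a) set"

definition op_graph :: "('a::complex_hilbert_space \<Rightarrow>\<^sub>L 'a) \<Rightarrow> 'a operator" where
  "op_graph T = {(\<xi>, T \<xi>) | \<xi>. True}"

definition closed_operator :: "'a::complex_hilbert_space operator \<Rightarrow> bool" where
  "closed_operator x \<longleftrightarrow> (0, 0) \<in> x \<and>
     (\<forall>\<xi> \<eta> \<xi>' \<eta>'. (\<xi>, \<eta>) \<in> x \<longrightarrow> (\<xi>', \<eta>') \<in> x \<longrightarrow> (\<xi> + \<xi>', \<eta> + \<eta>') \<in> x) \<and>
     (\<forall>c \<xi> \<eta>. (\<xi>, \<eta>) \<in> x \<longrightarrow> (c *\<^sub>C \<xi>, c *\<^sub>C \<eta>) \<in> x) \<and>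
     single_valued x \<and> closed x"

definition affiliated ::
    "('a::complex_hilbert_space \<Rightarrow>\<^sub>L 'a) set \<Rightarrow> 'a operator \<Rightarrow> bool" where
  "affiliated M x \<longleftrightarrow> (\<forall>y\<in>commutant M. \<forall>\<xi> \<eta>. (\<xi>, \<eta>) \<in> x \<longrightarrow> (y \<xi>, y \<eta>) \<in> x)"

definition strong_prod ::
    "'a::complex_hilbert_space operator \<Rightarrow> 'a operator \<Rightarrow> 'a operator" where
  "strong_prod x y = closure (y O x)"

definition strong_sum ::
    "'a::complex_hilbert_space operator \<Rightarrow> 'a operator \<Rightarrow> 'a operator" where
  "strong_sum x y = closure {(\<xi>, \<eta> + \<zeta>) | \<xi> \<eta> \<zeta>. (\<xi>, \<eta>) \<in> x \<and> (\<xi>, \<zeta>) \<in> y}"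

definition strong_diff ::
    "'a::complex_hilbert_space operator \<Rightarrow> 'a operator \<Rightarrow> 'a operator" where
  "strong_diff x y = closure {(\<xi>, \<eta> - \<zeta>) | \<xi> \<eta> \<zeta>. (\<xi>, \<eta>) \<in> x \<and> (\<xi>, \<zeta>) \<in> y}"

definition op_adjoint :: "'a::complex_hilbert_space operator \<Rightarrow> 'a operator" where
  "op_adjoint x = {(\<eta>, \<zeta>). \<forall>(\<xi>, \<theta>)\<in>x. cinner \<theta> \<eta> = cinner \<xi> \<zeta>}"

definition positive_operator :: "'a::complex_hilbert_space operator \<Rightarrow> bool" where
  "positive_operator x \<longleftrightarrow>
     closed_operator x \<and> op_adjoint x = x \<and> (\<forall>(\<xi>, \<eta>)\<in>x. cinner \<eta> \<xi> \<in> \<real>\<^sub>\<ge>\<^sub>0)"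

definition op_le :: "'a::complex_hilbert_space operator \<Rightarrow> 'a operator \<Rightarrow> bool" where
  "op_le x y \<longleftrightarrow> positive_operator (strong_diff y x)"

text \<open>\<open>|x|\<close> is the positive square root of \<open>x\<^sup>*x\<close>.\<close>

definition modulus :: "'a::complex_hilbert_space operator \<Rightarrow> 'a operator" where
  "modulus x = (THE h. positive_operator h \<and> h O h = x O op_adjoint x)"


section \<open>The algebras \<open>S(M)\<close>, \<open>LS(M)\<close> and \<open>E(M)\<close>\<close>

definition increases_to_one ::
    "('a::complex_hilbert_space \<Rightarrow>\<^sub>L 'a) set \<Rightarrow> (nat \<Rightarrow> 'a \<Rightarrow>\<^sub>L 'a) \<Rightarrow> bool" where
  "increases_to_one M p \<longleftrightarrow>
     (\<forall>n. proj_le (p n) (p (Suc n))) \<and> is_proj_sup M (range p) id_blinfun"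

definition measurable_ops ::
    "('a::complex_hilbert_space \<Rightarrow>\<^sub>L 'a) set \<Rightarrow> 'a operator set" where
  "measurable_ops M = {x. closed_operator x \<and> affiliated M x \<and>
     (\<exists>p. (\<forall>n. p n \<in> projections M) \<and> increases_to_one M p \<and>
        (\<forall>n. range (blinfun_apply (p n)) \<subseteq> Domain x) \<and>
        (\<forall>n. finite_projection M (perp (p n))))}"

text \<open>In the two definitions below \<open>zx\<close> has to be read as the strong product, i.e. as the closure of
  the composite: the bare composite has the domain of \<open>x\<close> and is in general not closed.\<close>

definition loc_measurable_ops ::
    "('a::complex_hilbert_space \<Rightarrow>\<^sub>L 'a) set \<Rightarrow> 'a operator set" where
  "loc_measurable_ops M = {x. closed_operator x \<and> affiliated M x \<and>
     (\<exists>z. (\<forall>n. z n \<in> projections (center M)) \<and> increases_to_one M z \<and>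
        (\<forall>n. strong_prod (op_graph (z n)) x \<in> measurable_ops M))}"

definition central_extension ::
    "('a::complex_hilbert_space \<Rightarrow>\<^sub>L 'a) set \<Rightarrow> 'a operator set" where
  "central_extension M = {x \<in> loc_measurable_ops M.
     \<exists>Z \<subseteq> projections (center M).
       (\<forall>z\<in>Z. \<forall>w\<in>Z. z \<noteq> w \<longrightarrow> z o\<^sub>L w = 0) \<and> is_proj_sup M Z id_blinfun \<and>
       (\<forall>z\<in>Z. strong_prod (op_graph z) x \<in> op_graph ` M)}"

text \<open>The infimum is taken in \<open>S(Z(M))\<close> with its operator order.\<close>

definition center_norm ::
    "('a::complex_hilbert_space \<Rightarrow>\<^sub>L 'a) set \<Rightarrow> 'a operator \<Rightarrow> 'a operator" where
  "center_norm M x =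
     (let SZ = measurable_ops (center M); F = {f \<in> SZ. op_le (modulus x) f}
      in THE c. c \<in> SZ \<and> (\<forall>f\<in>F. op_le c f) \<and>
           (\<forall>g\<in>SZ. (\<forall>f\<in>F. op_le g f) \<longrightarrow> op_le g c))"


section \<open>Representing the center by functions\<close>

text \<open>Elements of \<open>L\<^sup>0\<close> and \<open>L\<^sup>\<infinity>\<close> are represented by functions; all notions below are invariant under
  equality almost everywhere.\<close>

definition direct_sum_property :: "'b measure \<Rightarrow> bool" where
  "direct_sum_property \<mu> \<longleftrightarrow>
     (\<exists>\<O> \<subseteq> sets \<mu>. (\<forall>S\<in>\<O>. 0 < emeasure \<mu> S \<and> emeasure \<mu> S < \<infinity>) \<and>
       (\<forall>A\<in>sets \<mu>. emeasure \<mu> A < \<infinity> \<longrightarrow>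
          (\<exists>\<O>\<^sub>0 \<subseteq> \<O>. \<exists>B\<in>null_sets \<mu>. countable \<O>\<^sub>0 \<and> A = (\<Union>S\<in>\<O>\<^sub>0. A \<inter> S) \<union> B)))"

text \<open>The direct sum property only constrains sets of finite measure, and would hold vacuously if
  all sets were null or of infinite measure; as usual in this context, the measure is understood
  to be semifinite. (The library locale \<open>semifinite_measure\<close> does not express this: its condition is
  met by the empty subset.)\<close>

definition semifinite :: "'b measure \<Rightarrow> bool" where
  "semifinite \<mu> \<longleftrightarrow> (\<forall>A\<in>sets \<mu>. emeasure \<mu> A > 0 \<longrightarrow>
     (\<exists>B\<in>sets \<mu>. B \<subseteq> A \<and> 0 < emeasure \<mu> B \<and> emeasure \<mu> B < \<infinity>))"

definition Linf :: "'b measure \<Rightarrow> ('b \<Rightarrow> complex) set" where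
  "Linf \<mu> = {f \<in> borel_measurable \<mu>. \<exists>C. AE \<omega> in \<mu>. cmod (f \<omega>) \<le> C}"

definition Linf_norm :: "'b measure \<Rightarrow> ('b \<Rightarrow> complex) \<Rightarrow> real" where
  "Linf_norm \<mu> f = Inf {C. 0 \<le> C \<and> (AE \<omega> in \<mu>. cmod (f \<omega>) \<le> C)}"

text \<open>\<open>\<Phi>\<close> induces a *-isomorphism of \<open>L\<^sup>\<infinity>\<close> onto \<open>Z(M)\<close>.\<close>

definition center_iso :: "('a::complex_hilbert_space \<Rightarrow>\<^sub>L 'a) set \<Rightarrow> 'b measure
    \<Rightarrow> (('b \<Rightarrow> complex) \<Rightarrow> 'a \<Rightarrow>\<^sub>L 'a) \<Rightarrow> bool" where
  "center_iso M \<mu> \<Phi> \<longleftrightarrow> \<Phi> ` Linf \<mu> = center M \<and>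
     (\<forall>f\<in>Linf \<mu>. \<forall>g\<in>Linf \<mu>.
        (\<Phi> f = \<Phi> g \<longleftrightarrow> (AE \<omega> in \<mu>. f \<omega> = g \<omega>)) \<and>
        \<Phi> (\<lambda>\<omega>. f \<omega> + g \<omega>) = \<Phi> f + \<Phi> g \<and>
        \<Phi> (\<lambda>\<omega>. f \<omega> * g \<omega>) = \<Phi> f o\<^sub>L \<Phi> g) \<and>
     (\<forall>f\<in>Linf \<mu>. \<Phi> (\<lambda>\<omega>. cnj (f \<omega>)) = adj (\<Phi> f) \<and>
        (\<forall>c \<xi>. \<Phi> (\<lambda>\<omega>. c * f \<omega>) \<xi> = c *\<^sub>C \<Phi> f \<xi>))"

text \<open>The extension of \<open>\<Phi>\<close> to the identification of \<open>L\<^sup>0\<close> with \<open>S(Z(M))\<close>. It is determined by \<open>\<Phi>\<close>,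
  since \<open>f\<close> is bounded on each of the sets \<open>{|f| \<le> n}\<close>, which exhaust the measure space.\<close>

definition represents :: "('a::complex_hilbert_space \<Rightarrow>\<^sub>L 'a) set \<Rightarrow> 'b measure
    \<Rightarrow> (('b \<Rightarrow> complex) \<Rightarrow> 'a \<Rightarrow>\<^sub>L 'a) \<Rightarrow> ('b \<Rightarrow> complex) \<Rightarrow> 'a operator \<Rightarrow> bool" where
  "represents M \<mu> \<Phi> f x \<longleftrightarrow> f \<in> borel_measurable \<mu> \<and> x \<in> measurable_ops (center M) \<and>
     (\<forall>E\<in>sets \<mu>. (\<lambda>\<omega>. f \<omega> * indicator E \<omega>) \<in> Linf \<mu> \<longrightarrow>
        strong_prod x (op_graph (\<Phi> (indicator E))) = op_graph (\<Phi> (\<lambda>\<omega>. f \<omega> * indicator E \<omega>)))"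

definition W_nbhd :: "'b measure \<Rightarrow> 'b set \<Rightarrow> real \<Rightarrow> real \<Rightarrow> ('b \<Rightarrow> complex) set" where
  "W_nbhd \<mu> A \<epsilon> \<delta> = {f \<in> borel_measurable \<mu>.
     \<exists>B\<in>sets \<mu>. B \<subseteq> A \<and> emeasure \<mu> (A - B) \<le> ennreal \<delta> \<and>
       (\<lambda>\<omega>. f \<omega> * indicator B \<omega>) \<in> Linf \<mu> \<and>
       Linf_norm \<mu> (\<lambda>\<omega>. f \<omega> * indicator B \<omega>) \<le> \<epsilon>}"

text \<open>In the condition for \<open>e\<^sub>\<alpha> \<up> e\<close>, increasing nets are rendered as upward directed sets of
  projections, and the supremum is the one of \<open>L\<^sub>+\<close> modulo null sets, not the pointwise one.\<close>

definition dimension_function :: "('a::complex_hilbert_space \<Rightarrow>\<^sub>L 'a) set \<Rightarrow> 'b measure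
    \<Rightarrow> (('b \<Rightarrow> complex) \<Rightarrow> 'a \<Rightarrow>\<^sub>L 'a) \<Rightarrow> (('a \<Rightarrow>\<^sub>L 'a) \<Rightarrow> 'b \<Rightarrow> ennreal) \<Rightarrow> bool" where
  "dimension_function M \<mu> \<Phi> d \<longleftrightarrow>
     (\<forall>e\<in>projections M. d e \<in> borel_measurable \<mu>) \<and>
     (\<forall>e\<in>projections M. (AE \<omega> in \<mu>. d e \<omega> < \<infinity>) \<longleftrightarrow> finite_projection M e) \<and>
     (\<forall>e\<in>projections M. \<forall>q\<in>projections M. e o\<^sub>L q = 0 \<longrightarrow>
        (AE \<omega> in \<mu>. d (e + q) \<omega> = d e \<omega> + d q \<omega>)) \<and>
     (\<forall>u\<in>M. u o\<^sub>L adj u o\<^sub>L u = u \<longrightarrow>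
        (AE \<omega> in \<mu>. d (u o\<^sub>L adj u) \<omega> = d (adj u o\<^sub>L u) \<omega>)) \<and>
     (\<forall>E\<in>sets \<mu>. \<forall>e\<in>projections M.
        (AE \<omega> in \<mu>. d (\<Phi> (indicator E) o\<^sub>L e) \<omega> = indicator E \<omega> * d e \<omega>)) \<and>
     (\<forall>D e. D \<subseteq> projections M \<longrightarrow> D \<noteq> {} \<longrightarrow>
        (\<forall>a\<in>D. \<forall>b\<in>D. \<exists>c\<in>D. proj_le a c \<and> proj_le b c) \<longrightarrow> is_proj_sup M D e \<longrightarrow>
        (\<forall>a\<in>D. AE \<omega> in \<mu>. d a \<omega> \<le> d e \<omega>) \<and>
        (\<forall>g\<in>borel_measurable \<mu>. (\<forall>a\<in>D. AE \<omega> in \<mu>. d a \<omega> \<le> g \<omega>) \<longrightarrow>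
           (AE \<omega> in \<mu>. d e \<omega> \<le> g \<omega>))) \<and>
     (\<forall>e\<in>projections M. (AE \<omega> in \<mu>. d e \<omega> = 0) \<longrightarrow> e = 0)"


section \<open>The two topologies\<close>

definition O_nbhd :: "('a::complex_hilbert_space \<Rightarrow>\<^sub>L 'a) set \<Rightarrow> 'b measure
    \<Rightarrow> (('b \<Rightarrow> complex) \<Rightarrow> 'a \<Rightarrow>\<^sub>L 'a) \<Rightarrow> 'b set \<Rightarrow> real \<Rightarrow> real \<Rightarrow> 'a operator set" where
  "O_nbhd M \<mu> \<Phi> A \<epsilon> \<delta> =
     {x \<in> central_extension M. \<exists>f\<in>W_nbhd \<mu> A \<epsilon> \<delta>. represents M \<mu> \<Phi> f (center_norm M x)}"

text \<open>Every central projection \<open>z\<close> is the image under \<open>\<Phi>\<close> of an indicator function.\<close>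

definition V_nbhd :: "('a::complex_hilbert_space \<Rightarrow>\<^sub>L 'a) set \<Rightarrow> 'b measure
    \<Rightarrow> (('b \<Rightarrow> complex) \<Rightarrow> 'a \<Rightarrow>\<^sub>L 'a) \<Rightarrow> (('a \<Rightarrow>\<^sub>L 'a) \<Rightarrow> 'b \<Rightarrow> ennreal)
    \<Rightarrow> 'b set \<Rightarrow> real \<Rightarrow> real \<Rightarrow> 'a operator set" where
  "V_nbhd M \<mu> \<Phi> d A \<epsilon> \<delta> = {x \<in> loc_measurable_ops M.
     \<exists>p\<in>projections M. \<exists>z\<in>projections (center M). \<exists>E\<in>sets \<mu>. z = \<Phi> (indicator E) \<and>
       (\<exists>T\<in>M. strong_prod x (op_graph p) = op_graph T \<and> norm T \<le> \<epsilon>) \<and>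
       (\<exists>f\<in>W_nbhd \<mu> A \<epsilon> \<delta>. represents M \<mu> \<Phi> f (op_graph (perp z))) \<and>
       (AE \<omega> in \<mu>. d (z o\<^sub>L perp p) \<omega> \<le> ennreal \<epsilon> * indicator E \<omega>)}"

text \<open>The topology on a set \<open>X\<close> of operators such that the translates \<open>x + N A \<epsilon> \<delta>\<close>, with
  \<open>\<mu> A < \<infinity>\<close> and \<open>\<epsilon>, \<delta> > 0\<close>, form a base of neighborhoods of \<open>x\<close>.\<close>

definition translation_topology :: "'b measure \<Rightarrow> 'a::complex_hilbert_space operator set
    \<Rightarrow> ('b set \<Rightarrow> real \<Rightarrow> real \<Rightarrow> 'a operator set) \<Rightarrow> 'a operator topology" where
  "translation_topology \<mu> X N = topology (\<lambda>U. U \<subseteq> X \<and>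
     (\<forall>x\<in>U. \<exists>A\<in>sets \<mu>. \<exists>\<epsilon>>0. \<exists>\<delta>>0. emeasure \<mu> A < \<infinity> \<and> strong_sum x ` N A \<epsilon> \<delta> \<subseteq> U))"

definition center_norm_topology :: "('a::complex_hilbert_space \<Rightarrow>\<^sub>L 'a) set \<Rightarrow> 'b measure
    \<Rightarrow> (('b \<Rightarrow> complex) \<Rightarrow> 'a \<Rightarrow>\<^sub>L 'a) \<Rightarrow> 'a operator topology" where
  "center_norm_topology M \<mu> \<Phi> =
     translation_topology \<mu> (central_extension M) (O_nbhd M \<mu> \<Phi>)"

definition loc_measure_topology :: "('a::complex_hilbert_space \<Rightarrow>\<^sub>L 'a) set \<Rightarrow> 'b measure
    \<Rightarrow> (('b \<Rightarrow> complex) \<Rightarrow> 'a \<Rightarrow>\<^sub>L 'a) \<Rightarrow> (('a \<Rightarrow>\<^sub>L 'a) \<Rightarrow> 'b \<Rightarrow> ennreal)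
    \<Rightarrow> 'a operator topology" where
  "loc_measure_topology M \<mu> \<Phi> d =
     translation_topology \<mu> (loc_measurable_ops M) (V_nbhd M \<mu> \<Phi> d)"

lemma openin_translation_topology:
  assumes mono: "\<And>A A' \<epsilon> \<epsilon>' \<delta> \<delta>'. A \<subseteq> A' \<Longrightarrow> A \<in> sets \<mu> \<Longrightarrow> A' \<in> sets \<mu> \<Longrightarrow> \<epsilon> \<le> \<epsilon>' \<Longrightarrow> \<delta> \<le> \<delta>' \<Longrightarrow>
    N A' \<epsilon> \<delta> \<subseteq> N A \<epsilon>' \<delta>'"
  shows "openin (translation_topology \<mu> X N) U \<longleftrightarrow> U \<subseteq> X \<and>
    (\<forall>x\<in>U. \<exists>A\<in>sets \<mu>. \<exists>\<epsilon>>0. \<exists>\<delta>>0. emeasure \<mu> A < \<infinity> \<and> strong_sum x ` N A \<epsilon> \<delta> \<subseteq> U)"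
proof -
  define Q where "Q U x \<longleftrightarrow>
    (\<exists>A\<in>sets \<mu>. \<exists>\<epsilon>>0. \<exists>\<delta>>0. emeasure \<mu> A < \<infinity> \<and> strong_sum x ` N A \<epsilon> \<delta> \<subseteq> U)" for U x
  have Int: "Q (U \<inter> U') x" if "Q U x" "Q U' x" for U U' x
  proof -
    obtain A \<epsilon> \<delta> A' \<epsilon>' \<delta>' where
      N: "A \<in> sets \<mu>" "emeasure \<mu> A < \<infinity>" "0 < \<epsilon>" "0 < \<delta>" "strong_sum x ` N A \<epsilon> \<delta> \<subseteq> U" and
      N': "A' \<in> sets \<mu>" "emeasure \<mu> A' < \<infinity>" "0 < \<epsilon>'" "0 < \<delta>'" "strong_sum x ` N A' \<epsilon>' \<delta>' \<subseteq> U'"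
      using \<open>Q U x\<close> \<open>Q U' x\<close> unfolding Q_def by meson
    have "emeasure \<mu> (A \<union> A') < \<infinity>"
      using N(2) N'(2) by (intro le_less_trans[OF emeasure_subadditive[OF N(1) N'(1)]]) simp
    moreover have "A \<union> A' \<in> sets \<mu>" "0 < min \<epsilon> \<epsilon>'" "0 < min \<delta> \<delta>'" using N N' by auto
    moreover have "N (A \<union> A') (min \<epsilon> \<epsilon>') (min \<delta> \<delta>') \<subseteq> N A \<epsilon> \<delta>"
      by (rule mono) (use N N' in auto)
    moreover have "N (A \<union> A') (min \<epsilon> \<epsilon>') (min \<delta> \<delta>') \<subseteq> N A' \<epsilon>' \<delta>'"
      by (rule mono) (use N N' in auto)
    ultimately show ?thesis
      unfolding Q_def using N(5) N'(5) by (meson Int_greatest image_mono subset_trans)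
  qed
  have Sup: "Q U' x" if "Q U x" "U \<subseteq> U'" for U U' x
    using that unfolding Q_def by (meson subset_trans)
  have "istopology (\<lambda>U. U \<subseteq> X \<and> (\<forall>x\<in>U. Q U x))"
    unfolding istopology_def
  proof (intro conjI allI impI ballI)
    fix \<K> x assume "\<forall>U\<in>\<K>. U \<subseteq> X \<and> (\<forall>x\<in>U. Q U x)" "x \<in> \<Union>\<K>"
    then show "Q (\<Union>\<K>) x" by (meson Sup UnionE Union_upper)
  qed (use Int in blast)+
  then show ?thesis
    unfolding translation_topology_def Q_def by (simp only: topology_inverse')
qed

lemma W_nbhd_mono:
  assumes "A \<subseteq> A'" "A \<in> sets \<mu>" "A' \<in> sets \<mu>" "\<epsilon> \<le> \<epsilon>'" "\<delta> \<le> \<delta>'"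
  shows "W_nbhd \<mu> A' \<epsilon> \<delta> \<subseteq> W_nbhd \<mu> A \<epsilon>' \<delta>'"
proof
  fix f assume "f \<in> W_nbhd \<mu> A' \<epsilon> \<delta>"
  then obtain B where f: "f \<in> borel_measurable \<mu>" and B: "B \<in> sets \<mu>" "B \<subseteq> A'"
    and m: "emeasure \<mu> (A' - B) \<le> ennreal \<delta>"
    and bd: "(\<lambda>\<omega>. f \<omega> * indicator B \<omega>) \<in> Linf \<mu>"
    and nrm: "Linf_norm \<mu> (\<lambda>\<omega>. f \<omega> * indicator B \<omega>) \<le> \<epsilon>"
    unfolding W_nbhd_def by blast
  let ?g = "\<lambda>\<omega>. f \<omega> * indicator B \<omega>" and ?h = "\<lambda>\<omega>. f \<omega> * indicator (B \<inter> A) \<omega>"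
  have le: "cmod (?h \<omega>) \<le> cmod (?g \<omega>)" for \<omega>
    by (auto simp: indicator_def)
  have imp: "AE \<omega> in \<mu>. cmod (?h \<omega>) \<le> C" if "AE \<omega> in \<mu>. cmod (?g \<omega>) \<le> C" for C
    using that by eventually_elim (rule order_trans[OF le])
  have BA: "B \<inter> A \<in> sets \<mu>" using B assms by auto
  have h: "?h \<in> Linf \<mu>"
    using bd imp f BA unfolding Linf_def by auto
  obtain C where "AE \<omega> in \<mu>. cmod (?g \<omega>) \<le> C" using bd unfolding Linf_def by blast
  then have "AE \<omega> in \<mu>. cmod (?g \<omega>) \<le> max C 0" by eventually_elim auto
  then have "{C. 0 \<le> C \<and> (AE \<omega> in \<mu>. cmod (?g \<omega>) \<le> C)} \<noteq> {}"
    using max.cobounded2[of 0 C] by blast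
  then have "Linf_norm \<mu> ?h \<le> Linf_norm \<mu> ?g"
    unfolding Linf_norm_def
  proof (rule cInf_superset_mono)
    show "bdd_below {C. 0 \<le> C \<and> (AE \<omega> in \<mu>. cmod (?h \<omega>) \<le> C)}"
      by (rule bdd_belowI[of _ 0]) blast
  qed (use imp in blast)+
  moreover have "emeasure \<mu> (A - B \<inter> A) \<le> emeasure \<mu> (A' - B)"
    using assms B by (intro emeasure_mono) auto
  moreover have "ennreal \<delta> \<le> ennreal \<delta>'" using assms by (simp add: ennreal_leI)
  ultimately show "f \<in> W_nbhd \<mu> A \<epsilon>' \<delta>'"
    unfolding W_nbhd_def using f h BA nrm m assms(4)
    by (intro CollectI conjI bexI[of _ "B \<inter> A"]) (auto intro: order_trans)
qed

lemma V_nbhd_mono: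
  assumes "A \<subseteq> A'" "A \<in> sets \<mu>" "A' \<in> sets \<mu>" "\<epsilon> \<le> \<epsilon>'" "\<delta> \<le> \<delta>'"
  shows "V_nbhd M \<mu> \<Phi> d A' \<epsilon> \<delta> \<subseteq> V_nbhd M \<mu> \<Phi> d A \<epsilon>' \<delta>'"
proof
  fix x assume "x \<in> V_nbhd M \<mu> \<Phi> d A' \<epsilon> \<delta>"
  then obtain p z E T f where x: "x \<in> loc_measurable_ops M" "p \<in> projections M"
    "z \<in> projections (center M)" "E \<in> sets \<mu>" "z = \<Phi> (indicator E)" "T \<in> M"
    "strong_prod x (op_graph p) = op_graph T" and n: "norm T \<le> \<epsilon>"
    and f: "f \<in> W_nbhd \<mu> A' \<epsilon> \<delta>" "represents M \<mu> \<Phi> f (op_graph (perp z))"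
    and dd: "AE \<omega> in \<mu>. d (z o\<^sub>L perp p) \<omega> \<le> ennreal \<epsilon> * indicator E \<omega>"
    unfolding V_nbhd_def by blast
  have dd': "AE \<omega> in \<mu>. d (z o\<^sub>L perp p) \<omega> \<le> ennreal \<epsilon>' * indicator E \<omega>"
    using dd
  proof eventually_elim
    case (elim \<omega>)
    also have "ennreal \<epsilon> * indicator E \<omega> \<le> ennreal \<epsilon>' * indicator E \<omega>"
      using assms by (intro mult_right_mono ennreal_leI) auto
    finally show ?case .
  qed
  have "norm T \<le> \<epsilon>'" "f \<in> W_nbhd \<mu> A \<epsilon>' \<delta>'"
    using n f assms W_nbhd_mono[OF assms] by auto
  then show "x \<in> V_nbhd M \<mu> \<Phi> d A \<epsilon>' \<delta>'"
    using x f(2) dd' unfolding V_nbhd_def by blast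
qed

lemma O_nbhd_mono:
  assumes "A \<subseteq> A'" "A \<in> sets \<mu>" "A' \<in> sets \<mu>" "\<epsilon> \<le> \<epsilon>'" "\<delta> \<le> \<delta>'"
  shows "O_nbhd M \<mu> \<Phi> A' \<epsilon> \<delta> \<subseteq> O_nbhd M \<mu> \<Phi> A \<epsilon>' \<delta>'"
  using W_nbhd_mono[OF assms] unfolding O_nbhd_def by blast

lemma openin_center_norm_topology:
  "openin (center_norm_topology M \<mu> \<Phi>) U \<longleftrightarrow> U \<subseteq> central_extension M \<and>
     (\<forall>x\<in>U. \<exists>A\<in>sets \<mu>. \<exists>\<epsilon>>0. \<exists>\<delta>>0. emeasure \<mu> A < \<infinity> \<and>
        strong_sum x ` O_nbhd M \<mu> \<Phi> A \<epsilon> \<delta> \<subseteq> U)"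
  unfolding center_norm_topology_def by (rule openin_translation_topology) (rule O_nbhd_mono)

lemma openin_loc_measure_topology:
  "openin (loc_measure_topology M \<mu> \<Phi> d) U \<longleftrightarrow> U \<subseteq> loc_measurable_ops M \<and>
     (\<forall>x\<in>U. \<exists>A\<in>sets \<mu>. \<exists>\<epsilon>>0. \<exists>\<delta>>0. emeasure \<mu> A < \<infinity> \<and>
        strong_sum x ` V_nbhd M \<mu> \<Phi> d A \<epsilon> \<delta> \<subseteq> U)"
  unfolding loc_measure_topology_def by (rule openin_translation_topology) (rule V_nbhd_mono)

end

theory Submission
  imports Defs
begin

text \<open>Both neighborhood bases restrict the size of \<open>x\<close>, but the base sets \<open>O(A, \<epsilon>, \<delta>)\<close> of \<open>t\<^sub>c(M)\<close> only
  allow to discard central projections \<open>\<chi>\<^sub>A\<^sub>\<setminus>\<^sub>B\<close> with \<open>\<mu> (A - B) \<le> \<delta>\<close>, while the sets \<open>V(A, \<epsilon>, \<delta>)\<close> of \<open>t(M)\<close> also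
  allow to discard arbitrary projections of dimension at most \<open>\<epsilon>\<close>. The topologies therefore agree exactly if
  small projections are negligible, and this is what the absence of a type II summand means.

  To see this, the center-valued norm has to be made explicit. An operator belongs to \<open>E(M)\<close> exactly if it
  is glued from bounded pieces \<open>T\<^sub>n \<in> M\<close> over central projections \<open>z\<^sub>n \<up> 1\<close> (\<open>central_extension_iff\<close>), and sum,
  order and modulus may be computed piecewise (\<open>modulus_glue\<close>, which rests on the uniqueness of positive square
  roots in \<open>positive_root_unique\<close>). The center-valued norm of \<open>x\<close> is then the function whose sublevel set at \<open>r\<close> corresponds to
  the largest central projection \<open>z\<close> with \<open>\<parallel>x z\<parallel> \<le> r\<close> (\<open>center_norm_function\<close>). Hence \<open>O(A, \<epsilon>, \<delta>)\<close> consists of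
  the \<open>x\<close> with \<open>\<parallel>x \<chi>\<^sub>B\<parallel> \<le> \<epsilon>\<close> for some \<open>B \<subseteq> A\<close> with \<open>\<mu> (A - B) \<le> \<delta>\<close> (\<open>O_nbhd_iff\<close>). In particular
  \<open>O(A, \<epsilon>, \<delta>) \<subseteq> V(A, \<epsilon>, \<delta>)\<close>, so that \<open>t(M)\<close> is coarser than \<open>t\<^sub>c(M)\<close> for every \<open>M\<close>.

  Suppose that \<open>M\<close> has no type II summand. A non-zero central projection then either dominates a non-zero
  abelian projection \<open>e\<close>, or a non-zero central projection without non-zero finite subprojections. In the first case every
  non-zero projection under the central support of \<open>e\<close> has somewhere at least the dimension of \<open>e\<close>; in the second
  case every non-zero subprojection has somewhere infinite dimension. Either way a non-zero central part is found
  on which projections of sufficiently small dimension vanish (\<open>small_projections_vanish\<close>). Such parts exhaust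
  \<open>1\<close>, hence discarding small projections amounts to discarding central ones: \<open>LS(M) = E(M)\<close>
  (\<open>loc_measurable_eq_central_extension\<close>), and every \<open>O(A, \<epsilon>, \<delta>)\<close> contains some \<open>V(A, \<epsilon>', \<delta>')\<close>
  (\<open>V_nbhd_subset_O_nbhd\<close>).

  Suppose that \<open>M\<close> has a type II summand, and let \<open>e\<close> be a non-zero finite projection in it. No non-zero
  subprojection of \<open>e\<close> is abelian, so each of them contains two orthogonal non-zero equivalent projections
  (\<open>nonabelian_split\<close>), and by exhaustion \<open>e\<close> has subprojections \<open>f\<^sub>n\<close> with the same central support and
  \<open>d(f\<^sub>n) \<le> 2\<^sup>-\<^sup>n d(e)\<close> (\<open>halving_sequence\<close>). As \<open>d(e)\<close> is finite, \<open>f\<^sub>n\<close> tends to \<open>0\<close> in \<open>t(M)\<close>; it does not in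
  \<open>t\<^sub>c(M)\<close>, because the center-valued norm of \<open>f\<^sub>n\<close> is \<open>1\<close> on the central support of \<open>e\<close>.\<close>

section \<open>Hilbert space geometry\<close>

lemma scaleC_zero_left [simp]: "0 *\<^sub>C (\<xi>::'a::complex_hilbert_space) = 0"
  using scaleC_of_real[of 0 \<xi>] by simp

lemma scaleC_one [simp]: "1 *\<^sub>C (\<xi>::'a::complex_hilbert_space) = \<xi>"
  using scaleC_of_real[of 1 \<xi>] by simp

lemma scaleC_zero_right [simp]: "c *\<^sub>C (0::'a::complex_hilbert_space) = 0"
  using scaleC_scaleC[of c 0 0] by simp

lemma scaleC_minus_one [simp]: "(- 1) *\<^sub>C (\<xi>::'a::complex_hilbert_space) = - \<xi>"
  using scaleC_of_real[of "-1" \<xi>] by simp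

lemma scaleC_minus_right: "c *\<^sub>C (- \<xi>) = - (c *\<^sub>C (\<xi>::'a::complex_hilbert_space))"
  using scaleC_add_right[of c \<xi> "-\<xi>"] by (simp add: eq_neg_iff_add_eq_0 add.commute)

lemma scaleC_diff_right: "c *\<^sub>C (\<xi> - \<eta>) = c *\<^sub>C \<xi> - c *\<^sub>C (\<eta>::'a::complex_hilbert_space)"
  using scaleC_add_right[of c \<xi> "-\<eta>"] by (simp add: scaleC_minus_right)

lemma scaleR_eq_scaleC: "r *\<^sub>R \<xi> = complex_of_real r *\<^sub>C (\<xi>::'a::complex_hilbert_space)"
  by (simp add: scaleC_of_real)

lemma cinner_add_right:
  "cinner \<xi> (\<eta> + \<zeta>) = cinner \<xi> \<eta> + cinner \<xi> (\<zeta>::'a::complex_hilbert_space)"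
  by (subst (1 2 3) cinner_commute) (simp add: cinner_add_left)

lemma cinner_scaleC_right:
  "cinner \<xi> (c *\<^sub>C \<eta>) = cnj c * cinner \<xi> (\<eta>::'a::complex_hilbert_space)"
  by (subst (1 2) cinner_commute) (simp add: cinner_scaleC_left)

lemma cinner_zero_left [simp]: "cinner 0 (\<eta>::'a::complex_hilbert_space) = 0"
  using cinner_scaleC_left[of 0 0 \<eta>] by simp

lemma cinner_zero_right [simp]: "cinner (\<eta>::'a::complex_hilbert_space) 0 = 0"
  using cinner_scaleC_right[of \<eta> 0 0] by simp

lemma cinner_minus_left: "cinner (- \<xi>) (\<eta>::'a::complex_hilbert_space) = - cinner \<xi> \<eta>"
  using cinner_scaleC_left[of "-1" \<xi> \<eta>] by simp

lemma cinner_minus_right: "cinner \<xi> (- \<eta>) = - cinner \<xi> (\<eta>::'a::complex_hilbert_space)"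
  using cinner_scaleC_right[of \<xi> "-1" \<eta>] by simp

lemma cinner_diff_left:
  "cinner (\<xi> - \<xi>') (\<eta>::'a::complex_hilbert_space) = cinner \<xi> \<eta> - cinner \<xi>' \<eta>"
  using cinner_add_left[of \<xi> "-\<xi>'" \<eta>] by (simp add: cinner_minus_left)

lemma cinner_diff_right:
  "cinner \<xi> (\<eta> - \<eta>') = cinner \<xi> \<eta> - cinner \<xi> (\<eta>'::'a::complex_hilbert_space)"
  using cinner_add_right[of \<xi> \<eta> "-\<eta>'"] by (simp add: cinner_minus_right)

lemma cinner_scaleR_left:
  "cinner (r *\<^sub>R \<xi>) (\<eta>::'a::complex_hilbert_space) = complex_of_real r * cinner \<xi> \<eta>"
  by (simp add: scaleR_eq_scaleC cinner_scaleC_left)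

lemma cinner_scaleR_right:
  "cinner \<xi> (r *\<^sub>R \<eta>) = complex_of_real r * cinner \<xi> (\<eta>::'a::complex_hilbert_space)"
  by (simp add: scaleR_eq_scaleC cinner_scaleC_right)

lemmas cinner_simps = cinner_add_left cinner_add_right cinner_diff_left cinner_diff_right
  cinner_minus_left cinner_minus_right cinner_scaleC_left cinner_scaleC_right
  cinner_scaleR_left cinner_scaleR_right

lemmas blinfun_simps = blinfun.add_left blinfun.diff_left blinfun.minus_left blinfun.scaleR_left
  blinfun.add_right blinfun.diff_right blinfun.minus_right blinfun.scaleR_right

lemma Re_cinner_self: "Re (cinner \<xi> (\<xi>::'a::complex_hilbert_space)) = (norm \<xi>)\<^sup>2"
  by (simp add: cinner_norm)

lemma cinner_self_eq_0 [simp]: "cinner \<xi> \<xi> = 0 \<longleftrightarrow> \<xi> = (0::'a::complex_hilbert_space)"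
  by (simp add: cinner_norm)

lemma cinner_eqI:
  assumes "\<And>\<eta>. cinner \<xi> \<eta> = cinner \<xi>' (\<eta>::'a::complex_hilbert_space)" shows "\<xi> = \<xi>'"
  using assms[of "\<xi> - \<xi>'"] cinner_self_eq_0[of "\<xi> - \<xi>'"] by (simp add: cinner_diff_left)

lemma cinner_eqI_right:
  assumes "\<And>\<eta>. cinner \<eta> \<xi> = cinner \<eta> (\<xi>'::'a::complex_hilbert_space)" shows "\<xi> = \<xi>'"
proof (rule cinner_eqI)
  fix \<eta> show "cinner \<xi> \<eta> = cinner \<xi>' \<eta>"
    using assms[of \<eta>] cinner_commute[of \<xi> \<eta>] cinner_commute[of \<xi>' \<eta>] by simp
qed

lemma norm_scaleC: "norm (c *\<^sub>C \<xi>) = cmod c * norm (\<xi>::'a::complex_hilbert_space)"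
proof -
  have "complex_of_real ((norm (c *\<^sub>C \<xi>))\<^sup>2) = complex_of_real ((cmod c * norm \<xi>)\<^sup>2)"
    unfolding cinner_norm[symmetric] cinner_scaleC_left cinner_scaleC_right mult.assoc[symmetric]
    using complex_norm_square[of c] by (simp add: cinner_norm power_mult_distrib mult.commute)
  then show ?thesis
    unfolding of_real_eq_iff by (rule power2_eq_imp_eq) auto
qed

lemma norm_add_square:
  "(norm (\<xi> + \<eta>))\<^sup>2 = (norm \<xi>)\<^sup>2 + (norm \<eta>)\<^sup>2 + 2 * Re (cinner \<xi> (\<eta>::'a::complex_hilbert_space))"
proof -
  have "Re (cinner \<eta> \<xi>) = Re (cinner \<xi> \<eta>)" by (subst cinner_commute) simp
  then show ?thesis
    unfolding Re_cinner_self[symmetric] by (simp add: cinner_simps)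
qed

lemma norm_diff_square:
  "(norm (\<xi> - \<eta>))\<^sup>2 = (norm \<xi>)\<^sup>2 + (norm \<eta>)\<^sup>2 - 2 * Re (cinner \<xi> (\<eta>::'a::complex_hilbert_space))"
  using norm_add_square[of \<xi> "-\<eta>"] by (simp add: cinner_minus_right)

lemma parallelogram:
  "(norm (\<xi> + \<eta>))\<^sup>2 + (norm (\<xi> - \<eta>))\<^sup>2 = 2 * (norm \<xi>)\<^sup>2 + 2 * (norm (\<eta>::'a::complex_hilbert_space))\<^sup>2"
  by (simp add: norm_add_square norm_diff_square)

lemma pythagoras:
  "cinner \<xi> \<eta> = 0 \<Longrightarrow> (norm (\<xi> + \<eta>))\<^sup>2 = (norm \<xi>)\<^sup>2 + (norm (\<eta>::'a::complex_hilbert_space))\<^sup>2"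
  by (simp add: norm_add_square)

text \<open>A complex quadratic form that takes only real values is Hermitian; this is what makes
  positivity imply self-adjointness.\<close>

lemma hermitian_if_real_form:
  fixes T :: "'a::complex_hilbert_space \<Rightarrow> 'a"
  assumes add: "T (\<xi> + \<eta>) = T \<xi> + T \<eta>" "T (\<xi> + \<i> *\<^sub>C \<eta>) = T \<xi> + \<i> *\<^sub>C T \<eta>"
    and real: "\<And>\<zeta>. cinner (T \<zeta>) \<zeta> \<in> \<real>"
  shows "cinner (T \<xi>) \<eta> = cinner \<xi> (T \<eta>)"
proof -
  have im: "Im (cinner (T \<zeta>) \<zeta>) = 0" for \<zeta> using real[of \<zeta>] by (simp add: complex_is_Real_iff)
  have "Im (cinner (T \<xi>) \<eta> + cinner (T \<eta>) \<xi>) = 0"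
    using im[of "\<xi> + \<eta>"] im[of \<xi>] im[of \<eta>] by (simp add: cinner_simps add)
  moreover have "Re (cinner (T \<xi>) \<eta>) = Re (cinner (T \<eta>) \<xi>)"
    using im[of "\<xi> + \<i> *\<^sub>C \<eta>"] im[of \<xi>] im[of \<eta>] by (simp add: cinner_simps add)
  ultimately have "cinner (T \<xi>) \<eta> = cnj (cinner (T \<eta>) \<xi>)"
    by (simp add: complex_eq_iff)
  then show ?thesis by (simp add: cinner_commute[symmetric])
qed

definition pos_op :: "('a::complex_hilbert_space \<Rightarrow>\<^sub>L 'a) \<Rightarrow> bool" where
  "pos_op T \<longleftrightarrow> T \<in> bounded_ops \<and> (\<forall>\<xi>. cinner (T \<xi>) \<xi> \<in> \<real>\<^sub>\<ge>\<^sub>0)"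

lemma bounded_opsD: "T \<in> bounded_ops \<Longrightarrow> T (c *\<^sub>C \<xi>) = c *\<^sub>C T \<xi>"
  by (simp add: bounded_ops_def)

lemma pos_op_bounded: "pos_op T \<Longrightarrow> T \<in> bounded_ops"
  by (simp add: pos_op_def)

lemma pos_op_hermitian:
  assumes "pos_op T" shows "cinner (T \<xi>) \<eta> = cinner \<xi> (T \<eta>)"
  using assms nonneg_Reals_subset_Reals
  by (intro hermitian_if_real_form) (auto simp: pos_op_def bounded_opsD blinfun_simps)

lemma pos_op_Re: "pos_op T \<Longrightarrow> 0 \<le> Re (cinner (T \<xi>) \<xi>)"
  by (auto simp: pos_op_def complex_nonneg_Reals_iff)

lemma pos_opI:
  assumes "T \<in> bounded_ops" "\<And>\<xi> \<eta>. cinner (T \<xi>) \<eta> = cinner \<xi> (T \<eta>)"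
    "\<And>\<xi>. 0 \<le> Re (cinner (T \<xi>) \<xi>)"
  shows "pos_op T"
proof -
  have "Im (cinner (T \<xi>) \<xi>) = 0" for \<xi>
  proof -
    have "cinner (T \<xi>) \<xi> = cnj (cinner (T \<xi>) \<xi>)"
      using assms(2)[of \<xi> \<xi>] cinner_commute[of "T \<xi>" \<xi>] by metis
    then show ?thesis by (simp add: complex_eq_iff)
  qed
  then show ?thesis using assms by (auto simp: pos_op_def complex_nonneg_Reals_iff)
qed

lemma pos_op_Re': "pos_op T \<Longrightarrow> 0 \<le> Re (cinner \<xi> (T \<xi>))"
  by (simp add: pos_op_Re flip: pos_op_hermitian)

lemma id_bounded_ops [simp]: "id_blinfun \<in> bounded_ops"
  by (simp add: bounded_ops_def)

lemma pos_op_id [simp]: "pos_op id_blinfun"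
  by (intro pos_opI) (simp_all add: Re_cinner_self)

text \<open>The Cauchy-Schwarz inequality for the semidefinite form of a positive operator; the usual
  one is the case of the identity.\<close>

lemma pos_op_cauchy_schwarz:
  assumes "pos_op T"
  shows "(cmod (cinner (T \<xi>) \<eta>))\<^sup>2 \<le> Re (cinner (T \<xi>) \<xi>) * Re (cinner (T \<eta>) \<eta>)"
proof -
  define s where "s = cinner (T \<xi>) \<eta>"
  define A where "A = Re (cinner (T \<xi>) \<xi>)"
  define B where "B = Re (cinner (T \<eta>) \<eta>)"
  have AB: "0 \<le> A" "0 \<le> B" using pos_op_Re[OF assms] by (auto simp: A_def B_def)
  have s': "cinner (T \<eta>) \<xi> = cnj s"
    unfolding s_def pos_op_hermitian[OF assms, of \<eta> \<xi>] by (rule cinner_commute)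
  have q: "0 \<le> A - 2 * t * (cmod s)\<^sup>2 + t\<^sup>2 * (cmod s)\<^sup>2 * B" for t :: real
  proof -
    let ?l = "- (complex_of_real t * s)"
    have "0 \<le> Re (cinner (T (\<xi> + ?l *\<^sub>C \<eta>)) (\<xi> + ?l *\<^sub>C \<eta>))" by (rule pos_op_Re[OF assms])
    also have "cinner (T (\<xi> + ?l *\<^sub>C \<eta>)) (\<xi> + ?l *\<^sub>C \<eta>)
      = cinner (T \<xi>) \<xi> - 2 * complex_of_real t * (s * cnj s)
        + (complex_of_real t)\<^sup>2 * (s * cnj s) * cinner (T \<eta>) \<eta>"
      using pos_op_bounded[OF assms]
      by (simp add: blinfun_simps bounded_opsD cinner_simps s' s_def[symmetric] power2_eq_square
          algebra_simps)
    also have "Re \<dots> = A - 2 * t * (cmod s)\<^sup>2 + t\<^sup>2 * (cmod s)\<^sup>2 * B"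
      unfolding complex_norm_square[symmetric]
      by (simp add: A_def B_def flip: of_real_power of_real_mult)
    finally show ?thesis .
  qed
  have "(cmod s)\<^sup>2 \<le> A * B"
  proof (cases "B = 0")
    case True
    have "(cmod s)\<^sup>2 = 0"
    proof (rule ccontr)
      assume "(cmod s)\<^sup>2 \<noteq> 0"
      then show False using q[of "(A + 1) / (2 * (cmod s)\<^sup>2)"] True AB by (simp add: field_simps)
    qed
    then show ?thesis using True by simp
  next
    case False
    then have "0 < B" using AB by simp
    then show ?thesis using q[of "1 / B"] by (simp add: field_simps power2_eq_square)
  qed
  then show ?thesis by (simp add: s_def A_def B_def)
qed

lemma cauchy_schwarz: "cmod (cinner \<xi> \<eta>) \<le> norm \<xi> * norm (\<eta>::'a::complex_hilbert_space)"
proof -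
  have "(cmod (cinner \<xi> \<eta>))\<^sup>2 \<le> (norm \<xi> * norm \<eta>)\<^sup>2"
    using pos_op_cauchy_schwarz[OF pos_op_id, of \<xi> \<eta>] by (simp add: Re_cinner_self power_mult_distrib)
  then show ?thesis by (rule power2_le_imp_le) simp
qed

lemma bounded_bilinear_cinner: "bounded_bilinear (cinner :: 'a::complex_hilbert_space \<Rightarrow> 'a \<Rightarrow> complex)"
  by (rule bounded_bilinear.intro) (auto simp: cinner_simps scaleR_conv_of_real cauchy_schwarz
      intro!: exI[of _ 1])

lemmas tendsto_cinner = bounded_bilinear.tendsto[OF bounded_bilinear_cinner]

lemma pos_op_null:
  assumes "pos_op T" "Re (cinner (T \<xi>) \<xi>) = 0" shows "T \<xi> = 0"
  using pos_op_cauchy_schwarz[OF assms(1), of \<xi> "T \<xi>"] assms(2) by simp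

definition csubspace :: "'a::complex_hilbert_space set \<Rightarrow> bool" where
  "csubspace S \<longleftrightarrow> 0 \<in> S \<and> (\<forall>\<xi>\<in>S. \<forall>\<eta>\<in>S. \<xi> + \<eta> \<in> S) \<and> (\<forall>c. \<forall>\<xi>\<in>S. c *\<^sub>C \<xi> \<in> S)"

lemma csubspaceD:
  assumes "csubspace S"
  shows "0 \<in> S" "\<xi> \<in> S \<Longrightarrow> \<eta> \<in> S \<Longrightarrow> \<xi> + \<eta> \<in> S" "\<xi> \<in> S \<Longrightarrow> c *\<^sub>C \<xi> \<in> S"
    "\<xi> \<in> S \<Longrightarrow> \<eta> \<in> S \<Longrightarrow> \<xi> - \<eta> \<in> S" "\<xi> \<in> S \<Longrightarrow> r *\<^sub>R \<xi> \<in> S" "\<xi> \<in> S \<Longrightarrow> - \<xi> \<in> S"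
proof -
  show *: "0 \<in> S" "\<xi> \<in> S \<Longrightarrow> \<eta> \<in> S \<Longrightarrow> \<xi> + \<eta> \<in> S" "\<xi> \<in> S \<Longrightarrow> c *\<^sub>C \<xi> \<in> S" for \<xi> \<eta> c
    using assms by (auto simp: csubspace_def)
  show neg: "\<xi> \<in> S \<Longrightarrow> - \<xi> \<in> S" for \<xi> using *(3)[of \<xi> "-1"] by simp
  show "\<xi> \<in> S \<Longrightarrow> \<eta> \<in> S \<Longrightarrow> \<xi> - \<eta> \<in> S" using *(2)[of \<xi> "-\<eta>"] neg by simp
  show "\<xi> \<in> S \<Longrightarrow> r *\<^sub>R \<xi> \<in> S" using *(3) by (simp add: scaleR_eq_scaleC)
qed

lemma csubspace_closure:
  assumes "csubspace S" shows "csubspace (closure S)"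
  unfolding csubspace_def
proof (intro conjI ballI allI)
  show "0 \<in> closure S" using csubspaceD(1)[OF assms] closure_subset by auto
next
  fix \<xi> \<eta> assume "\<xi> \<in> closure S" "\<eta> \<in> closure S"
  then obtain f g where "\<And>n. f n \<in> S" "f \<longlonglongrightarrow> \<xi>" "\<And>n. g n \<in> S" "g \<longlonglongrightarrow> \<eta>"
    unfolding closure_sequential by blast
  then show "\<xi> + \<eta> \<in> closure S"
    unfolding closure_sequential using csubspaceD(2)[OF assms] tendsto_add[of f \<xi> _ g \<eta>]
    by (intro exI[of _ "\<lambda>n. f n + g n"]) auto
next
  fix c \<xi> assume "\<xi> \<in> closure S"
  then obtain f where f: "\<And>n. f n \<in> S" "f \<longlonglongrightarrow> \<xi>" unfolding closure_sequential by blast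
  have "bounded_linear ((*\<^sub>C) c :: 'a \<Rightarrow> 'a)"
    by (rule bounded_linear_intro[where K = "cmod c"])
      (simp_all add: scaleC_add_right scaleR_eq_scaleC scaleC_scaleC norm_scaleC mult.commute)
  from bounded_linear.tendsto[OF this f(2)] f(1)
  show "c *\<^sub>C \<xi> \<in> closure S"
    unfolding closure_sequential using csubspaceD(3)[OF assms]
    by (intro exI[of _ "\<lambda>n. c *\<^sub>C f n"]) auto
qed

text \<open>By the parallelogram law a minimising sequence for the distance of \<open>\<xi>\<close> to \<open>S\<close> is Cauchy, and at the nearest
  point no direction in \<open>S\<close> decreases the distance.\<close>

lemma projection_theorem:
  fixes \<xi> :: "'a::complex_hilbert_space"
  assumes S: "csubspace S" "closed S"
  shows "\<exists>\<eta>\<in>S. \<forall>\<zeta>\<in>S. cinner (\<xi> - \<eta>) \<zeta> = 0"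
proof -
  define m where "m = Inf ((\<lambda>\<eta>. (norm (\<xi> - \<eta>))\<^sup>2) ` S)"
  have ne: "S \<noteq> {}" using csubspaceD(1)[OF S(1)] by auto
  have bdd: "bdd_below ((\<lambda>\<eta>. (norm (\<xi> - \<eta>))\<^sup>2) ` S)" by (rule bdd_belowI[of _ 0]) auto
  have low: "m \<le> (norm (\<xi> - \<eta>))\<^sup>2" if "\<eta> \<in> S" for \<eta>
    unfolding m_def by (rule cINF_lower[OF bdd that])
  have "\<exists>\<eta>\<in>S. (norm (\<xi> - \<eta>))\<^sup>2 < m + 1 / real (Suc n)" for n
    using cINF_less_iff[OF ne bdd, of "m + 1 / real (Suc n)"] by (simp add: m_def)
  then obtain f where f: "\<And>n. f n \<in> S" "\<And>n. (norm (\<xi> - f n))\<^sup>2 < m + 1 / real (Suc n)" by metis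
  have par: "(norm (f i - f j))\<^sup>2 \<le> 2 / real (Suc i) + 2 / real (Suc j)" for i j
  proof -
    have "4 * m \<le> 4 * (norm (\<xi> - (1/2) *\<^sub>R (f i + f j)))\<^sup>2"
      using low[of "(1/2) *\<^sub>R (f i + f j)"] csubspaceD[OF S(1)] f(1) by simp
    also have "\<dots> = (norm (2 *\<^sub>R (\<xi> - (1/2) *\<^sub>R (f i + f j))))\<^sup>2"
      unfolding norm_scaleR by (simp add: power_mult_distrib)
    also have "2 *\<^sub>R (\<xi> - (1/2) *\<^sub>R (f i + f j)) = (\<xi> - f i) + (\<xi> - f j)"
      by (simp add: scaleR_diff_right scaleR_2)
    finally have "4 * m \<le> (norm ((\<xi> - f i) + (\<xi> - f j)))\<^sup>2" .
    moreover have "(norm ((\<xi> - f i) - (\<xi> - f j)))\<^sup>2 = (norm (f i - f j))\<^sup>2"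
      by (simp add: norm_minus_commute)
    moreover have "2 / real (Suc i) = 2 * (1 / real (Suc i))" "2 / real (Suc j) = 2 * (1 / real (Suc j))"
      by simp_all
    ultimately show ?thesis
      using parallelogram[of "\<xi> - f i" "\<xi> - f j"] f(2)[of i] f(2)[of j] by linarith
  qed
  have "Cauchy f"
  proof (rule metric_CauchyI)
    fix e :: real assume "0 < e"
    then obtain N where N: "inverse (real (Suc N)) < e\<^sup>2 / 4" using reals_Archimedean[of "e\<^sup>2 / 4"] by auto
    have "dist (f i) (f j) < e" if "N \<le> i" "N \<le> j" for i j
    proof -
      have "1 / real (Suc i) \<le> 1 / real (Suc N)" "1 / real (Suc j) \<le> 1 / real (Suc N)"
        using that by (simp_all add: frac_le)
      then have "(norm (f i - f j))\<^sup>2 < e\<^sup>2"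
        using par[of i j] N by (simp add: inverse_eq_divide)
      then show ?thesis using \<open>0 < e\<close> by (simp add: dist_norm power2_less_imp_less)
    qed
    then show "\<exists>N. \<forall>i\<ge>N. \<forall>j\<ge>N. dist (f i) (f j) < e" by blast
  qed
  then obtain \<eta> where \<eta>: "f \<longlonglongrightarrow> \<eta>" using Cauchy_convergent_iff convergent_def by blast
  have \<eta>S: "\<eta> \<in> S" using S(2) f(1) \<eta> closed_sequentially by blast
  have le: "(norm (\<xi> - \<eta>))\<^sup>2 \<le> m"
  proof (rule LIMSEQ_le)
    show "(\<lambda>n. (norm (\<xi> - f n))\<^sup>2) \<longlonglongrightarrow> (norm (\<xi> - \<eta>))\<^sup>2" by (intro tendsto_intros \<eta>)
    show "(\<lambda>n. m + 1 / real (Suc n)) \<longlonglongrightarrow> m"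
      using LIMSEQ_inverse_real_of_nat_add[of m] by (simp add: inverse_eq_divide)
    show "\<exists>N. \<forall>n\<ge>N. (norm (\<xi> - f n))\<^sup>2 \<le> m + 1 / real (Suc n)" using f(2) less_imp_le by blast
  qed
  have "cinner (\<xi> - \<eta>) \<zeta> = 0" if "\<zeta> \<in> S" for \<zeta>
  proof (rule ccontr)
    define s where "s = cinner (\<xi> - \<eta>) \<zeta>"
    assume "cinner (\<xi> - \<eta>) \<zeta> \<noteq> 0"
    then have s0: "s \<noteq> 0" "\<zeta> \<noteq> 0" by (auto simp: s_def)
    define t where "t = s / complex_of_real ((norm \<zeta>)\<^sup>2)"
    have "m \<le> (norm (\<xi> - (\<eta> + t *\<^sub>C \<zeta>)))\<^sup>2"
      using low csubspaceD[OF S(1)] \<eta>S that by blast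
    also have "\<xi> - (\<eta> + t *\<^sub>C \<zeta>) = (\<xi> - \<eta>) - t *\<^sub>C \<zeta>" by simp
    also have "(norm \<dots>)\<^sup>2 = (norm (\<xi> - \<eta>))\<^sup>2 + (cmod t * norm \<zeta>)\<^sup>2 - 2 * Re (cnj t * s)"
      by (simp add: norm_diff_square cinner_scaleC_right s_def norm_scaleC)
    also have "cnj t * s = complex_of_real ((cmod s)\<^sup>2 / (norm \<zeta>)\<^sup>2)"
      using complex_norm_square[of s] by (simp add: t_def mult.commute)
    also have "(cmod t * norm \<zeta>)\<^sup>2 = (cmod s)\<^sup>2 / (norm \<zeta>)\<^sup>2"
      using s0 by (simp add: t_def norm_divide norm_mult power2_eq_square field_simps)
    finally have "(cmod s)\<^sup>2 / (norm \<zeta>)\<^sup>2 \<le> 0" using le by (simp del: of_real_divide)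
    then show False using s0 by (simp add: divide_le_0_iff)
  qed
  then show ?thesis using \<eta>S by blast
qed

text \<open>A non-zero vector orthogonal to the kernel of \<open>f\<close> is, after scaling, the representing one.\<close>

lemma riesz_representation:
  fixes f :: "'a::complex_hilbert_space \<Rightarrow> complex"
  assumes f: "bounded_linear f" "\<And>c \<xi>. f (c *\<^sub>C \<xi>) = c * f \<xi>"
  shows "\<exists>\<zeta>. \<forall>\<xi>. f \<xi> = cinner \<xi> \<zeta>"
proof (cases "\<forall>\<xi>. f \<xi> = 0")
  case True
  then show ?thesis by (intro exI[of _ 0]) simp
next
  case False
  then obtain \<xi>0 where \<xi>0: "f \<xi>0 \<noteq> 0" by blast
  interpret f: bounded_linear f by fact
  have cs: "csubspace {\<xi>. f \<xi> = 0}" by (auto simp: csubspace_def f.zero f.add f(2))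
  have "closed {\<xi>. f \<xi> = 0}"
    by (intro closed_Collect_eq) (auto intro!: linear_continuous_on f(1))
  from projection_theorem[OF cs this, of \<xi>0] obtain \<eta>
    where \<eta>: "f \<eta> = 0" "\<And>\<zeta>. f \<zeta> = 0 \<Longrightarrow> cinner (\<xi>0 - \<eta>) \<zeta> = 0" by blast
  define v where "v = \<xi>0 - \<eta>"
  have v: "f v \<noteq> 0" "v \<noteq> 0" "\<And>\<zeta>. f \<zeta> = 0 \<Longrightarrow> cinner v \<zeta> = 0"
    using \<xi>0 \<eta> by (auto simp: v_def f.diff)
  define n where "n = complex_of_real ((norm v)\<^sup>2)"
  have n0: "n \<noteq> 0" using v by (simp add: n_def)
  have "f \<xi> = cinner \<xi> ((cnj (f v) / n) *\<^sub>C v)" for \<xi>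
  proof -
    have "f (f v *\<^sub>C \<xi> - f \<xi> *\<^sub>C v) = 0" by (simp add: f.diff f(2))
    then have "cinner (f v *\<^sub>C \<xi> - f \<xi> *\<^sub>C v) v = 0"
      using v(3) cinner_commute[of "f v *\<^sub>C \<xi> - f \<xi> *\<^sub>C v" v] by simp
    then have "f v * cinner \<xi> v = f \<xi> * n"
      by (simp add: cinner_simps cinner_norm n_def)
    moreover have "cnj n = n" by (simp add: n_def)
    ultimately show ?thesis using n0 by (simp add: cinner_scaleC_right field_simps)
  qed
  then show ?thesis by blast
qed

section \<open>The algebra of bounded operators\<close>

lemma bounded_ops_zero [simp]: "0 \<in> bounded_ops" by (simp add: bounded_ops_def)
lemma bounded_ops_add: "S \<in> bounded_ops \<Longrightarrow> T \<in> bounded_ops \<Longrightarrow> S + T \<in> bounded_ops"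
  by (simp add: bounded_ops_def blinfun_simps scaleC_add_right)
lemma bounded_ops_diff: "S \<in> bounded_ops \<Longrightarrow> T \<in> bounded_ops \<Longrightarrow> S - T \<in> bounded_ops"
  by (simp add: bounded_ops_def blinfun_simps scaleC_diff_right)
lemma bounded_ops_scaleR: "T \<in> bounded_ops \<Longrightarrow> r *\<^sub>R T \<in> bounded_ops"
  by (simp add: bounded_ops_def blinfun_simps scaleR_eq_scaleC scaleC_scaleC mult.commute)
lemma bounded_ops_compose: "S \<in> bounded_ops \<Longrightarrow> T \<in> bounded_ops \<Longrightarrow> S o\<^sub>L T \<in> bounded_ops"
  by (simp add: bounded_ops_def)

lemmas bounded_ops_intros = bounded_ops_zero bounded_ops_add bounded_ops_diff bounded_ops_scaleR
  bounded_ops_compose id_bounded_ops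

lemma adj_exists:
  fixes T :: "'a::complex_hilbert_space \<Rightarrow>\<^sub>L 'a"
  assumes T: "T \<in> bounded_ops"
  shows "\<exists>S. S \<in> bounded_ops \<and> (\<forall>\<xi> \<eta>. cinner (T \<xi>) \<eta> = cinner \<xi> (S \<eta>))"
proof -
  have bl: "bounded_linear (\<lambda>\<xi>. cinner (T \<xi>) \<eta>)" for \<eta>
    by (intro bounded_linear_compose[OF bounded_bilinear.bounded_linear_left[OF bounded_bilinear_cinner]]
        blinfun.bounded_linear_right)
  have "\<exists>\<zeta>. \<forall>\<xi>. cinner (T \<xi>) \<eta> = cinner \<xi> \<zeta>" for \<eta>
    by (rule riesz_representation[OF bl]) (simp add: bounded_opsD[OF T] cinner_scaleC_left)
  then obtain g where g: "\<And>\<xi> \<eta>. cinner (T \<xi>) \<eta> = cinner \<xi> (g \<eta>)" by metis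
  have g_add: "g (\<eta> + \<eta>') = g \<eta> + g \<eta>'" for \<eta> \<eta>'
    by (rule cinner_eqI_right) (simp add: cinner_add_right g[symmetric])
  have g_sc: "g (c *\<^sub>C \<eta>) = c *\<^sub>C g \<eta>" for c \<eta>
    by (rule cinner_eqI_right) (simp add: cinner_scaleC_right g[symmetric])
  have g_bd: "norm (g \<eta>) \<le> norm \<eta> * norm T" for \<eta>
  proof (cases "g \<eta> = 0")
    case False
    have "(norm (g \<eta>))\<^sup>2 = cmod (cinner (T (g \<eta>)) \<eta>)"
      unfolding g cinner_norm by (simp only: norm_of_real abs_power2)
    also have "\<dots> \<le> norm (T (g \<eta>)) * norm \<eta>" by (rule cauchy_schwarz)
    also have "\<dots> \<le> norm T * norm (g \<eta>) * norm \<eta>" by (intro mult_right_mono norm_blinfun) auto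
    finally show ?thesis using False by (simp add: power2_eq_square algebra_simps)
  qed simp
  have "bounded_linear g"
    by (rule bounded_linear_intro[where K = "norm T"])
      (simp_all add: g_add g_sc scaleR_eq_scaleC g_bd)
  then have "blinfun_apply (Blinfun g) = g" by (rule bounded_linear_Blinfun_apply)
  then show ?thesis using g g_sc by (intro exI[of _ "Blinfun g"]) (simp add: bounded_ops_def)
qed

lemma adj_bounded_ops [simp]: "T \<in> bounded_ops \<Longrightarrow> adj T \<in> bounded_ops"
  and adj_cinner: "(T::'a::complex_hilbert_space \<Rightarrow>\<^sub>L 'a) \<in> bounded_ops \<Longrightarrow> cinner (T \<xi>) \<eta> = cinner \<xi> (adj T \<eta>)"
proof -
  assume T: "T \<in> bounded_ops"
  have "\<exists>!S. S \<in> bounded_ops \<and> (\<forall>\<xi> \<eta>. cinner (T \<xi>) \<eta> = cinner \<xi> (S \<eta>))"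
  proof (rule ex_ex1I[OF adj_exists[OF T]])
    fix S S' assume "S \<in> bounded_ops \<and> (\<forall>\<xi> \<eta>. cinner (T \<xi>) \<eta> = cinner \<xi> (S \<eta>))"
      "S' \<in> bounded_ops \<and> (\<forall>\<xi> \<eta>. cinner (T \<xi>) \<eta> = cinner \<xi> (S' \<eta>))"
    then show "S = S'" by (intro blinfun_eqI cinner_eqI_right) simp
  qed
  note th = theI'[OF this, folded adj_def]
  from th show "adj T \<in> bounded_ops" by (rule conjunct1)
  from th show "cinner (T \<xi>) \<eta> = cinner \<xi> (adj T \<eta>)" by blast
qed

lemma adj_cinner': "T \<in> bounded_ops \<Longrightarrow> cinner (adj T \<xi>) \<eta> = cinner \<xi> (T \<eta>)"
  using cinner_commute[of "adj T \<xi>" \<eta>] cinner_commute[of \<xi> "T \<eta>"] by (simp flip: adj_cinner)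

lemma adj_eqI:
  fixes S T :: "'a::complex_hilbert_space \<Rightarrow>\<^sub>L 'a"
  assumes "T \<in> bounded_ops" "\<And>\<xi> \<eta>. cinner (T \<xi>) \<eta> = cinner \<xi> (S \<eta>)" shows "adj T = S"
  by (intro blinfun_eqI cinner_eqI_right) (simp add: assms(1) flip: adj_cinner assms(2))

lemma adj_adj [simp]: "T \<in> bounded_ops \<Longrightarrow> adj (adj T) = T"
  by (rule adj_eqI) (simp_all add: adj_cinner')

lemma adj_compose:
  "S \<in> bounded_ops \<Longrightarrow> T \<in> bounded_ops \<Longrightarrow> adj (S o\<^sub>L T) = adj T o\<^sub>L adj S"
  by (rule adj_eqI) (simp_all add: bounded_ops_compose adj_cinner)

lemma adj_add: "S \<in> bounded_ops \<Longrightarrow> T \<in> bounded_ops \<Longrightarrow> adj (S + T) = adj S + adj T"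
  by (rule adj_eqI) (simp_all add: bounded_ops_add adj_cinner blinfun_simps cinner_simps)

lemma adj_diff: "S \<in> bounded_ops \<Longrightarrow> T \<in> bounded_ops \<Longrightarrow> adj (S - T) = adj S - adj T"
  by (rule adj_eqI) (simp_all add: bounded_ops_diff adj_cinner blinfun_simps cinner_simps)

lemma adj_scaleR: "T \<in> bounded_ops \<Longrightarrow> adj (r *\<^sub>R T) = r *\<^sub>R adj T"
  by (rule adj_eqI) (simp_all add: bounded_ops_scaleR adj_cinner blinfun_simps cinner_simps)

lemma adj_zero [simp]: "adj (0 :: 'a::complex_hilbert_space \<Rightarrow>\<^sub>L 'a) = 0" by (rule adj_eqI) simp_all
lemma adj_id [simp]: "adj (id_blinfun :: 'a::complex_hilbert_space \<Rightarrow>\<^sub>L 'a) = id_blinfun"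
  by (rule adj_eqI) simp_all

lemma pos_op_adj: "pos_op T \<Longrightarrow> adj T = T"
  by (rule adj_eqI) (simp_all add: pos_op_bounded pos_op_hermitian)

lemma pos_op_iff:
  "T \<in> bounded_ops \<Longrightarrow> adj T = T \<Longrightarrow> pos_op T \<longleftrightarrow> (\<forall>\<xi>. 0 \<le> Re (cinner (T \<xi>) \<xi>))"
  using pos_opI[of T] pos_op_Re[of T] adj_cinner[of T] by metis

lemma pos_op_add: "pos_op S \<Longrightarrow> pos_op T \<Longrightarrow> pos_op (S + T)"
  by (intro pos_opI) (simp_all add: pos_op_bounded bounded_ops_add blinfun_simps cinner_simps
      pos_op_hermitian pos_op_Re')

lemma pos_op_scaleR: "pos_op T \<Longrightarrow> 0 \<le> r \<Longrightarrow> pos_op (r *\<^sub>R T)"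
  by (intro pos_opI) (simp_all add: pos_op_bounded bounded_ops_scaleR blinfun_simps cinner_simps
      pos_op_hermitian pos_op_Re')

lemma pos_op_adj_compose: "T \<in> bounded_ops \<Longrightarrow> pos_op (adj T o\<^sub>L T)"
  by (intro pos_opI) (simp_all add: bounded_ops_compose adj_cinner' Re_cinner_self
      flip: adj_cinner)

lemma pos_op_sandwich: "pos_op S \<Longrightarrow> T \<in> bounded_ops \<Longrightarrow> pos_op (adj T o\<^sub>L S o\<^sub>L T)"
  by (intro pos_opI) (simp_all add: bounded_ops_compose pos_op_bounded adj_cinner' pos_op_Re'
      pos_op_hermitian flip: adj_cinner)

lemma bounded_ops_limit:
  assumes "\<And>n. S n \<in> bounded_ops" "S \<longlonglongrightarrow> T" shows "T \<in> bounded_ops"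
proof -
  have "T (c *\<^sub>C \<xi>) = c *\<^sub>C T \<xi>" for c \<xi>
  proof (rule LIMSEQ_unique)
    show "(\<lambda>n. S n (c *\<^sub>C \<xi>)) \<longlonglongrightarrow> T (c *\<^sub>C \<xi>)" by (intro blinfun.tendsto assms tendsto_const)
    have "bounded_linear ((*\<^sub>C) c :: 'a \<Rightarrow> 'a)"
      by (rule bounded_linear_intro[where K = "cmod c"])
        (simp_all add: scaleC_add_right scaleR_eq_scaleC scaleC_scaleC norm_scaleC mult.commute)
    then have "(\<lambda>n. c *\<^sub>C S n \<xi>) \<longlonglongrightarrow> c *\<^sub>C T \<xi>"
      by (rule bounded_linear.tendsto) (intro blinfun.tendsto assms tendsto_const)
    then show "(\<lambda>n. S n (c *\<^sub>C \<xi>)) \<longlonglongrightarrow> c *\<^sub>C T \<xi>" by (simp add: bounded_opsD[OF assms(1)])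
  qed
  then show ?thesis by (simp add: bounded_ops_def)
qed

text \<open>The Cauchy-Schwarz inequality of the form of \<open>T\<close> at \<open>\<xi>\<close> and \<open>T \<xi>\<close>.\<close>

lemma norm_le_if_pos_le:
  assumes "pos_op T" "0 \<le> C" "\<And>\<xi>. Re (cinner (T \<xi>) \<xi>) \<le> C * (norm \<xi>)\<^sup>2"
  shows "norm (T \<xi>) \<le> C * norm \<xi>"
proof (cases "T \<xi> = 0")
  case False
  have "((norm (T \<xi>))\<^sup>2)\<^sup>2 = (cmod (cinner (T \<xi>) (T \<xi>)))\<^sup>2"
    unfolding cinner_norm by (simp only: norm_of_real abs_power2)
  also have "\<dots> \<le> Re (cinner (T \<xi>) \<xi>) * Re (cinner (T (T \<xi>)) (T \<xi>))"
    by (rule pos_op_cauchy_schwarz[OF assms(1)])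
  also have "\<dots> \<le> (C * (norm \<xi>)\<^sup>2) * (C * (norm (T \<xi>))\<^sup>2)"
    using assms(2) by (intro mult_mono assms(3) pos_op_Re[OF assms(1)]) auto
  finally have "(norm (T \<xi>))\<^sup>2 \<le> (C * norm \<xi>)\<^sup>2"
    using False by (simp add: power2_eq_square mult.assoc mult.left_commute)
  then show ?thesis by (rule power2_le_imp_le) (use assms(2) in simp)
qed (use assms in simp)

section \<open>Projections and von Neumann algebras\<close>

definition is_proj :: "('a::complex_hilbert_space \<Rightarrow>\<^sub>L 'a) \<Rightarrow> bool" where
  "is_proj p \<longleftrightarrow> p \<in> bounded_ops \<and> p o\<^sub>L p = p \<and> adj p = p"

lemma is_projD:
  assumes "is_proj p"
  shows "p \<in> bounded_ops" "p (p \<xi>) = p \<xi>" "cinner (p \<xi>) \<eta> = cinner \<xi> (p \<eta>)" "adj p = p"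
    "pos_op p" "p o\<^sub>L p = p"
proof -
  show *: "p \<in> bounded_ops" "p (p \<xi>) = p \<xi>" "adj p = p" "p o\<^sub>L p = p" for \<xi>
    using assms by (auto simp: is_proj_def simp flip: blinfun_apply_blinfun_compose)
  show sym: "cinner (p \<xi>) \<eta> = cinner \<xi> (p \<eta>)" for \<xi> \<eta> using adj_cinner[OF *(1)] *(3) by simp
  show "pos_op p"
  proof (rule pos_opI)
    fix \<xi>
    have "cinner (p \<xi>) \<xi> = cinner (p \<xi>) (p \<xi>)" by (simp add: sym *(2))
    then show "0 \<le> Re (cinner (p \<xi>) \<xi>)" by (simp add: Re_cinner_self)
  qed (simp_all add: *(1) sym)
qed

lemma is_projI:
  assumes "p \<in> bounded_ops" "\<And>\<xi>. p (p \<xi>) = p \<xi>" "\<And>\<xi> \<eta>. cinner (p \<xi>) \<eta> = cinner \<xi> (p \<eta>)"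
  shows "is_proj p"
  unfolding is_proj_def using assms by (intro conjI adj_eqI) (auto intro!: blinfun_eqI)

lemma is_proj_zero [simp]: "is_proj 0" and is_proj_id [simp]: "is_proj id_blinfun"
  by (auto intro!: is_projI)

lemma is_proj_perp: "is_proj p \<Longrightarrow> is_proj (perp p)"
  by (intro is_projI) (simp_all add: bounded_ops_diff is_projD blinfun_simps cinner_simps)

lemma proj_pythagoras: "is_proj p \<Longrightarrow> (norm \<xi>)\<^sup>2 = (norm (p \<xi>))\<^sup>2 + (norm (\<xi> - p \<xi>))\<^sup>2"
  using pythagoras[of "p \<xi>" "\<xi> - p \<xi>"] by (simp add: is_projD cinner_simps)

lemma proj_norm_le: assumes "is_proj p" shows "norm (p \<xi>) \<le> norm \<xi>"
proof (rule power2_le_imp_le)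
  show "(norm (p \<xi>))\<^sup>2 \<le> (norm \<xi>)\<^sup>2" unfolding proj_pythagoras[OF assms, of \<xi>] by simp
qed simp

lemma proj_comm_compose:
  "is_proj p \<Longrightarrow> is_proj q \<Longrightarrow> p o\<^sub>L q = q o\<^sub>L p \<Longrightarrow> is_proj (p o\<^sub>L q)"
proof -
  assume pq: "is_proj p" "is_proj q" "p o\<^sub>L q = q o\<^sub>L p"
  then have pq': "p (q \<xi>) = q (p \<xi>)" for \<xi> by (metis blinfun_apply_blinfun_compose)
  show "is_proj (p o\<^sub>L q)"
    by (rule is_projI) (simp_all add: bounded_ops_compose is_projD pq flip: pq')
qed

lemma proj_le_iff: "proj_le p q \<longleftrightarrow> (\<forall>\<xi>. q (p \<xi>) = p \<xi>)"
  unfolding proj_le_def by (metis blinfun_apply_blinfun_compose blinfun_eqI)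

lemma proj_le_absorb_right:
  assumes "is_proj p" "is_proj q" "proj_le p q" shows "p (q \<xi>) = p \<xi>"
proof -
  have "q o\<^sub>L p = p" using assms(3) by (simp add: proj_le_def)
  then have "adj (q o\<^sub>L p) = adj p" by simp
  then have "p o\<^sub>L q = p" using assms(1,2) by (simp add: adj_compose is_projD)
  then show ?thesis by (metis blinfun_apply_blinfun_compose)
qed

lemma proj_le_refl: "is_proj p \<Longrightarrow> proj_le p p" by (simp add: proj_le_iff is_projD)

lemma proj_le_trans: "proj_le p q \<Longrightarrow> proj_le q r \<Longrightarrow> proj_le p r"
  unfolding proj_le_iff by metis

lemma proj_le_antisym:
  "is_proj p \<Longrightarrow> is_proj q \<Longrightarrow> proj_le p q \<Longrightarrow> proj_le q p \<Longrightarrow> p = q"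
  by (rule blinfun_eqI) (metis proj_le_absorb_right proj_le_iff)

lemma proj_le_fixI:
  fixes p q :: "'a::complex_hilbert_space \<Rightarrow>\<^sub>L 'a"
  assumes "is_proj p" "\<And>\<xi>. p \<xi> = \<xi> \<Longrightarrow> q \<xi> = \<xi>" shows "proj_le p q"
  using assms by (simp add: proj_le_iff is_projD)

lemma is_proj_diff:
  assumes "is_proj p" "is_proj q" "proj_le p q" shows "is_proj (q - p)"
  using assms proj_le_absorb_right[OF assms]
  by (intro is_projI) (simp_all add: bounded_ops_diff is_projD blinfun_simps cinner_simps proj_le_iff)

lemma proj_norm_mono:
  assumes "is_proj p" "is_proj q" "proj_le p q" shows "norm (\<xi> - q \<xi>) \<le> norm (\<xi> - p \<xi>)"
proof -
  have "perp q \<xi> = perp q (perp p \<xi>)"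
    using assms by (simp add: blinfun_simps proj_le_iff)
  then show ?thesis
    using proj_norm_le[OF is_proj_perp[OF assms(2)], of "perp p \<xi>"] by (simp add: blinfun_simps)
qed

lemma is_proj_orth_sum:
  assumes "is_proj p" "is_proj q" "p o\<^sub>L q = 0" shows "is_proj (p + q)" "q o\<^sub>L p = 0"
proof -
  have "adj (p o\<^sub>L q) = 0" using assms(3) by simp
  then show qp: "q o\<^sub>L p = 0" using assms(1,2) by (simp add: adj_compose is_projD)
  have "p (q \<xi>) = 0" "q (p \<xi>) = 0" for \<xi>
    using assms(3) qp by (metis blinfun.zero_left blinfun_apply_blinfun_compose)+
  then show "is_proj (p + q)"
    using assms by (intro is_projI) (simp_all add: bounded_ops_add is_projD blinfun_simps cinner_simps)
qed

definition proj_on :: "'a::complex_hilbert_space set \<Rightarrow> 'a \<Rightarrow>\<^sub>L 'a" where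
  "proj_on S = Blinfun (\<lambda>\<xi>. SOME \<eta>. \<eta> \<in> S \<and> (\<forall>\<zeta>\<in>S. cinner (\<xi> - \<eta>) \<zeta> = 0))"

lemma
  fixes S :: "'a::complex_hilbert_space set"
  assumes S: "csubspace S" "closed S"
  shows proj_on_in: "proj_on S \<xi> \<in> S"
    and proj_on_orth: "\<zeta> \<in> S \<Longrightarrow> cinner (\<xi> - proj_on S \<xi>) \<zeta> = 0"
    and proj_on_unique: "\<eta> \<in> S \<Longrightarrow> (\<And>\<zeta>. \<zeta> \<in> S \<Longrightarrow> cinner (\<xi> - \<eta>) \<zeta> = 0) \<Longrightarrow> proj_on S \<xi> = \<eta>"
    and is_proj_proj_on: "is_proj (proj_on S)"
proof -
  define f where "f = (\<lambda>\<xi>. SOME \<eta>. \<eta> \<in> S \<and> (\<forall>\<zeta>\<in>S. cinner (\<xi> - \<eta>) \<zeta> = 0))"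
  have f: "f \<xi> \<in> S" "\<zeta> \<in> S \<Longrightarrow> cinner (\<xi> - f \<xi>) \<zeta> = 0" for \<xi> \<zeta>
    using someI_ex[OF projection_theorem[OF S, of \<xi>, unfolded Bex_def]] unfolding f_def by blast+
  have uniq: "f \<xi> = \<eta>" if \<eta>: "\<eta> \<in> S" "\<And>\<zeta>. \<zeta> \<in> S \<Longrightarrow> cinner (\<xi> - \<eta>) \<zeta> = 0" for \<xi> \<eta>
  proof -
    have "f \<xi> - \<eta> \<in> S" by (intro csubspaceD(4)[OF S(1)] f \<eta>)
    then have "cinner (f \<xi> - \<eta>) (f \<xi> - \<eta>) = 0"
      using f(2)[of "f \<xi> - \<eta>" \<xi>] \<eta>(2)[of "f \<xi> - \<eta>"] by (simp add: cinner_diff_left)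
    then show ?thesis by simp
  qed
  have add: "f (\<xi> + \<eta>) = f \<xi> + f \<eta>" for \<xi> \<eta>
  proof (rule uniq)
    fix \<zeta> assume "\<zeta> \<in> S"
    then show "cinner (\<xi> + \<eta> - (f \<xi> + f \<eta>)) \<zeta> = 0"
      using f(2)[of \<zeta> \<xi>] f(2)[of \<zeta> \<eta>] by (simp add: cinner_simps)
  qed (intro csubspaceD(2)[OF S(1)] f(1))
  have sc: "f (c *\<^sub>C \<xi>) = c *\<^sub>C f \<xi>" for c \<xi>
  proof (rule uniq)
    fix \<zeta> assume "\<zeta> \<in> S"
    then show "cinner (c *\<^sub>C \<xi> - c *\<^sub>C f \<xi>) \<zeta> = 0"
      using f(2)[of \<zeta> \<xi>] by (simp add: cinner_simps flip: right_diff_distrib)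
  qed (intro csubspaceD(3)[OF S(1)] f(1))
  have sa: "cinner (f \<xi>) \<eta> = cinner \<xi> (f \<eta>)" for \<xi> \<eta>
  proof -
    have "cinner (f \<xi>) (\<eta> - f \<eta>) = 0"
      using f(2)[OF f(1), of \<eta> \<xi>] cinner_commute[of "f \<xi>" "\<eta> - f \<eta>"] by simp
    then show ?thesis using f(2)[OF f(1), of \<xi> \<eta>] by (simp add: cinner_simps)
  qed
  have bd: "norm (f \<xi>) \<le> norm \<xi> * 1" for \<xi>
  proof -
    have "cinner (f \<xi>) (\<xi> - f \<xi>) = 0"
      using f(2)[OF f(1), of \<xi> \<xi>] cinner_commute[of "f \<xi>" "\<xi> - f \<xi>"] by simp
    from pythagoras[OF this] have "(norm (f \<xi>))\<^sup>2 \<le> (norm \<xi>)\<^sup>2" by simp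
    then have "norm (f \<xi>) \<le> norm \<xi>" by (rule power2_le_imp_le) simp
    then show ?thesis by simp
  qed
  have "bounded_linear f"
    by (rule bounded_linear_intro[where K = 1]) (use add sc bd in \<open>simp_all add: scaleR_eq_scaleC\<close>)
  then have eq: "blinfun_apply (proj_on S) = f"
    by (simp add: proj_on_def f_def bounded_linear_Blinfun_apply)
  show "proj_on S \<xi> \<in> S" "\<zeta> \<in> S \<Longrightarrow> cinner (\<xi> - proj_on S \<xi>) \<zeta> = 0" using f by (auto simp: eq)
  show "\<eta> \<in> S \<Longrightarrow> (\<And>\<zeta>. \<zeta> \<in> S \<Longrightarrow> cinner (\<xi> - \<eta>) \<zeta> = 0) \<Longrightarrow> proj_on S \<xi> = \<eta>"
    unfolding eq by (rule uniq)
  have "f (f \<xi>) = f \<xi>" for \<xi> by (rule uniq) (simp_all add: f)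
  then show "is_proj (proj_on S)"
    by (intro is_projI) (simp_all add: eq sa bounded_ops_def sc)
qed

lemma proj_on_fix_iff: "csubspace S \<Longrightarrow> closed S \<Longrightarrow> proj_on S \<xi> = \<xi> \<longleftrightarrow> \<xi> \<in> S"
  by (metis cinner_zero_left diff_self proj_on_in proj_on_unique)

lemma proj_on_commute:
  assumes S: "csubspace S" "closed S" and T: "T \<in> bounded_ops"
    and inv: "\<And>\<xi>. \<xi> \<in> S \<Longrightarrow> T \<xi> \<in> S" "\<And>\<xi>. \<xi> \<in> S \<Longrightarrow> adj T \<xi> \<in> S"
  shows "proj_on S o\<^sub>L T = T o\<^sub>L proj_on S"
proof (rule blinfun_eqI)
  fix \<xi>
  have "proj_on S (T \<xi>) = T (proj_on S \<xi>)"
  proof (rule proj_on_unique[OF S])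
    show "T (proj_on S \<xi>) \<in> S" by (intro inv proj_on_in S)
    fix \<zeta> assume "\<zeta> \<in> S"
    then have "cinner (\<xi> - proj_on S \<xi>) (adj T \<zeta>) = 0" by (intro proj_on_orth S inv)
    then show "cinner (T \<xi> - T (proj_on S \<xi>)) \<zeta> = 0"
      by (simp add: adj_cinner[OF T] flip: blinfun.diff_right)
  qed
  then show "(proj_on S o\<^sub>L T) \<xi> = (T o\<^sub>L proj_on S) \<xi>" by simp
qed

definition closed_hull :: "'a::complex_hilbert_space set \<Rightarrow> 'a set" where
  "closed_hull X = \<Inter>{S. csubspace S \<and> closed S \<and> X \<subseteq> S}"

lemma csubspace_closed_hull [simp]: "csubspace (closed_hull X)"
  and closed_closed_hull [simp]: "closed (closed_hull X)"
  and closed_hull_superset: "X \<subseteq> closed_hull X"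
  and closed_hull_least: "csubspace S \<Longrightarrow> closed S \<Longrightarrow> X \<subseteq> S \<Longrightarrow> closed_hull X \<subseteq> S"
  unfolding closed_hull_def by (auto simp: csubspace_def intro!: closed_Inter)

lemma csubspace_vimage:
  "T \<in> bounded_ops \<Longrightarrow> csubspace S \<Longrightarrow> csubspace {\<xi>. T \<xi> \<in> S}"
  by (simp add: csubspace_def blinfun_simps bounded_opsD)

lemma closed_vimage_blinfun: "closed S \<Longrightarrow> closed {\<xi>. blinfun_apply T \<xi> \<in> S}"
  using closed_vimage[of S "blinfun_apply T"]
  by (simp add: vimage_def linear_continuous_on blinfun.bounded_linear_right)

lemma closed_hull_invariant:
  assumes "T \<in> bounded_ops" "\<And>\<xi>. \<xi> \<in> X \<Longrightarrow> T \<xi> \<in> closed_hull X" "\<xi> \<in> closed_hull X"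
  shows "T \<xi> \<in> closed_hull X"
  using closed_hull_least[of "{\<xi>. T \<xi> \<in> closed_hull X}" X] assms
  by (auto simp: csubspace_vimage closed_vimage_blinfun)

text \<open>Multiplication by \<open>\<i>\<close>, used to express that algebras of operators are complex subspaces.\<close>

definition imag_unit :: "'a::complex_hilbert_space \<Rightarrow>\<^sub>L 'a" where
  "imag_unit = Blinfun ((*\<^sub>C) \<i>)"

lemma imag_unit_apply [simp]: "imag_unit \<xi> = \<i> *\<^sub>C \<xi>"
proof -
  have "bounded_linear ((*\<^sub>C) \<i> :: 'a \<Rightarrow> 'a)"
    by (rule bounded_linear_intro[where K = 1])
      (simp_all add: scaleC_add_right scaleR_eq_scaleC scaleC_scaleC norm_scaleC mult.commute)
  then show ?thesis by (simp add: imag_unit_def bounded_linear_Blinfun_apply)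
qed

lemma imag_unit_bounded_ops: "imag_unit \<in> bounded_ops"
  by (simp add: bounded_ops_def scaleC_scaleC mult.commute)

lemma commutantD:
  fixes N :: "('a::complex_hilbert_space \<Rightarrow>\<^sub>L 'a) set"
  assumes "y \<in> commutant N" shows "y \<in> bounded_ops" "x \<in> N \<Longrightarrow> y (x \<xi>) = x (y \<xi>)"
  using assms by (auto simp: commutant_def) (metis blinfun_apply_blinfun_compose)

lemma commutantI:
  fixes N :: "('a::complex_hilbert_space \<Rightarrow>\<^sub>L 'a) set"
  assumes "y \<in> bounded_ops" "\<And>x \<xi>. x \<in> N \<Longrightarrow> y (x \<xi>) = x (y \<xi>)" shows "y \<in> commutant N"
  using assms by (auto simp: commutant_def intro!: blinfun_eqI)

lemma commutant_adj:
  fixes N :: "('a::complex_hilbert_space \<Rightarrow>\<^sub>L 'a) set"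
  assumes "N \<subseteq> bounded_ops" "\<And>x. x \<in> N \<Longrightarrow> adj x \<in> N" "y \<in> commutant N"
  shows "adj y \<in> commutant N"
proof (rule commutantI)
  fix x \<xi> assume x: "x \<in> N"
  show "adj y (x \<xi>) = x (adj y \<xi>)"
  proof (rule cinner_eqI_right)
    fix \<eta>
    have yx: "y \<in> bounded_ops" "x \<in> bounded_ops" "y (adj x \<eta>) = adj x (y \<eta>)"
      using x assms(1) commutantD(1)[OF assms(3)] commutantD(2)[OF assms(3) assms(2)[OF x]] by auto
    have "cinner \<eta> (adj y (x \<xi>)) = cinner (adj x (y \<eta>)) \<xi>"
      by (simp only: adj_cinner[OF yx(1), symmetric] adj_cinner'[OF yx(2)])
    also have "\<dots> = cinner \<eta> (x (adj y \<xi>))"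
      by (simp only: yx(3)[symmetric] adj_cinner[OF yx(1)] adj_cinner'[OF yx(2)])
    finally show "cinner \<eta> (adj y (x \<xi>)) = cinner \<eta> (x (adj y \<xi>))" .
  qed
qed (intro adj_bounded_ops commutantD(1)[OF assms(3)])

locale von_neumann =
  fixes M :: "('a::complex_hilbert_space \<Rightarrow>\<^sub>L 'a) set"
  assumes vN: "von_neumann_algebra M"
begin

lemma bdd: "x \<in> M \<Longrightarrow> x \<in> bounded_ops" and adj: "x \<in> M \<Longrightarrow> adj x \<in> M"
  using vN by (auto simp: von_neumann_algebra_def)

lemma memI:
  assumes "T \<in> bounded_ops" "\<And>y \<xi>. y \<in> commutant M \<Longrightarrow> T (y \<xi>) = y (T \<xi>)" shows "T \<in> M"
  using commutantI[OF assms(1), of "commutant M"] assms(2) vN by (simp add: von_neumann_algebra_def)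

lemma comm: "y \<in> commutant M \<Longrightarrow> T \<in> M \<Longrightarrow> y (T \<xi>) = T (y \<xi>)"
  using commutantD by blast

lemma commutant_adj: "y \<in> commutant M \<Longrightarrow> adj y \<in> commutant M"
  using commutant_adj[of M y] bdd adj by blast

lemma zero [simp]: "0 \<in> M" and id [simp]: "id_blinfun \<in> M"
  by (rule memI; simp)+

lemma add: "S \<in> M \<Longrightarrow> T \<in> M \<Longrightarrow> S + T \<in> M"
  using comm[of _ S] comm[of _ T] by (intro memI) (simp_all add: bounded_ops_add bdd blinfun_simps)

lemma diff: "S \<in> M \<Longrightarrow> T \<in> M \<Longrightarrow> S - T \<in> M"
  using comm[of _ S] comm[of _ T] by (intro memI) (simp_all add: bounded_ops_diff bdd blinfun_simps)

lemma scaleR: "T \<in> M \<Longrightarrow> r *\<^sub>R T \<in> M"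
  using comm[of _ T] by (intro memI) (simp_all add: bounded_ops_scaleR bdd blinfun_simps)

lemma compose: "S \<in> M \<Longrightarrow> T \<in> M \<Longrightarrow> S o\<^sub>L T \<in> M"
  using comm[of _ S] comm[of _ T] by (intro memI) (simp_all add: bounded_ops_compose bdd)

lemma imag: "T \<in> M \<Longrightarrow> imag_unit o\<^sub>L T \<in> M"
  using comm[of _ T]
  by (intro memI) (simp_all add: bounded_ops_compose bdd imag_unit_bounded_ops bounded_opsD[OF commutantD(1)])

lemmas alg = zero id add diff scaleR compose adj

lemma projectionsD: "p \<in> projections M \<Longrightarrow> is_proj p" "p \<in> projections M \<Longrightarrow> p \<in> M"
  by (auto simp: projections_def is_proj_def bdd)

lemma projectionsI: "is_proj p \<Longrightarrow> p \<in> M \<Longrightarrow> p \<in> projections M"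
  by (auto simp: projections_def is_proj_def)

lemma perp_projection: "p \<in> projections M \<Longrightarrow> perp p \<in> projections M"
  by (meson diff id is_proj_perp projectionsD projectionsI)

lemma proj_on_mem:
  assumes "csubspace S" "closed S" "\<And>y \<xi>. y \<in> commutant M \<Longrightarrow> \<xi> \<in> S \<Longrightarrow> y \<xi> \<in> S"
  shows "proj_on S \<in> projections M"
proof (intro projectionsI memI)
  show "is_proj (proj_on S)" using assms is_proj_proj_on by blast
  then show "proj_on S \<in> bounded_ops" by (rule is_projD)
  fix y \<xi> assume "y \<in> commutant M"
  then have "proj_on S o\<^sub>L y = y o\<^sub>L proj_on S"
    by (intro proj_on_commute assms) (auto intro: assms commutant_adj commutantD)
  then show "proj_on S (y \<xi>) = y (proj_on S \<xi>)" by (metis blinfun_apply_blinfun_compose)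
qed

lemma centerD: "z \<in> center M \<Longrightarrow> z \<in> M" "z \<in> center M \<Longrightarrow> x \<in> M \<Longrightarrow> z (x \<xi>) = x (z \<xi>)"
  "z \<in> center M \<Longrightarrow> z \<in> commutant M"
proof -
  show *: "z \<in> center M \<Longrightarrow> z \<in> M" "z \<in> center M \<Longrightarrow> x \<in> M \<Longrightarrow> z (x \<xi>) = x (z \<xi>)" for x \<xi>
    by (auto simp: center_def) (metis blinfun_apply_blinfun_compose)
  show "z \<in> center M \<Longrightarrow> z \<in> commutant M" using * bdd by (auto intro!: commutantI)
qed

lemma centerI: "z \<in> M \<Longrightarrow> (\<And>x \<xi>. x \<in> M \<Longrightarrow> z (x \<xi>) = x (z \<xi>)) \<Longrightarrow> z \<in> center M"
  by (auto simp: center_def intro!: blinfun_eqI)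

lemma center_von_neumann: "von_neumann_algebra (center M)"
  unfolding von_neumann_algebra_def
proof (intro conjI ballI subset_antisym subsetI)
  fix z assume z: "z \<in> center M"
  then show "z \<in> bounded_ops" using bdd centerD by blast
  have "adj z \<in> commutant M" using commutant_adj centerD(3) z by blast
  then show "adj z \<in> center M" using adj z centerD(1) commutantD by (intro centerI) auto
  show "z \<in> commutant (commutant (center M))"
    using commutantD(2)[of _ "center M" z] z by (intro commutantI \<open>z \<in> bounded_ops\<close>) simp
next
  fix z assume z: "z \<in> commutant (commutant (center M))"
  have "y \<in> commutant (center M)" if "y \<in> M \<or> y \<in> commutant M" for y
  proof (rule commutantI)
    show "y \<in> bounded_ops" using that bdd commutantD by blast
    show "y (x \<xi>) = x (y \<xi>)" if "x \<in> center M" for x \<xi>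
      using that \<open>y \<in> M \<or> y \<in> commutant M\<close> centerD comm by metis
  qed
  then have *: "z (y \<xi>) = y (z \<xi>)" if "y \<in> M \<or> y \<in> commutant M" for y \<xi>
    using z that commutantD(2) by blast
  show "z \<in> center M"
    using * z commutantD(1) by (intro centerI memI) auto
qed

lemma center_proj_on:
  assumes "csubspace S" "closed S" "\<And>y \<xi>. y \<in> commutant M \<Longrightarrow> \<xi> \<in> S \<Longrightarrow> y \<xi> \<in> S"
    "\<And>y \<xi>. y \<in> M \<Longrightarrow> \<xi> \<in> S \<Longrightarrow> y \<xi> \<in> S"
  shows "proj_on S \<in> projections (center M)"
proof -
  have 1: "proj_on S \<in> projections M" by (rule proj_on_mem) (use assms in auto)
  have "proj_on S \<in> center M"
  proof (rule centerI)
    fix y \<xi> assume "y \<in> M"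
    then have "proj_on S o\<^sub>L y = y o\<^sub>L proj_on S"
      by (intro proj_on_commute assms) (auto intro: assms adj bdd)
    then show "proj_on S (y \<xi>) = y (proj_on S \<xi>)" by (metis blinfun_apply_blinfun_compose)
  qed (use 1 projectionsD in blast)
  then show ?thesis using 1 by (simp add: projections_def)
qed

end

text \<open>The least upper bound of a family of projections projects onto the closed span of their ranges;
  it does not depend on the algebra.\<close>

definition proj_sup :: "('a::complex_hilbert_space \<Rightarrow>\<^sub>L 'a) set \<Rightarrow> 'a \<Rightarrow>\<^sub>L 'a" where
  "proj_sup D = proj_on (closed_hull (\<Union>p\<in>D. range (blinfun_apply p)))"

lemma is_proj_proj_sup: "is_proj (proj_sup D)"
  unfolding proj_sup_def by (simp add: is_proj_proj_on)

lemma proj_sup_upper: "p \<in> D \<Longrightarrow> proj_le p (proj_sup D)"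
proof -
  assume "p \<in> D"
  then have "p \<xi> \<in> closed_hull (\<Union>p\<in>D. range (blinfun_apply p))" for \<xi>
    using closed_hull_superset[of "\<Union>p\<in>D. range (blinfun_apply p)"] by blast
  then show ?thesis by (simp add: proj_le_iff proj_sup_def proj_on_fix_iff)
qed

lemma fix_csubspace:
  assumes "T \<in> bounded_ops" shows "csubspace {\<xi>. T \<xi> = \<xi>}" "closed {\<xi>. T \<xi> = \<xi>}"
proof -
  show "csubspace {\<xi>. T \<xi> = \<xi>}" using assms by (simp add: csubspace_def blinfun_simps bounded_opsD)
  show "closed {\<xi>. T \<xi> = \<xi>}"
    by (intro closed_Collect_eq) (auto intro!: linear_continuous_on blinfun.bounded_linear_right)
qed

lemma proj_sup_fix_least:
  fixes D :: "('a::complex_hilbert_space \<Rightarrow>\<^sub>L 'a) set"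
  assumes S: "csubspace S" "closed S" "\<And>p \<xi>. p \<in> D \<Longrightarrow> p \<xi> \<in> S" and "proj_sup D \<xi> = \<xi>"
  shows "\<xi> \<in> S"
  using closed_hull_least[of S "\<Union>p\<in>D. range (blinfun_apply p)"] assms
  by (auto simp: proj_sup_def proj_on_fix_iff)

lemma proj_sup_least:
  assumes "is_proj q" "\<And>p. p \<in> D \<Longrightarrow> proj_le p q" shows "proj_le (proj_sup D) q"
  by (rule proj_le_fixI[OF is_proj_proj_sup], drule proj_sup_fix_least[rotated 3])
    (use assms fix_csubspace[of q] is_projD in \<open>auto simp: proj_le_iff\<close>)

text \<open>For an upward directed family no span is needed, so its projections converge strongly.\<close>

lemma proj_sup_directed:
  fixes D :: "('a::complex_hilbert_space \<Rightarrow>\<^sub>L 'a) set"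
  assumes D: "\<And>p. p \<in> D \<Longrightarrow> is_proj p" "D \<noteq> {}"
    and dir: "\<And>p q. p \<in> D \<Longrightarrow> q \<in> D \<Longrightarrow> \<exists>r\<in>D. proj_le p r \<and> proj_le q r"
    and \<xi>: "proj_sup D \<xi> = \<xi>" and "0 < e"
  shows "\<exists>p\<in>D. norm (\<xi> - p \<xi>) < e"
proof -
  let ?U = "\<Union>p\<in>D. range (blinfun_apply p)"
  have "csubspace ?U"
    unfolding csubspace_def
  proof (intro conjI ballI allI)
    show "0 \<in> ?U" using D(2) by (auto intro!: rangeI image_eqI[of _ _ 0])
  next
    fix \<xi> \<eta> assume "\<xi> \<in> ?U" "\<eta> \<in> ?U"
    then obtain p q \<xi>' \<eta>' where pq: "p \<in> D" "q \<in> D" "\<xi> = p \<xi>'" "\<eta> = q \<eta>'" by auto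
    then obtain r where "r \<in> D" "proj_le p r" "proj_le q r" using dir by blast
    then have "r (\<xi> + \<eta>) = \<xi> + \<eta>" using pq by (simp add: proj_le_iff blinfun_simps)
    then show "\<xi> + \<eta> \<in> ?U" using \<open>r \<in> D\<close> by (metis UN_I rangeI)
  next
    fix c \<xi> assume "\<xi> \<in> ?U"
    then obtain p \<xi>' where "p \<in> D" "\<xi> = p \<xi>'" by auto
    then have "c *\<^sub>C \<xi> = p (c *\<^sub>C \<xi>')" using D(1) is_projD(1) bounded_opsD by metis
    then show "c *\<^sub>C \<xi> \<in> ?U" using \<open>p \<in> D\<close> by blast
  qed
  then have "\<xi> \<in> closure ?U"
    by (rule proj_sup_fix_least[OF csubspace_closure _ _ \<xi>])
      (use closure_subset in \<open>auto intro: subsetD[OF closure_subset]\<close>)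
  then obtain \<eta> where \<eta>: "\<eta> \<in> ?U" "dist \<eta> \<xi> < e" using \<open>0 < e\<close> closure_approachable by blast
  then obtain p \<eta>' where p: "p \<in> D" "\<eta> = p \<eta>'" by auto
  then have "p \<eta> = \<eta>" using D(1) is_projD(2) by blast
  then have "\<xi> - p \<xi> = perp p (\<xi> - \<eta>)" by (simp add: blinfun_simps)
  then have "norm (\<xi> - p \<xi>) \<le> norm (\<xi> - \<eta>)"
    using proj_norm_le[OF is_proj_perp] D(1) p(1) by metis
  then show ?thesis using p(1) \<eta>(2) by (intro bexI[of _ p]) (simp_all add: dist_norm norm_minus_commute)
qed

lemma (in von_neumann) proj_sup_mem:
  assumes "D \<subseteq> projections M" shows "proj_sup D \<in> projections M"
  unfolding proj_sup_def
proof (rule proj_on_mem)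
  fix y \<xi> assume y: "y \<in> commutant M" and \<xi>: "\<xi> \<in> closed_hull (\<Union>p\<in>D. range (blinfun_apply p))"
  show "y \<xi> \<in> closed_hull (\<Union>p\<in>D. range (blinfun_apply p))"
  proof (rule closed_hull_invariant[OF _ _ \<xi>])
    fix \<eta> assume "\<eta> \<in> (\<Union>p\<in>D. range (blinfun_apply p))"
    then obtain p \<zeta> where "p \<in> D" "\<eta> = p \<zeta>" by auto
    then have "y \<eta> = p (y \<zeta>)" using comm[OF y] assms projectionsD(2) by (simp add: subset_iff)
    then have "y \<eta> \<in> (\<Union>p\<in>D. range (blinfun_apply p))" using \<open>p \<in> D\<close> by auto
    then show "y \<eta> \<in> closed_hull (\<Union>p\<in>D. range (blinfun_apply p))"
      by (rule subsetD[OF closed_hull_superset])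
  qed (use y commutantD in auto)
qed auto

lemma (in von_neumann) is_proj_sup_iff:
  assumes "D \<subseteq> projections M" shows "is_proj_sup M D p \<longleftrightarrow> p = proj_sup D"
proof
  assume p: "is_proj_sup M D p"
  then have "p \<in> projections M" "\<And>a. a \<in> D \<Longrightarrow> proj_le a p"
    "proj_le p (proj_sup D)"
    using proj_sup_mem[OF assms] proj_sup_upper[of _ D] by (auto simp: is_proj_sup_def)
  then show "p = proj_sup D"
    by (intro proj_le_antisym is_proj_proj_sup proj_sup_least) (auto dest: projectionsD)
next
  assume "p = proj_sup D"
  then show "is_proj_sup M D p"
    unfolding is_proj_sup_def using proj_sup_mem[OF assms] proj_sup_upper[of _ D] proj_sup_least[of _ D] projectionsD
    by blast
qed

lemma proj_incseq:
  fixes p :: "nat \<Rightarrow> 'a::complex_hilbert_space \<Rightarrow>\<^sub>L 'a"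
  assumes "\<And>n. proj_le (p n) (p (Suc n))" "\<And>n. is_proj (p n)" "m \<le> n" shows "proj_le (p m) (p n)"
  using assms(3) by (induction n rule: dec_induct) (auto intro: assms proj_le_refl proj_le_trans)

lemma (in von_neumann) increases_to_one_iff:
  assumes "\<And>n. p n \<in> projections M"
  shows "increases_to_one M p \<longleftrightarrow> (\<forall>n. proj_le (p n) (p (Suc n))) \<and> (\<forall>\<xi>. (\<lambda>n. p n \<xi>) \<longlonglongrightarrow> \<xi>)"
proof -
  have pr: "is_proj (p n)" for n using assms projectionsD by blast
  have sup: "is_proj_sup M (range p) id_blinfun \<longleftrightarrow> proj_sup (range p) = id_blinfun"
    by (subst is_proj_sup_iff) (use assms in auto)
  have "proj_sup (range p) = id_blinfun \<longleftrightarrow> (\<forall>\<xi>. (\<lambda>n. p n \<xi>) \<longlonglongrightarrow> \<xi>)"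
    if inc: "\<And>n. proj_le (p n) (p (Suc n))"
  proof (intro iffI allI)
    fix \<xi> assume 1: "proj_sup (range p) = id_blinfun"
    have le: "proj_le (p m) (p n)" if "m \<le> n" for m n
      by (rule proj_incseq[where p = p]) (use inc pr that in auto)
    show "(\<lambda>n. p n \<xi>) \<longlonglongrightarrow> \<xi>"
    proof (rule LIMSEQ_I)
      fix e :: real assume "0 < e"
      have "\<exists>q\<in>range p. norm (\<xi> - q \<xi>) < e"
      proof (rule proj_sup_directed)
        show "\<exists>r\<in>range p. proj_le q r \<and> proj_le q' r" if "q \<in> range p" "q' \<in> range p" for q q'
          using that le by (metis imageE max.cobounded1 max.cobounded2 rangeI)
      qed (use pr 1 \<open>0 < e\<close> in auto)
      then obtain m where "norm (\<xi> - p m \<xi>) < e" by auto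
      then have "norm (p n \<xi> - \<xi>) < e" if "m \<le> n" for n
        using proj_norm_mono[OF pr pr le[OF that], of \<xi>] by (simp add: norm_minus_commute)
      then show "\<exists>no. \<forall>n\<ge>no. norm (p n \<xi> - \<xi>) < e" by blast
    qed
  next
    assume lim: "\<forall>\<xi>. (\<lambda>n. p n \<xi>) \<longlonglongrightarrow> \<xi>"
    show "proj_sup (range p) = id_blinfun"
    proof (rule blinfun_eqI)
      fix \<xi>
      have "(\<lambda>n. proj_sup (range p) (p n \<xi>)) \<longlonglongrightarrow> proj_sup (range p) \<xi>"
        by (intro blinfun.tendsto tendsto_const) (use lim in blast)
      moreover have "proj_sup (range p) (p n \<xi>) = p n \<xi>" for n
        using proj_sup_upper[of "p n" "range p"] by (simp add: proj_le_iff)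
      ultimately have "(\<lambda>n. p n \<xi>) \<longlonglongrightarrow> proj_sup (range p) \<xi>" by simp
      then show "proj_sup (range p) \<xi> = id_blinfun \<xi>"
        using LIMSEQ_unique lim by simp blast
    qed
  qed
  then show ?thesis by (auto simp: increases_to_one_def sup)
qed

section \<open>Square roots, moduli and polar decomposition\<close>

text \<open>If \<open>a\<close> is a self-adjoint contraction, the recursion \<open>y \<mapsto> (a + y\<^sup>2) / 2\<close> converges in norm to
  a solution of \<open>(1 - y)\<^sup>2 = 1 - a\<close>, because its increments are majorised by those of the scalar
  recursion for \<open>a = 1\<close>, which increases to \<open>1\<close>.\<close>

fun sqrt_iter :: "('a::complex_hilbert_space \<Rightarrow>\<^sub>L 'a) \<Rightarrow> nat \<Rightarrow> 'a \<Rightarrow>\<^sub>L 'a" where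
  "sqrt_iter a 0 = 0"
| "sqrt_iter a (Suc n) = (1/2) *\<^sub>R (a + (sqrt_iter a n o\<^sub>L sqrt_iter a n))"

fun sqrt_iter_real :: "nat \<Rightarrow> real" where
  "sqrt_iter_real 0 = 0"
| "sqrt_iter_real (Suc n) = (1 + (sqrt_iter_real n)\<^sup>2) / 2"

lemma sqrt_iter_real_bounds: "0 \<le> sqrt_iter_real n \<and> sqrt_iter_real n \<le> 1"
  by (induction n) (auto simp: power_le_one)

lemma sqrt_iter_real_mono: "sqrt_iter_real n \<le> sqrt_iter_real (Suc n)"
  using zero_le_power2[of "sqrt_iter_real n - 1"] by (simp add: power2_eq_square algebra_simps)

lemma norm_sqrt_iter:
  assumes "norm a \<le> 1"
  shows "norm (sqrt_iter a n) \<le> sqrt_iter_real n"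
    and "norm (sqrt_iter a (Suc n) - sqrt_iter a n) \<le> sqrt_iter_real (Suc n) - sqrt_iter_real n"
proof -
  show bd: "norm (sqrt_iter a n) \<le> sqrt_iter_real n" for n
  proof (induction n)
    case (Suc n)
    have "norm (sqrt_iter a n o\<^sub>L sqrt_iter a n) \<le> (sqrt_iter_real n)\<^sup>2"
      unfolding power2_eq_square
      by (rule order_trans[OF norm_blinfun_compose]) (intro mult_mono Suc; simp add: sqrt_iter_real_bounds)
    then show ?case
      using assms norm_triangle_ineq[of a "sqrt_iter a n o\<^sub>L sqrt_iter a n"] by simp
  qed simp
  show "norm (sqrt_iter a (Suc n) - sqrt_iter a n) \<le> sqrt_iter_real (Suc n) - sqrt_iter_real n"
  proof (induction n)
    case (Suc n)
    let ?y = "sqrt_iter a (Suc n)" and ?x = "sqrt_iter a n"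
    let ?s = "sqrt_iter_real (Suc n)" and ?r = "sqrt_iter_real n"
    have "sqrt_iter a (Suc (Suc n)) - ?y
        = (1/2) *\<^sub>R ((?y o\<^sub>L (?y - ?x)) + ((?y - ?x) o\<^sub>L ?x))"
      by (rule blinfun_eqI) (simp add: blinfun_simps del: sqrt_iter.simps(2),
          simp add: blinfun_simps algebra_simps)
    also have "norm \<dots> \<le> (1/2) * (norm ?y * norm (?y - ?x) + norm (?y - ?x) * norm ?x)"
      unfolding norm_scaleR
      by (intro mult_mono norm_triangle_le add_mono norm_blinfun_compose) auto
    also have "\<dots> \<le> (1/2) * (?s * (?s - ?r) + (?s - ?r) * ?r)"
      by (intro mult_left_mono add_mono mult_mono bd Suc)
        (use sqrt_iter_real_bounds sqrt_iter_real_mono in \<open>simp_all del: sqrt_iter_real.simps\<close>)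
    also have "\<dots> = (1 + ?s\<^sup>2) / 2 - ?s"
    proof -
      have "?r\<^sup>2 = 2 * ?s - 1" by (simp add: field_simps)
      then show ?thesis by (simp add: power2_eq_square algebra_simps del: sqrt_iter_real.simps)
    qed
    also have "\<dots> = sqrt_iter_real (Suc (Suc n)) - ?s" by (simp only: sqrt_iter_real.simps(2)[of "Suc n"])
    finally show ?case .
  qed (use assms in simp)
qed

lemma contraction_sqrt:
  assumes a: "norm a \<le> 1" "a \<in> bounded_ops" "adj a = a"
  obtains y where "y \<in> bounded_ops" "adj y = y" "norm y \<le> 1" "2 *\<^sub>R y = a + (y o\<^sub>L y)"
    "\<And>T. T o\<^sub>L a = a o\<^sub>L T \<Longrightarrow> T o\<^sub>L y = y o\<^sub>L T"
proof -
  let ?y = "sqrt_iter a" and ?s = sqrt_iter_real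
  have diff: "norm (?y (n + k) - ?y n) \<le> ?s (n + k) - ?s n" for n k
  proof (induction k)
    case (Suc k)
    have "?y (n + Suc k) - ?y n = (?y (Suc (n + k)) - ?y (n + k)) + (?y (n + k) - ?y n)" by simp
    then show ?case
      using norm_sqrt_iter(2)[OF a(1), of "n + k"] Suc
      by (simp only: add_Suc_right) (smt (verit) norm_triangle_ineq)
  qed simp
  have "incseq ?s" using sqrt_iter_real_mono by (rule incseq_SucI)
  then obtain l where "?s \<longlonglongrightarrow> l" using incseq_convergent[of ?s 1] sqrt_iter_real_bounds by blast
  then have cs: "Cauchy ?s" by (simp add: LIMSEQ_imp_Cauchy)
  have "Cauchy ?y"
  proof (rule metric_CauchyI)
    fix e :: real assume "0 < e"
    then obtain N where N: "\<And>m n. N \<le> m \<Longrightarrow> N \<le> n \<Longrightarrow> dist (?s m) (?s n) < e"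
      using metric_CauchyD[OF cs] by blast
    have le: "dist (?y m) (?y n) < e" if "N \<le> n" "n \<le> m" for m n
    proof -
      have "dist (?s m) (?s n) < e" by (rule N) (use that in auto)
      then show ?thesis using diff[of n "m - n"] that by (simp add: dist_norm)
    qed
    then have "dist (?y m) (?y n) < e" if "N \<le> m" "N \<le> n" for m n
      using le[of n m] le[of m n] that by (cases "n \<le> m") (auto simp: dist_commute)
    then show "\<exists>N. \<forall>m\<ge>N. \<forall>n\<ge>N. dist (?y m) (?y n) < e" by blast
  qed
  then obtain y where y: "?y \<longlonglongrightarrow> y" using Cauchy_convergent_iff convergent_def by blast
  have bo: "?y n \<in> bounded_ops" for n by (induction n) (auto intro!: bounded_ops_intros a(2))
  have sa: "cinner (?y n \<xi>) \<eta> = cinner \<xi> (?y n \<eta>)" for n \<xi> \<eta>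
  proof (induction n arbitrary: \<xi> \<eta>)
    case (Suc n)
    then show ?case using adj_cinner[OF a(2), of \<xi> \<eta>] a(3) by (simp add: blinfun_simps cinner_simps)
  qed simp
  show ?thesis
  proof (rule that)
    show ybo: "y \<in> bounded_ops" using bo y by (rule bounded_ops_limit)
    show "adj y = y"
    proof (rule adj_eqI[OF ybo])
      fix \<xi> \<eta>
      have "(\<lambda>n. cinner (?y n \<xi>) \<eta>) \<longlonglongrightarrow> cinner (y \<xi>) \<eta>" "(\<lambda>n. cinner \<xi> (?y n \<eta>)) \<longlonglongrightarrow> cinner \<xi> (y \<eta>)"
        by (intro tendsto_cinner blinfun.tendsto y tendsto_const)+
      then show "cinner (y \<xi>) \<eta> = cinner \<xi> (y \<eta>)" unfolding sa using LIMSEQ_unique by blast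
    qed
    show "norm y \<le> 1"
    proof (rule LIMSEQ_le_const2)
      show "(\<lambda>n. norm (?y n)) \<longlonglongrightarrow> norm y" by (intro tendsto_norm y)
      show "\<exists>N. \<forall>n\<ge>N. norm (?y n) \<le> 1"
        using norm_sqrt_iter(1)[OF a(1)] sqrt_iter_real_bounds order_trans by blast
    qed
    have "(\<lambda>n. ?y (Suc n)) \<longlonglongrightarrow> (1/2) *\<^sub>R (a + (y o\<^sub>L y))"
      unfolding sqrt_iter.simps
      by (intro tendsto_intros bounded_bilinear.tendsto[OF bounded_bilinear_blinfun_compose] y)
    moreover have "(\<lambda>n. ?y (Suc n)) \<longlonglongrightarrow> y" using y by (rule LIMSEQ_Suc)
    ultimately have "y = (1/2) *\<^sub>R (a + (y o\<^sub>L y))" using LIMSEQ_unique by blast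
    then have "2 *\<^sub>R y = 2 *\<^sub>R ((1/2) *\<^sub>R (a + (y o\<^sub>L y)))" by simp
    then show "2 *\<^sub>R y = a + (y o\<^sub>L y)" by simp
    fix T assume T: "T o\<^sub>L a = a o\<^sub>L T"
    have Ta: "T (a \<xi>) = a (T \<xi>)" for \<xi> using T by (metis blinfun_apply_blinfun_compose)
    have Ty: "T (?y n \<xi>) = ?y n (T \<xi>)" for n \<xi>
      by (induction n arbitrary: \<xi>) (simp_all add: blinfun_simps Ta)
    show "T o\<^sub>L y = y o\<^sub>L T"
    proof (rule blinfun_eqI)
      fix \<xi>
      have "(\<lambda>n. T (?y n \<xi>)) \<longlonglongrightarrow> T (y \<xi>)" "(\<lambda>n. ?y n (T \<xi>)) \<longlonglongrightarrow> y (T \<xi>)"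
        by (intro blinfun.tendsto y tendsto_const)+
      then show "(T o\<^sub>L y) \<xi> = (y o\<^sub>L T) \<xi>" unfolding Ty using LIMSEQ_unique by auto
    qed
  qed
qed

text \<open>For \<open>c = \<parallel>A\<parallel>\<close> the operator \<open>a = 1 - A / c\<close> is a contraction, and \<open>\<surd>c (1 - y)\<close> is the wanted root if \<open>y\<close>
  solves \<open>(1 - y)\<^sup>2 = 1 - a\<close>. Being a limit of polynomials in \<open>A\<close> it commutes with everything that commutes with \<open>A\<close>.\<close>

lemma pos_sqrt_exists:
  assumes A: "pos_op A"
  shows "\<exists>B. pos_op B \<and> B o\<^sub>L B = A \<and> (\<forall>T. T o\<^sub>L A = A o\<^sub>L T \<longrightarrow> T o\<^sub>L B = B o\<^sub>L T)"
proof (cases "A = 0")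
  case True
  have "pos_op (0 :: 'a \<Rightarrow>\<^sub>L 'a)" by (rule pos_opI) simp_all
  then show ?thesis using True by (intro exI[of _ 0]) simp
next
  case False
  define c where "c = norm A"
  have c: "0 < c" using False by (simp add: c_def)
  define a where "a = id_blinfun - (1/c) *\<^sub>R A"
  have abo: "a \<in> bounded_ops" by (simp add: a_def bounded_ops_intros pos_op_bounded[OF A])
  have aa: "adj a = a"
    by (simp add: a_def adj_diff adj_scaleR bounded_ops_intros pos_op_bounded[OF A] pos_op_adj[OF A])
  have form: "Re (cinner (a \<xi>) \<xi>) = (norm \<xi>)\<^sup>2 - Re (cinner (A \<xi>) \<xi>) / c" for \<xi>
    by (simp add: a_def blinfun_simps cinner_simps Re_cinner_self)
  have Ale: "Re (cinner (A \<xi>) \<xi>) \<le> c * (norm \<xi>)\<^sup>2" for \<xi>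
  proof -
    have "Re (cinner (A \<xi>) \<xi>) \<le> norm (A \<xi>) * norm \<xi>"
      using complex_Re_le_cmod cauchy_schwarz order_trans by blast
    also have "\<dots> \<le> c * norm \<xi> * norm \<xi>" unfolding c_def by (intro mult_right_mono norm_blinfun) auto
    finally show ?thesis by (simp add: power2_eq_square mult.assoc)
  qed
  have "pos_op a"
    using Ale c by (subst pos_op_iff[OF abo aa]) (simp add: form field_simps)
  moreover have "Re (cinner (a \<xi>) \<xi>) \<le> 1 * (norm \<xi>)\<^sup>2" for \<xi>
    using pos_op_Re[OF A, of \<xi>] c by (simp add: form)
  ultimately have "norm (a \<xi>) \<le> 1 * norm \<xi>" for \<xi> by (intro norm_le_if_pos_le) auto
  then have "norm a \<le> 1" by (intro norm_blinfun_bound) auto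
  from contraction_sqrt[OF this abo aa] obtain y
    where y: "y \<in> bounded_ops" "adj y = y" "norm y \<le> 1" "2 *\<^sub>R y = a + (y o\<^sub>L y)"
      "\<And>T. T o\<^sub>L a = a o\<^sub>L T \<Longrightarrow> T o\<^sub>L y = y o\<^sub>L T" by metis
  define B where "B = sqrt c *\<^sub>R (id_blinfun - y)"
  have "pos_op (id_blinfun - y)"
  proof (subst pos_op_iff)
    show "\<forall>\<xi>. 0 \<le> Re (cinner ((id_blinfun - y) \<xi>) \<xi>)"
    proof
      fix \<xi>
      have "Re (cinner (y \<xi>) \<xi>) \<le> norm (y \<xi>) * norm \<xi>"
        using complex_Re_le_cmod cauchy_schwarz order_trans by blast
      also have "\<dots> \<le> (norm y * norm \<xi>) * norm \<xi>" by (intro mult_right_mono norm_blinfun) auto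
      also have "\<dots> \<le> (1 * norm \<xi>) * norm \<xi>" by (intro mult_right_mono y) auto
      finally show "0 \<le> Re (cinner ((id_blinfun - y) \<xi>) \<xi>)"
        by (simp add: blinfun_simps cinner_simps Re_cinner_self power2_eq_square)
    qed
  qed (simp_all add: y bounded_ops_intros adj_diff)
  then have B: "pos_op B" unfolding B_def using c by (intro pos_op_scaleR) auto
  have "B o\<^sub>L B = A"
  proof (rule blinfun_eqI)
    fix \<xi>
    have "2 *\<^sub>R y \<xi> = a \<xi> + y (y \<xi>)"
      using y(4) by (metis blinfun.add_left blinfun.scaleR_left blinfun_apply_blinfun_compose)
    then have yy: "y (y \<xi>) = 2 *\<^sub>R y \<xi> - a \<xi>" by simp
    have "(B o\<^sub>L B) \<xi> = c *\<^sub>R ((\<xi> - y \<xi>) - (y \<xi> - y (y \<xi>)))"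
      using c by (simp add: B_def blinfun_simps scaleR_diff_right)
    also have "\<dots> = c *\<^sub>R (\<xi> - a \<xi>)" by (simp add: yy scaleR_2)
    also have "\<dots> = A \<xi>" using c by (simp add: a_def blinfun_simps)
    finally show "(B o\<^sub>L B) \<xi> = A \<xi>" .
  qed
  moreover have "T o\<^sub>L B = B o\<^sub>L T" if T: "T o\<^sub>L A = A o\<^sub>L T" for T
  proof -
    have TA: "T (A \<xi>) = A (T \<xi>)" for \<xi> using T by (metis blinfun_apply_blinfun_compose)
    have "T o\<^sub>L a = a o\<^sub>L T" by (rule blinfun_eqI) (simp add: a_def blinfun_simps TA)
    then have "T (y \<xi>) = y (T \<xi>)" for \<xi> using y(5) by (metis blinfun_apply_blinfun_compose)
    then show ?thesis by (intro blinfun_eqI) (simp add: B_def blinfun_simps)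
  qed
  ultimately show ?thesis using B by blast
qed

text \<open>Any root \<open>E\<close> commutes with the root \<open>D\<close> constructed above, so \<open>(E + D) (E - D) = E\<^sup>2 - D\<^sup>2 = 0\<close>. Both \<open>E\<close> and
  \<open>D\<close> being positive, each of them vanishes on \<open>v = (E - D) \<xi>\<close>, and then \<open>\<parallel>v\<parallel>\<^sup>2 = \<langle>(E - D) v, \<xi>\<rangle> = 0\<close>.\<close>

lemma pos_sqrt_unique:
  assumes B: "pos_op B" and C: "pos_op C" and eq: "B o\<^sub>L B = C o\<^sub>L C" shows "B = C"
proof -
  obtain D where D: "pos_op D" "D o\<^sub>L D = B o\<^sub>L B" "\<And>T. T o\<^sub>L (B o\<^sub>L B) = (B o\<^sub>L B) o\<^sub>L T \<Longrightarrow> T o\<^sub>L D = D o\<^sub>L T"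
  proof -
    have "pos_op (B o\<^sub>L B)" using pos_op_adj_compose[of B] B by (simp add: pos_op_adj pos_op_bounded)
    then show ?thesis using that pos_sqrt_exists by metis
  qed
  have "E = D" if E: "pos_op E" and EE: "E o\<^sub>L E = B o\<^sub>L B" for E
  proof (rule blinfun_eqI)
    fix \<xi>
    have "E o\<^sub>L (B o\<^sub>L B) = (B o\<^sub>L B) o\<^sub>L E" unfolding EE[symmetric] by (rule blinfun_eqI) simp
    then have ED: "E (D \<zeta>) = D (E \<zeta>)" for \<zeta> using D(3) by (metis blinfun_apply_blinfun_compose)
    have sq: "E (E \<zeta>) = D (D \<zeta>)" for \<zeta> using EE D(2) by (metis blinfun_apply_blinfun_compose)
    define v where "v = E \<xi> - D \<xi>"
    have "E v + D v = 0" by (simp add: v_def blinfun_simps ED sq)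
    then have "Re (cinner (E v) v) + Re (cinner (D v) v) = 0"
      by (metis cinner_add_left cinner_zero_left plus_complex.sel(1) zero_complex.sel(1))
    then have "E v = 0" "D v = 0"
      using pos_op_Re[OF E, of v] pos_op_Re[OF D(1), of v] pos_op_null[OF E, of v] pos_op_null[OF D(1), of v]
      by auto
    then have "cinner v v = 0"
      unfolding v_def by (simp add: cinner_diff_left pos_op_hermitian[OF E] pos_op_hermitian[OF D(1)])
    then show "E \<xi> = D \<xi>" by (simp add: v_def)
  qed
  then show ?thesis using B C eq by metis
qed

definition pos_sqrt :: "('a::complex_hilbert_space \<Rightarrow>\<^sub>L 'a) \<Rightarrow> 'a \<Rightarrow>\<^sub>L 'a" where
  "pos_sqrt A = (THE B. pos_op B \<and> B o\<^sub>L B = A)"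

lemma pos_sqrt_eqI: "pos_op B \<Longrightarrow> B o\<^sub>L B = A \<Longrightarrow> pos_sqrt A = B"
  unfolding pos_sqrt_def using pos_sqrt_unique by (intro the_equality) auto

lemma
  assumes "pos_op A"
  shows pos_op_sqrt: "pos_op (pos_sqrt A)" and sqrt_square: "pos_sqrt A o\<^sub>L pos_sqrt A = A"
    and sqrt_commute: "T o\<^sub>L A = A o\<^sub>L T \<Longrightarrow> T (pos_sqrt A \<xi>) = pos_sqrt A (T \<xi>)"
proof -
  obtain B where B: "pos_op B" "B o\<^sub>L B = A" "\<And>T. T o\<^sub>L A = A o\<^sub>L T \<Longrightarrow> T o\<^sub>L B = B o\<^sub>L T"
    using pos_sqrt_exists[OF assms] by blast
  have eq: "pos_sqrt A = B" using B by (intro pos_sqrt_eqI)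
  show "pos_op (pos_sqrt A)" "pos_sqrt A o\<^sub>L pos_sqrt A = A" unfolding eq by (rule B(1), rule B(2))
  show "T (pos_sqrt A \<xi>) = pos_sqrt A (T \<xi>)" if "T o\<^sub>L A = A o\<^sub>L T"
    using B(3)[OF that] eq by (metis blinfun_apply_blinfun_compose)
qed

definition op_abs :: "('a::complex_hilbert_space \<Rightarrow>\<^sub>L 'a) \<Rightarrow> 'a \<Rightarrow>\<^sub>L 'a" where
  "op_abs T = pos_sqrt (adj T o\<^sub>L T)"

lemma
  assumes "T \<in> bounded_ops"
  shows pos_op_abs: "pos_op (op_abs T)" and abs_square: "op_abs T (op_abs T \<xi>) = adj T (T \<xi>)"
    and norm_op_abs: "norm (op_abs T \<xi>) = norm (T \<xi>)"
proof -
  have P: "pos_op (adj T o\<^sub>L T)" by (rule pos_op_adj_compose[OF assms])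
  show pos: "pos_op (op_abs T)" unfolding op_abs_def by (rule pos_op_sqrt[OF P])
  show sq: "op_abs T (op_abs T \<xi>) = adj T (T \<xi>)" for \<xi>
    using sqrt_square[OF P] unfolding op_abs_def by (metis blinfun_apply_blinfun_compose)
  have "complex_of_real ((norm (op_abs T \<xi>))\<^sup>2) = complex_of_real ((norm (T \<xi>))\<^sup>2)"
    unfolding cinner_norm[symmetric]
    by (simp add: pos_op_hermitian[OF pos] sq flip: adj_cinner[OF assms])
  then have "(norm (op_abs T \<xi>))\<^sup>2 = (norm (T \<xi>))\<^sup>2" by (simp only: of_real_eq_iff)
  then show "norm (op_abs T \<xi>) = norm (T \<xi>)" by (rule power2_eq_imp_eq) auto
qed

text \<open>The root of \<open>X\<close> commutes with \<open>G\<close>, so \<open>X G\<close> is \<open>X\<^sup>1\<^sup>/\<^sup>2 G X\<^sup>1\<^sup>/\<^sup>2\<close>.\<close>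

lemma pos_op_compose_commuting:
  assumes X: "pos_op X" and G: "pos_op G" and comm: "X o\<^sub>L G = G o\<^sub>L X" shows "pos_op (X o\<^sub>L G)"
proof -
  obtain s where s: "pos_op s" "s o\<^sub>L s = X" "\<And>\<xi>. G (s \<xi>) = s (G \<xi>)"
    using pos_op_sqrt[OF X] sqrt_square[OF X] sqrt_commute[OF X comm[symmetric]] by blast
  have "X o\<^sub>L G = adj s o\<^sub>L G o\<^sub>L s"
    unfolding pos_op_adj[OF s(1)] s(2)[symmetric] by (intro blinfun_eqI) (simp add: s(3))
  then show ?thesis using pos_op_sandwich[OF G pos_op_bounded[OF s(1)]] by simp
qed

context von_neumann
begin

lemma sqrt_mem: assumes "A \<in> M" "pos_op A" shows "pos_sqrt A \<in> M"
proof (rule memI)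
  show "pos_sqrt A \<in> bounded_ops" using pos_op_sqrt[OF assms(2)] by (rule pos_op_bounded)
  fix y \<xi> assume y: "y \<in> commutant M"
  have "y o\<^sub>L A = A o\<^sub>L y" by (rule blinfun_eqI) (simp add: comm[OF y assms(1)])
  then show "pos_sqrt A (y \<xi>) = y (pos_sqrt A \<xi>)" using sqrt_commute[OF assms(2)] by metis
qed

lemma abs_mem: "T \<in> M \<Longrightarrow> op_abs T \<in> M"
  unfolding op_abs_def by (intro sqrt_mem pos_op_adj_compose bdd compose adj)

text \<open>The partial isometry of the polar decomposition \<open>x = u |x|\<close> is the isometric extension of
  \<open>|x| \<xi> \<mapsto> x \<xi>\<close> to the closure of the range of \<open>|x|\<close>; it lies in the algebra because it commutes
  with the commutant.\<close>

lemma polar_decomposition: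
  fixes q :: "'a \<Rightarrow>\<^sub>L 'a"
  assumes x: "x \<in> M" "x \<noteq> 0" and q: "\<And>\<xi>. q (x \<xi>) = x \<xi>" and e: "is_proj e" "\<And>\<xi>. x (e \<xi>) = x \<xi>"
  obtains u where "u \<in> M" "u \<noteq> 0" "u o\<^sub>L adj u o\<^sub>L u = u"
    "adj u o\<^sub>L u \<in> projections M" "u o\<^sub>L adj u \<in> projections M"
    "proj_le (adj u o\<^sub>L u) e" "proj_le (u o\<^sub>L adj u) q"
proof -
  have xb: "x \<in> bounded_ops" using x bdd by blast
  define h where "h = op_abs x"
  have h: "pos_op h" "h \<in> M" "\<And>\<xi>. norm (h \<xi>) = norm (x \<xi>)"
    using pos_op_abs[OF xb] abs_mem[OF x(1)] norm_op_abs[OF xb] by (auto simp: h_def)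
  define S where "S = closure (range (blinfun_apply h))"
  have "csubspace (range (blinfun_apply h))"
    unfolding csubspace_def
  proof (intro conjI ballI allI)
    show "0 \<in> range (blinfun_apply h)" by (rule range_eqI[of _ _ 0]) simp
    fix \<xi> \<eta> assume "\<xi> \<in> range (blinfun_apply h)" "\<eta> \<in> range (blinfun_apply h)"
    then obtain \<xi>' \<eta>' where "\<xi> = h \<xi>'" "\<eta> = h \<eta>'" by auto
    then show "\<xi> + \<eta> \<in> range (blinfun_apply h)" by (simp flip: blinfun.add_right)
  next
    fix c \<xi> assume "\<xi> \<in> range (blinfun_apply h)"
    then obtain \<xi>' where "\<xi> = h \<xi>'" by auto
    then show "c *\<^sub>C \<xi> \<in> range (blinfun_apply h)"
      by (simp add: bounded_opsD[OF pos_op_bounded[OF h(1)], symmetric])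
  qed
  then have S: "csubspace S" "closed S" unfolding S_def by (auto intro: csubspace_closure)
  define P where "P = proj_on S"
  have P: "is_proj P" unfolding P_def by (rule is_proj_proj_on[OF S])
  \<comment> \<open>The closure of the graph of \<open>h \<xi> \<mapsto> x \<xi>\<close>.\<close>
  define R where "R \<zeta> \<eta> \<longleftrightarrow> (\<exists>f. (\<lambda>n::nat. h (f n)) \<longlonglongrightarrow> \<zeta> \<and> (\<lambda>n. x (f n)) \<longlonglongrightarrow> \<eta>)" for \<zeta> \<eta>
  have R_add: "R (\<zeta> + \<zeta>') (\<eta> + \<eta>')" if a: "R \<zeta> \<eta>" "R \<zeta>' \<eta>'" for \<zeta> \<zeta>' \<eta> \<eta>'
  proof -
    obtain f where "(\<lambda>n. h (f n)) \<longlonglongrightarrow> \<zeta>" "(\<lambda>n. x (f n)) \<longlonglongrightarrow> \<eta>"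
      using a(1) unfolding R_def by blast
    moreover obtain g where "(\<lambda>n. h (g n)) \<longlonglongrightarrow> \<zeta>'" "(\<lambda>n. x (g n)) \<longlonglongrightarrow> \<eta>'"
      using a(2) unfolding R_def by blast
    ultimately show ?thesis
      unfolding R_def by (intro exI[of _ "\<lambda>n. f n + g n"]) (simp add: blinfun_simps tendsto_add)
  qed
  have R_map: "R (y \<zeta>) (y \<eta>)" if a: "R \<zeta> \<eta>" "\<And>\<xi>. y (h \<xi>) = h (y \<xi>)" "\<And>\<xi>. y (x \<xi>) = x (y \<xi>)"
    for y :: "'a \<Rightarrow>\<^sub>L 'a" and \<zeta> \<eta>
  proof -
    obtain f where f: "(\<lambda>n. h (f n)) \<longlonglongrightarrow> \<zeta>" "(\<lambda>n. x (f n)) \<longlonglongrightarrow> \<eta>" using a(1) unfolding R_def by blast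
    have "(\<lambda>n. y (h (f n))) \<longlonglongrightarrow> y \<zeta>" "(\<lambda>n. y (x (f n))) \<longlonglongrightarrow> y \<eta>"
      by (intro blinfun.tendsto f tendsto_const)+
    then show ?thesis unfolding R_def a(2,3) by (intro exI[of _ "\<lambda>n. y (f n)"] conjI)
  qed
  have R_norm: "norm \<eta> = norm \<zeta>" if a: "R \<zeta> \<eta>" for \<zeta> \<eta>
  proof -
    obtain f where f: "(\<lambda>n. h (f n)) \<longlonglongrightarrow> \<zeta>" "(\<lambda>n. x (f n)) \<longlonglongrightarrow> \<eta>" using a unfolding R_def by blast
    from tendsto_norm[OF f(1)] tendsto_norm[OF f(2)] show ?thesis
      unfolding h(3) by (rule LIMSEQ_unique[rotated])
  qed
  have R_neg: "R (- \<zeta>) (- \<eta>)" if "R \<zeta> \<eta>" for \<zeta> \<eta>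
    using R_map[OF that, of "- id_blinfun"] by (simp add: blinfun_simps)
  have R_unique: "\<eta> = \<eta>'" if "R \<zeta> \<eta>" "R \<zeta> \<eta>'" for \<zeta> \<eta> \<eta>'
    using R_norm[OF R_add[OF that(1) R_neg[OF that(2)]]] by simp
  have R_ex: "\<exists>\<eta>. R (P \<zeta>) \<eta>" for \<zeta>
  proof -
    have "P \<zeta> \<in> closure (range (blinfun_apply h))" using proj_on_in[OF S] unfolding P_def S_def by blast
    then obtain g where g: "\<And>n. g n \<in> range (blinfun_apply h)" "g \<longlonglongrightarrow> P \<zeta>"
      unfolding closure_sequential by blast
    have "\<forall>n. \<exists>\<xi>. g n = h \<xi>" using g(1) by blast
    then obtain f where gf: "\<And>n. g n = h (f n)" by metis
    have "dist (x (f m)) (x (f n)) = dist (g m) (g n)" for m n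
      using h(3)[of "f m - f n"] by (simp add: gf dist_norm blinfun_simps)
    then have "Cauchy (\<lambda>n. x (f n))" using LIMSEQ_imp_Cauchy[OF g(2)] by (simp add: Cauchy_def)
    then obtain \<eta> where "(\<lambda>n. x (f n)) \<longlonglongrightarrow> \<eta>" using Cauchy_convergent_iff convergent_def by blast
    moreover have "(\<lambda>n. h (f n)) \<longlonglongrightarrow> P \<zeta>" using g(2) by (simp flip: gf)
    ultimately show ?thesis unfolding R_def by (intro exI[of _ \<eta>] exI[of _ f] conjI)
  qed
  then obtain v where v: "\<And>\<zeta>. R (P \<zeta>) (v \<zeta>)" by metis
  have sc_map: "R (c *\<^sub>C \<zeta>) (c *\<^sub>C \<eta>)" if "R \<zeta> \<eta>" for c \<zeta> \<eta>
  proof -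
    have "bounded_linear ((*\<^sub>C) c :: 'a \<Rightarrow> 'a)"
      by (rule bounded_linear_intro[where K = "cmod c"])
        (simp_all add: scaleC_add_right scaleR_eq_scaleC scaleC_scaleC norm_scaleC mult.commute)
    then have "blinfun_apply (Blinfun ((*\<^sub>C) c :: 'a \<Rightarrow> 'a)) = (*\<^sub>C) c" by (rule bounded_linear_Blinfun_apply)
    then show ?thesis
      using R_map[OF that, of "Blinfun ((*\<^sub>C) c)"] bdd[OF h(2)] xb by (simp add: bounded_opsD)
  qed
  have v_add: "v (\<zeta> + \<zeta>') = v \<zeta> + v \<zeta>'" for \<zeta> \<zeta>'
    using R_unique[OF v[of "\<zeta> + \<zeta>'"]] R_add[OF v v] by (simp add: blinfun_simps)
  have v_sc: "v (c *\<^sub>C \<zeta>) = c *\<^sub>C v \<zeta>" for c \<zeta>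
    using R_unique[OF v[of "c *\<^sub>C \<zeta>"]] sc_map[OF v] by (simp add: bounded_opsD is_projD(1)[OF P])
  have "bounded_linear v"
    by (rule bounded_linear_intro[where K = 1])
      (use v_add v_sc R_norm[OF v] proj_norm_le[OF P] in \<open>simp_all add: scaleR_eq_scaleC\<close>)
  then have Bv: "blinfun_apply (Blinfun v) = v" by (rule bounded_linear_Blinfun_apply)
  define u where "u = Blinfun v"
  have u: "R (P \<zeta>) (u \<zeta>)" "u \<in> bounded_ops" for \<zeta>
    using v v_sc by (simp_all add: u_def Bv bounded_ops_def)
  have hS: "h \<xi> \<in> S" for \<xi> unfolding S_def by (rule subsetD[OF closure_subset]) simp
  have PS: "P \<zeta> = \<zeta>" if "\<zeta> \<in> S" for \<zeta> using that unfolding P_def by (simp add: proj_on_fix_iff S)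
  have uh: "u (h \<xi>) = x \<xi>" for \<xi>
  proof (rule R_unique)
    show "R (h \<xi>) (u (h \<xi>))" using u(1)[of "h \<xi>"] by (simp add: PS hS)
    show "R (h \<xi>) (x \<xi>)" unfolding R_def by (intro exI[of _ "\<lambda>_. \<xi>"]) simp
  qed
  have yS: "y \<zeta> \<in> S" if a: "y \<in> commutant M" "\<zeta> \<in> S" for y \<zeta>
  proof -
    obtain g where g: "\<And>n. g n \<in> range (blinfun_apply h)" "g \<longlonglongrightarrow> \<zeta>"
      using a(2) unfolding S_def closure_sequential by blast
    have "y (g n) \<in> range (blinfun_apply h)" for n using g(1)[of n] comm[OF a(1) h(2)] by auto
    moreover have "(\<lambda>n. y (g n)) \<longlonglongrightarrow> y \<zeta>" by (intro blinfun.tendsto g tendsto_const)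
    ultimately show ?thesis
      unfolding S_def closure_sequential by (intro exI[of _ "\<lambda>n. y (g n)"]) simp
  qed
  have PM: "P \<in> projections M" unfolding P_def by (rule proj_on_mem[OF S yS])
  have uM: "u \<in> M"
  proof (rule memI[OF u(2)])
    fix y \<xi> assume y: "y \<in> commutant M"
    have "R (P (y \<xi>)) (y (u \<xi>))"
      using R_map[OF u(1), of y \<xi>] comm[OF y] h(2) x(1) projectionsD(2)[OF PM] by simp
    then show "u (y \<xi>) = y (u \<xi>)" using R_unique u(1) by blast
  qed
  have uP: "u (P \<zeta>) = u \<zeta>" for \<zeta> using R_unique[OF u(1)[of "P \<zeta>"]] u(1)[of \<zeta>] by (simp add: is_projD[OF P])
  have uu: "adj u o\<^sub>L u = P"
  proof -
    have form: "cinner (((adj u o\<^sub>L u) - P) \<xi>) \<xi> = 0" for \<xi>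
    proof -
      have "cinner (P \<xi>) \<xi> = cinner (P \<xi>) (P \<xi>)"
        using is_projD(3)[OF P, of "P \<xi>" \<xi>] by (simp add: is_projD(2)[OF P])
      moreover have "cinner (adj u (u \<xi>)) \<xi> = cinner (u \<xi>) (u \<xi>)" by (rule adj_cinner'[OF u(2)])
      moreover have "norm (u \<xi>) = norm (P \<xi>)" by (rule R_norm[OF u(1)])
      ultimately show ?thesis by (simp add: blinfun.diff_left cinner_diff_left cinner_norm)
    qed
    have "(adj u o\<^sub>L u) - P \<in> bounded_ops"
      using u(2) is_projD(1)[OF P] by (intro bounded_ops_diff bounded_ops_compose) auto
    then have "pos_op ((adj u o\<^sub>L u) - P)" by (simp add: pos_op_def form)
    then have "((adj u o\<^sub>L u) - P) \<xi> = 0" for \<xi> by (rule pos_op_null) (simp add: form)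
    then have "(adj u o\<^sub>L u) - P = 0" by (intro blinfun_eqI) simp
    then show ?thesis by simp
  qed
  have uuu: "u o\<^sub>L adj u o\<^sub>L u = u"
  proof (rule blinfun_eqI)
    fix \<xi>
    have "adj u (u \<xi>) = P \<xi>" using uu by (metis blinfun_apply_blinfun_compose)
    then show "(u o\<^sub>L adj u o\<^sub>L u) \<xi> = u \<xi>" by (simp add: uP)
  qed
  have eS: "e \<zeta> = \<zeta>" if "\<zeta> \<in> S" for \<zeta>
  proof -
    have "h (e \<xi>) = h \<xi>" for \<xi>
      using h(3)[of "e \<xi> - \<xi>"] e(2)[of \<xi>] by (simp add: blinfun_simps)
    then have "e (h \<xi>) = h \<xi>" for \<xi>
      by (intro cinner_eqI) (metis is_projD(3)[OF e(1)] pos_op_hermitian[OF h(1)])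
    then have "range (blinfun_apply h) \<subseteq> {\<zeta>. e \<zeta> = \<zeta>}" by auto
    then have "S \<subseteq> {\<zeta>. e \<zeta> = \<zeta>}"
      unfolding S_def by (rule closure_minimal) (rule fix_csubspace(2)[OF is_projD(1)[OF e(1)]])
    then show ?thesis using that by blast
  qed
  have qu: "q (u \<zeta>) = u \<zeta>" for \<zeta>
  proof -
    obtain f where f: "(\<lambda>n. x (f n)) \<longlonglongrightarrow> u \<zeta>" using u(1)[of \<zeta>] unfolding R_def by blast
    have "(\<lambda>n. q (x (f n))) \<longlonglongrightarrow> q (u \<zeta>)" by (intro blinfun.tendsto f tendsto_const)
    then show ?thesis unfolding q using f LIMSEQ_unique by blast
  qed
  show ?thesis
  proof (rule that[OF uM _ uuu])
    show "u \<noteq> 0"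
    proof
      assume "u = 0"
      then have "x = 0" using uh by (intro blinfun_eqI) simp
      then show False using x(2) by simp
    qed
    show "adj u o\<^sub>L u \<in> projections M" using PM uu by simp
    show "proj_le (adj u o\<^sub>L u) e"
      unfolding uu proj_le_iff using eS proj_on_in[OF S] by (simp add: P_def)
    show "proj_le (u o\<^sub>L adj u) q" by (simp add: proj_le_iff qu)
    show "u o\<^sub>L adj u \<in> projections M"
    proof (rule projectionsI)
      show "u o\<^sub>L adj u \<in> M" by (intro compose adj uM)
      have "u (adj u (u \<xi>)) = u \<xi>" for \<xi> using uuu by (metis blinfun_apply_blinfun_compose)
      then show "is_proj (u o\<^sub>L adj u)"
        by (intro is_projI) (simp_all add: bounded_ops_compose u(2) adj_cinner[OF u(2)] adj_cinner'[OF u(2)])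
    qed
  qed
qed

end

section \<open>The closed graph theorem\<close>

text \<open>By Baire's theorem the closure of some sublevel set of \<open>norm \<circ> T\<close> contains a ball; after
  translating to the origin every vector is, up to half its size, the image-controlled
  approximation needed to sum a geometric series, and closedness identifies the limit.\<close>

theorem closed_graph_bounded:
  fixes T :: "'a::banach \<Rightarrow> 'b::banach"
  assumes add: "\<And>\<xi> \<eta>. T (\<xi> + \<eta>) = T \<xi> + T \<eta>" and sc: "\<And>r \<xi>. T (r *\<^sub>R \<xi>) = r *\<^sub>R T \<xi>"
    and closed: "\<And>f \<xi> \<eta>. f \<longlonglongrightarrow> \<xi> \<Longrightarrow> (\<lambda>n::nat. T (f n)) \<longlonglongrightarrow> \<eta> \<Longrightarrow> T \<xi> = \<eta>"
  shows "bounded_linear T"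
proof -
  have diff: "T (\<xi> - \<eta>) = T \<xi> - T \<eta>" for \<xi> \<eta>
    using add[of \<xi> "(-1) *\<^sub>R \<eta>"] sc[of "-1" \<eta>] by simp
  have T0: "T 0 = 0" using sc[of 0 0] by simp
  define S where "S n = closure {\<xi>. norm (T \<xi>) \<le> real n}" for n
  have "\<exists>n. interior (S n) \<noteq> {}"
  proof (rule ccontr)
    assume *: "\<nexists>n. interior (S n) \<noteq> {}"
    have "(\<Union>(range S)) = UNIV"
    proof -
      have "\<xi> \<in> S (nat \<lceil>norm (T \<xi>)\<rceil>)" for \<xi>
        unfolding S_def by (rule subsetD[OF closure_subset]) (simp add: real_nat_ceiling_ge)
      then show ?thesis by blast
    qed
    moreover have "euclidean interior_of \<Union>(range S) = {}"
      using Met_TC.metric_Baire_category_alt[of "range S"] *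
      by (simp add: complete_UNIV S_def image_iff) (metis closed_closure closed_closedin)
    ultimately show False by simp
  qed
  then obtain n a where "a \<in> interior (S n)" by blast
  then obtain r where r: "0 < r" "ball a r \<subseteq> S n"
    by (meson interior_subset open_contains_ball open_interior subset_trans)
  define C where "C = 2 * real n"
  have approx: "\<exists>\<zeta>. norm (T \<zeta>) \<le> C \<and> norm (\<xi> - \<zeta>) < e" if \<xi>: "norm \<xi> < r" and e: "0 < e" for \<xi> e
  proof -
    have "a + \<xi> \<in> S n" "a \<in> S n" using r \<xi> by (auto simp: dist_norm intro!: subsetD[OF r(2)])
    then obtain u v where uv: "norm (T u) \<le> real n" "dist u (a + \<xi>) < e / 2" "norm (T v) \<le> real n" "dist v a < e / 2"
      unfolding S_def closure_approachable using e half_gt_zero by (metis (mono_tags) mem_Collect_eq)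
    have "norm (T (u - v)) \<le> C" unfolding diff C_def using uv norm_triangle_ineq4[of "T u" "T v"] by simp
    moreover have "norm (\<xi> - (u - v)) < e"
    proof -
      have eq: "\<xi> - (u - v) = (a + \<xi> - u) - (a - v)" by simp
      have "norm (a + \<xi> - u) < e / 2" "norm (a - v) < e / 2"
        using uv(2,4) by (simp_all add: dist_norm norm_minus_commute)
      then show ?thesis unfolding eq using norm_triangle_ineq4[of "a + \<xi> - u" "a - v"] by linarith
    qed
    ultimately show ?thesis by blast
  qed
  have step: "\<exists>\<zeta>. norm (T \<zeta>) \<le> C * t \<and> norm (\<xi> - \<zeta>) < e" if \<xi>: "norm \<xi> < r * t" and e: "0 < e" and t: "0 < t" for \<xi> e t
  proof -
    have "norm ((1/t) *\<^sub>R \<xi>) < r" "0 < e / t" using \<xi> t e by (simp_all add: field_simps)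
    from approx[OF this] obtain \<zeta> where \<zeta>: "norm (T \<zeta>) \<le> C" "norm ((1/t) *\<^sub>R \<xi> - \<zeta>) < e / t" by blast
    have "norm (\<xi> - t *\<^sub>R \<zeta>) = t * norm ((1/t) *\<^sub>R \<xi> - \<zeta>)"
      using t norm_scaleR[of t "(1/t) *\<^sub>R \<xi> - \<zeta>"] by (simp add: scaleR_diff_right)
    then have "norm (\<xi> - t *\<^sub>R \<zeta>) < e" using \<zeta>(2) t by (simp add: field_simps)
    moreover have "norm (T (t *\<^sub>R \<zeta>)) \<le> C * t" using \<zeta>(1) t by (simp add: sc mult.commute)
    ultimately show ?thesis by blast
  qed
  have bound: "norm (T \<xi>) \<le> 2 * C" if \<xi>: "norm \<xi> < r" for \<xi>
  proof -
    \<comment> \<open>The partial sums of the series: each step halves the remaining distance to \<open>\<xi>\<close>.\<close>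
    define P where "P n s \<longleftrightarrow> norm (\<xi> - s) < r * (1/2) ^ n" for n s
    have "\<exists>s. \<forall>n. P n (s n) \<and> norm (T (s (Suc n) - s n)) \<le> C * (1/2) ^ n \<and> (n = 0 \<longrightarrow> s n = 0)"
    proof -
      have "\<exists>s. \<forall>n. (P n (s n) \<and> (n = 0 \<longrightarrow> s n = 0)) \<and> norm (T (s (Suc n) - s n)) \<le> C * (1/2) ^ n"
      proof (rule dependent_nat_choice)
        show "\<exists>s. P 0 s \<and> (0 = 0 \<longrightarrow> s = (0::'a))" using \<xi> by (intro exI[of _ 0]) (simp add: P_def)
        fix s and n :: nat assume "P n s \<and> (n = 0 \<longrightarrow> s = 0)"
        then have "norm (\<xi> - s) < r * (1/2) ^ n" by (simp add: P_def)
        from step[OF this, of "r * (1/2) ^ Suc n"] r(1) obtain \<zeta>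
          where "norm (T \<zeta>) \<le> C * (1/2) ^ n" "norm (\<xi> - s - \<zeta>) < r * (1/2) ^ Suc n" by auto
        then show "\<exists>s'. (P (Suc n) s' \<and> (Suc n = 0 \<longrightarrow> s' = 0)) \<and> norm (T (s' - s)) \<le> C * (1/2) ^ n"
          by (intro exI[of _ "s + \<zeta>"]) (simp add: P_def diff_diff_eq)
      qed
      then show ?thesis by blast
    qed
    then obtain s where s: "\<And>n. norm (\<xi> - s n) < r * (1/2) ^ n" "s 0 = 0"
      "\<And>n. norm (T (s (Suc n) - s n)) \<le> C * (1/2) ^ n" unfolding P_def by blast
    have lim: "s \<longlonglongrightarrow> \<xi>"
    proof -
      have "(\<lambda>n. r * (1/2) ^ n) \<longlonglongrightarrow> 0"
        by (intro tendsto_mult_right_zero LIMSEQ_realpow_zero) auto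
      then have "(\<lambda>n. \<xi> - s n) \<longlonglongrightarrow> 0"
        by (rule Lim_null_comparison[rotated]) (use s(1) less_imp_le in \<open>auto intro!: always_eventually\<close>)
      then have "(\<lambda>n. \<xi> - (\<xi> - s n)) \<longlonglongrightarrow> \<xi> - 0" by (intro tendsto_diff tendsto_const)
      then show ?thesis by simp
    qed
    have summ: "summable (\<lambda>n. C * (1/2) ^ n)" by (intro summable_mult summable_geometric) simp
    have sm: "summable (\<lambda>n. T (s (Suc n) - s n))"
      by (rule summable_comparison_test'[OF summ, of 0]) (use s(3) in auto)
    have "(\<Sum>i<n. T (s (Suc i) - s i)) = T (s n)" for n
      by (induction n) (simp_all add: s(2) T0 diff)
    then have "(\<lambda>n. T (s n)) \<longlonglongrightarrow> (\<Sum>n. T (s (Suc n) - s n))" using summable_LIMSEQ[OF sm] by simp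
    then have "T \<xi> = (\<Sum>n. T (s (Suc n) - s n))" by (rule closed[OF lim])
    also have "norm \<dots> \<le> (\<Sum>n. C * (1/2) ^ n)" by (rule norm_suminf_le[OF s(3) summ])
    also have "\<dots> = 2 * C" using suminf_geometric[of "1/2::real"] by (simp add: suminf_mult summable_geometric)
    finally show ?thesis .
  qed
  have "norm (T \<xi>) \<le> norm \<xi> * (4 * C / r)" for \<xi>
  proof (cases "\<xi> = 0")
    case False
    define t where "t = r / (2 * norm \<xi>)"
    have t: "0 < t" using False r by (simp add: t_def)
    have "norm (t *\<^sub>R \<xi>) < r" using False r by (simp add: t_def)
    from bound[OF this] have "norm (T \<xi>) \<le> 2 * C / t" using t by (simp add: sc field_simps)
    then show ?thesis using False r by (simp add: t_def field_simps)
  qed (simp add: T0)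
  then show ?thesis by (intro bounded_linear_intro[where K = "4 * C / r"] add sc)
qed

section \<open>Closed operators that are bounded on a resolution of the identity\<close>

lemma op_graph_iff: "(\<xi>, \<eta>) \<in> op_graph T \<longleftrightarrow> \<eta> = T \<xi>"
  by (auto simp: op_graph_def)

lemma op_graph_inject: "op_graph S = op_graph T \<longleftrightarrow> S = T"
  by (metis blinfun_eqI op_graph_iff)

lemma closed_operatorD:
  fixes x :: "'a::complex_hilbert_space operator"
  assumes "closed_operator x"
  shows "(0, 0) \<in> x"
    "(\<xi>, \<eta>) \<in> x \<Longrightarrow> (\<xi>', \<eta>') \<in> x \<Longrightarrow> (\<xi> + \<xi>', \<eta> + \<eta>') \<in> x"
    "(\<xi>, \<eta>) \<in> x \<Longrightarrow> (c *\<^sub>C \<xi>, c *\<^sub>C \<eta>) \<in> x"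
    "(\<xi>, \<eta>) \<in> x \<Longrightarrow> (\<xi>, \<eta>') \<in> x \<Longrightarrow> \<eta> = \<eta>'"
    "(\<And>n::nat. (f n, g n) \<in> x) \<Longrightarrow> f \<longlonglongrightarrow> \<xi> \<Longrightarrow> g \<longlonglongrightarrow> \<eta> \<Longrightarrow> (\<xi>, \<eta>) \<in> x"
    "(\<xi>, \<eta>) \<in> x \<Longrightarrow> (\<xi>', \<eta>') \<in> x \<Longrightarrow> (\<xi> - \<xi>', \<eta> - \<eta>') \<in> x"
proof -
  show "(0, 0) \<in> x" using assms by (simp add: closed_operator_def)
  show add: "(\<xi>, \<eta>) \<in> x \<Longrightarrow> (\<xi>', \<eta>') \<in> x \<Longrightarrow> (\<xi> + \<xi>', \<eta> + \<eta>') \<in> x" for \<xi> \<eta> \<xi>' \<eta>'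
    using assms unfolding closed_operator_def by blast
  show sc: "(\<xi>, \<eta>) \<in> x \<Longrightarrow> (c *\<^sub>C \<xi>, c *\<^sub>C \<eta>) \<in> x" for c \<xi> \<eta>
    using assms unfolding closed_operator_def by blast
  show "(\<xi>, \<eta>) \<in> x \<Longrightarrow> (\<xi>, \<eta>') \<in> x \<Longrightarrow> \<eta> = \<eta>'"
    using assms unfolding closed_operator_def single_valued_def by blast
  show "(\<xi>, \<eta>) \<in> x" if "\<And>n::nat. (f n, g n) \<in> x" "f \<longlonglongrightarrow> \<xi>" "g \<longlonglongrightarrow> \<eta>"
    using assms closed_sequentially[of x "\<lambda>n. (f n, g n)" "(\<xi>, \<eta>)"] that
    by (simp add: closed_operator_def tendsto_Pair)
  show "(\<xi>, \<eta>) \<in> x \<Longrightarrow> (\<xi>', \<eta>') \<in> x \<Longrightarrow> (\<xi> - \<xi>', \<eta> - \<eta>') \<in> x"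
    using add[of \<xi> \<eta> "-\<xi>'" "-\<eta>'"] sc[of \<xi>' \<eta>' "-1"] by simp
qed

lemma closed_operator_op_graph:
  assumes "T \<in> bounded_ops" shows "closed_operator (op_graph T)"
  unfolding closed_operator_def
proof (intro conjI allI impI)
  have "op_graph T = {p. snd p = T (fst p)}" by (auto simp: op_graph_def)
  moreover have "closed {p. snd p = blinfun_apply T (fst p)}"
    by (intro closed_Collect_eq continuous_intros)
  ultimately show "closed (op_graph T)" by simp
qed (use assms in \<open>auto simp: op_graph_iff blinfun_simps bounded_opsD single_valued_def\<close>)

text \<open>The everywhere defined operator \<open>x p\<close> has a closed graph.\<close>

lemma closed_operator_bounded_part:
  assumes x: "closed_operator x" and p: "p \<in> bounded_ops" "range (blinfun_apply p) \<subseteq> Domain x"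
  obtains T where "T \<in> bounded_ops" "\<And>\<xi>. (p \<xi>, T \<xi>) \<in> x"
proof -
  have "\<exists>\<eta>. (p \<xi>, \<eta>) \<in> x" for \<xi> using p(2) by auto
  then obtain t where t: "\<And>\<xi>. (p \<xi>, t \<xi>) \<in> x" by metis
  have uniq: "t \<xi> = \<eta>" if "(p \<xi>, \<eta>) \<in> x" for \<xi> \<eta> by (rule closed_operatorD(4)[OF x t that])
  have add: "t (\<xi> + \<eta>) = t \<xi> + t \<eta>" for \<xi> \<eta>
    by (rule uniq) (simp add: blinfun_simps closed_operatorD(2)[OF x] t)
  have sc: "t (c *\<^sub>C \<xi>) = c *\<^sub>C t \<xi>" for c \<xi>
    by (rule uniq) (simp add: bounded_opsD[OF p(1)] closed_operatorD(3)[OF x] t)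
  have "bounded_linear t"
  proof (rule closed_graph_bounded)
    show "t (\<xi> + \<eta>) = t \<xi> + t \<eta>" "t (r *\<^sub>R \<xi>) = r *\<^sub>R t \<xi>" for \<xi> \<eta> r
      by (simp_all add: add sc scaleR_eq_scaleC)
    fix f \<xi> \<eta> assume f: "f \<longlonglongrightarrow> \<xi>" "(\<lambda>n::nat. t (f n)) \<longlonglongrightarrow> \<eta>"
    have "(\<lambda>n. p (f n)) \<longlonglongrightarrow> p \<xi>" by (intro blinfun.tendsto f tendsto_const)
    then show "t \<xi> = \<eta>" using closed_operatorD(5)[OF x t _ f(2)] uniq by blast
  qed
  then have Bt: "blinfun_apply (Blinfun t) = t" by (rule bounded_linear_Blinfun_apply)
  show ?thesis by (rule that[of "Blinfun t"]) (simp_all add: Bt bounded_ops_def sc t)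
qed

lemma strong_prod_right:
  fixes w S :: "'a::complex_hilbert_space \<Rightarrow>\<^sub>L 'a"
  assumes x: "closed_operator x" and w: "\<And>\<xi>. (w \<xi>, S \<xi>) \<in> x"
  shows "strong_prod x (op_graph w) = op_graph S"
proof -
  have "op_graph w O x = op_graph S"
    using w closed_operatorD(4)[OF x] by (auto simp: op_graph_iff relcomp_unfold)
  moreover have "closed (op_graph S)"
  proof -
    have "op_graph S = {p. snd p = S (fst p)}" by (auto simp: op_graph_def)
    moreover have "closed {p. snd p = blinfun_apply S (fst p)}"
      by (intro closed_Collect_eq continuous_intros)
    ultimately show ?thesis by simp
  qed
  ultimately show ?thesis by (simp add: strong_prod_def)
qed

lemma strong_prod_rightD:
  fixes w S :: "'a::complex_hilbert_space \<Rightarrow>\<^sub>L 'a"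
  assumes x: "closed_operator x" and "strong_prod x (op_graph w) = op_graph S"
  shows "(w \<xi>, S \<xi>) \<in> x"
proof -
  have "(\<xi>, S \<xi>) \<in> closure (op_graph w O x)"
    using assms(2) by (simp add: strong_prod_def op_graph_iff)
  then obtain h where h: "\<And>n. h n \<in> op_graph w O x" "h \<longlonglongrightarrow> (\<xi>, S \<xi>)"
    unfolding closure_sequential by blast
  have "(w (fst (h n)), snd (h n)) \<in> x" for n using h(1)[of n] by (auto simp: op_graph_iff)
  moreover have "(\<lambda>n. w (fst (h n))) \<longlonglongrightarrow> w \<xi>" "(\<lambda>n. snd (h n)) \<longlonglongrightarrow> S \<xi>"
    using tendsto_fst[OF h(2)] tendsto_snd[OF h(2)] by (auto intro!: blinfun.tendsto tendsto_const)
  ultimately show ?thesis by (rule closed_operatorD(5)[OF x])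
qed

text \<open>If \<open>z\<close> increases to the identity and the bounded operators \<open>T\<^sub>n\<close> are the compressions of each
  other, they are the restrictions of exactly one closed operator that commutes with every \<open>z\<^sub>n\<close>.\<close>

definition resolving :: "(nat \<Rightarrow> 'a::complex_hilbert_space \<Rightarrow>\<^sub>L 'a) \<Rightarrow> bool" where
  "resolving z \<longleftrightarrow> (\<forall>n. is_proj (z n)) \<and> (\<forall>n. proj_le (z n) (z (Suc n))) \<and> (\<forall>\<xi>. (\<lambda>n. z n \<xi>) \<longlonglongrightarrow> \<xi>)"

definition coherent :: "(nat \<Rightarrow> 'a::complex_hilbert_space \<Rightarrow>\<^sub>L 'a) \<Rightarrow> (nat \<Rightarrow> 'a \<Rightarrow>\<^sub>L 'a) \<Rightarrow> bool" where
  "coherent z T \<longleftrightarrow> resolving z \<and> (\<forall>n. T n \<in> bounded_ops) \<and>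
     (\<forall>m n \<xi>. m \<le> n \<longrightarrow> T n (z m \<xi>) = T m \<xi> \<and> z m (T n \<xi>) = T m \<xi>)"

definition glue :: "(nat \<Rightarrow> 'a::complex_hilbert_space \<Rightarrow>\<^sub>L 'a) \<Rightarrow> (nat \<Rightarrow> 'a \<Rightarrow>\<^sub>L 'a) \<Rightarrow> 'a operator" where
  "glue z T = {(\<xi>, \<eta>). \<forall>n. z n \<eta> = T n \<xi>}"

lemma resolvingD:
  assumes "resolving z"
  shows "is_proj (z n)" "(\<lambda>n. z n \<xi>) \<longlonglongrightarrow> \<xi>" "m \<le> n \<Longrightarrow> proj_le (z m) (z n)"
    "m \<le> n \<Longrightarrow> z n (z m \<xi>) = z m \<xi>" "m \<le> n \<Longrightarrow> z m (z n \<xi>) = z m \<xi>"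
proof -
  show p: "is_proj (z n)" "(\<lambda>n. z n \<xi>) \<longlonglongrightarrow> \<xi>" for n using assms by (auto simp: resolving_def)
  show le: "proj_le (z m) (z n)" if "m \<le> n" for m n
    by (rule proj_incseq[where p = z]) (use assms that in \<open>auto simp: resolving_def\<close>)
  show "z n (z m \<xi>) = z m \<xi>" if "m \<le> n" using le[OF that] by (simp add: proj_le_iff)
  show "z m (z n \<xi>) = z m \<xi>" if "m \<le> n" by (rule proj_le_absorb_right[OF p(1) p(1) le[OF that]])
qed

lemma coherentD:
  assumes "coherent z T"
  shows "resolving z" "T n \<in> bounded_ops" "m \<le> n \<Longrightarrow> T n (z m \<xi>) = T m \<xi>" "m \<le> n \<Longrightarrow> z m (T n \<xi>) = T m \<xi>"
    "T n (z n \<xi>) = T n \<xi>" "z n (T n \<xi>) = T n \<xi>" "m \<le> n \<Longrightarrow> T m (z n \<xi>) = T m \<xi>" "m \<le> n \<Longrightarrow> z n (T m \<xi>) = T m \<xi>"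
proof -
  show r: "resolving z" and c: "T n \<in> bounded_ops" "m \<le> n \<Longrightarrow> T n (z m \<xi>) = T m \<xi>" "m \<le> n \<Longrightarrow> z m (T n \<xi>) = T m \<xi>"
    "T n (z n \<xi>) = T n \<xi>" "z n (T n \<xi>) = T n \<xi>" for m n \<xi> using assms by (auto simp: coherent_def)
  show "T m (z n \<xi>) = T m \<xi>" if "m \<le> n"
    using c(4)[of m "z n \<xi>"] c(4)[of m \<xi>] resolvingD(5)[OF r that] by simp
  show "z n (T m \<xi>) = T m \<xi>" if "m \<le> n"
    using c(5)[of m \<xi>] resolvingD(4)[OF r that] by metis
qed

lemma glue_compression: "(\<xi>, \<eta>) \<in> glue z T \<Longrightarrow> z n \<eta> = T n \<xi>"
  by (simp add: glue_def)

context
  fixes z T :: "nat \<Rightarrow> 'a::complex_hilbert_space \<Rightarrow>\<^sub>L 'a"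
  assumes co: "coherent z T"
begin

lemma glue_restrict: "(z n \<xi>, T n \<xi>) \<in> glue z T"
  unfolding glue_def
proof safe
  fix m
  show "z m (T n \<xi>) = T m (z n \<xi>)"
  proof (cases "m \<le> n")
    case True
    then show ?thesis by (simp add: coherentD[OF co])
  next
    case False
    then have "n \<le> m" by simp
    then show ?thesis by (simp add: coherentD[OF co])
  qed
qed

lemma glue_iff: "(\<xi>, \<eta>) \<in> glue z T \<longleftrightarrow> (\<lambda>n. T n \<xi>) \<longlonglongrightarrow> \<eta>"
proof
  assume "(\<xi>, \<eta>) \<in> glue z T"
  then have "z n \<eta> = T n \<xi>" for n by (rule glue_compression)
  then show "(\<lambda>n. T n \<xi>) \<longlonglongrightarrow> \<eta>" using resolvingD(2)[OF coherentD(1)[OF co], of \<eta>] by simp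
next
  assume lim: "(\<lambda>n. T n \<xi>) \<longlonglongrightarrow> \<eta>"
  show "(\<xi>, \<eta>) \<in> glue z T"
    unfolding glue_def
  proof safe
    fix m
    have "(\<lambda>n. z m (T n \<xi>)) \<longlonglongrightarrow> z m \<eta>" by (intro blinfun.tendsto lim tendsto_const)
    moreover have "\<forall>\<^sub>F n in sequentially. z m (T n \<xi>) = T m \<xi>"
      using eventually_ge_at_top[of m] by eventually_elim (rule coherentD(4)[OF co])
    ultimately have "(\<lambda>n. T m \<xi>) \<longlonglongrightarrow> z m \<eta>" by (simp add: tendsto_cong)
    then show "z m \<eta> = T m \<xi>" using LIMSEQ_unique tendsto_const by blast
  qed
qed

lemma glue_unique: "(\<xi>, \<eta>) \<in> glue z T \<Longrightarrow> (\<xi>, \<eta>') \<in> glue z T \<Longrightarrow> \<eta> = \<eta>'"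
  unfolding glue_iff by (rule LIMSEQ_unique)

lemma closed_operator_glue: "closed_operator (glue z T)"
  unfolding closed_operator_def
proof (intro conjI allI impI)
  have "glue z T = (\<Inter>n. {p. z n (snd p) = T n (fst p)})" by (auto simp: glue_def)
  moreover have "closed {p. blinfun_apply (z n) (snd p) = blinfun_apply (T n) (fst p)}" for n
    by (intro closed_Collect_eq continuous_intros)
  ultimately show "closed (glue z T)" by auto
  show "single_valued (glue z T)" using glue_unique by (auto simp: single_valued_def)
qed (use coherentD(2)[OF co] is_projD(1)[OF resolvingD(1)[OF coherentD(1)[OF co]]]
      in \<open>auto simp: glue_def blinfun_simps bounded_opsD\<close>)

lemma eq_glueI:
  assumes x: "closed_operator x" and res: "\<And>n \<xi>. (z n \<xi>, T n \<xi>) \<in> x"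
    and comm: "\<And>n \<xi> \<eta>. (\<xi>, \<eta>) \<in> x \<Longrightarrow> (z n \<xi>, z n \<eta>) \<in> x"
  shows "x = glue z T"
proof (intro set_eqI iffI; clarify)
  fix \<xi> \<eta> assume "(\<xi>, \<eta>) \<in> x"
  then have "z n \<eta> = T n \<xi>" for n by (rule closed_operatorD(4)[OF x comm res])
  then show "(\<xi>, \<eta>) \<in> glue z T" by (simp add: glue_def)
next
  fix \<xi> \<eta> assume "(\<xi>, \<eta>) \<in> glue z T"
  then have "(\<lambda>n. T n \<xi>) \<longlonglongrightarrow> \<eta>" by (simp add: glue_iff)
  then show "(\<xi>, \<eta>) \<in> x"
    by (rule closed_operatorD(5)[OF x res resolvingD(2)[OF coherentD(1)[OF co]]])
qed

lemma coherent_adj: "coherent z (\<lambda>n. adj (T n))"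
  unfolding coherent_def
proof (intro conjI allI impI)
  note b = coherentD(2)[OF co] and p = resolvingD(1)[OF coherentD(1)[OF co]]
  fix m n \<xi> assume mn: "m \<le> (n::nat)"
  show "adj (T n) (z m \<xi>) = adj (T m) \<xi>"
    by (rule cinner_eqI) (simp add: adj_cinner'[OF b] is_projD(3)[OF p] coherentD[OF co] mn)
  show "z m (adj (T n) \<xi>) = adj (T m) \<xi>"
    by (rule cinner_eqI) (simp add: adj_cinner'[OF b] is_projD(3)[OF p] coherentD[OF co] mn)
qed (use coherentD[OF co] in auto)

lemma op_adjoint_glue: "op_adjoint (glue z T) = glue z (\<lambda>n. adj (T n))"
proof (intro set_eqI iffI; clarify)
  note b = coherentD(2)[OF co] and p = resolvingD(1)[OF coherentD(1)[OF co]]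
    and l = resolvingD(2)[OF coherentD(1)[OF co]]
  fix \<eta> \<zeta>
  show "(\<eta>, \<zeta>) \<in> glue z (\<lambda>n. adj (T n))" if "(\<eta>, \<zeta>) \<in> op_adjoint (glue z T)"
    unfolding glue_def
  proof safe
    fix n show "z n \<zeta> = adj (T n) \<eta>"
    proof (rule cinner_eqI_right)
      fix \<xi>
      have "cinner (T n \<xi>) \<eta> = cinner (z n \<xi>) \<zeta>"
        using that glue_restrict[of n \<xi>] unfolding op_adjoint_def by blast
      then show "cinner \<xi> (z n \<zeta>) = cinner \<xi> (adj (T n) \<eta>)" by (simp add: adj_cinner[OF b] is_projD(3)[OF p])
    qed
  qed
  show "(\<eta>, \<zeta>) \<in> op_adjoint (glue z T)" if g: "(\<eta>, \<zeta>) \<in> glue z (\<lambda>n. adj (T n))"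
    unfolding op_adjoint_def
  proof clarify
    fix \<xi> \<theta> assume "(\<xi>, \<theta>) \<in> glue z T"
    then have "cinner (z n \<theta>) \<eta> = cinner \<xi> (z n \<zeta>)" for n
      using glue_compression[OF g, of n] glue_compression[of \<xi> \<theta> z T n] by (simp add: adj_cinner[OF b])
    moreover have "(\<lambda>n. cinner (z n \<theta>) \<eta>) \<longlonglongrightarrow> cinner \<theta> \<eta>" "(\<lambda>n. cinner \<xi> (z n \<zeta>)) \<longlonglongrightarrow> cinner \<xi> \<zeta>"
      by (intro tendsto_cinner l tendsto_const)+
    ultimately show "cinner \<theta> \<eta> = cinner \<xi> \<zeta>" using LIMSEQ_unique by simp
  qed
qed

lemma Domain_glue: "\<xi> \<in> Domain (glue z T) \<longleftrightarrow> Cauchy (\<lambda>n. T n \<xi>)"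
  by (auto simp: Domain_iff glue_iff Cauchy_convergent_iff convergent_def)

end

lemma coherent_add: "coherent z S \<Longrightarrow> coherent z T \<Longrightarrow> coherent z (\<lambda>n. S n + T n)"
  unfolding coherent_def by (simp add: bounded_ops_add blinfun_simps)

lemma coherent_diff: "coherent z S \<Longrightarrow> coherent z T \<Longrightarrow> coherent z (\<lambda>n. S n - T n)"
  unfolding coherent_def by (simp add: bounded_ops_diff blinfun_simps)

lemma strong_sum_glue:
  assumes S: "coherent z S" and T: "coherent z T"
  shows "strong_sum (glue z S) (glue z T) = glue z (\<lambda>n. S n + T n)"
  unfolding strong_sum_def
proof (intro subset_antisym closure_minimal subsetI)
  note ST = coherent_add[OF S T]
  show "closed (glue z (\<lambda>n. S n + T n))" using closed_operator_glue[OF ST] by (simp add: closed_operator_def)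
  fix p assume "p \<in> glue z (\<lambda>n. S n + T n)"
  then obtain \<xi> \<eta> where p: "p = (\<xi>, \<eta>)" "(\<lambda>n. (S n + T n) \<xi>) \<longlonglongrightarrow> \<eta>" by (cases p) (auto simp: glue_iff[OF ST])
  have "(\<lambda>n. (z n \<xi>, S n \<xi> + T n \<xi>)) \<longlonglongrightarrow> (\<xi>, \<eta>)"
    using p(2) by (intro tendsto_Pair resolvingD(2)[OF coherentD(1)[OF S]]) (simp add: blinfun_simps)
  then show "p \<in> closure {(\<xi>, \<eta> + \<zeta>) |\<xi> \<eta> \<zeta>. (\<xi>, \<eta>) \<in> glue z S \<and> (\<xi>, \<zeta>) \<in> glue z T}"
    unfolding p closure_sequential
    by (intro exI[of _ "\<lambda>n. (z n \<xi>, S n \<xi> + T n \<xi>)"]) (use glue_restrict[OF S] glue_restrict[OF T] in blast)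
qed (auto simp: glue_def blinfun_simps)

lemma strong_diff_glue:
  assumes S: "coherent z S" and T: "coherent z T"
  shows "strong_diff (glue z S) (glue z T) = glue z (\<lambda>n. S n - T n)"
  unfolding strong_diff_def
proof (intro subset_antisym closure_minimal subsetI)
  note ST = coherent_diff[OF S T]
  show "closed (glue z (\<lambda>n. S n - T n))" using closed_operator_glue[OF ST] by (simp add: closed_operator_def)
  fix p assume "p \<in> glue z (\<lambda>n. S n - T n)"
  then obtain \<xi> \<eta> where p: "p = (\<xi>, \<eta>)" "(\<lambda>n. (S n - T n) \<xi>) \<longlonglongrightarrow> \<eta>" by (cases p) (auto simp: glue_iff[OF ST])
  have "(\<lambda>n. (z n \<xi>, S n \<xi> - T n \<xi>)) \<longlonglongrightarrow> (\<xi>, \<eta>)"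
    using p(2) by (intro tendsto_Pair resolvingD(2)[OF coherentD(1)[OF S]]) (simp add: blinfun_simps)
  then show "p \<in> closure {(\<xi>, \<eta> - \<zeta>) |\<xi> \<eta> \<zeta>. (\<xi>, \<eta>) \<in> glue z S \<and> (\<xi>, \<zeta>) \<in> glue z T}"
    unfolding p closure_sequential
    by (intro exI[of _ "\<lambda>n. (z n \<xi>, S n \<xi> - T n \<xi>)"]) (use glue_restrict[OF S] glue_restrict[OF T] in blast)
qed (auto simp: glue_def blinfun_simps)

lemma positive_glue_iff:
  assumes co: "coherent z T" shows "positive_operator (glue z T) \<longleftrightarrow> (\<forall>n. pos_op (T n))"
proof
  note p = resolvingD(1)[OF coherentD(1)[OF co]]
  assume P: "positive_operator (glue z T)"
  then have "glue z (\<lambda>n. adj (T n)) = glue z T" by (simp add: positive_operator_def op_adjoint_glue[OF co])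
  have "cinner (T n \<xi>) \<xi> \<in> \<real>\<^sub>\<ge>\<^sub>0" for n \<xi>
  proof -
    have "cinner (T n \<xi>) (z n \<xi>) \<in> \<real>\<^sub>\<ge>\<^sub>0"
      using P glue_restrict[OF co, of n \<xi>] unfolding positive_operator_def by blast
    moreover have "cinner (T n \<xi>) (z n \<xi>) = cinner (z n (T n \<xi>)) \<xi>" by (simp add: is_projD(3)[OF p])
    ultimately show ?thesis by (simp add: coherentD(6)[OF co])
  qed
  then show "\<forall>n. pos_op (T n)" by (simp add: pos_op_def coherentD(2)[OF co])
next
  assume P: "\<forall>n. pos_op (T n)"
  have "cinner \<eta> \<xi> \<in> \<real>\<^sub>\<ge>\<^sub>0" if "(\<xi>, \<eta>) \<in> glue z T" for \<xi> \<eta>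
  proof -
    have "(\<lambda>n. cinner (T n \<xi>) \<xi>) \<longlonglongrightarrow> cinner \<eta> \<xi>"
      using that unfolding glue_iff[OF co] by (intro tendsto_cinner tendsto_const)
    moreover have "cinner (T n \<xi>) \<xi> \<in> \<real>\<^sub>\<ge>\<^sub>0" for n using P by (simp add: pos_op_def)
    ultimately show ?thesis
      using closed_sequentially[OF closed_nonneg_Reals_complex, of "\<lambda>n. cinner (T n \<xi>) \<xi>"] by simp
  qed
  moreover have "(\<lambda>n. adj (T n)) = T" using P pos_op_adj by auto
  ultimately show "positive_operator (glue z T)"
    using op_adjoint_glue[OF co] closed_operator_glue[OF co] by (auto simp: positive_operator_def)
qed

text \<open>Two glued operators can be combined piece by piece once they are glued over the same sequence; the
  products of the projections provide one.\<close>

lemma resolving_compose: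
  fixes z w :: "nat \<Rightarrow> 'a::complex_hilbert_space \<Rightarrow>\<^sub>L 'a"
  assumes z: "resolving z" and w: "resolving w" and comm: "\<And>m n \<xi>. z m (w n \<xi>) = w n (z m \<xi>)"
  shows "resolving (\<lambda>n. z n o\<^sub>L w n)"
  unfolding resolving_def
proof (intro conjI allI)
  note pz = resolvingD(1)[OF z] and pw = resolvingD(1)[OF w]
  fix n
  show "is_proj (z n o\<^sub>L w n)" by (intro proj_comm_compose pz pw blinfun_eqI) (simp add: comm)
  show "proj_le (z n o\<^sub>L w n) (z (Suc n) o\<^sub>L w (Suc n))"
    unfolding proj_le_iff
  proof
    fix \<xi>
    have "z (Suc n) (w (Suc n) (z n (w n \<xi>))) = z (Suc n) (z n (w (Suc n) (w n \<xi>)))" by (simp add: comm)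
    also have "\<dots> = z n (w n \<xi>)" by (simp add: resolvingD(4)[OF w] resolvingD(4)[OF z])
    finally show "(z (Suc n) o\<^sub>L w (Suc n)) ((z n o\<^sub>L w n) \<xi>) = (z n o\<^sub>L w n) \<xi>" by simp
  qed
next
  fix \<xi>
  have "norm (z n (w n \<xi>) - \<xi>) \<le> norm (w n \<xi> - \<xi>) + norm (z n \<xi> - \<xi>)" for n
  proof -
    have eq: "z n (w n \<xi>) - \<xi> = z n (w n \<xi> - \<xi>) + (z n \<xi> - \<xi>)" by (simp add: blinfun_simps)
    show ?thesis
      unfolding eq using proj_norm_le[OF resolvingD(1)[OF z], of n "w n \<xi> - \<xi>"]
        norm_triangle_ineq[of "z n (w n \<xi> - \<xi>)" "z n \<xi> - \<xi>"] by linarith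
  qed
  moreover have "(\<lambda>n. norm (w n \<xi> - \<xi>) + norm (z n \<xi> - \<xi>)) \<longlonglongrightarrow> 0"
    using resolvingD(2)[OF z, of \<xi>] resolvingD(2)[OF w, of \<xi>]
    by (intro tendsto_add_zero tendsto_norm_zero) (simp_all add: LIM_zero)
  ultimately have "(\<lambda>n. z n (w n \<xi>) - \<xi>) \<longlonglongrightarrow> 0"
    by (intro Lim_null_comparison[of "\<lambda>n. z n (w n \<xi>) - \<xi>"] always_eventually) auto
  then show "(\<lambda>n. (z n o\<^sub>L w n) \<xi>) \<longlonglongrightarrow> \<xi>" by (simp add: LIM_zero_iff)
qed

lemma
  fixes z w T :: "nat \<Rightarrow> 'a::complex_hilbert_space \<Rightarrow>\<^sub>L 'a"
  assumes co: "coherent z T" and w: "resolving w"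
    and comm: "\<And>m n \<xi>. z m (w n \<xi>) = w n (z m \<xi>)" "\<And>m n \<xi>. T m (w n \<xi>) = w n (T m \<xi>)"
  shows coherent_refine: "coherent (\<lambda>n. z n o\<^sub>L w n) (\<lambda>n. T n o\<^sub>L w n)"
    and glue_refine: "glue (\<lambda>n. z n o\<^sub>L w n) (\<lambda>n. T n o\<^sub>L w n) = glue z T"
proof -
  note z = coherentD(1)[OF co]
  show c: "coherent (\<lambda>n. z n o\<^sub>L w n) (\<lambda>n. T n o\<^sub>L w n)"
    unfolding coherent_def
  proof (intro conjI allI impI)
    show "resolving (\<lambda>n. z n o\<^sub>L w n)" by (rule resolving_compose[OF z w comm(1)])
    show "T n o\<^sub>L w n \<in> bounded_ops" for n
      by (intro bounded_ops_compose coherentD(2)[OF co] is_projD(1) resolvingD(1)[OF w])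
    fix m n :: nat and \<xi> assume mn: "m \<le> n"
    show "(T n o\<^sub>L w n) ((z m o\<^sub>L w m) \<xi>) = (T m o\<^sub>L w m) \<xi>"
    proof -
      have "T n (w n (z m (w m \<xi>))) = T n (z m (w n (w m \<xi>)))" by (simp add: comm)
      then show ?thesis using mn by (simp add: resolvingD(4)[OF w] coherentD[OF co])
    qed
    show "(z m o\<^sub>L w m) ((T n o\<^sub>L w n) \<xi>) = (T m o\<^sub>L w m) \<xi>"
    proof -
      have "z m (w m (T n (w n \<xi>))) = z m (T n (w m (w n \<xi>)))" by (simp add: comm)
      then show ?thesis using mn by (simp add: resolvingD(5)[OF w] coherentD[OF co])
    qed
  qed
  show "glue (\<lambda>n. z n o\<^sub>L w n) (\<lambda>n. T n o\<^sub>L w n) = glue z T"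
  proof (rule eq_glueI[OF c closed_operator_glue[OF co], symmetric])
    fix n \<xi> show "((z n o\<^sub>L w n) \<xi>, (T n o\<^sub>L w n) \<xi>) \<in> glue z T"
      using glue_restrict[OF co, of n "w n \<xi>"] by simp
    fix \<eta> assume g: "(\<xi>, \<eta>) \<in> glue z T"
    show "((z n o\<^sub>L w n) \<xi>, (z n o\<^sub>L w n) \<eta>) \<in> glue z T"
      using glue_restrict[OF co, of n "w n \<xi>"] glue_compression[OF g, of n] by (simp add: comm)
  qed
qed

section \<open>The modulus of a glued operator\<close>

lemma coherent_abs:
  fixes z T :: "nat \<Rightarrow> 'a::complex_hilbert_space \<Rightarrow>\<^sub>L 'a"
  assumes co: "coherent z T" shows "coherent z (\<lambda>n. op_abs (T n))"
proof -
  note b = coherentD(2)[OF co] and p = resolvingD(1)[OF coherentD(1)[OF co]] and ad = coherent_adj[OF co]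
  have P: "pos_op (adj (T n) o\<^sub>L T n)" for n by (rule pos_op_adj_compose[OF b])
  have *: "op_abs (T n) (z m \<xi>) = op_abs (T m) \<xi> \<and> z m (op_abs (T n) \<xi>) = op_abs (T m) \<xi>"
    if mn: "m \<le> n" for m n \<xi>
  proof -
    have Az: "adj (T n) (T n (z m \<xi>)) = adj (T m) (T m \<xi>)" for \<xi>
      using coherentD(3)[OF ad mn, of "T m \<xi>"] by (simp add: coherentD[OF co] mn)
    have zA: "z m (adj (T n) (T n \<xi>)) = adj (T m) (T m \<xi>)" for \<xi>
      using coherentD(5)[OF ad, of m "T n \<xi>"] by (simp add: coherentD(4)[OF ad mn] coherentD(4)[OF co mn])
    have "z m o\<^sub>L (adj (T n) o\<^sub>L T n) = (adj (T n) o\<^sub>L T n) o\<^sub>L z m" by (rule blinfun_eqI) (simp add: Az zA)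
    then have zH: "z m (op_abs (T n) \<xi>) = op_abs (T n) (z m \<xi>)" for \<xi>
      unfolding op_abs_def using sqrt_commute[OF P] by blast
    have "pos_op (op_abs (T n) o\<^sub>L z m)"
      by (intro pos_op_compose_commuting pos_op_abs b is_projD(5) p blinfun_eqI) (simp add: zH)
    moreover have "(op_abs (T n) o\<^sub>L z m) o\<^sub>L (op_abs (T n) o\<^sub>L z m) = adj (T m) o\<^sub>L T m"
      by (rule blinfun_eqI) (simp add: zH is_projD(2)[OF p] abs_square[OF b] Az)
    ultimately have "op_abs (T m) = op_abs (T n) o\<^sub>L z m"
      unfolding op_abs_def[of "T m"] by (rule pos_sqrt_eqI)
    then show ?thesis by (simp add: zH)
  qed
  show ?thesis
    unfolding coherent_def using * coherentD(1)[OF co] pos_op_bounded[OF pos_op_abs[OF b]] by blast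
qed

lemma relcomp_glue_adjoint:
  fixes z T :: "nat \<Rightarrow> 'a::complex_hilbert_space \<Rightarrow>\<^sub>L 'a"
  assumes co: "coherent z T"
  shows "(\<xi>, \<zeta>) \<in> glue z T O glue z (\<lambda>n. adj (T n)) \<longleftrightarrow>
    Cauchy (\<lambda>n. T n \<xi>) \<and> (\<forall>n. z n \<zeta> = adj (T n) (T n \<xi>))"
proof
  note ad = coherent_adj[OF co]
  {
    assume "(\<xi>, \<zeta>) \<in> glue z T O glue z (\<lambda>n. adj (T n))"
    then obtain \<eta> where \<eta>: "(\<xi>, \<eta>) \<in> glue z T" "(\<eta>, \<zeta>) \<in> glue z (\<lambda>n. adj (T n))" by blast
    have "z n \<zeta> = adj (T n) (T n \<xi>)" for n
      using glue_compression[OF \<eta>(1), of n] glue_compression[OF \<eta>(2), of n] coherentD(5)[OF ad, of n \<eta>] by simp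
    then show "Cauchy (\<lambda>n. T n \<xi>) \<and> (\<forall>n. z n \<zeta> = adj (T n) (T n \<xi>))"
      using \<eta>(1) Domain_glue[OF co] by blast
  next
    assume r: "Cauchy (\<lambda>n. T n \<xi>) \<and> (\<forall>n. z n \<zeta> = adj (T n) (T n \<xi>))"
    then obtain \<eta> where \<eta>: "(\<xi>, \<eta>) \<in> glue z T" using Domain_glue[OF co] by blast
    have "z n \<zeta> = adj (T n) \<eta>" for n
      using glue_compression[OF \<eta>(1), of n] r coherentD(5)[OF ad, of n \<eta>] by metis
    then have "(\<eta>, \<zeta>) \<in> glue z (\<lambda>n. adj (T n))" by (simp add: glue_def)
    then show "(\<xi>, \<zeta>) \<in> glue z T O glue z (\<lambda>n. adj (T n))" using \<eta> by blast
  }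
qed

text \<open>Both sides have the pieces \<open>T\<^sub>n\<^sup>* T\<^sub>n = |T\<^sub>n|\<^sup>2\<close>, and the same domain because \<open>\<parallel>|T\<^sub>n| \<xi> - |T\<^sub>m| \<xi>\<parallel> = \<parallel>T\<^sub>n \<xi> - T\<^sub>m \<xi>\<parallel>\<close>.\<close>

lemma glue_abs_square:
  fixes z T :: "nat \<Rightarrow> 'a::complex_hilbert_space \<Rightarrow>\<^sub>L 'a"
  assumes co: "coherent z T"
  shows "glue z (\<lambda>n. op_abs (T n)) O glue z (\<lambda>n. op_abs (T n)) = glue z T O op_adjoint (glue z T)"
proof -
  note b = coherentD(2)[OF co] and ab = coherent_abs[OF co]
  have *: "dist (op_abs (T m) \<xi>) (op_abs (T n) \<xi>) = dist (T m \<xi>) (T n \<xi>)" if "m \<le> n" for m n \<xi>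
  proof -
    have "norm (op_abs (T n) (\<xi> - z m \<xi>)) = norm (T n (\<xi> - z m \<xi>))" by (rule norm_op_abs[OF b])
    then show ?thesis
      using that coherentD(3)[OF co that, of \<xi>] coherentD(3)[OF ab that, of \<xi>]
      by (simp add: blinfun_simps dist_norm norm_minus_commute)
  qed
  have "dist (op_abs (T m) \<xi>) (op_abs (T n) \<xi>) = dist (T m \<xi>) (T n \<xi>)" for m n \<xi>
    using *[of m n \<xi>] *[of n m \<xi>] by (cases "m \<le> n") (auto simp: dist_commute)
  then have "Cauchy (\<lambda>n. op_abs (T n) \<xi>) \<longleftrightarrow> Cauchy (\<lambda>n. T n \<xi>)" for \<xi> by (simp add: Cauchy_def)
  then have "(\<xi>, \<zeta>) \<in> glue z (\<lambda>n. op_abs (T n)) O glue z (\<lambda>n. op_abs (T n))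
      \<longleftrightarrow> (\<xi>, \<zeta>) \<in> glue z T O op_adjoint (glue z T)" for \<xi> \<zeta>
    using relcomp_glue_adjoint[OF ab, of \<xi> \<zeta>] relcomp_glue_adjoint[OF co, of \<xi> \<zeta>]
    by (simp only: op_adjoint_glue[OF co] pos_op_adj[OF pos_op_abs[OF b]] abs_square[OF b])
  then show ?thesis by auto
qed

text \<open>A positive root \<open>h\<close> must leave the range of each \<open>w = z\<^sub>n\<close> invariant, which reduces uniqueness to
  the bounded case. Write \<open>h w = X + Y\<close> with \<open>X = w h w\<close> and \<open>Y = (1 - w) h w\<close>, and
  \<open>G = Y\<^sup>* Y\<close>. As \<open>h\<^sup>2\<close> preserves the range of \<open>w\<close>, positivity of \<open>h\<close> on the range of \<open>Y\<close> reads
  \<open>G X \<le> 0\<close>; since \<open>G\<close> and \<open>X\<close> are positive, \<open>G X = 0\<close>. Then \<open>h Y = G\<close>, \<open>h G = Y G\<close>, and positivity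
  of \<open>h\<close> at \<open>Y \<xi> - G \<xi>\<close> forces \<open>G = 0\<close>.\<close>

lemma positive_root_unique:
  fixes z T :: "nat \<Rightarrow> 'a::complex_hilbert_space \<Rightarrow>\<^sub>L 'a"
  assumes co: "coherent z T" and h: "positive_operator h"
    and sq: "h O h = glue z (\<lambda>n. op_abs (T n)) O glue z (\<lambda>n. op_abs (T n))"
  shows "h = glue z (\<lambda>n. op_abs (T n))"
proof -
  note b = coherentD(2)[OF co] and ab = coherent_abs[OF co] and p = resolvingD(1)[OF coherentD(1)[OF co]]
  let ?H = "\<lambda>n. op_abs (T n)"
  have cl: "closed_operator h" using h by (simp add: positive_operator_def)
  have sym: "cinner \<eta> \<xi>' = cinner \<xi> \<eta>'" if "(\<xi>, \<eta>) \<in> h" "(\<xi>', \<eta>') \<in> h" for \<xi> \<eta> \<xi>' \<eta>'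
  proof -
    have "(\<xi>', \<eta>') \<in> op_adjoint h" using h that(2) by (simp add: positive_operator_def)
    then show ?thesis using that(1) unfolding op_adjoint_def by blast
  qed
  have pos: "cinner \<eta> \<xi> \<in> \<real>\<^sub>\<ge>\<^sub>0" if "(\<xi>, \<eta>) \<in> h" for \<xi> \<eta>
    using h that unfolding positive_operator_def by blast
  have part: "(z n \<xi>, ?H n \<xi>) \<in> h" for n \<xi>
  proof -
    define w where "w = z n"
    define A where "A = ?H n o\<^sub>L ?H n"
    have w: "is_proj w" unfolding w_def by (rule p)
    have wA: "w (A \<xi>) = A \<xi>" for \<xi> by (simp add: w_def A_def coherentD(6)[OF ab])
    have hh: "(w \<xi>, A \<xi>) \<in> h O h" for \<xi>
    proof -
      have "(w \<xi>, ?H n \<xi>) \<in> glue z ?H" unfolding w_def by (rule glue_restrict[OF ab])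
      moreover have "(?H n \<xi>, A \<xi>) \<in> glue z ?H"
        using glue_restrict[OF ab, of n "?H n \<xi>"] by (simp add: A_def coherentD(6)[OF ab])
      ultimately show ?thesis unfolding sq by blast
    qed
    then have "range (blinfun_apply w) \<subseteq> Domain h" by blast
    then obtain K where Kb: "K \<in> bounded_ops" and K: "\<And>\<xi>. (w \<xi>, K \<xi>) \<in> h"
      using closed_operator_bounded_part[OF cl is_projD(1)[OF w]] by blast
    have KA: "(K \<xi>, A \<xi>) \<in> h" for \<xi>
      using hh[of \<xi>] closed_operatorD(4)[OF cl K[of \<xi>]] by blast
    have Kw: "K (w \<xi>) = K \<xi>" for \<xi>
      using closed_operatorD(4)[OF cl K[of "w \<xi>"]] K[of \<xi>] by (simp add: is_projD(2)[OF w])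
    define X where "X = w o\<^sub>L K"
    define Y where "Y = K - X"
    have Xb: "X \<in> bounded_ops" and Yb: "Y \<in> bounded_ops"
      by (simp_all add: X_def Y_def bounded_ops_compose bounded_ops_diff Kb is_projD(1)[OF w])
    have wX: "w (X \<xi>) = X \<xi>" and wY: "w (Y \<xi>) = 0" and Xw: "X (w \<xi>) = X \<xi>" and Yw: "Y (w \<xi>) = Y \<xi>"
      and KXY: "K \<xi> = X \<xi> + Y \<xi>" for \<xi>
      by (simp_all add: X_def Y_def is_projD(2)[OF w] blinfun_simps Kw)
    have orth: "cinner \<alpha> (Y \<beta>) = 0" if "w \<alpha> = \<alpha>" for \<alpha> \<beta>
      using is_projD(3)[OF w, of \<alpha> "Y \<beta>"] that by (simp add: wY)
    have orth': "cinner (Y \<beta>) \<alpha> = 0" if "w \<alpha> = \<alpha>" for \<alpha> \<beta>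
      using is_projD(3)[OF w, of "Y \<beta>" \<alpha>] that by (simp add: wY)
    define G where "G = adj Y o\<^sub>L Y"
    have G: "pos_op G" unfolding G_def by (rule pos_op_adj_compose[OF Yb])
    have GY: "cinner (G \<xi>) \<eta> = cinner (Y \<xi>) (Y \<eta>)" for \<xi> \<eta> by (simp add: G_def adj_cinner'[OF Yb])
    have Xpos: "pos_op X"
      using pos[OF K] by (simp add: pos_op_def Xb) (simp add: X_def is_projD(3)[OF w])
    have KK: "K (K \<xi>) = X (X \<xi>) + Y (X \<xi>)" for \<xi>
    proof -
      have "K (K \<xi>) = K (X \<xi>)" using Kw[of "K \<xi>"] by (simp add: X_def)
      then show ?thesis by (simp add: KXY)
    qed
    have YK: "(Y \<xi>, A \<xi> - K (K \<xi>)) \<in> h" for \<xi>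
      using closed_operatorD(6)[OF cl KA[of \<xi>] K[of "K \<xi>"]] by (simp add: Y_def X_def blinfun_simps)
    have N: "pos_op (- (G o\<^sub>L X))"
    proof -
      have "cinner (- (G (X \<xi>))) \<xi> = cinner (A \<xi> - K (K \<xi>)) (Y \<xi>)" for \<xi>
        using orth[OF wA] orth[OF wX] by (simp add: KK cinner_simps GY)
      then have "cinner (- (G (X \<xi>))) \<xi> \<in> \<real>\<^sub>\<ge>\<^sub>0" for \<xi> using pos[OF YK] by simp
      moreover have "- (G o\<^sub>L X) \<in> bounded_ops"
        using bounded_ops_diff[OF bounded_ops_zero bounded_ops_compose[OF pos_op_bounded[OF G] Xb]] by simp
      ultimately show ?thesis by (simp add: pos_op_def blinfun_simps)
    qed
    have GX: "G (X \<xi>) = X (G \<xi>)" for \<xi>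
    proof (rule cinner_eqI)
      fix \<eta>
      have "cinner (G (X \<xi>)) \<eta> = cinner \<xi> (G (X \<eta>))"
        using pos_op_hermitian[OF N, of \<xi> \<eta>] by (simp add: blinfun_simps cinner_simps)
      also have "\<dots> = cinner (X (G \<xi>)) \<eta>" by (simp add: pos_op_hermitian[OF G] pos_op_hermitian[OF Xpos])
      finally show "cinner (G (X \<xi>)) \<eta> = cinner (X (G \<xi>)) \<eta>" .
    qed
    have XG0: "X (G \<xi>) = 0" for \<xi>
    proof -
      have P: "pos_op (X o\<^sub>L G)" by (rule pos_op_compose_commuting[OF Xpos G]) (simp add: blinfun_eqI GX)
      have "Re (cinner ((X o\<^sub>L G) \<xi>) \<xi>) = 0"
        using pos_op_Re[OF P, of \<xi>] pos_op_Re[OF N, of \<xi>] by (simp add: blinfun_simps cinner_simps GX)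
      from pos_op_null[OF P this] show ?thesis by simp
    qed
    have YX0: "Y (X \<xi>) = 0" for \<xi>
    proof -
      have "cinner (Y (X \<xi>)) (Y (X \<xi>)) = 0" by (simp add: GX XG0 flip: GY)
      then show ?thesis by simp
    qed
    have AXG: "A \<xi> = X (X \<xi>) + G \<xi>" for \<xi>
    proof (rule cinner_eqI)
      fix \<eta>
      have "cinner (A \<xi>) \<eta> = cinner (w (A \<xi>)) \<eta>" by (simp add: wA)
      also have "\<dots> = cinner (A \<xi>) (w \<eta>)" by (rule is_projD(3)[OF w])
      also have "\<dots> = cinner (K \<xi>) (K \<eta>)" by (rule sym[OF KA K])
      also have "\<dots> = cinner (X (X \<xi>) + G \<xi>) \<eta>"
        using orth[OF wX] orth'[OF wX] by (simp add: KXY cinner_simps GY pos_op_hermitian[OF Xpos])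
      finally show "cinner (A \<xi>) \<eta> = cinner (X (X \<xi>) + G \<xi>) \<eta>" .
    qed
    have wG: "w (G \<xi>) = G \<xi>" for \<xi>
      using wA[of \<xi>] by (simp add: AXG blinfun_simps wX)
    have G0: "G \<xi> = 0" for \<xi>
    proof -
      have 1: "(Y \<xi>, G \<xi>) \<in> h" using YK[of \<xi>] by (simp add: AXG KK YX0)
      have 2: "(G \<xi>, Y (G \<xi>)) \<in> h" using K[of "G \<xi>"] by (simp add: wG KXY XG0)
      have "0 \<le> Re (cinner (G \<xi> - Y (G \<xi>)) (Y \<xi> - G \<xi>))"
        using pos[OF closed_operatorD(6)[OF cl 1 2]] by (simp add: complex_nonneg_Reals_iff)
      also have "cinner (G \<xi> - Y (G \<xi>)) (Y \<xi> - G \<xi>) = - 2 * cinner (G \<xi>) (G \<xi>)"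
        using orth[OF wG] orth'[OF wG] GY[of "G \<xi>" \<xi>] pos_op_hermitian[OF G, of "G \<xi>" \<xi>] by (simp add: cinner_simps)
      finally show ?thesis by (simp add: cinner_norm)
    qed
    have Y0: "Y \<xi> = 0" for \<xi> using GY[of \<xi> \<xi>] by (simp add: G0)
    have "X o\<^sub>L X = adj (T n) o\<^sub>L T n"
      using AXG by (intro blinfun_eqI) (simp add: A_def abs_square[OF b] G0)
    then have "?H n = X" unfolding op_abs_def by (intro pos_sqrt_eqI Xpos)
    then show ?thesis using K[of \<xi>] by (simp add: w_def KXY Y0)
  qed
  have sub: "glue z ?H \<subseteq> h"
  proof clarify
    fix \<xi> \<eta> assume "(\<xi>, \<eta>) \<in> glue z ?H"
    then have "(\<lambda>n. ?H n \<xi>) \<longlonglongrightarrow> \<eta>" by (simp add: glue_iff[OF ab])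
    then show "(\<xi>, \<eta>) \<in> h" by (rule closed_operatorD(5)[OF cl part resolvingD(2)[OF coherentD(1)[OF co]]])
  qed
  have adj: "op_adjoint (glue z ?H) = glue z ?H"
    by (simp add: op_adjoint_glue[OF ab] pos_op_adj[OF pos_op_abs[OF b]])
  have "h \<subseteq> op_adjoint (glue z ?H)"
    using sym sub by (auto simp: op_adjoint_def)
  then show ?thesis using sub adj by blast
qed

lemma modulus_glue:
  fixes z T :: "nat \<Rightarrow> 'a::complex_hilbert_space \<Rightarrow>\<^sub>L 'a"
  assumes co: "coherent z T" shows "modulus (glue z T) = glue z (\<lambda>n. op_abs (T n))"
  unfolding modulus_def
proof (rule the_equality)
  have "positive_operator (glue z (\<lambda>n. op_abs (T n)))"
    by (simp add: positive_glue_iff[OF coherent_abs[OF co]] pos_op_abs[OF coherentD(2)[OF co]])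
  then show "positive_operator (glue z (\<lambda>n. op_abs (T n))) \<and>
      glue z (\<lambda>n. op_abs (T n)) O glue z (\<lambda>n. op_abs (T n)) = glue z T O op_adjoint (glue z T)"
    by (simp add: glue_abs_square[OF co])
  fix h assume "positive_operator h \<and> h O h = glue z T O op_adjoint (glue z T)"
  then show "h = glue z (\<lambda>n. op_abs (T n))"
    by (intro positive_root_unique[OF co]) (simp_all add: glue_abs_square[OF co])
qed

section \<open>The central extension\<close>

lemma proj_sup_eq_id:
  fixes z :: "nat \<Rightarrow> 'a::complex_hilbert_space \<Rightarrow>\<^sub>L 'a"
  assumes "\<And>n. z n \<xi> = proj_sup D (z n \<xi>)" "(\<lambda>n. blinfun_apply (z n) \<xi>) \<longlonglongrightarrow> \<xi>"
  shows "proj_sup D \<xi> = \<xi>"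
proof -
  have "(\<lambda>n. proj_sup D (z n \<xi>)) \<longlonglongrightarrow> proj_sup D \<xi>" by (intro blinfun.tendsto assms tendsto_const)
  then have "(\<lambda>n. z n \<xi>) \<longlonglongrightarrow> proj_sup D \<xi>" by (simp flip: assms(1))
  then show ?thesis using assms(2) LIMSEQ_unique by blast
qed

text \<open>For a projection \<open>w\<close> this means that \<open>x w\<close> is everywhere defined with norm at most \<open>r\<close>.\<close>

definition bounded_on :: "'a::complex_hilbert_space operator \<Rightarrow> ('a \<Rightarrow>\<^sub>L 'a) \<Rightarrow> real \<Rightarrow> bool" where
  "bounded_on x w r \<longleftrightarrow> (\<forall>\<xi>. w \<xi> = \<xi> \<longrightarrow> (\<exists>\<eta>. (\<xi>, \<eta>) \<in> x \<and> norm \<eta> \<le> r * norm \<xi>))"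

lemma bounded_on_mono: "bounded_on x w r \<Longrightarrow> r \<le> s \<Longrightarrow> bounded_on x w s"
  unfolding bounded_on_def by (meson mult_right_mono norm_ge_zero order_trans)

lemma bounded_on_le: "bounded_on x w r \<Longrightarrow> proj_le v w \<Longrightarrow> bounded_on x v r"
  unfolding bounded_on_def proj_le_iff by metis

lemma bounded_onI:
  fixes w S :: "'a::complex_hilbert_space \<Rightarrow>\<^sub>L 'a"
  assumes "is_proj w" "\<And>\<xi>. (w \<xi>, S \<xi>) \<in> x" "\<And>\<xi>. norm (S \<xi>) \<le> r * norm \<xi>" shows "bounded_on x w r"
  unfolding bounded_on_def using assms by metis

lemma bounded_on_norm:
  assumes "closed_operator x" "bounded_on x w r" "is_proj w" "(w \<xi>, \<eta>) \<in> x"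
  shows "norm \<eta> \<le> r * norm (w \<xi>)"
proof -
  have "w (w \<xi>) = w \<xi>" by (rule is_projD(2)[OF assms(3)])
  then obtain \<eta>' where "(w \<xi>, \<eta>') \<in> x" "norm \<eta>' \<le> r * norm (w \<xi>)" using assms(2) unfolding bounded_on_def by blast
  then show ?thesis using closed_operatorD(4)[OF assms(1) assms(4)] by blast
qed

lemma strong_prod_leftD:
  fixes w :: "'a::complex_hilbert_space \<Rightarrow>\<^sub>L 'a" and x :: "'a::complex_hilbert_space operator"
  assumes x: "closed_operator x" and comm: "\<And>\<xi> \<eta>. (\<xi>, \<eta>) \<in> x \<Longrightarrow> (w \<xi>, w \<eta>) \<in> x"
    and "(\<xi>, \<eta>) \<in> strong_prod (op_graph w) x" and "w o\<^sub>L w = w"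
  shows "(w \<xi>, \<eta>) \<in> x"
proof -
  obtain f where f: "\<And>n. f n \<in> x O op_graph w" "f \<longlonglongrightarrow> (\<xi>, \<eta>)"
    using assms(3) unfolding strong_prod_def closure_sequential by blast
  have "(w (fst (f n)), snd (f n)) \<in> x" for n
    using f(1)[of n] comm by (auto simp: op_graph_iff)
  moreover have "(\<lambda>n. w (fst (f n))) \<longlonglongrightarrow> w \<xi>" "(\<lambda>n. snd (f n)) \<longlonglongrightarrow> \<eta>"
    using tendsto_fst[OF f(2)] tendsto_snd[OF f(2)] by (auto intro!: blinfun.tendsto tendsto_const)
  ultimately show ?thesis by (rule closed_operatorD(5)[OF x])
qed

text \<open>The product \<open>w x\<close> has the domain of \<open>x\<close> only, on which it agrees with the bounded \<open>S\<close>. The ranges of the \<open>z\<^sub>n\<close>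
  make this domain dense, so the closure is all of \<open>S\<close>.\<close>

lemma strong_prod_left:
  fixes w S :: "'a::complex_hilbert_space \<Rightarrow>\<^sub>L 'a" and x :: "'a::complex_hilbert_space operator"
  assumes x: "closed_operator x" and comm: "\<And>\<xi> \<eta>. (\<xi>, \<eta>) \<in> x \<Longrightarrow> (w \<xi>, w \<eta>) \<in> x"
    and z: "resolving z" "\<And>n. range (blinfun_apply (z n)) \<subseteq> Domain x"
    and S: "S \<in> bounded_ops" "\<And>\<xi>. (w \<xi>, S \<xi>) \<in> x"
  shows "strong_prod (op_graph w) x = op_graph S"
proof -
  have eq: "x O op_graph w = {(\<xi>, S \<xi>) |\<xi>. \<xi> \<in> Domain x}"
  proof (intro set_eqI iffI; clarify)
    fix \<xi> \<eta> \<zeta> assume "(\<xi>, \<eta>) \<in> x" "(\<eta>, \<zeta>) \<in> op_graph w"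
    then have "S \<xi> = \<zeta>" using closed_operatorD(4)[OF x S(2)[of \<xi>]] comm by (simp add: op_graph_iff)
    then show "\<exists>\<xi>'. (\<xi>, \<zeta>) = (\<xi>', S \<xi>') \<and> \<xi>' \<in> Domain x" using \<open>(\<xi>, \<eta>) \<in> x\<close> by blast
  next
    fix \<xi> \<eta> assume "(\<xi>, \<eta>) \<in> x"
    then have "S \<xi> = w \<eta>" using closed_operatorD(4)[OF x S(2)[of \<xi>]] comm by simp
    then show "(\<xi>, S \<xi>) \<in> x O op_graph w" using \<open>(\<xi>, \<eta>) \<in> x\<close> by (auto simp: op_graph_iff)
  qed
  have cl: "closed (op_graph S)"
    using closed_operator_op_graph[OF S(1)] by (simp add: closed_operator_def)
  show ?thesis
    unfolding strong_prod_def eq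
  proof (intro subset_antisym closure_minimal cl subsetI)
    fix p assume "p \<in> op_graph S"
    then obtain \<xi> where p: "p = (\<xi>, S \<xi>)" by (auto simp: op_graph_def)
    have "(\<lambda>m. (z m \<xi>, S (z m \<xi>))) \<longlonglongrightarrow> (\<xi>, S \<xi>)"
      by (intro tendsto_Pair blinfun.tendsto resolvingD(2)[OF z(1)] tendsto_const)
    moreover have "z m \<xi> \<in> Domain x" for m using z(2) by blast
    ultimately show "p \<in> closure {(\<xi>, S \<xi>) |\<xi>. \<xi> \<in> Domain x}"
      unfolding p closure_sequential by (intro exI[of _ "\<lambda>m. (z m \<xi>, S (z m \<xi>))"]) blast
  qed (auto simp: op_graph_iff)
qed

context von_neumann
begin

lemma von_neumann_center: "von_neumann (center M)"
  by unfold_locales (rule center_von_neumann)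

lemma center_proj_iff: "w \<in> projections (center M) \<longleftrightarrow> is_proj w \<and> w \<in> center M"
  by (auto simp: projections_def is_proj_def bdd centerD)

lemma center_projD:
  assumes "w \<in> projections (center M)"
  shows "is_proj w" "w \<in> M" "w \<in> center M" "w \<in> projections M" "w \<in> commutant M"
    "x \<in> M \<Longrightarrow> w (x \<xi>) = x (w \<xi>)"
  using assms centerD projectionsI by (auto simp: center_proj_iff)

lemma center_proj_compose:
  assumes "v \<in> projections (center M)" "w \<in> projections (center M)"
  shows "v o\<^sub>L w \<in> projections (center M)" "v (w \<xi>) = w (v \<xi>)"
proof -
  show *: "v (w \<xi>) = w (v \<xi>)" for \<xi> using center_projD[OF assms(1)] center_projD[OF assms(2)] by blast
  have "v o\<^sub>L w \<in> center M"
    using von_neumann.compose[OF von_neumann_center] assms center_projD(3) by blast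
  moreover have "is_proj (v o\<^sub>L w)"
    by (rule proj_comm_compose) (use assms center_projD(1) * in \<open>auto intro!: blinfun_eqI\<close>)
  ultimately show "v o\<^sub>L w \<in> projections (center M)" by (simp add: center_proj_iff)
qed

lemma center_proj_id [simp]: "id_blinfun \<in> projections (center M)"
  and center_proj_zero [simp]: "0 \<in> projections (center M)"
  by (simp_all add: center_proj_iff von_neumann.id[OF von_neumann_center] von_neumann.zero[OF von_neumann_center])

lemma center_proj_perp: "w \<in> projections (center M) \<Longrightarrow> perp w \<in> projections (center M)"
  by (rule von_neumann.perp_projection[OF von_neumann_center])

lemma center_proj_sup: "D \<subseteq> projections (center M) \<Longrightarrow> proj_sup D \<in> projections (center M)"
  by (rule von_neumann.proj_sup_mem[OF von_neumann_center])

lemma affiliated_commute: "affiliated M x \<Longrightarrow> w \<in> projections (center M) \<Longrightarrow> (\<xi>, \<eta>) \<in> x \<Longrightarrow> (w \<xi>, w \<eta>) \<in> x"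
  using center_projD(5) unfolding affiliated_def by blast

text \<open>The join of two central projections on which \<open>x\<close> is bounded by \<open>r\<close> has the same property,
  because the two pieces are orthogonal; closedness of \<open>x\<close> then extends this to arbitrary joins.\<close>

lemma bounded_on_join:
  assumes x: "closed_operator x" "affiliated M x" and r: "0 \<le> r"
    and v: "v \<in> projections (center M)" "bounded_on x v r"
    and w: "w \<in> projections (center M)" "bounded_on x w r"
  shows "v + (w o\<^sub>L perp v) \<in> projections (center M)" (is "?j \<in> _")
    "bounded_on x (v + (w o\<^sub>L perp v)) r"
    "proj_le v (v + (w o\<^sub>L perp v))" "proj_le w (v + (w o\<^sub>L perp v))"
proof -
  note pv = center_projD(1)[OF v(1)] and pw = center_projD(1)[OF w(1)] and cm = center_proj_compose(2)[OF v(1) w(1)]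
  have u: "w o\<^sub>L perp v \<in> projections (center M)" by (intro center_proj_compose center_proj_perp v w)
  note pu = center_projD(1)[OF u]
  have vu: "v o\<^sub>L (w o\<^sub>L perp v) = 0"
    by (rule blinfun_eqI) (simp add: cm blinfun_simps is_projD(2)[OF pv])
  show j: "?j \<in> projections (center M)"
    using is_proj_orth_sum(1)[OF pv pu vu] v u by (simp add: center_proj_iff von_neumann.add[OF von_neumann_center])
  show "proj_le v ?j" by (simp add: proj_le_iff blinfun_simps is_projD(2)[OF pv])
  show "proj_le w ?j"
    by (simp add: proj_le_iff blinfun_simps cm is_projD(2)[OF pw])
  show "bounded_on x ?j r"
    unfolding bounded_on_def
  proof (intro allI impI)
    fix \<xi> assume \<xi>: "?j \<xi> = \<xi>"
    define u where "u = (w o\<^sub>L perp v)"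
    have usub: "w (u \<xi>) = u \<xi>" by (simp add: u_def is_projD(2)[OF pw])
    have "v (v \<xi>) = v \<xi>" by (simp add: is_projD(2)[OF pv])
    then obtain \<eta>1 where 1: "(v \<xi>, \<eta>1) \<in> x" "norm \<eta>1 \<le> r * norm (v \<xi>)" using v(2) unfolding bounded_on_def by blast
    obtain \<eta>2 where 2: "(u \<xi>, \<eta>2) \<in> x" "norm \<eta>2 \<le> r * norm (u \<xi>)" using w(2) usub unfolding bounded_on_def by blast
    have vu0: "v (u \<xi>) = 0" using vu unfolding u_def by (metis blinfun.zero_left blinfun_apply_blinfun_compose)
    have "(v \<xi>, v \<eta>1) \<in> x"
      using affiliated_commute[OF x(2) v(1) 1(1)] unfolding is_projD(2)[OF pv] .
    then have "v \<eta>1 = \<eta>1" by (rule closed_operatorD(4)[OF x(1) _ 1(1)])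
    moreover have "(0, v \<eta>2) \<in> x" using affiliated_commute[OF x(2) v(1) 2(1)] unfolding vu0 .
    then have "v \<eta>2 = 0" by (rule closed_operatorD(4)[OF x(1) _ closed_operatorD(1)[OF x(1)]])
    ultimately have o: "cinner \<eta>1 \<eta>2 = 0" using is_projD(3)[OF pv, of \<eta>1 \<eta>2] by simp
    have o': "cinner (v \<xi>) (u \<xi>) = 0" by (simp add: is_projD(3)[OF pv] vu0)
    have eq: "\<xi> = v \<xi> + u \<xi>" using \<xi> by (simp add: u_def blinfun.add_left)
    have "(norm (\<eta>1 + \<eta>2))\<^sup>2 = (norm \<eta>1)\<^sup>2 + (norm \<eta>2)\<^sup>2" by (rule pythagoras[OF o])
    also have "\<dots> \<le> (r * norm (v \<xi>))\<^sup>2 + (r * norm (u \<xi>))\<^sup>2" by (intro add_mono power_mono 1 2) auto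
    also have "\<dots> = r\<^sup>2 * (norm (v \<xi> + u \<xi>))\<^sup>2" by (simp add: pythagoras[OF o'] power_mult_distrib distrib_left)
    also have "\<dots> = (r * norm \<xi>)\<^sup>2" by (simp add: power_mult_distrib flip: eq)
    finally have "norm (\<eta>1 + \<eta>2) \<le> r * norm \<xi>" by (rule power2_le_imp_le) (simp add: r)
    moreover have "(\<xi>, \<eta>1 + \<eta>2) \<in> x" using closed_operatorD(2)[OF x(1) 1(1) 2(1)] by (simp flip: eq)
    ultimately show "\<exists>\<eta>. (\<xi>, \<eta>) \<in> x \<and> norm \<eta> \<le> r * norm \<xi>" by blast
  qed
qed

lemma bounded_on_sup:
  assumes x: "closed_operator x" "affiliated M x" and r: "0 \<le> r"
  shows "bounded_on x (proj_sup {w \<in> projections (center M). bounded_on x w r}) r"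
proof (subst bounded_on_def, intro allI impI)
  let ?D = "{w \<in> projections (center M). bounded_on x w r}"
  fix \<xi> assume \<xi>: "proj_sup ?D \<xi> = \<xi>"
  have z: "0 \<in> ?D" using closed_operatorD(1)[OF x(1)] by (simp add: bounded_on_def)
  then have ne: "?D \<noteq> {}" by blast
  have "\<exists>w\<in>?D. norm (\<xi> - w \<xi>) < 1 / real (Suc k)" for k
  proof (rule proj_sup_directed[OF _ ne _ \<xi>])
    fix v w assume vw: "v \<in> ?D" "w \<in> ?D"
    then show "\<exists>u\<in>?D. proj_le v u \<and> proj_le w u" using bounded_on_join[OF x r, of v w] by blast
  qed (use center_projD(1) in auto)
  then obtain w where w: "\<And>k. w k \<in> ?D" "\<And>k. norm (\<xi> - w k \<xi>) < 1 / real (Suc k)" by metis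
  have "\<exists>\<eta>. (w k \<xi>, \<eta>) \<in> x \<and> norm \<eta> \<le> r * norm (w k \<xi>)" for k
    using w(1)[of k] is_projD(2)[OF center_projD(1)] unfolding bounded_on_def by blast
  then obtain \<eta> where \<eta>: "\<And>k. (w k \<xi>, \<eta> k) \<in> x" "\<And>k. norm (\<eta> k) \<le> r * norm (w k \<xi>)" by metis
  have lim: "(\<lambda>k. w k \<xi>) \<longlonglongrightarrow> \<xi>"
  proof (rule LIMSEQ_I)
    fix e :: real assume "0 < e"
    then obtain N where N: "inverse (real (Suc N)) < e" using reals_Archimedean by blast
    have "norm (w k \<xi> - \<xi>) < e" if "N \<le> k" for k
    proof -
      have "1 / real (Suc k) \<le> 1 / real (Suc N)" using that by (simp add: frac_le)
      then show ?thesis using w(2)[of k] N by (simp add: norm_minus_commute inverse_eq_divide)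
    qed
    then show "\<exists>no. \<forall>n\<ge>no. norm (w n \<xi> - \<xi>) < e" by blast
  qed
  have diff: "norm (\<eta> k - \<eta> l) \<le> r * norm (w k \<xi> - w l \<xi>)" for k l
  proof -
    obtain u where u: "bounded_on x u r" "proj_le (w k) u" "proj_le (w l) u"
      using bounded_on_join[OF x r, of "w k" "w l"] w(1)[of k] w(1)[of l] by blast
    have "u (w k \<xi> - w l \<xi>) = w k \<xi> - w l \<xi>" using u by (simp add: proj_le_iff blinfun_simps)
    then obtain \<zeta> where \<zeta>: "(w k \<xi> - w l \<xi>, \<zeta>) \<in> x" "norm \<zeta> \<le> r * norm (w k \<xi> - w l \<xi>)"
      using u(1) unfolding bounded_on_def by blast
    then show ?thesis
      using closed_operatorD(4)[OF x(1) \<zeta>(1) closed_operatorD(6)[OF x(1) \<eta>(1) \<eta>(1)]] by simp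
  qed
  have "Cauchy \<eta>"
  proof (rule metric_CauchyI)
    fix e :: real assume e: "0 < e"
    have "0 < e / (r + 1)" using e r by simp
    then obtain N where N: "\<And>k l. N \<le> k \<Longrightarrow> N \<le> l \<Longrightarrow> dist (w k \<xi>) (w l \<xi>) < e / (r + 1)"
      using metric_CauchyD[OF LIMSEQ_imp_Cauchy[OF lim]] by blast
    have "dist (\<eta> k) (\<eta> l) < e" if "N \<le> k" "N \<le> l" for k l
    proof -
      have "norm (w k \<xi> - w l \<xi>) * (r + 1) < e" using N[OF that] r by (simp add: dist_norm field_simps)
      moreover have "r * norm (w k \<xi> - w l \<xi>) \<le> norm (w k \<xi> - w l \<xi>) * (r + 1)" by (simp add: algebra_simps)
      ultimately show ?thesis using diff[of k l] by (simp add: dist_norm)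
    qed
    then show "\<exists>N. \<forall>k\<ge>N. \<forall>l\<ge>N. dist (\<eta> k) (\<eta> l) < e" by blast
  qed
  then obtain \<zeta> where \<zeta>: "\<eta> \<longlonglongrightarrow> \<zeta>" using Cauchy_convergent_iff convergent_def by blast
  have "(\<xi>, \<zeta>) \<in> x" by (rule closed_operatorD(5)[OF x(1) \<eta>(1) lim \<zeta>])
  moreover have "norm \<zeta> \<le> r * norm \<xi>"
    by (rule LIMSEQ_le[of "\<lambda>k. norm (\<eta> k)" _ "\<lambda>k. r * norm (w k \<xi>)"])
      (use \<eta>(2) in \<open>auto intro!: tendsto_norm tendsto_mult_left \<zeta> lim\<close>)
  ultimately show "\<exists>\<eta>. (\<xi>, \<eta>) \<in> x \<and> norm \<eta> \<le> r * norm \<xi>" by blast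
qed

definition central_glue where
  "central_glue N z T \<longleftrightarrow> (\<forall>n. z n \<in> projections (center M)) \<and> (\<forall>n. T n \<in> N) \<and> coherent z T"

lemma central_glueD:
  assumes "central_glue N z T"
  shows "z n \<in> projections (center M)" "T n \<in> N" "coherent z T"
  using assms by (auto simp: central_glue_def)

lemma glue_affiliated:
  assumes "central_glue M z T" shows "affiliated M (glue z T)"
  unfolding affiliated_def glue_def
proof safe
  fix y \<xi> \<eta> n assume "y \<in> commutant M" "\<forall>n. z n \<eta> = T n \<xi>"
  then show "z n (y \<eta>) = T n (y \<xi>)"
    using comm[of y "z n" \<eta>] comm[of y "T n" \<xi>] central_glueD[OF assms] center_projD(2) by simp
qed

text \<open>A closed affiliated operator that is defined on the ranges of central projections with
  supremum \<open>1\<close> can be glued from bounded pieces: one takes for \<open>z\<^sub>n\<close> the largest central projection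
  on which it is bounded by \<open>n\<close>.\<close>

definition bound_proj :: "'a operator \<Rightarrow> real \<Rightarrow> 'a \<Rightarrow>\<^sub>L 'a" where
  "bound_proj x r = proj_sup {w \<in> projections (center M). bounded_on x w r}"

lemma bound_proj_center: "bound_proj x r \<in> projections (center M)"
  unfolding bound_proj_def by (rule center_proj_sup) auto

lemma bound_proj_bounded:
  "closed_operator x \<Longrightarrow> affiliated M x \<Longrightarrow> 0 \<le> r \<Longrightarrow> bounded_on x (bound_proj x r) r"
  unfolding bound_proj_def by (rule bounded_on_sup)

lemma bound_proj_upper: "w \<in> projections (center M) \<Longrightarrow> bounded_on x w r \<Longrightarrow> proj_le w (bound_proj x r)"
  unfolding bound_proj_def by (rule proj_sup_upper) simp

lemma bound_proj_mono: "r \<le> s \<Longrightarrow> proj_le (bound_proj x r) (bound_proj x s)"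
  unfolding bound_proj_def
  by (rule proj_sup_least[OF is_proj_proj_sup]) (auto intro!: proj_sup_upper intro: bounded_on_mono)

lemma locally_bounded_glue:
  assumes x: "closed_operator x" "affiliated M x"
    and W: "W \<subseteq> projections (center M)" "proj_sup W = id_blinfun"
      "\<And>w. w \<in> W \<Longrightarrow> range (blinfun_apply w) \<subseteq> Domain x"
  obtains T where "central_glue M (\<lambda>n. bound_proj x (real n)) T" "x = glue (\<lambda>n. bound_proj x (real n)) T"
    "\<And>n. norm (T n) \<le> real n"
proof -
  define z where "z n = bound_proj x (real n)" for n
  have zc: "z n \<in> projections (center M)" for n unfolding z_def by (rule bound_proj_center)
  note pz = center_projD(1)[OF zc]
  have zb: "bounded_on x (z n) (real n)" for n unfolding z_def by (rule bound_proj_bounded[OF x]) simp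
  have inc: "proj_le (z n) (z (Suc n))" for n unfolding z_def by (rule bound_proj_mono) simp
  have le: "proj_le w (proj_sup (range z))" if w: "w \<in> W" for w
  proof -
    have wc: "w \<in> projections (center M)" using w W(1) by blast
    obtain S where S: "S \<in> bounded_ops" "\<And>\<xi>. (w \<xi>, S \<xi>) \<in> x"
      using closed_operator_bounded_part[OF x(1) is_projD(1)[OF center_projD(1)[OF wc]] W(3)[OF w]] by blast
    have "norm (S \<xi>) \<le> real (nat \<lceil>norm S\<rceil>) * norm \<xi>" for \<xi>
      by (rule order_trans[OF norm_blinfun]) (intro mult_right_mono real_nat_ceiling_ge norm_ge_zero)
    then have "bounded_on x w (real (nat \<lceil>norm S\<rceil>))"
      by (intro bounded_onI[of w S x] S center_projD(1)[OF wc])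
    then have "proj_le w (z (nat \<lceil>norm S\<rceil>))" unfolding z_def by (rule bound_proj_upper[OF wc])
    then show ?thesis by (rule proj_le_trans) (rule proj_sup_upper, simp)
  qed
  have "proj_le (proj_sup W) (proj_sup (range z))" by (rule proj_sup_least[OF is_proj_proj_sup le])
  then have "proj_sup (range z) = id_blinfun"
    by (intro blinfun_eqI) (simp add: W(2) proj_le_iff)
  then have "increases_to_one M z"
    unfolding increases_to_one_def using inc zc center_projD(4)
    by (subst is_proj_sup_iff) auto
  then have res: "resolving z"
    using increases_to_one_iff[of z] zc center_projD(4) pz by (auto simp: resolving_def)
  have "range (blinfun_apply (z n)) \<subseteq> Domain x" for n
    using zb[of n] is_projD(2)[OF pz] unfolding bounded_on_def by blast
  then have "\<exists>S. S \<in> bounded_ops \<and> (\<forall>\<xi>. (z n \<xi>, S \<xi>) \<in> x)" for n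
    using closed_operator_bounded_part[OF x(1) is_projD(1)[OF pz]] by metis
  then obtain T where T: "\<And>n. T n \<in> bounded_ops" "\<And>n \<xi>. (z n \<xi>, T n \<xi>) \<in> x" by metis
  note uniq = closed_operatorD(4)[OF x(1)]
  have co: "coherent z T"
    unfolding coherent_def
  proof (intro conjI allI impI res T(1))
    fix m n \<xi> assume mn: "m \<le> (n::nat)"
    show "T n (z m \<xi>) = T m \<xi>"
      using uniq[OF T(2)[of m \<xi>]] T(2)[of n "z m \<xi>"] by (simp add: resolvingD(4)[OF res mn])
    show "z m (T n \<xi>) = T m \<xi>"
      using uniq[OF T(2)[of m \<xi>]] affiliated_commute[OF x(2) zc[of m] T(2)[of n \<xi>]] by (simp add: resolvingD(5)[OF res mn])
  qed
  have TM: "T n \<in> M" for n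
  proof (rule memI[OF T(1)])
    fix y \<xi> assume y: "y \<in> commutant M"
    have "(y (z n \<xi>), y (T n \<xi>)) \<in> x" using x(2) y T(2) unfolding affiliated_def by blast
    then show "T n (y \<xi>) = y (T n \<xi>)"
      using uniq[OF T(2)[of n "y \<xi>"]] comm[OF y center_projD(2)[OF zc[of n]]] by simp
  qed
  have nT: "norm (T n) \<le> real n" for n
  proof (rule norm_blinfun_bound)
    fix \<xi>
    have "norm (T n \<xi>) \<le> real n * norm (z n \<xi>)" by (rule bounded_on_norm[OF x(1) zb pz T(2)])
    also have "\<dots> \<le> real n * norm \<xi>" by (intro mult_left_mono proj_norm_le pz) simp
    finally show "norm (T n \<xi>) \<le> real n * norm \<xi>" .
  qed simp
  have eq: "x = glue z T"
    by (rule eq_glueI[OF co x(1) T(2)]) (rule affiliated_commute[OF x(2) zc])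
  have "central_glue M z T" by (simp add: central_glue_def zc TM co)
  then show ?thesis using that[of T] eq nT unfolding z_def by blast
qed

lemma finite_projection_zero: "finite_projection M 0"
  by (auto simp: finite_projection_def projectionsI proj_le_def)

lemma op_graph_measurable: assumes "T \<in> M" shows "op_graph T \<in> measurable_ops M"
  unfolding measurable_ops_def
proof (intro CollectI conjI exI[of _ "\<lambda>_. id_blinfun"])
  show "closed_operator (op_graph T)" by (rule closed_operator_op_graph[OF bdd[OF assms]])
  show "affiliated M (op_graph T)" using comm[OF _ assms] by (simp add: affiliated_def op_graph_iff)
  show "increases_to_one M (\<lambda>_. id_blinfun)"
    by (subst increases_to_one_iff) (auto intro: projectionsI proj_le_refl)
qed (auto simp: op_graph_def projectionsI finite_projection_zero)

text \<open>The differences \<open>z\<^sub>n - z\<^sub>n\<^sub>-\<^sub>1\<close> are the orthogonal central projections with supremum \<open>1\<close> that the central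
  extension asks for.\<close>

lemma glue_central_extension:
  assumes cg: "central_glue M z T" shows "glue z T \<in> central_extension M"
proof -
  note zc = central_glueD(1)[OF cg] and co = central_glueD(3)[OF cg] and TM = central_glueD(2)[OF cg]
  note res = coherentD(1)[OF co] and pz = center_projD(1)[OF zc]
  have cl: "closed_operator (glue z T)" and af: "affiliated M (glue z T)"
    by (rule closed_operator_glue[OF co]) (rule glue_affiliated[OF cg])
  note comm' = affiliated_commute[OF af]
  have dom: "range (blinfun_apply (z n)) \<subseteq> Domain (glue z T)" for n using glue_restrict[OF co] by blast
  have inc: "increases_to_one M z"
    using res increases_to_one_iff[of z] center_projD(4)[OF zc] by (simp add: resolving_def)
  have sp: "strong_prod (op_graph w) (glue z T) = op_graph S"
    if "w \<in> projections (center M)" "S \<in> M" "\<And>\<xi>. (w \<xi>, S \<xi>) \<in> glue z T" for w S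
    using that by (intro strong_prod_left[OF cl comm' res dom]) (auto intro: bdd)
  have "strong_prod (op_graph (z n)) (glue z T) \<in> measurable_ops M" for n
    by (subst sp[OF zc TM glue_restrict[OF co]]) (rule op_graph_measurable[OF TM])
  then have ls: "glue z T \<in> loc_measurable_ops M"
    unfolding loc_measurable_ops_def using cl af inc zc by blast
  define e where "e n = (if n = 0 then z 0 else z n - z (n - 1))" for n
  define S where "S n = (if n = 0 then T 0 else T n - T (n - 1))" for n
  have e: "e n \<in> projections (center M)" for n
  proof -
    have "is_proj (z n - z (n - 1))" by (rule is_proj_diff[OF pz pz resolvingD(3)[OF res]]) simp
    then show ?thesis
      using zc[of n] zc[of "n - 1"]
      by (cases "n = 0") (simp_all add: e_def center_proj_iff von_neumann.diff[OF von_neumann_center])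
  qed
  have eo: "e m o\<^sub>L e n = 0" if "m < n" for m n
  proof (rule blinfun_eqI)
    fix \<xi>
    have e1: "e n \<xi> = z n \<xi> - z (n - 1) \<xi>" using that by (simp add: e_def blinfun_simps)
    have "z m (e n \<xi>) = 0" using that resolvingD(5)[OF res, of m n \<xi>] resolvingD(5)[OF res, of m "n - 1" \<xi>]
      by (simp add: e1 blinfun_simps)
    moreover have "z (m - 1) (e n \<xi>) = 0"
      using that resolvingD(5)[OF res, of "m - 1" n \<xi>] resolvingD(5)[OF res, of "m - 1" "n - 1" \<xi>]
      by (simp add: e1 blinfun_simps)
    ultimately show "(e m o\<^sub>L e n) \<xi> = blinfun_apply 0 \<xi>"
      by (cases "m = 0") (simp_all add: e_def[of 0] e_def[of m] blinfun_simps)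
  qed
  have orth: "e m o\<^sub>L e n = 0" if "e m \<noteq> e n" for m n
  proof -
    have "m < n \<or> n < m" using that by (metis nat_neq_iff)
    then show ?thesis
      using eo[of m n] is_proj_orth_sum(2)[OF center_projD(1)[OF e] center_projD(1)[OF e] eo[of n m]] by blast
  qed
  have up: "z n \<xi> = proj_sup (range e) (z n \<xi>)" for n \<xi>
  proof -
    have ee: "proj_sup (range e) (e n \<xi>) = e n \<xi>" for n
      using proj_sup_upper[of "e n" "range e"] by (simp add: proj_le_iff)
    show ?thesis
    proof (induction n)
      case 0 then show ?case using ee[of 0] by (simp add: e_def)
    next
      case (Suc n)
      have "z (Suc n) \<xi> = z n \<xi> + e (Suc n) \<xi>" by (simp add: e_def blinfun_simps)
      then show ?case using Suc ee[of "Suc n"] by (simp add: blinfun_simps)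
    qed
  qed
  have "proj_sup (range e) = id_blinfun"
    by (rule blinfun_eqI) (simp add: proj_sup_eq_id[OF up resolvingD(2)[OF res]])
  then have "is_proj_sup M (range e) id_blinfun"
    using e center_projD(4) by (subst is_proj_sup_iff) auto
  moreover have "strong_prod (op_graph (e n)) (glue z T) = op_graph (S n)" for n
  proof (rule sp[OF e])
    show "S n \<in> M" by (simp add: S_def TM diff)
    fix \<xi> show "(e n \<xi>, S n \<xi>) \<in> glue z T"
      using glue_restrict[OF co, of n \<xi>] closed_operatorD(6)[OF cl glue_restrict[OF co, of n \<xi>] glue_restrict[OF co, of "n - 1" \<xi>]]
      by (cases "n = 0") (simp_all add: e_def S_def blinfun_simps)
  qed
  moreover have "S n \<in> M" for n by (simp add: S_def TM diff)
  ultimately show ?thesis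
    unfolding central_extension_def using ls e orth by (intro CollectI conjI exI[of _ "range e"]) auto
qed

lemma central_extension_glue:
  assumes "x \<in> central_extension M"
  obtains T where "central_glue M (\<lambda>n. bound_proj x (real n)) T" "x = glue (\<lambda>n. bound_proj x (real n)) T"
    "\<And>n. norm (T n) \<le> real n"
proof -
  have x: "closed_operator x" "affiliated M x"
    using assms by (simp_all add: central_extension_def loc_measurable_ops_def)
  obtain W where W: "W \<subseteq> projections (center M)" "is_proj_sup M W id_blinfun"
    "\<And>w. w \<in> W \<Longrightarrow> strong_prod (op_graph w) x \<in> op_graph ` M"
    using assms by (auto simp: central_extension_def)
  have "W \<subseteq> projections M" using W(1) center_projD(4) by blast
  then have sup: "proj_sup W = id_blinfun" using is_proj_sup_iff[of W id_blinfun] W(2) by simp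
  have "range (blinfun_apply w) \<subseteq> Domain x" if w: "w \<in> W" for w
  proof clarify
    fix \<xi>
    obtain S where "strong_prod (op_graph w) x = op_graph S" using W(3)[OF w] by blast
    then have "(\<xi>, S \<xi>) \<in> strong_prod (op_graph w) x" by (simp add: op_graph_iff)
    have wc: "w \<in> projections (center M)" using w W(1) by blast
    have "(w \<xi>, S \<xi>) \<in> x"
      by (rule strong_prod_leftD[OF x(1) affiliated_commute[OF x(2) wc] _ is_projD(6)[OF center_projD(1)[OF wc]]])
        (assumption, fact)
    then show "w \<xi> \<in> Domain x" by blast
  qed
  from locally_bounded_glue[OF x W(1) sup this] show ?thesis using that by blast
qed

lemma central_extension_iff:
  "x \<in> central_extension M \<longleftrightarrow> (\<exists>z T. central_glue M z T \<and> x = glue z T)"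
  using central_extension_glue glue_central_extension by metis

lemma center_finite_projection:
  assumes "p \<in> projections (center M)" shows "finite_projection (center M) p"
  unfolding finite_projection_def proj_equiv_def
proof safe
  fix u q assume "u \<in> center M" "p = adj u o\<^sub>L u"
  then show "u o\<^sub>L adj u = adj u o\<^sub>L u"
    using adj[OF centerD(1)] by (auto simp: center_def)
qed (use assms in auto)

text \<open>All projections of a commutative algebra are finite, so the measurable operators affiliated with the center are
  exactly those glued from central pieces.\<close>

lemma center_measurable_iff:
  "x \<in> measurable_ops (center M) \<longleftrightarrow> (\<exists>z T. central_glue (center M) z T \<and> x = glue z T)"
proof
  note Z = von_neumann_center
  have cc: "projections (center (center M)) = projections (center M)"
    using centerD by (auto simp: projections_def center_def)
  {
    assume "x \<in> measurable_ops (center M)"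
    then obtain p where x: "closed_operator x" "affiliated (center M) x"
      and p: "\<And>n. p n \<in> projections (center M)" "increases_to_one (center M) p"
        "\<And>n. range (blinfun_apply (p n)) \<subseteq> Domain x"
      unfolding measurable_ops_def by blast
    have sup: "proj_sup (range p) = id_blinfun"
      using p(1,2) by (intro von_neumann.is_proj_sup_iff[OF Z, THEN iffD1, symmetric]) (auto simp: increases_to_one_def)
    obtain z T where zT: "von_neumann.central_glue (center M) (center M) z T" "x = glue z T"
    proof (rule von_neumann.locally_bounded_glue[OF Z x _ sup])
      show "range p \<subseteq> projections (center (center M))" using p(1) cc by auto
      show "range (blinfun_apply w) \<subseteq> Domain x" if "w \<in> range p" for w using that p(3) by blast
    qed blast
    then show "\<exists>z T. central_glue (center M) z T \<and> x = glue z T"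
      unfolding von_neumann.central_glue_def[OF Z] central_glue_def cc by blast
  next
    assume "\<exists>z T. central_glue (center M) z T \<and> x = glue z T"
    then obtain z T where zT: "central_glue (center M) z T" "x = glue z T" by blast
    note zc = central_glueD(1)[OF zT(1)] and co = central_glueD(3)[OF zT(1)]
    have zT': "von_neumann.central_glue (center M) (center M) z T"
      using zT(1) unfolding von_neumann.central_glue_def[OF Z] central_glue_def cc .
    have "increases_to_one (center M) z"
      using coherentD(1)[OF co] von_neumann.increases_to_one_iff[OF Z, of z] zc by (simp add: resolving_def)
    moreover have "closed_operator x" unfolding zT(2) by (rule closed_operator_glue[OF co])
    moreover have "affiliated (center M) x" unfolding zT(2) by (rule von_neumann.glue_affiliated[OF Z zT'])
    moreover have "range (blinfun_apply (z n)) \<subseteq> Domain x" for n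
      unfolding zT(2) using glue_restrict[OF co] by blast
    ultimately show "x \<in> measurable_ops (center M)"
      unfolding measurable_ops_def using zc center_finite_projection[OF center_proj_perp[OF zc]] by blast
  }
qed

text \<open>Sums and comparisons involve two operators at once; cutting both resolutions by each other reduces
  them to bounded pieces over the same central projections.\<close>

lemma central_glue_refine:
  assumes S: "central_glue N z S" "N \<subseteq> M" and N: "\<And>x w. x \<in> N \<Longrightarrow> w \<in> projections (center M) \<Longrightarrow> x o\<^sub>L w \<in> N"
    and w: "\<And>n. w n \<in> projections (center M)" "resolving w"
  shows "central_glue N (\<lambda>n. z n o\<^sub>L w n) (\<lambda>n. S n o\<^sub>L w n)"
    "glue (\<lambda>n. z n o\<^sub>L w n) (\<lambda>n. S n o\<^sub>L w n) = glue z S"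
proof -
  note zc = central_glueD(1)[OF S(1)] and co = central_glueD(3)[OF S(1)]
  have SM: "S n \<in> M" for n using central_glueD(2)[OF S(1)] S(2) by blast
  have c1: "z m (w n \<xi>) = w n (z m \<xi>)" for m n \<xi> by (rule center_proj_compose(2)[OF zc w(1)])
  have c2: "S m (w n \<xi>) = w n (S m \<xi>)" for m n \<xi> using center_projD(6)[OF w(1) SM] by simp
  show "glue (\<lambda>n. z n o\<^sub>L w n) (\<lambda>n. S n o\<^sub>L w n) = glue z S" by (rule glue_refine[OF co w(2) c1 c2])
  show "central_glue N (\<lambda>n. z n o\<^sub>L w n) (\<lambda>n. S n o\<^sub>L w n)"
    unfolding central_glue_def
    using coherent_refine[OF co w(2) c1 c2] center_proj_compose(1)[OF zc w(1)] N[OF central_glueD(2)[OF S(1)] w(1)] by blast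
qed

lemma central_glue_common:
  assumes S: "central_glue N z S" "N = M \<or> N = center M" and T: "central_glue N' w T" "N' = M \<or> N' = center M"
  obtains u S' T' where "central_glue N u S'" "glue u S' = glue z S" "central_glue N' u T'" "glue u T' = glue w T"
    "\<And>n. proj_le (u n) (z n)" "\<And>n. proj_le (u n) (w n)"
proof -
  have N: "N \<subseteq> M" "N' \<subseteq> M" using S(2) T(2) centerD(1) by auto
  have cl: "x o\<^sub>L v \<in> K" if "K = M \<or> K = center M" "x \<in> K" "v \<in> projections (center M)" for x v K
    using that compose von_neumann.compose[OF von_neumann_center] center_projD(2,3) by blast
  note zc = central_glueD(1)[OF S(1)] and wc = central_glueD(1)[OF T(1)]
    and rz = coherentD(1)[OF central_glueD(3)[OF S(1)]] and rw = coherentD(1)[OF central_glueD(3)[OF T(1)]]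
  have eq: "w n o\<^sub>L z n = z n o\<^sub>L w n" for n by (rule blinfun_eqI) (simp add: center_proj_compose(2)[OF wc zc])
  have 2: "central_glue N' (\<lambda>n. z n o\<^sub>L w n) (\<lambda>n. T n o\<^sub>L z n)" "glue (\<lambda>n. z n o\<^sub>L w n) (\<lambda>n. T n o\<^sub>L z n) = glue w T"
    using central_glue_refine[OF T(1) N(2) cl[OF T(2)] zc rz] unfolding eq by blast+
  note 1 = central_glue_refine[OF S(1) N(1) cl[OF S(2)] wc rw]
  show ?thesis
  proof (rule that[OF 1 2])
    show "proj_le (z n o\<^sub>L w n) (z n)" "proj_le (z n o\<^sub>L w n) (w n)" for n
      using is_projD(2)[OF center_projD(1)[OF zc]] is_projD(2)[OF center_projD(1)[OF wc]]
      by (simp_all add: proj_le_iff center_proj_compose(2)[OF zc wc])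
  qed
qed

lemma central_extension_sum:
  assumes "x \<in> central_extension M" "y \<in> central_extension M"
  shows "strong_sum x y \<in> central_extension M"
proof -
  obtain z S w T where "central_glue M z S" "x = glue z S" "central_glue M w T" "y = glue w T"
    using assms central_extension_iff by metis
  then obtain u S' T' where u: "central_glue M u S'" "x = glue u S'" "central_glue M u T'" "y = glue u T'"
    using central_glue_common[of M z S M w T] by metis
  have "strong_sum x y = glue u (\<lambda>n. S' n + T' n)"
    unfolding u using u central_glueD(3) by (intro strong_sum_glue)
  moreover have "central_glue M u (\<lambda>n. S' n + T' n)"
    using u(1,3) coherent_add add by (auto simp: central_glue_def)
  ultimately show ?thesis by (simp add: glue_central_extension)
qed

lemma bounded_on_sum:
  assumes v: "bounded_on x v r" "bounded_on y v s"
  shows "bounded_on (strong_sum x y) v (r + s)"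
  unfolding bounded_on_def
proof (intro allI impI)
  fix \<xi> assume "v \<xi> = \<xi>"
  then obtain \<eta> \<zeta> where "(\<xi>, \<eta>) \<in> x" "norm \<eta> \<le> r * norm \<xi>" "(\<xi>, \<zeta>) \<in> y" "norm \<zeta> \<le> s * norm \<xi>"
    using v unfolding bounded_on_def by blast
  then have 1: "(\<xi>, \<eta> + \<zeta>) \<in> {(\<xi>, \<eta> + \<zeta>) |\<xi> \<eta> \<zeta>. (\<xi>, \<eta>) \<in> x \<and> (\<xi>, \<zeta>) \<in> y}"
    and "norm (\<eta> + \<zeta>) \<le> (r + s) * norm \<xi>"
    using norm_triangle_ineq[of \<eta> \<zeta>] by (blast, simp add: algebra_simps)
  moreover have "(\<xi>, \<eta> + \<zeta>) \<in> strong_sum x y"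
    unfolding strong_sum_def by (rule subsetD[OF closure_subset 1])
  ultimately have "(\<xi>, \<eta> + \<zeta>) \<in> strong_sum x y" "norm (\<eta> + \<zeta>) \<le> (r + s) * norm \<xi>" by blast+
  then show "\<exists>\<eta>. (\<xi>, \<eta>) \<in> strong_sum x y \<and> norm \<eta> \<le> (r + s) * norm \<xi>" by blast
qed

lemma op_graph_central_extension: assumes "T \<in> M" shows "op_graph T \<in> central_extension M"
proof -
  have "coherent (\<lambda>_. id_blinfun) (\<lambda>_. T)"
    by (simp add: coherent_def resolving_def bdd[OF assms] proj_le_refl)
  then have "central_glue M (\<lambda>_. id_blinfun) (\<lambda>_. T)" by (simp add: central_glue_def assms)
  moreover have "glue (\<lambda>_. id_blinfun) (\<lambda>_. T) = op_graph T" by (auto simp: glue_def op_graph_iff)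
  ultimately show ?thesis using glue_central_extension by metis
qed

end

section \<open>The center as an algebra of functions\<close>

lemma blinfun_compose_eqD: "S o\<^sub>L T = R \<Longrightarrow> S (T \<xi>) = blinfun_apply R \<xi>"
  by (metis blinfun_apply_blinfun_compose)

locale represented_center = von_neumann M for M :: "('a::complex_hilbert_space \<Rightarrow>\<^sub>L 'a) set" +
  fixes \<mu> :: "'b measure" and \<Phi> :: "('b \<Rightarrow> complex) \<Rightarrow> 'a \<Rightarrow>\<^sub>L 'a"
  assumes iso: "center_iso M \<mu> \<Phi>"
begin

lemma LinfI: "f \<in> borel_measurable \<mu> \<Longrightarrow> AE \<omega> in \<mu>. cmod (f \<omega>) \<le> C \<Longrightarrow> f \<in> Linf \<mu>"
  by (auto simp: Linf_def)

lemma LinfD: assumes "f \<in> Linf \<mu>"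
  shows "f \<in> borel_measurable \<mu>" "\<exists>C\<ge>0. AE \<omega> in \<mu>. cmod (f \<omega>) \<le> C"
proof -
  from assms obtain C where C: "f \<in> borel_measurable \<mu>" "AE \<omega> in \<mu>. cmod (f \<omega>) \<le> C" by (auto simp: Linf_def)
  show "f \<in> borel_measurable \<mu>" by (rule C)
  have "AE \<omega> in \<mu>. cmod (f \<omega>) \<le> max C 0" using C(2) by eventually_elim auto
  then show "\<exists>C\<ge>0. AE \<omega> in \<mu>. cmod (f \<omega>) \<le> C" by (intro exI[of _ "max C 0"]) simp
qed

lemma Linf_const [simp]: "(\<lambda>_. c) \<in> Linf \<mu>"
  by (rule LinfI[of _ "cmod c"]) auto

lemma Linf_indicator [simp]: "E \<in> sets \<mu> \<Longrightarrow> indicator E \<in> Linf \<mu>"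
  by (rule LinfI[of _ 1]) (auto simp: indicator_def)

lemma Linf_add: assumes "f \<in> Linf \<mu>" "g \<in> Linf \<mu>" shows "(\<lambda>\<omega>. f \<omega> + g \<omega>) \<in> Linf \<mu>"
proof -
  obtain C D where C: "AE \<omega> in \<mu>. cmod (f \<omega>) \<le> C" and D: "AE \<omega> in \<mu>. cmod (g \<omega>) \<le> D"
    using LinfD(2)[OF assms(1)] LinfD(2)[OF assms(2)] by blast
  have "AE \<omega> in \<mu>. cmod (f \<omega> + g \<omega>) \<le> C + D"
    using C D by eventually_elim (rule norm_triangle_mono)
  then show ?thesis using LinfD(1)[OF assms(1)] LinfD(1)[OF assms(2)] by (intro LinfI) auto
qed

lemma Linf_mult: assumes "f \<in> Linf \<mu>" "g \<in> Linf \<mu>" shows "(\<lambda>\<omega>. f \<omega> * g \<omega>) \<in> Linf \<mu>"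
proof -
  obtain C D where C: "0 \<le> C" "AE \<omega> in \<mu>. cmod (f \<omega>) \<le> C" and D: "AE \<omega> in \<mu>. cmod (g \<omega>) \<le> D"
    using LinfD(2)[OF assms(1)] LinfD(2)[OF assms(2)] by blast
  have "AE \<omega> in \<mu>. cmod (f \<omega> * g \<omega>) \<le> C * D"
    using C(2) D by eventually_elim (use C(1) in \<open>auto simp: norm_mult intro: mult_mono\<close>)
  then show ?thesis using LinfD(1)[OF assms(1)] LinfD(1)[OF assms(2)] by (intro LinfI) auto
qed

lemma Phi_center: "f \<in> Linf \<mu> \<Longrightarrow> \<Phi> f \<in> center M"
  using iso by (auto simp: center_iso_def)

lemma Phi_surj: "x \<in> center M \<Longrightarrow> \<exists>f\<in>Linf \<mu>. x = \<Phi> f"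
  using iso unfolding center_iso_def by blast

lemma Phi_eq_iff: "f \<in> Linf \<mu> \<Longrightarrow> g \<in> Linf \<mu> \<Longrightarrow> \<Phi> f = \<Phi> g \<longleftrightarrow> (AE \<omega> in \<mu>. f \<omega> = g \<omega>)"
  and Phi_add: "f \<in> Linf \<mu> \<Longrightarrow> g \<in> Linf \<mu> \<Longrightarrow> \<Phi> (\<lambda>\<omega>. f \<omega> + g \<omega>) = \<Phi> f + \<Phi> g"
  and Phi_mult: "f \<in> Linf \<mu> \<Longrightarrow> g \<in> Linf \<mu> \<Longrightarrow> \<Phi> (\<lambda>\<omega>. f \<omega> * g \<omega>) = \<Phi> f o\<^sub>L \<Phi> g"
  and Phi_cnj: "f \<in> Linf \<mu> \<Longrightarrow> \<Phi> (\<lambda>\<omega>. cnj (f \<omega>)) = adj (\<Phi> f)"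
  and Phi_scaleC: "f \<in> Linf \<mu> \<Longrightarrow> \<Phi> (\<lambda>\<omega>. c * f \<omega>) \<xi> = c *\<^sub>C \<Phi> f \<xi>"
  using iso unfolding center_iso_def by blast+

lemma Phi_scaleR: "f \<in> Linf \<mu> \<Longrightarrow> \<Phi> (\<lambda>\<omega>. complex_of_real r * f \<omega>) = r *\<^sub>R \<Phi> f"
  by (rule blinfun_eqI) (simp add: Phi_scaleC scaleR_eq_scaleC blinfun.scaleR_left)

lemma Linf_diff: "f \<in> Linf \<mu> \<Longrightarrow> g \<in> Linf \<mu> \<Longrightarrow> (\<lambda>\<omega>. f \<omega> - g \<omega>) \<in> Linf \<mu>"
  using Linf_add[of f "\<lambda>\<omega>. -1 * g \<omega>"] Linf_mult[of "\<lambda>_. -1" g] by simp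

lemma Phi_diff: "f \<in> Linf \<mu> \<Longrightarrow> g \<in> Linf \<mu> \<Longrightarrow> \<Phi> (\<lambda>\<omega>. f \<omega> - g \<omega>) = \<Phi> f - \<Phi> g"
  using Phi_add[of f "\<lambda>\<omega>. -1 * g \<omega>"] Linf_mult[of "\<lambda>_. -1" g] Phi_scaleR[of g "-1"] by simp

lemma Phi_cong: "f \<in> Linf \<mu> \<Longrightarrow> g \<in> Linf \<mu> \<Longrightarrow> (AE \<omega> in \<mu>. f \<omega> = g \<omega>) \<Longrightarrow> \<Phi> f = \<Phi> g"
  by (simp add: Phi_eq_iff)

lemma Phi_one: "\<Phi> (\<lambda>_. 1) = id_blinfun"
proof -
  have "id_blinfun \<in> center M" using center_proj_id center_projD(3) by blast
  then obtain f where f: "f \<in> Linf \<mu>" "id_blinfun = \<Phi> f" using Phi_surj by blast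
  have "\<Phi> (\<lambda>_. 1) = \<Phi> (\<lambda>_. 1) o\<^sub>L \<Phi> f" by (simp flip: f(2) add: blinfun_eqI)
  also have "\<dots> = \<Phi> (\<lambda>\<omega>. 1 * f \<omega>)" by (rule Phi_mult[symmetric]) (simp_all add: f)
  also have "\<dots> = id_blinfun" using f(2) by simp
  finally show ?thesis .
qed

definition chi :: "'b set \<Rightarrow> 'a \<Rightarrow>\<^sub>L 'a" where "chi E = \<Phi> (indicator E)"

lemma chi_center_proj: assumes E: "E \<in> sets \<mu>" shows "chi E \<in> projections (center M)"
proof -
  have "\<Phi> (\<lambda>\<omega>. indicator E \<omega> * indicator E \<omega>) = chi E o\<^sub>L chi E"
    unfolding chi_def using E by (intro Phi_mult) auto
  moreover have "\<Phi> (\<lambda>\<omega>. cnj (indicator E \<omega>)) = adj (chi E)"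
    unfolding chi_def using E by (intro Phi_cnj) auto
  moreover have "(\<lambda>\<omega>. indicator E \<omega> * indicator E \<omega>) = (indicator E :: 'b \<Rightarrow> complex)"
    "(\<lambda>\<omega>. cnj (indicator E \<omega>)) = (indicator E :: 'b \<Rightarrow> complex)" by (auto simp: indicator_def)
  ultimately show ?thesis
    using Phi_center[of "indicator E"] E by (simp add: projections_def chi_def)
qed

lemmas chi_proj = center_projD(1)[OF chi_center_proj]

lemma center_proj_chi:
  assumes "z \<in> projections (center M)" obtains E where "E \<in> sets \<mu>" "z = chi E"
proof -
  obtain f where f: "f \<in> Linf \<mu>" "z = \<Phi> f" using Phi_surj center_projD(3)[OF assms] by blast
  define E where "E = {\<omega> \<in> space \<mu>. f \<omega> = 1}"
  have E: "E \<in> sets \<mu>" unfolding E_def using LinfD(1)[OF f(1)] by measurable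
  have "\<Phi> (\<lambda>\<omega>. f \<omega> * f \<omega>) = \<Phi> f"
    using Phi_mult[OF f(1) f(1)] is_projD(6)[OF center_projD(1)[OF assms]] f(2) by simp
  then have "AE \<omega> in \<mu>. f \<omega> * f \<omega> = f \<omega>" using Phi_eq_iff[OF Linf_mult[OF f(1) f(1)] f(1)] by simp
  then have "AE \<omega> in \<mu>. f \<omega> = indicator E \<omega>"
    using AE_space by eventually_elim (auto simp: E_def indicator_def)
  then have "\<Phi> f = chi E" unfolding chi_def by (intro Phi_cong f) (use E in auto)
  then show ?thesis using that E f(2) by blast
qed

lemma chi_Int:
  assumes "E \<in> sets \<mu>" "F \<in> sets \<mu>" shows "chi (E \<inter> F) = chi E o\<^sub>L chi F"
proof -
  have "(\<lambda>\<omega>. indicator E \<omega> * indicator F \<omega>) = (indicator (E \<inter> F) :: 'b \<Rightarrow> complex)"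
    by (auto simp: indicator_def fun_eq_iff)
  then show ?thesis using Phi_mult[of "indicator E" "indicator F"] assms by (simp add: chi_def)
qed

lemma chi_empty [simp]: "chi {} = 0"
proof -
  have "\<Phi> (\<lambda>\<omega>. complex_of_real 0 * 1) = 0 *\<^sub>R \<Phi> (\<lambda>_. 1)" by (rule Phi_scaleR) simp
  moreover have "(indicator {} :: 'b \<Rightarrow> complex) = (\<lambda>_. 0)" by auto
  ultimately show ?thesis by (simp add: chi_def)
qed

lemma chi_Un:
  assumes "E \<in> sets \<mu>" "F \<in> sets \<mu>" "E \<inter> F = {}" shows "chi (E \<union> F) = chi E + chi F"
proof -
  have "(indicator (E \<union> F) :: 'b \<Rightarrow> complex) = (\<lambda>\<omega>. indicator E \<omega> + indicator F \<omega>)"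
    using assms(3) by (auto simp: indicator_def fun_eq_iff)
  then show ?thesis using Phi_add[of "indicator E" "indicator F"] assms by (simp add: chi_def)
qed

lemma chi_cong:
  assumes "E \<in> sets \<mu>" "F \<in> sets \<mu>" "AE \<omega> in \<mu>. \<omega> \<in> E \<longleftrightarrow> \<omega> \<in> F" shows "chi E = chi F"
  unfolding chi_def using assms(3) by (intro Phi_cong) (use assms in \<open>auto simp: indicator_def\<close>)

lemma chi_space: "chi (space \<mu>) = id_blinfun"
  unfolding chi_def Phi_one[symmetric] by (intro Phi_cong) (auto intro!: AE_I2)

lemma chi_compl: assumes "E \<in> sets \<mu>" shows "chi (space \<mu> - E) = perp (chi E)"
proof -
  have "chi (E \<union> (space \<mu> - E)) = chi E + chi (space \<mu> - E)" using assms by (intro chi_Un) auto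
  moreover have "E \<union> (space \<mu> - E) = space \<mu>" using sets.sets_into_space[OF assms] by auto
  ultimately show ?thesis using chi_space by (metis add_diff_cancel_left')
qed

lemma chi_eq_0_iff: assumes "E \<in> sets \<mu>" shows "chi E = 0 \<longleftrightarrow> (AE \<omega> in \<mu>. \<omega> \<notin> E)"
proof -
  have "chi E = chi {} \<longleftrightarrow> (AE \<omega> in \<mu>. indicator E \<omega> = (indicator {} \<omega> :: complex))"
    unfolding chi_def using assms by (intro Phi_eq_iff) auto
  then show ?thesis by (simp add: indicator_def)
qed

lemma chi_le_iff:
  assumes "E \<in> sets \<mu>" "F \<in> sets \<mu>" shows "proj_le (chi E) (chi F) \<longleftrightarrow> (AE \<omega> in \<mu>. \<omega> \<in> E \<longrightarrow> \<omega> \<in> F)"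
proof -
  have "proj_le (chi E) (chi F) \<longleftrightarrow> \<Phi> (indicator (F \<inter> E)) = \<Phi> (indicator E)"
    using assms by (simp add: proj_le_def chi_Int flip: chi_def)
  also have "\<dots> \<longleftrightarrow> (AE \<omega> in \<mu>. indicator (F \<inter> E) \<omega> = (indicator E \<omega> :: complex))"
    using assms by (intro Phi_eq_iff) auto
  also have "\<dots> \<longleftrightarrow> (AE \<omega> in \<mu>. \<omega> \<in> E \<longrightarrow> \<omega> \<in> F)"
    by (intro AE_cong) (auto simp: indicator_def)
  finally show ?thesis .
qed

text \<open>The projection of the union fixes every \<open>\<chi>\<^sub>F\<^sub>n \<xi>\<close>, hence the limit \<open>\<xi>\<close>; so the complement of the union is null.\<close>

lemma chi_exhausts:
  assumes F: "\<And>n. F n \<in> sets \<mu>" and lim: "\<And>\<xi>. (\<lambda>n. chi (F n) \<xi>) \<longlonglongrightarrow> \<xi>"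
  shows "AE \<omega> in \<mu>. \<exists>n. \<omega> \<in> F n"
proof -
  let ?G = "\<Union>n. F n"
  have G: "?G \<in> sets \<mu>" using F by auto
  have "chi ?G \<xi> = \<xi>" for \<xi>
  proof -
    have "proj_le (chi (F n)) (chi ?G)" for n using F G by (subst chi_le_iff) auto
    then have "chi ?G (chi (F n) \<xi>) = chi (F n) \<xi>" for n by (simp add: proj_le_iff)
    moreover have "(\<lambda>n. chi ?G (chi (F n) \<xi>)) \<longlonglongrightarrow> chi ?G \<xi>" by (intro blinfun.tendsto lim tendsto_const)
    ultimately show ?thesis using lim LIMSEQ_unique by simp blast
  qed
  then have "chi (space \<mu> - ?G) = 0" unfolding chi_compl[OF G] by (intro blinfun_eqI) (simp add: blinfun_simps)
  then have "AE \<omega> in \<mu>. \<omega> \<notin> space \<mu> - ?G" using G by (subst (asm) chi_eq_0_iff) auto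
  then show ?thesis using AE_space by eventually_elim auto
qed

lemma chi_resolving:
  assumes F: "\<And>n. F n \<in> sets \<mu>" "\<And>n. AE \<omega> in \<mu>. \<omega> \<in> F n \<longrightarrow> \<omega> \<in> F (Suc n)" "AE \<omega> in \<mu>. \<exists>n. \<omega> \<in> F n"
  shows "resolving (\<lambda>n. chi (F n))"
proof -
  let ?D = "range (\<lambda>n. chi (F n))"
  have D: "?D \<subseteq> projections (center M)" using F chi_center_proj by auto
  obtain G where G: "G \<in> sets \<mu>" "proj_sup ?D = chi G" using center_proj_chi[OF center_proj_sup[OF D]] by blast
  have "AE \<omega> in \<mu>. \<omega> \<in> F n \<longrightarrow> \<omega> \<in> G" for n
    using proj_sup_upper[of "chi (F n)" ?D] F(1) G by (simp add: chi_le_iff)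
  then have "AE \<omega> in \<mu>. \<forall>n. \<omega> \<in> F n \<longrightarrow> \<omega> \<in> G" by (subst AE_all_countable) blast
  then have "AE \<omega> in \<mu>. \<omega> \<in> G \<longleftrightarrow> \<omega> \<in> space \<mu>"
    using F(3) AE_space by eventually_elim auto
  then have "proj_sup ?D = id_blinfun"
    unfolding G(2) chi_space[symmetric] using G(1) by (intro chi_cong) auto
  moreover have inc: "proj_le (chi (F n)) (chi (F (Suc n)))" for n using F by (simp add: chi_le_iff)
  ultimately have "increases_to_one M (\<lambda>n. chi (F n))"
    unfolding increases_to_one_def using D center_projD(4) by (subst is_proj_sup_iff) auto
  then show ?thesis
    using increases_to_one_iff[of "\<lambda>n. chi (F n)"] center_projD(4)[OF chi_center_proj[OF F(1)]] chi_proj[OF F(1)]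
    by (simp add: resolving_def)
qed

lemma Linf_sqrt:
  assumes "f \<in> Linf \<mu>" shows "(\<lambda>\<omega>. complex_of_real (sqrt (max 0 (Re (f \<omega>))))) \<in> Linf \<mu>"
proof -
  obtain C where C: "0 \<le> C" "AE \<omega> in \<mu>. cmod (f \<omega>) \<le> C" using LinfD(2)[OF assms] by blast
  have "AE \<omega> in \<mu>. cmod (complex_of_real (sqrt (max 0 (Re (f \<omega>))))) \<le> sqrt C"
    using C(2)
  proof eventually_elim
    case (elim \<omega>)
    then have "max 0 (Re (f \<omega>)) \<le> C" using complex_Re_le_cmod[of "f \<omega>"] C(1) by simp
    then show ?case by simp
  qed
  moreover have [measurable]: "f \<in> borel_measurable \<mu>" using LinfD(1)[OF assms] .
  ultimately show ?thesis by (intro LinfI) measurable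
qed

lemma Phi_pos:
  assumes f: "f \<in> Linf \<mu>" "AE \<omega> in \<mu>. Im (f \<omega>) = 0 \<and> 0 \<le> Re (f \<omega>)" shows "pos_op (\<Phi> f)"
proof -
  define h where "h \<omega> = complex_of_real (sqrt (max 0 (Re (f \<omega>))))" for \<omega>
  have h: "h \<in> Linf \<mu>" unfolding h_def by (rule Linf_sqrt[OF f(1)])
  have "(\<lambda>\<omega>. cnj (h \<omega>)) = h" by (simp add: h_def fun_eq_iff)
  then have ah: "adj (\<Phi> h) = \<Phi> h" using Phi_cnj[OF h] by simp
  have "AE \<omega> in \<mu>. f \<omega> = h \<omega> * h \<omega>"
    using f(2) by eventually_elim (simp add: h_def complex_eq_iff)
  then have "\<Phi> f = \<Phi> (\<lambda>\<omega>. h \<omega> * h \<omega>)" by (intro Phi_cong f(1) Linf_mult h)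
  also have "\<dots> = adj (\<Phi> h) o\<^sub>L \<Phi> h" unfolding ah by (rule Phi_mult[OF h h])
  finally show ?thesis
    using pos_op_adj_compose[OF bdd[OF centerD(1)[OF Phi_center[OF h]]]] by simp
qed

text \<open>If the real part were negative on a non-null set \<open>E\<close>, then \<open>- f \<chi>\<^sub>E\<close> would be positive and so would be its
  negative, the compression of \<open>\<Phi> f\<close> to \<open>\<chi>\<^sub>E\<close>. Both would vanish.\<close>

lemma Phi_pos_iff:
  assumes f: "f \<in> Linf \<mu>" shows "pos_op (\<Phi> f) \<longleftrightarrow> (AE \<omega> in \<mu>. Im (f \<omega>) = 0 \<and> 0 \<le> Re (f \<omega>))"
proof
  assume P: "pos_op (\<Phi> f)"
  have "(\<lambda>\<omega>. cnj (f \<omega>)) \<in> borel_measurable \<mu>"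
    by (rule measurable_compose[OF LinfD(1)[OF f]]) (intro borel_measurable_continuous_onI continuous_intros)
  then have cf: "(\<lambda>\<omega>. cnj (f \<omega>)) \<in> Linf \<mu>" using LinfD(2)[OF f] by (auto simp: Linf_def)
  have "\<Phi> (\<lambda>\<omega>. cnj (f \<omega>)) = \<Phi> f" by (simp add: Phi_cnj[OF f] pos_op_adj[OF P])
  then have "AE \<omega> in \<mu>. cnj (f \<omega>) = f \<omega>" using Phi_eq_iff[OF cf f] by simp
  then have im: "AE \<omega> in \<mu>. Im (f \<omega>) = 0" by eventually_elim (simp add: complex_eq_iff)
  define E where "E = {\<omega> \<in> space \<mu>. Re (f \<omega>) < 0}"
  have [measurable]: "f \<in> borel_measurable \<mu>" using LinfD(1)[OF f] .
  have E: "E \<in> sets \<mu>" unfolding E_def by measurable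
  define g where "g = (\<lambda>\<omega>. - 1 * (f \<omega> * indicator E \<omega>))"
  have g: "g \<in> Linf \<mu>" unfolding g_def by (intro Linf_mult f) (use E in auto)
  have "AE \<omega> in \<mu>. Im (g \<omega>) = 0 \<and> 0 \<le> Re (g \<omega>)"
    using im by eventually_elim (auto simp: g_def E_def indicator_def)
  then have Q: "pos_op (\<Phi> g)" by (rule Phi_pos[OF g])
  have fE: "(\<lambda>\<omega>. f \<omega> * indicator E \<omega>) \<in> Linf \<mu>" by (intro Linf_mult f) (use E in auto)
  have eqg: "\<Phi> g \<xi> = - \<Phi> f (chi E \<xi>)" for \<xi>
    unfolding g_def using Phi_scaleC[OF fE, of "-1"] Phi_mult[OF f, of "indicator E"] E by (simp add: chi_def)
  have comm: "\<Phi> f (chi E \<xi>) = chi E (\<Phi> f \<xi>)" for \<xi>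
    using center_projD(6)[OF chi_center_proj[OF E] centerD(1)[OF Phi_center[OF f]]] by simp
  have "\<Phi> g \<xi> = 0" for \<xi>
  proof (rule pos_op_null[OF Q])
    have "cinner (\<Phi> g \<xi>) \<xi> = - cinner (\<Phi> f (chi E \<xi>)) (chi E \<xi>)"
      using is_projD(3)[OF chi_proj[OF E], of "\<Phi> f \<xi>" \<xi>] is_projD(2,3)[OF chi_proj[OF E]]
      by (simp add: eqg comm cinner_minus_left)
    then have "Re (cinner (\<Phi> g \<xi>) \<xi>) \<le> 0" using pos_op_Re[OF P] by simp
    then show "Re (cinner (\<Phi> g \<xi>) \<xi>) = 0" using pos_op_Re[OF Q, of \<xi>] by simp
  qed
  then have "\<Phi> g = chi {}" by (intro blinfun_eqI) simp
  then have "AE \<omega> in \<mu>. g \<omega> = 0" using Phi_eq_iff[OF g, of "indicator {}"] by (simp add: chi_def)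
  then show "AE \<omega> in \<mu>. Im (f \<omega>) = 0 \<and> 0 \<le> Re (f \<omega>)"
    using im AE_space
  proof eventually_elim
    case (elim \<omega>)
    then show ?case by (cases "\<omega> \<in> E") (auto simp: g_def E_def)
  qed
qed (rule Phi_pos[OF f])

abbreviation level :: "('b \<Rightarrow> complex) \<Rightarrow> nat \<Rightarrow> 'b set" where
  "level f n \<equiv> {\<omega> \<in> space \<mu>. cmod (f \<omega>) \<le> real n}"

text \<open>The operator in \<open>S(Z(M))\<close> that corresponds to a measurable function.\<close>

definition fun_op :: "('b \<Rightarrow> complex) \<Rightarrow> 'a operator" where
  "fun_op f = glue (\<lambda>n. chi (level f n)) (\<lambda>n. \<Phi> (\<lambda>\<omega>. f \<omega> * indicator (level f n) \<omega>))"

context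
  fixes f :: "'b \<Rightarrow> complex" assumes f[measurable]: "f \<in> borel_measurable \<mu>"
begin

lemma Linf_truncate: "E \<in> sets \<mu> \<Longrightarrow> (AE \<omega> in \<mu>. \<omega> \<in> E \<longrightarrow> cmod (f \<omega>) \<le> C) \<Longrightarrow> (\<lambda>\<omega>. f \<omega> * indicator E \<omega>) \<in> Linf \<mu>"
  by (rule LinfI[of _ "max 0 C"]) (auto simp: indicator_def elim!: eventually_mono)

lemma central_glue_fun_op:
  "central_glue (center M) (\<lambda>n. chi (level f n)) (\<lambda>n. \<Phi> (\<lambda>\<omega>. f \<omega> * indicator (level f n) \<omega>))"
proof -
  have F: "level f n \<in> sets \<mu>" for n by measurable
  have L: "(\<lambda>\<omega>. f \<omega> * indicator (level f n) \<omega>) \<in> Linf \<mu>" for n by (rule Linf_truncate[of _ "real n"]) auto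
  have res: "resolving (\<lambda>n. chi (level f n))"
    by (rule chi_resolving) (auto intro!: AE_I2 real_arch_simple)
  have L1: "\<Phi> (\<lambda>\<omega>. f \<omega> * indicator (level f n) \<omega>) (chi (level f m) \<xi>) = \<Phi> (\<lambda>\<omega>. f \<omega> * indicator (level f m) \<omega>) \<xi>" if "m \<le> n" for m n \<xi>
  proof -
    have "\<Phi> (\<lambda>\<omega>. f \<omega> * indicator (level f n) \<omega>) o\<^sub>L chi (level f m) = \<Phi> (\<lambda>\<omega>. f \<omega> * indicator (level f n) \<omega> * indicator (level f m) \<omega>)"
      unfolding chi_def by (rule Phi_mult[symmetric, OF L]) (use F in auto)
    also have "(\<lambda>\<omega>. f \<omega> * indicator (level f n) \<omega> * indicator (level f m) \<omega>) = (\<lambda>\<omega>. f \<omega> * indicator (level f m) \<omega>)"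
      using that by (auto simp: indicator_def fun_eq_iff)
    finally show ?thesis by (rule blinfun_compose_eqD)
  qed
  have L2: "chi (level f m) (\<Phi> (\<lambda>\<omega>. f \<omega> * indicator (level f n) \<omega>) \<xi>) = \<Phi> (\<lambda>\<omega>. f \<omega> * indicator (level f n) \<omega>) (chi (level f m) \<xi>)" for m n \<xi>
    by (rule center_projD(6)[OF chi_center_proj[OF F] centerD(1)[OF Phi_center[OF L]]])
  show ?thesis
    unfolding central_glue_def coherent_def
    using res L1 L2 chi_center_proj[OF F] Phi_center[OF L] bdd[OF centerD(1)[OF Phi_center[OF L]]] by simp
qed

lemma fun_op_measurable: "fun_op f \<in> measurable_ops (center M)"
  unfolding fun_op_def center_measurable_iff using central_glue_fun_op by blast

lemma represents_fun_op: "represents M \<mu> \<Phi> f (fun_op f)"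
  unfolding represents_def
proof (intro conjI ballI impI f fun_op_measurable)
  fix E assume E: "E \<in> sets \<mu>" and L: "(\<lambda>\<omega>. f \<omega> * indicator E \<omega>) \<in> Linf \<mu>"
  have F: "level f n \<in> sets \<mu>" for n by measurable
  have LF: "(\<lambda>\<omega>. f \<omega> * indicator (level f n) \<omega>) \<in> Linf \<mu>" for n by (rule Linf_truncate[of _ "real n"]) auto
  have "closed_operator (fun_op f)"
    unfolding fun_op_def by (rule closed_operator_glue[OF central_glueD(3)[OF central_glue_fun_op]])
  moreover have "(\<Phi> (indicator E) \<xi>, \<Phi> (\<lambda>\<omega>. f \<omega> * indicator E \<omega>) \<xi>) \<in> fun_op f" for \<xi>
    unfolding fun_op_def glue_def
  proof safe
    fix n
    have "chi (level f n) o\<^sub>L \<Phi> (\<lambda>\<omega>. f \<omega> * indicator E \<omega>) = \<Phi> (\<lambda>\<omega>. indicator (level f n) \<omega> * (f \<omega> * indicator E \<omega>))"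
      unfolding chi_def by (rule Phi_mult[symmetric, OF _ L]) (use F in auto)
    also have "(\<lambda>\<omega>. indicator (level f n) \<omega> * (f \<omega> * indicator E \<omega>)) = (\<lambda>\<omega>. f \<omega> * indicator (level f n) \<omega> * indicator E \<omega>)"
      by (auto simp: fun_eq_iff)
    also have "\<Phi> \<dots> = \<Phi> (\<lambda>\<omega>. f \<omega> * indicator (level f n) \<omega>) o\<^sub>L \<Phi> (indicator E)"
      by (rule Phi_mult[OF LF]) (use E in auto)
    finally show "chi (level f n) (\<Phi> (\<lambda>\<omega>. f \<omega> * indicator E \<omega>) \<xi>) = \<Phi> (\<lambda>\<omega>. f \<omega> * indicator (level f n) \<omega>) (\<Phi> (indicator E) \<xi>)"
      by (rule blinfun_compose_eqD[THEN trans]) (rule blinfun_apply_blinfun_compose)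
  qed
  ultimately show "strong_prod (fun_op f) (op_graph (\<Phi> (indicator E))) = op_graph (\<Phi> (\<lambda>\<omega>. f \<omega> * indicator E \<omega>))"
    by (rule strong_prod_right)
qed

end

lemma represents_unique:
  assumes f: "represents M \<mu> \<Phi> f x" and g: "represents M \<mu> \<Phi> g x" shows "AE \<omega> in \<mu>. f \<omega> = g \<omega>"
proof -
  have [measurable]: "f \<in> borel_measurable \<mu>" "g \<in> borel_measurable \<mu>" using f g by (auto simp: represents_def)
  define E where "E n = {\<omega> \<in> space \<mu>. cmod (f \<omega>) \<le> real n \<and> cmod (g \<omega>) \<le> real n}" for n
  have E: "E n \<in> sets \<mu>" for n unfolding E_def by measurable
  have L: "(\<lambda>\<omega>. f \<omega> * indicator (E n) \<omega>) \<in> Linf \<mu>" "(\<lambda>\<omega>. g \<omega> * indicator (E n) \<omega>) \<in> Linf \<mu>" for n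
    by (auto intro!: Linf_truncate[where C = "real n"] E simp: E_def)
  have "op_graph (\<Phi> (\<lambda>\<omega>. f \<omega> * indicator (E n) \<omega>)) = op_graph (\<Phi> (\<lambda>\<omega>. g \<omega> * indicator (E n) \<omega>))" for n
    using f g E L unfolding represents_def by metis
  then have "AE \<omega> in \<mu>. f \<omega> * indicator (E n) \<omega> = g \<omega> * indicator (E n) \<omega>" for n
    using Phi_eq_iff[OF L] by (simp add: op_graph_inject)
  then have "AE \<omega> in \<mu>. \<forall>n. f \<omega> * indicator (E n) \<omega> = g \<omega> * indicator (E n) \<omega>" by (subst AE_all_countable) blast
  then show ?thesis
    using AE_space
  proof eventually_elim
    case (elim \<omega>)
    obtain n where "max (cmod (f \<omega>)) (cmod (g \<omega>)) \<le> real n" using real_arch_simple by blast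
    then have "\<omega> \<in> E n" using elim by (simp add: E_def)
    then show ?case using elim(1)[rule_format, of n] by simp
  qed
qed

lemma W_nbhd_iff:
  assumes "0 \<le> \<epsilon>"
  shows "f \<in> W_nbhd \<mu> A \<epsilon> \<delta> \<longleftrightarrow> f \<in> borel_measurable \<mu> \<and>
    (\<exists>B\<in>sets \<mu>. B \<subseteq> A \<and> emeasure \<mu> (A - B) \<le> ennreal \<delta> \<and> (AE \<omega> in \<mu>. \<omega> \<in> B \<longrightarrow> cmod (f \<omega>) \<le> \<epsilon>))"
proof -
  have "(\<lambda>\<omega>. f \<omega> * indicator B \<omega>) \<in> Linf \<mu> \<and> Linf_norm \<mu> (\<lambda>\<omega>. f \<omega> * indicator B \<omega>) \<le> \<epsilon>
      \<longleftrightarrow> (AE \<omega> in \<mu>. \<omega> \<in> B \<longrightarrow> cmod (f \<omega>) \<le> \<epsilon>)" if f: "f \<in> borel_measurable \<mu>" and B: "B \<in> sets \<mu>" for B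
  proof
    let ?S = "{C. 0 \<le> C \<and> (AE \<omega> in \<mu>. cmod (f \<omega> * indicator B \<omega>) \<le> C)}"
    have bdd: "bdd_below ?S" by (rule bdd_belowI[of _ 0]) auto
    {
      assume L: "(\<lambda>\<omega>. f \<omega> * indicator B \<omega>) \<in> Linf \<mu> \<and> Linf_norm \<mu> (\<lambda>\<omega>. f \<omega> * indicator B \<omega>) \<le> \<epsilon>"
      then have ne: "?S \<noteq> {}" using LinfD(2) by blast
      have "AE \<omega> in \<mu>. cmod (f \<omega> * indicator B \<omega>) \<le> \<epsilon> + 1 / real (Suc n)" for n
      proof -
        have "Inf ?S < \<epsilon> + 1 / real (Suc n)"
          using L unfolding Linf_norm_def by (smt (verit) divide_pos_pos of_nat_0_less_iff zero_less_Suc)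
        then obtain C where "C \<in> ?S" "C < \<epsilon> + 1 / real (Suc n)" using cInf_less_iff[OF ne bdd] by blast
        then show ?thesis by (auto elim!: eventually_mono)
      qed
      then have "AE \<omega> in \<mu>. \<forall>n. cmod (f \<omega> * indicator B \<omega>) \<le> \<epsilon> + 1 / real (Suc n)" by (simp add: AE_all_countable)
      then show "AE \<omega> in \<mu>. \<omega> \<in> B \<longrightarrow> cmod (f \<omega>) \<le> \<epsilon>"
      proof eventually_elim
        case (elim \<omega>)
        have "(\<lambda>n. \<epsilon> + 1 / real (Suc n)) \<longlonglongrightarrow> \<epsilon>"
          using LIMSEQ_inverse_real_of_nat_add[of \<epsilon>] by (simp add: inverse_eq_divide)
        then have "cmod (f \<omega> * indicator B \<omega>) \<le> \<epsilon>" using elim LIMSEQ_le_const by blast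
        then show ?case by (auto simp: indicator_def)
      qed
    next
      assume *: "AE \<omega> in \<mu>. \<omega> \<in> B \<longrightarrow> cmod (f \<omega>) \<le> \<epsilon>"
      then have "AE \<omega> in \<mu>. cmod (f \<omega> * indicator B \<omega>) \<le> \<epsilon>"
        by eventually_elim (use assms in \<open>auto simp: indicator_def\<close>)
      then have "\<epsilon> \<in> ?S" using assms by simp
      then have "Linf_norm \<mu> (\<lambda>\<omega>. f \<omega> * indicator B \<omega>) \<le> \<epsilon>"
        unfolding Linf_norm_def by (rule cInf_lower[OF _ bdd])
      then show "(\<lambda>\<omega>. f \<omega> * indicator B \<omega>) \<in> Linf \<mu> \<and> Linf_norm \<mu> (\<lambda>\<omega>. f \<omega> * indicator B \<omega>) \<le> \<epsilon>"
        using Linf_truncate[OF f B *] by blast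
    }
  qed
  then show ?thesis unfolding W_nbhd_def by blast
qed

end

section \<open>The center-valued norm as a function\<close>

lemma op_le_glue_iff:
  assumes "coherent u S" "coherent u T" shows "op_le (glue u S) (glue u T) \<longleftrightarrow> (\<forall>n. pos_op (T n - S n))"
  unfolding op_le_def strong_diff_glue[OF assms(2,1)] by (rule positive_glue_iff[OF coherent_diff[OF assms(2,1)]])

lemma Re_cinner_le: "Re (cinner \<xi> \<eta>) \<le> norm \<xi> * norm (\<eta>::'a::complex_hilbert_space)"
  using complex_Re_le_cmod[of "cinner \<xi> \<eta>"] cauchy_schwarz[of \<xi> \<eta>] by linarith

context represented_center
begin

text \<open>The function \<open>c\<close> below is the center-valued norm of \<open>x\<close>: it is obtained from the largest central
  projections on which \<open>x\<close> is bounded by \<open>r\<close>, for \<open>r\<close> rational, as a function from its level sets.\<close>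

lemma bound_function:
  assumes "x \<in> central_extension M"
  obtains c :: "'b \<Rightarrow> real" where "c \<in> borel_measurable \<mu>" "\<And>\<omega>. 0 \<le> c \<omega>"
    "\<And>B \<epsilon>. B \<in> sets \<mu> \<Longrightarrow> 0 \<le> \<epsilon> \<Longrightarrow> (AE \<omega> in \<mu>. \<omega> \<in> B \<longrightarrow> c \<omega> \<le> \<epsilon>) \<longleftrightarrow> bounded_on x (chi B) \<epsilon>"
proof -
  obtain T where T: "central_glue M (\<lambda>n. bound_proj x (real n)) T" "x = glue (\<lambda>n. bound_proj x (real n)) T"
    using central_extension_glue[OF assms] by metis
  have cl: "closed_operator x" and af: "affiliated M x"
    using closed_operator_glue[OF central_glueD(3)[OF T(1)]] glue_affiliated[OF T(1)] T(2) by auto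
  have "\<exists>E. E \<in> sets \<mu> \<and> bound_proj x r = chi E" for r
    using center_proj_chi[OF bound_proj_center] by metis
  then obtain E where E: "\<And>r. E r \<in> sets \<mu>" "\<And>r. bound_proj x r = chi (E r)" by metis
  \<comment> \<open>Rational thresholds keep the infimum measurable and the exceptional null sets countable in number.\<close>
  define Q where "Q = {r \<in> \<rat>. (0::real) \<le> r}"
  have Q: "countable Q" unfolding Q_def using countable_rat by (rule countable_subset[rotated]) auto
  define k where "k \<omega> = (INF r\<in>Q. if \<omega> \<in> E r then ennreal r else \<infinity>)" for \<omega>
  have [measurable]: "E r \<in> sets \<mu>" for r by (rule E)
  have k[measurable]: "k \<in> borel_measurable \<mu>" unfolding k_def using Q by measurable
  have "AE \<omega> in \<mu>. \<exists>n. \<omega> \<in> E (real n)"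
    using resolvingD(2)[OF coherentD(1)[OF central_glueD(3)[OF T(1)]]] by (intro chi_exhausts E) (simp add: E(2))
  then have kfin: "AE \<omega> in \<mu>. k \<omega> < \<infinity>"
  proof eventually_elim
    case (elim \<omega>)
    then obtain n where "\<omega> \<in> E (real n)" by blast
    then have "k \<omega> \<le> ennreal (real n)" unfolding k_def by (intro INF_lower2[of "real n"]) (auto simp: Q_def)
    then show ?case by (simp add: le_less_trans)
  qed
  have "AE \<omega> in \<mu>. r \<le> s \<longrightarrow> \<omega> \<in> E r \<longrightarrow> \<omega> \<in> E s" for r s
    using bound_proj_mono[of r s x] by (cases "r \<le> s") (simp_all add: E chi_le_iff)
  then have mono: "AE \<omega> in \<mu>. \<forall>r\<in>Q. \<forall>s\<in>Q. r \<le> s \<longrightarrow> \<omega> \<in> E r \<longrightarrow> \<omega> \<in> E s"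
    by (simp add: AE_ball_countable[OF Q])
  define c where "c \<omega> = enn2real (k \<omega>)" for \<omega>
  have c1: "AE \<omega> in \<mu>. \<forall>q\<in>Q. c \<omega> < q \<longrightarrow> \<omega> \<in> E q"
    using kfin mono
  proof eventually_elim
    case (elim \<omega>)
    show ?case
    proof (intro ballI impI)
      fix q assume q: "q \<in> Q" "c \<omega> < q"
      then have "k \<omega> < ennreal q"
        using elim(1) by (simp add: c_def enn2real_less_iff)
      then obtain r where r: "r \<in> Q" "(if \<omega> \<in> E r then ennreal r else \<infinity>) < ennreal q"
        unfolding k_def INF_less_iff by blast
      then have "\<omega> \<in> E r" "r \<le> q" using q by (auto simp: Q_def ennreal_less_iff split: if_splits)
      then show "\<omega> \<in> E q" using elim(2) r(1) q(1) by blast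
    qed
  qed
  have c2: "c \<omega> \<le> q" if "q \<in> Q" "\<omega> \<in> E q" for \<omega> q
  proof -
    have "k \<omega> \<le> ennreal q" unfolding k_def using that by (intro INF_lower2[of q]) auto
    then show ?thesis using that(1) by (simp add: c_def Q_def enn2real_leI)
  qed
  show ?thesis
  proof (rule that)
    show "c \<in> borel_measurable \<mu>" unfolding c_def by measurable
    show "0 \<le> c \<omega>" for \<omega> by (simp add: c_def)
    fix B \<epsilon> assume B: "B \<in> sets \<mu>" and \<epsilon>: "(0::real) \<le> \<epsilon>"
    show "(AE \<omega> in \<mu>. \<omega> \<in> B \<longrightarrow> c \<omega> \<le> \<epsilon>) \<longleftrightarrow> bounded_on x (chi B) \<epsilon>"
    proof
      assume b: "bounded_on x (chi B) \<epsilon>"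
      have "AE \<omega> in \<mu>. \<epsilon> \<le> q \<longrightarrow> \<omega> \<in> B \<longrightarrow> \<omega> \<in> E q" for q
        using bound_proj_upper[OF chi_center_proj[OF B] bounded_on_mono[OF b, of q]] B
        by (cases "\<epsilon> \<le> q") (simp_all add: E chi_le_iff)
      then have "AE \<omega> in \<mu>. \<forall>q\<in>Q. \<epsilon> \<le> q \<longrightarrow> \<omega> \<in> B \<longrightarrow> \<omega> \<in> E q" by (simp add: AE_ball_countable[OF Q])
      then show "AE \<omega> in \<mu>. \<omega> \<in> B \<longrightarrow> c \<omega> \<le> \<epsilon>"
      proof eventually_elim
        case (elim \<omega>)
        show ?case
        proof (rule impI, rule ccontr)
          assume "\<omega> \<in> B" "\<not> c \<omega> \<le> \<epsilon>"
          then obtain q where "q \<in> \<rat>" "\<epsilon> < q" "q < c \<omega>" using Rats_dense_in_real[of \<epsilon> "c \<omega>"] by auto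
          then show False using elim c2[of q \<omega>] \<epsilon> \<open>\<omega> \<in> B\<close> by (auto simp: Q_def)
        qed
      qed
    next
      assume a: "AE \<omega> in \<mu>. \<omega> \<in> B \<longrightarrow> c \<omega> \<le> \<epsilon>"
      have q: "bounded_on x (chi B) q" if "q \<in> \<rat>" "\<epsilon> < q" for q
      proof -
        have "AE \<omega> in \<mu>. \<omega> \<in> B \<longrightarrow> \<omega> \<in> E q"
          using a c1 by eventually_elim (use that \<epsilon> in \<open>auto simp: Q_def\<close>)
        then have "proj_le (chi B) (bound_proj x q)" using B E by (simp add: chi_le_iff)
        then show ?thesis using bounded_on_le[OF bound_proj_bounded[OF cl af]] that \<epsilon> by simp
      qed
      show "bounded_on x (chi B) \<epsilon>"
        unfolding bounded_on_def
      proof (intro allI impI)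
        fix \<xi> assume \<xi>: "chi B \<xi> = \<xi>"
        obtain q0 where "q0 \<in> \<rat>" "\<epsilon> < q0" using Rats_dense_in_real[of \<epsilon> "\<epsilon> + 1"] by auto
        then obtain \<eta> where \<eta>: "(\<xi>, \<eta>) \<in> x" using q \<xi> unfolding bounded_on_def by blast
        have le: "norm \<eta> \<le> q * norm \<xi>" if "q \<in> \<rat>" "\<epsilon> < q" for q
          using bounded_on_norm[OF cl q[OF that] chi_proj[OF B], of \<xi> \<eta>] \<eta> \<xi> by simp
        have "norm \<eta> \<le> \<epsilon> * norm \<xi>"
        proof (rule ccontr)
          assume "\<not> norm \<eta> \<le> \<epsilon> * norm \<xi>"
          moreover have "0 < norm \<xi>"
            using calculation le[OF \<open>q0 \<in> \<rat>\<close> \<open>\<epsilon> < q0\<close>] by (cases "\<xi> = 0") auto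
          ultimately have "\<epsilon> < norm \<eta> / norm \<xi>" by (simp add: field_simps)
          then obtain q where "q \<in> \<rat>" "\<epsilon> < q" "q < norm \<eta> / norm \<xi>" using Rats_dense_in_real by blast
          then show False using le[of q] \<open>0 < norm \<xi>\<close> by (simp add: field_simps)
        qed
        then show "\<exists>\<eta>. (\<xi>, \<eta>) \<in> x \<and> norm \<eta> \<le> \<epsilon> * norm \<xi>" using \<eta> by blast
      qed
    qed
  qed
qed

lemma fun_op_piece:
  assumes f: "f \<in> borel_measurable \<mu>" and D: "coherent v D" "glue v D = fun_op f"
    and V: "V \<in> sets \<mu>" "v n = chi V" "proj_le (v n) (chi (level f n))"
  shows "D n = \<Phi> (\<lambda>\<omega>. f \<omega> * indicator V \<omega>)" "(\<lambda>\<omega>. f \<omega> * indicator V \<omega>) \<in> Linf \<mu>"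
proof -
  have [measurable]: "f \<in> borel_measurable \<mu>" by (rule f)
  have lev: "level f n \<in> sets \<mu>" by measurable
  have "AE \<omega> in \<mu>. \<omega> \<in> V \<longrightarrow> \<omega> \<in> level f n"
    using V(3) chi_le_iff[OF V(1) lev] by (simp add: V(2))
  then have "AE \<omega> in \<mu>. \<omega> \<in> V \<longrightarrow> cmod (f \<omega>) \<le> real n" by eventually_elim auto
  then show L: "(\<lambda>\<omega>. f \<omega> * indicator V \<omega>) \<in> Linf \<mu>" by (rule Linf_truncate[OF f V(1)])
  have cl: "closed_operator (fun_op f)" using closed_operator_glue[OF D(1)] D(2) by simp
  have sp: "strong_prod (fun_op f) (op_graph (chi V)) = op_graph (\<Phi> (\<lambda>\<omega>. f \<omega> * indicator V \<omega>))"
    using represents_fun_op[OF f] V(1) L unfolding represents_def chi_def by blast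
  show "D n = \<Phi> (\<lambda>\<omega>. f \<omega> * indicator V \<omega>)"
  proof (rule blinfun_eqI)
    fix \<xi>
    have "(chi V \<xi>, D n \<xi>) \<in> fun_op f" using glue_restrict[OF D(1), of n \<xi>] by (simp add: V(2) D(2))
    then show "D n \<xi> = \<Phi> (\<lambda>\<omega>. f \<omega> * indicator V \<omega>) \<xi>"
      by (rule closed_operatorD(4)[OF cl _ strong_prod_rightD[OF cl sp]])
  qed
qed

lemma chi_commute: "E \<in> sets \<mu> \<Longrightarrow> x \<in> M \<Longrightarrow> chi E (x \<xi>) = x (chi E \<xi>)"
  by (rule center_projD(6)[OF chi_center_proj])

text \<open>On the set where \<open>j t \<le> c < (j + 1) t\<close> the operator \<open>|x|\<close> is at most \<open>(j + 1) t \<le> c + t\<close>. Adding up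
  over \<open>j\<close> gives \<open>|x| \<le> c + t\<close> for every mesh \<open>t\<close>.\<close>

lemma modulus_le_bound_function:
  assumes x: "x \<in> central_extension M"
    and c: "c \<in> borel_measurable \<mu>" "\<And>\<omega>. 0 \<le> c \<omega>"
    and bd: "\<And>B \<epsilon>. B \<in> sets \<mu> \<Longrightarrow> 0 \<le> \<epsilon> \<Longrightarrow> AE \<omega> in \<mu>. \<omega> \<in> B \<longrightarrow> c \<omega> \<le> \<epsilon> \<Longrightarrow> bounded_on x (chi B) \<epsilon>"
  shows "op_le (modulus x) (fun_op (\<lambda>\<omega>. complex_of_real (c \<omega>)))"
proof -
  let ?f = "\<lambda>\<omega>. complex_of_real (c \<omega>)"
  have [measurable]: "c \<in> borel_measurable \<mu>" by (rule c)
  have f: "?f \<in> borel_measurable \<mu>" by measurable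
  obtain z T where zT: "central_glue M z T" "x = glue z T" using x central_extension_iff by blast
  obtain u S D where S: "central_glue M u S" "glue u S = x"
    and D: "central_glue (center M) u D" "glue u D = fun_op ?f" "\<And>n. proj_le (u n) (chi (level ?f n))"
    by (rule central_glue_common[OF zT(1) disjI1[OF refl] central_glue_fun_op[OF f] disjI2[OF refl],
          folded fun_op_def zT(2)]) (rule that)
  note coS = central_glueD(3)[OF S(1)] and coD = central_glueD(3)[OF D(1)] and uc = central_glueD(1)[OF S(1)]
    and SM = central_glueD(2)[OF S(1)]
  have clx: "closed_operator x" using closed_operator_glue[OF coS] S(2) by simp
  have m: "modulus x = glue u (\<lambda>n. op_abs (S n))" using modulus_glue[OF coS] S(2) by simp
  have "pos_op (D n - op_abs (S n))" for n
  proof -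
    obtain V where V: "V \<in> sets \<mu>" "u n = chi V" using center_proj_chi[OF uc] by blast
    note Dn = fun_op_piece[OF f coD D(2) V D(3)]
    let ?A = "op_abs (S n)"
    have Apos: "pos_op ?A" by (rule pos_op_abs[OF bdd[OF SM]])
    have Dpos: "pos_op (D n)" unfolding Dn(1) by (rule Phi_pos[OF Dn(2)]) (auto intro!: AE_I2 simp: c(2) split: split_indicator)
    have AM: "?A \<in> M" by (rule abs_mem[OF SM])
    have DM: "D n \<in> M" using central_glueD(2)[OF D(1)] centerD(1) by blast
    have uV: "chi V (op_abs (S n) \<xi>) = op_abs (S n) \<xi>" "chi V (D n \<xi>) = D n \<xi>"
      "D n (chi V \<xi>) = D n \<xi>" "op_abs (S n) (chi V \<xi>) = op_abs (S n) \<xi>" for \<xi>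
      using coherentD(5,6)[OF coherent_abs[OF coS], of n] coherentD(5,6)[OF coD, of n] V(2) by simp_all
    have key: "0 \<le> Re (cinner (D n \<xi>) \<xi>) - Re (cinner (?A \<xi>) \<xi>) + t * (norm \<xi>)\<^sup>2"
      if t: "t = 1 / real (Suc k)" for \<xi> t k
    proof -
      define P where "P = D n - ?A + t *\<^sub>R id_blinfun"
      have PM: "P \<in> M" unfolding P_def by (intro alg DM AM)
      have P: "cinner (P \<zeta>) \<zeta> = cinner (D n \<zeta>) \<zeta> - cinner (?A \<zeta>) \<zeta> + complex_of_real t * cinner \<zeta> \<zeta>" for \<zeta>
        by (simp add: P_def blinfun_simps cinner_simps)
      have t0: "0 < t" by (simp add: t)
      define G where "G j = {\<omega> \<in> space \<mu>. real j * t \<le> c \<omega> \<and> c \<omega> < real (Suc j) * t} \<inter> V" for j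
      define H where "H j = {\<omega> \<in> space \<mu>. c \<omega> < real j * t} \<inter> V" for j
      have G: "G j \<in> sets \<mu>" and H: "H j \<in> sets \<mu>" for j unfolding G_def H_def using V(1) by measurable
      have stepG: "0 \<le> Re (cinner (P (chi (G j) \<xi>)) (chi (G j) \<xi>))" for j
      proof -
        let ?\<zeta> = "chi (G j) \<xi>"
        define s where "s = real j * t"
        note pG = chi_proj[OF G[of j]]
        have LG: "(\<lambda>\<omega>. ?f \<omega> * indicator V \<omega> * indicator (G j) \<omega> - complex_of_real s * indicator (G j) \<omega>) \<in> Linf \<mu>"
          by (intro Linf_diff Linf_mult Dn(2) Linf_const) (use G in auto)
        have "pos_op (\<Phi> (\<lambda>\<omega>. ?f \<omega> * indicator V \<omega> * indicator (G j) \<omega> - complex_of_real s * indicator (G j) \<omega>))"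
          by (rule Phi_pos[OF LG]) (auto intro!: AE_I2 simp: s_def G_def split: split_indicator)
        also have "\<Phi> (\<lambda>\<omega>. ?f \<omega> * indicator V \<omega> * indicator (G j) \<omega> - complex_of_real s * indicator (G j) \<omega>)
          = (D n o\<^sub>L chi (G j)) - s *\<^sub>R chi (G j)"
          using G Dn(2) by (simp add: Phi_diff Phi_mult[OF Dn(2)] Phi_scaleR Linf_mult Dn(1) chi_def)
        finally have "0 \<le> Re (cinner (D n ?\<zeta> - s *\<^sub>R ?\<zeta>) \<xi>)"
          by (drule_tac pos_op_Re[of _ \<xi>]) (simp add: blinfun_simps)
        also have "cinner (D n ?\<zeta> - s *\<^sub>R ?\<zeta>) \<xi> = cinner (D n ?\<zeta> - s *\<^sub>R ?\<zeta>) ?\<zeta>"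
          unfolding is_projD(3)[OF pG, symmetric] using chi_commute[OF G DM]
          by (simp add: blinfun_simps is_projD(2)[OF pG])
        finally have 1: "s * (norm ?\<zeta>)\<^sup>2 \<le> Re (cinner (D n ?\<zeta>) ?\<zeta>)"
          by (simp add: cinner_simps cinner_norm)
        have "AE \<omega> in \<mu>. \<omega> \<in> G j \<longrightarrow> c \<omega> \<le> real (Suc j) * t" by (auto intro!: AE_I2 simp: G_def)
        then have b: "bounded_on x (chi (G j)) (real (Suc j) * t)" using t0 by (intro bd G) auto
        have "chi V (chi (G j) \<xi>) = chi (G j) \<xi>"
        proof -
          have "V \<inter> G j = G j" by (auto simp: G_def)
          then show ?thesis using chi_Int[OF V(1) G[of j]] by (metis blinfun_apply_blinfun_compose)
        qed
        then have "(?\<zeta>, S n ?\<zeta>) \<in> x" using glue_restrict[OF coS, of n ?\<zeta>] S(2) V(2) by simp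
        then have "norm (S n ?\<zeta>) \<le> real (Suc j) * t * norm ?\<zeta>" by (rule bounded_on_norm[OF clx b pG])
        then have "norm (?A ?\<zeta>) * norm ?\<zeta> \<le> real (Suc j) * t * norm ?\<zeta> * norm ?\<zeta>"
          by (intro mult_right_mono) (simp_all add: norm_op_abs[OF bdd[OF SM]])
        then have "Re (cinner (?A ?\<zeta>) ?\<zeta>) \<le> real (Suc j) * t * (norm ?\<zeta>)\<^sup>2"
          using Re_cinner_le[of "?A ?\<zeta>" ?\<zeta>] by (simp add: power2_eq_square mult.assoc)
        then show ?thesis using 1 by (simp add: P Re_cinner_self s_def algebra_simps)
      qed
      have "0 \<le> Re (cinner (P (chi (H j) \<xi>)) (chi (H j) \<xi>))" for j
      proof (induction j)
        case 0
        have "H 0 = {}" using c(2)[THEN leD] by (auto simp: H_def)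
        then show ?case by simp
      next
        case (Suc j)
        have un: "H (Suc j) = H j \<union> G j" and dj: "H j \<inter> G j = {}"
          using t0 by (auto simp: H_def G_def not_less) (smt (verit) mult_right_mono of_nat_Suc)
        have "chi (H (Suc j)) = chi (H j) + chi (G j)" unfolding un by (rule chi_Un[OF H G dj])
        then have s: "chi (H (Suc j)) \<xi> = chi (H j) \<xi> + chi (G j) \<xi>" by (simp add: blinfun_simps)
        have z: "chi (G j) (chi (H j) \<xi>) = 0" "chi (H j) (chi (G j) \<xi>) = 0"
          using chi_Int[OF H[of j] G[of j]] chi_Int[OF G[of j] H[of j]] dj
          by (metis Int_commute blinfun.zero_left blinfun_apply_blinfun_compose chi_empty)+
        have "cinner (P (chi (H j) \<xi>)) (chi (G j) \<xi>) = cinner (P (chi (G j) (chi (H j) \<xi>))) \<xi>"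
          "cinner (P (chi (G j) \<xi>)) (chi (H j) \<xi>) = cinner (P (chi (H j) (chi (G j) \<xi>))) \<xi>"
          using is_projD(3)[OF chi_proj[OF G[of j]], of "P (chi (H j) \<xi>)" \<xi>]
            is_projD(3)[OF chi_proj[OF H[of j]], of "P (chi (G j) \<xi>)" \<xi>]
            chi_commute[OF G PM, of j "chi (H j) \<xi>"] chi_commute[OF H PM, of j "chi (G j) \<xi>"] by simp_all
        then show ?case using Suc stepG[of j] by (simp add: s blinfun.add_right cinner_simps z)
      qed
      moreover have "chi (H (Suc k * Suc n)) = chi V"
      proof (rule chi_cong[OF H V(1)])
        have lev: "level ?f n \<in> sets \<mu>" by measurable
        have "AE \<omega> in \<mu>. \<omega> \<in> V \<longrightarrow> \<omega> \<in> level ?f n" using D(3)[of n] chi_le_iff[OF V(1) lev] by (simp add: V(2))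
        then show "AE \<omega> in \<mu>. \<omega> \<in> H (Suc k * Suc n) \<longleftrightarrow> \<omega> \<in> V"
        proof eventually_elim
          case (elim \<omega>)
          have "real (Suc k * Suc n) * t = real (Suc n)" unfolding t of_nat_mult by simp
          then show ?case using elim c(2)[of \<omega>] by (auto simp: H_def simp del: of_nat_mult of_nat_Suc)
        qed
      qed
      ultimately have "0 \<le> Re (cinner (P (chi V \<xi>)) (chi V \<xi>))" by metis
      also have "\<dots> = Re (cinner (D n \<xi>) \<xi>) - Re (cinner (?A \<xi>) \<xi>) + t * (norm (chi V \<xi>))\<^sup>2"
        using is_projD(3)[OF chi_proj[OF V(1)], of "D n \<xi>" \<xi>] is_projD(3)[OF chi_proj[OF V(1)], of "?A \<xi>" \<xi>]
        by (simp add: P uV Re_cinner_self)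
      also have "\<dots> \<le> Re (cinner (D n \<xi>) \<xi>) - Re (cinner (?A \<xi>) \<xi>) + t * (norm \<xi>)\<^sup>2"
        using t0 by (intro add_left_mono mult_left_mono power_mono proj_norm_le chi_proj V) auto
      finally show ?thesis .
    qed
    have form: "0 \<le> Re (cinner (D n \<xi>) \<xi>) - Re (cinner (?A \<xi>) \<xi>)" for \<xi>
    proof (rule LIMSEQ_le_const)
      have "(\<lambda>k. Re (cinner (D n \<xi>) \<xi>) - Re (cinner (?A \<xi>) \<xi>) + inverse (real (Suc k)) * (norm \<xi>)\<^sup>2)
        \<longlonglongrightarrow> Re (cinner (D n \<xi>) \<xi>) - Re (cinner (?A \<xi>) \<xi>) + 0 * (norm \<xi>)\<^sup>2"
        by (intro tendsto_intros LIMSEQ_inverse_real_of_nat)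
      then show "(\<lambda>k. Re (cinner (D n \<xi>) \<xi>) - Re (cinner (?A \<xi>) \<xi>) + inverse (real (Suc k)) * (norm \<xi>)\<^sup>2)
        \<longlonglongrightarrow> Re (cinner (D n \<xi>) \<xi>) - Re (cinner (?A \<xi>) \<xi>)" by simp
      show "\<exists>N. \<forall>k\<ge>N. 0 \<le> Re (cinner (D n \<xi>) \<xi>) - Re (cinner (?A \<xi>) \<xi>) + inverse (real (Suc k)) * (norm \<xi>)\<^sup>2"
        using key[OF refl, of \<xi>] by (simp add: inverse_eq_divide)
    qed
    show ?thesis
      using form by (intro pos_opI) (simp_all add: bounded_ops_diff pos_op_bounded Apos Dpos blinfun_simps
          cinner_simps pos_op_hermitian[OF Apos] pos_op_hermitian[OF Dpos])
  qed
  then show ?thesis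
    unfolding m D(2)[symmetric] by (subst op_le_glue_iff[OF coherent_abs[OF coS] coD]) blast
qed

text \<open>Where \<open>g < q\<close>, also \<open>|x| \<le> q\<close>, so \<open>x\<close> is bounded by \<open>q\<close> there, and \<open>bd\<close> gives \<open>c \<le> q\<close>. Letting \<open>q\<close> run through the
  rationals yields \<open>c \<le> g\<close>. The bounded pieces of \<open>g\<close> are represented by the functions \<open>\<phi>\<close> below.\<close>

lemma bound_function_least:
  assumes x: "x \<in> central_extension M"
    and c: "c \<in> borel_measurable \<mu>" "\<And>\<omega>. 0 \<le> c \<omega>"
    and bd: "\<And>B \<epsilon>. B \<in> sets \<mu> \<Longrightarrow> 0 \<le> \<epsilon> \<Longrightarrow> bounded_on x (chi B) \<epsilon> \<Longrightarrow> AE \<omega> in \<mu>. \<omega> \<in> B \<longrightarrow> c \<omega> \<le> \<epsilon>"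
    and g: "g \<in> measurable_ops (center M)" "op_le (modulus x) g"
  shows "op_le (fun_op (\<lambda>\<omega>. complex_of_real (c \<omega>))) g"
proof -
  let ?f = "\<lambda>\<omega>. complex_of_real (c \<omega>)"
  have [measurable]: "c \<in> borel_measurable \<mu>" by (rule c)
  have f: "?f \<in> borel_measurable \<mu>" by measurable
  obtain z T where zT: "central_glue M z T" "x = glue z T" using x central_extension_iff by blast
  obtain w R where wR: "central_glue (center M) w R" "g = glue w R" using g(1) center_measurable_iff by blast
  obtain u S F where S: "central_glue M u S" "glue u S = x" and F: "central_glue (center M) u F" "glue u F = g"
    by (rule central_glue_common[OF zT(1) disjI1[OF refl] wR(1) disjI2[OF refl], folded zT(2) wR(2)]) (rule that)
  obtain v F' D where F': "central_glue (center M) v F'" "glue v F' = g"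
    and D: "central_glue (center M) v D" "glue v D = fun_op ?f"
    and le: "\<And>n. proj_le (v n) (u n)" "\<And>n. proj_le (v n) (chi (level ?f n))"
    by (rule central_glue_common[OF F(1) disjI2[OF refl] central_glue_fun_op[OF f] disjI2[OF refl],
          folded fun_op_def, unfolded F(2)]) (rule that)
  note coS = central_glueD(3)[OF S(1)] and coF = central_glueD(3)[OF F(1)] and coF' = central_glueD(3)[OF F'(1)]
    and coD = central_glueD(3)[OF D(1)] and vc = central_glueD(1)[OF F'(1)] and SM = central_glueD(2)[OF S(1)]
  have clg: "closed_operator g" using closed_operator_glue[OF coF] F(2) by simp
  have m: "modulus x = glue u (\<lambda>n. op_abs (S n))" using modulus_glue[OF coS] S(2) by simp
  have FS: "pos_op (F n - op_abs (S n))" for n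
    using g(2) unfolding m F(2)[symmetric] by (subst (asm) op_le_glue_iff[OF coherent_abs[OF coS] coF]) blast
  have "pos_op (F' n - D n)" for n
  proof -
    obtain V where V: "V \<in> sets \<mu>" "v n = chi V" using center_proj_chi[OF vc] by blast
    note Dn = fun_op_piece[OF f coD D(2) V le(2)]
    let ?A = "op_abs (S n)"
    have Apos: "pos_op ?A" by (rule pos_op_abs[OF bdd[OF SM]])
    have Fpos: "pos_op (F n)" using pos_op_add[OF FS[of n] Apos] by simp
    obtain \<phi>0 where \<phi>0: "\<phi>0 \<in> Linf \<mu>" "F' n = \<Phi> \<phi>0" using Phi_surj central_glueD(2)[OF F'(1)] by blast
    define \<phi> where "\<phi> \<omega> = \<phi>0 \<omega> * indicator V \<omega>" for \<omega>
    have \<phi>: "\<phi> \<in> Linf \<mu>" unfolding \<phi>_def by (intro Linf_mult \<phi>0) (use V in auto)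
    have [measurable]: "\<phi> \<in> borel_measurable \<mu>" by (rule LinfD(1)[OF \<phi>])
    have F'\<phi>: "F' n = \<Phi> \<phi>"
    proof -
      have "\<Phi> \<phi> = F' n o\<^sub>L chi V" unfolding \<phi>_def chi_def \<phi>0(2) by (rule Phi_mult) (use \<phi>0 V in auto)
      then show ?thesis using coherentD(5)[OF coF', of n] V(2) by (intro blinfun_eqI) simp
    qed
    have uv: "u n (v n \<xi>) = v n \<xi>" for \<xi> using le(1)[of n] by (simp add: proj_le_iff)
    have FF: "F' n \<xi> = F n (v n \<xi>)" for \<xi>
    proof (rule closed_operatorD(4)[OF clg])
      show "(v n \<xi>, F' n \<xi>) \<in> g" using glue_restrict[OF coF', of n \<xi>] F'(2) by simp
      show "(v n \<xi>, F n (v n \<xi>)) \<in> g" using glue_restrict[OF coF, of n "v n \<xi>"] F(2) by (simp add: uv)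
    qed
    have form: "cinner (F' n \<xi>) \<xi> = cinner (F n (v n \<xi>)) (v n \<xi>)" for \<xi>
      using is_projD(3)[OF center_projD(1)[OF vc], of n "F' n \<xi>" \<xi>] coherentD(6)[OF coF', of n \<xi>] by (simp add: FF)
    have "pos_op (F' n)"
      using Fpos bdd[OF centerD(1)[OF central_glueD(2)[OF F'(1)]]] unfolding pos_op_def form by blast
    then have \<phi>pos: "AE \<omega> in \<mu>. Im (\<phi> \<omega>) = 0 \<and> 0 \<le> Re (\<phi> \<omega>)" unfolding F'\<phi> by (simp add: Phi_pos_iff[OF \<phi>])
    have cq: "AE \<omega> in \<mu>. \<omega> \<in> V \<and> Re (\<phi> \<omega>) < q \<longrightarrow> c \<omega> \<le> q" if q: "0 \<le> q" for q
    proof -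
      define W where "W = {\<omega> \<in> space \<mu>. Re (\<phi> \<omega>) < q} \<inter> V"
      have W: "W \<in> sets \<mu>" unfolding W_def using V(1) by measurable
      note pW = chi_proj[OF W]
      have "V \<inter> W = W" by (auto simp: W_def)
      then have VW: "chi V (chi W \<xi>) = chi W \<xi>" for \<xi>
        using chi_Int[OF V(1) W] by (metis blinfun_apply_blinfun_compose)
      have AW: "chi W (?A \<xi>) = ?A (chi W \<xi>)" for \<xi> by (rule chi_commute[OF W abs_mem[OF SM]])
      have Bpos: "pos_op (?A o\<^sub>L chi W)"
        by (intro pos_op_compose_commuting Apos is_projD(5) pW blinfun_eqI) (simp add: AW)
      have L: "(\<lambda>\<omega>. complex_of_real q * indicator W \<omega> - \<phi> \<omega> * indicator W \<omega>) \<in> Linf \<mu>"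
        by (intro Linf_diff Linf_mult \<phi> Linf_const) (use W in auto)
      have "pos_op (\<Phi> (\<lambda>\<omega>. complex_of_real q * indicator W \<omega> - \<phi> \<omega> * indicator W \<omega>))"
        by (rule Phi_pos[OF L]) (use \<phi>pos in \<open>eventually_elim, auto simp: W_def split: split_indicator\<close>)
      also have "\<Phi> (\<lambda>\<omega>. complex_of_real q * indicator W \<omega> - \<phi> \<omega> * indicator W \<omega>) = q *\<^sub>R chi W - (F' n o\<^sub>L chi W)"
        using W \<phi> by (simp add: Phi_diff Phi_mult[OF \<phi>] Phi_scaleR Linf_mult F'\<phi> chi_def)
      finally have Q: "pos_op (q *\<^sub>R chi W - (F' n o\<^sub>L chi W))" .
      have Ble: "Re (cinner ((?A o\<^sub>L chi W) \<xi>) \<xi>) \<le> q * (norm \<xi>)\<^sup>2" for \<xi>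
      proof -
        let ?\<zeta> = "chi W \<xi>"
        have "cinner ((?A o\<^sub>L chi W) \<xi>) \<xi> = cinner (?A ?\<zeta>) ?\<zeta>"
          using is_projD(3)[OF pW, of "?A ?\<zeta>" \<xi>] by (simp add: AW is_projD(2)[OF pW])
        moreover have "Re (cinner (?A ?\<zeta>) ?\<zeta>) \<le> Re (cinner (F n ?\<zeta>) ?\<zeta>)"
          using pos_op_Re[OF FS[of n], of ?\<zeta>] by (simp add: blinfun_simps cinner_simps)
        moreover have "cinner (F n ?\<zeta>) ?\<zeta> = cinner (F' n ?\<zeta>) ?\<zeta>" by (simp add: form V(2) VW)
        moreover have "0 \<le> Re (cinner (q *\<^sub>R ?\<zeta> - F' n ?\<zeta>) ?\<zeta>)"
          using pos_op_Re[OF Q, of ?\<zeta>] by (simp add: blinfun_simps is_projD(2)[OF pW])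
        then have "Re (cinner (F' n ?\<zeta>) ?\<zeta>) \<le> q * (norm ?\<zeta>)\<^sup>2" by (simp add: cinner_simps cinner_norm)
        moreover have "q * (norm ?\<zeta>)\<^sup>2 \<le> q * (norm \<xi>)\<^sup>2"
          using q by (intro mult_left_mono power_mono proj_norm_le pW) auto
        ultimately show ?thesis by simp
      qed
      have "bounded_on x (chi W) q"
      proof (rule bounded_onI[of _ "S n o\<^sub>L chi W"])
        show "is_proj (chi W)" by (rule pW)
        fix \<xi>
        have "u n (chi W \<xi>) = chi W \<xi>" using uv[of "chi W \<xi>"] by (simp add: V(2) VW)
        then show "(chi W \<xi>, (S n o\<^sub>L chi W) \<xi>) \<in> x" using glue_restrict[OF coS, of n "chi W \<xi>"] S(2) by simp
        have "norm ((?A o\<^sub>L chi W) \<xi>) \<le> q * norm \<xi>" by (rule norm_le_if_pos_le[OF Bpos q Ble])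
        then show "norm ((S n o\<^sub>L chi W) \<xi>) \<le> q * norm \<xi>" by (simp add: norm_op_abs[OF bdd[OF SM]])
      qed
      then have "AE \<omega> in \<mu>. \<omega> \<in> W \<longrightarrow> c \<omega> \<le> q" by (rule bd[OF W q])
      then show ?thesis using AE_space by eventually_elim (auto simp: W_def)
    qed
    define Q where "Q = {r \<in> \<rat>. (0::real) \<le> r}"
    have Q: "countable Q" unfolding Q_def using countable_rat by (rule countable_subset[rotated]) auto
    have "AE \<omega> in \<mu>. \<forall>q\<in>Q. \<omega> \<in> V \<and> Re (\<phi> \<omega>) < q \<longrightarrow> c \<omega> \<le> q"
      using cq by (subst AE_ball_countable[OF Q]) (auto simp: Q_def)
    then have c\<phi>: "AE \<omega> in \<mu>. \<omega> \<in> V \<longrightarrow> c \<omega> \<le> Re (\<phi> \<omega>)"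
      using \<phi>pos
    proof eventually_elim
      case (elim \<omega>)
      show ?case
      proof (rule impI, rule ccontr)
        assume "\<omega> \<in> V" "\<not> c \<omega> \<le> Re (\<phi> \<omega>)"
        then obtain q where "q \<in> \<rat>" "Re (\<phi> \<omega>) < q" "q < c \<omega>" using Rats_dense_in_real[of "Re (\<phi> \<omega>)" "c \<omega>"] by auto
        then show False using elim \<open>\<omega> \<in> V\<close> by (auto simp: Q_def)
      qed
    qed
    have "pos_op (\<Phi> (\<lambda>\<omega>. \<phi> \<omega> - ?f \<omega> * indicator V \<omega>))"
    proof (rule Phi_pos[OF Linf_diff[OF \<phi> Dn(2)]])
      show "AE \<omega> in \<mu>. Im (\<phi> \<omega> - ?f \<omega> * indicator V \<omega>) = 0 \<and> 0 \<le> Re (\<phi> \<omega> - ?f \<omega> * indicator V \<omega>)"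
        using \<phi>pos c\<phi> by eventually_elim (auto simp: \<phi>_def split: split_indicator split_indicator_asm)
    qed
    then show ?thesis by (simp add: Phi_diff[OF \<phi> Dn(2)] F'\<phi> Dn(1))
  qed
  then show ?thesis
    unfolding D(2)[symmetric] F'(2)[symmetric] by (subst op_le_glue_iff[OF coD coF']) blast
qed

lemma op_le_antisym:
  assumes "f \<in> measurable_ops (center M)" "g \<in> measurable_ops (center M)" "op_le f g" "op_le g f"
  shows "f = g"
proof -
  obtain z S w T where "central_glue (center M) z S" "f = glue z S" "central_glue (center M) w T" "g = glue w T"
    using assms(1,2) center_measurable_iff by metis
  then obtain u S' T' where u: "central_glue (center M) u S'" "f = glue u S'" "central_glue (center M) u T'" "g = glue u T'"
    using central_glue_common[of "center M" z S "center M" w T] by metis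
  note S = central_glueD(3)[OF u(1)] and T = central_glueD(3)[OF u(3)]
  have pos: "pos_op (T' n - S' n)" "pos_op (S' n - T' n)" for n
    using assms(3,4) unfolding u by (simp_all add: op_le_glue_iff[OF S T] op_le_glue_iff[OF T S])
  have "T' n \<xi> - S' n \<xi> = 0" for n \<xi>
  proof -
    have "Re (cinner ((T' n - S' n) \<xi>) \<xi>) = 0"
      using pos_op_Re[OF pos(1), of n \<xi>] pos_op_Re[OF pos(2), of n \<xi>] by (simp add: blinfun_simps cinner_simps)
    then show ?thesis using pos_op_null[OF pos(1)] by (simp add: blinfun_simps)
  qed
  then have "S' = T'" by (intro ext blinfun_eqI) simp
  then show ?thesis using u by simp
qed

text \<open>The function of the preceding lemmas is a lower bound of the upper bounds of \<open>|x|\<close> and is itself one of them,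
  hence the infimum in the definition of the center-valued norm.\<close>

theorem center_norm_function:
  assumes x: "x \<in> central_extension M"
  obtains c :: "'b \<Rightarrow> real" where "c \<in> borel_measurable \<mu>" "\<And>\<omega>. 0 \<le> c \<omega>"
    "represents M \<mu> \<Phi> (\<lambda>\<omega>. complex_of_real (c \<omega>)) (center_norm M x)"
    "\<And>B \<epsilon>. B \<in> sets \<mu> \<Longrightarrow> 0 \<le> \<epsilon> \<Longrightarrow> (AE \<omega> in \<mu>. \<omega> \<in> B \<longrightarrow> c \<omega> \<le> \<epsilon>) \<longleftrightarrow> bounded_on x (chi B) \<epsilon>"
proof -
  obtain c :: "'b \<Rightarrow> real" where c: "c \<in> borel_measurable \<mu>" "\<And>\<omega>. 0 \<le> c \<omega>"
    "\<And>B \<epsilon>. B \<in> sets \<mu> \<Longrightarrow> 0 \<le> \<epsilon> \<Longrightarrow> (AE \<omega> in \<mu>. \<omega> \<in> B \<longrightarrow> c \<omega> \<le> \<epsilon>) \<longleftrightarrow> bounded_on x (chi B) \<epsilon>"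
    by (rule bound_function[OF x]) (rule that)
  let ?f = "\<lambda>\<omega>. complex_of_real (c \<omega>)"
  have f: "?f \<in> borel_measurable \<mu>" using c(1) by measurable
  have C: "fun_op ?f \<in> measurable_ops (center M)" by (rule fun_op_measurable[OF f])
  have 1: "op_le (modulus x) (fun_op ?f)" by (rule modulus_le_bound_function[OF x c(1,2)]) (simp add: c(3))
  have 2: "op_le (fun_op ?f) g" if "g \<in> measurable_ops (center M)" "op_le (modulus x) g" for g
    by (rule bound_function_least[OF x c(1,2) _ that]) (simp add: c(3))
  have "center_norm M x = fun_op ?f"
    unfolding center_norm_def Let_def
  proof (rule the_equality)
    fix C' assume "C' \<in> measurable_ops (center M) \<and> (\<forall>f\<in>{f \<in> measurable_ops (center M). op_le (modulus x) f}. op_le C' f) \<and>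
      (\<forall>g\<in>measurable_ops (center M). (\<forall>f\<in>{f \<in> measurable_ops (center M). op_le (modulus x) f}. op_le g f) \<longrightarrow> op_le g C')"
    then show "C' = fun_op ?f" using C 1 2 by (intro op_le_antisym) auto
  qed (use C 1 2 in auto)
  then have "represents M \<mu> \<Phi> ?f (center_norm M x)" using represents_fun_op[OF f] by simp
  then show ?thesis by (rule that[OF c(1,2) _ c(3)])
qed

text \<open>With the center-valued norm as a function, being at most \<open>\<epsilon>\<close> on \<open>B\<close> and being bounded by \<open>\<epsilon>\<close> on \<open>\<chi>\<^sub>B\<close> are the
  same.\<close>

theorem O_nbhd_iff:
  assumes "0 \<le> \<epsilon>"
  shows "x \<in> O_nbhd M \<mu> \<Phi> A \<epsilon> \<delta> \<longleftrightarrow> x \<in> central_extension M \<and>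
    (\<exists>B\<in>sets \<mu>. B \<subseteq> A \<and> emeasure \<mu> (A - B) \<le> ennreal \<delta> \<and> bounded_on x (chi B) \<epsilon>)"
proof (cases "x \<in> central_extension M")
  case True
  obtain c :: "'b \<Rightarrow> real" where c: "c \<in> borel_measurable \<mu>" "\<And>\<omega>. 0 \<le> c \<omega>"
    "represents M \<mu> \<Phi> (\<lambda>\<omega>. complex_of_real (c \<omega>)) (center_norm M x)"
    "\<And>B \<epsilon>. B \<in> sets \<mu> \<Longrightarrow> 0 \<le> \<epsilon> \<Longrightarrow> (AE \<omega> in \<mu>. \<omega> \<in> B \<longrightarrow> c \<omega> \<le> \<epsilon>) \<longleftrightarrow> bounded_on x (chi B) \<epsilon>"
    by (rule center_norm_function[OF True]) (rule that)
  have "x \<in> O_nbhd M \<mu> \<Phi> A \<epsilon> \<delta> \<longleftrightarrow> (\<lambda>\<omega>. complex_of_real (c \<omega>)) \<in> W_nbhd \<mu> A \<epsilon> \<delta>"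
  proof
    assume "x \<in> O_nbhd M \<mu> \<Phi> A \<epsilon> \<delta>"
    then obtain f where f: "f \<in> W_nbhd \<mu> A \<epsilon> \<delta>" "represents M \<mu> \<Phi> f (center_norm M x)"
      unfolding O_nbhd_def by blast
    have "AE \<omega> in \<mu>. f \<omega> = complex_of_real (c \<omega>)" by (rule represents_unique[OF f(2) c(3)])
    then have "AE \<omega> in \<mu>. \<omega> \<in> B \<longrightarrow> cmod (complex_of_real (c \<omega>)) \<le> \<epsilon>" if "AE \<omega> in \<mu>. \<omega> \<in> B \<longrightarrow> cmod (f \<omega>) \<le> \<epsilon>" for B
      using that by eventually_elim auto
    moreover have "(\<lambda>\<omega>. complex_of_real (c \<omega>)) \<in> borel_measurable \<mu>" using c(1) by measurable
    ultimately show "(\<lambda>\<omega>. complex_of_real (c \<omega>)) \<in> W_nbhd \<mu> A \<epsilon> \<delta>"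
      using f(1) unfolding W_nbhd_iff[OF assms] by blast
  qed (use c(3) True in \<open>auto simp: O_nbhd_def\<close>)
  moreover have "(\<lambda>\<omega>. complex_of_real (c \<omega>)) \<in> borel_measurable \<mu>" using c(1) by measurable
  ultimately show ?thesis
    using True c(2) by (simp add: W_nbhd_iff[OF assms] c(4)[OF _ assms, symmetric] cong: bex_cong)
qed (simp add: O_nbhd_def)

end

section \<open>Central supports and abelian projections\<close>

lemma blinfun_ext_iff: "S = T \<longleftrightarrow> (\<forall>\<xi>. blinfun_apply S \<xi> = blinfun_apply T \<xi>)"
  using blinfun_eqI by blast

context von_neumann
begin

definition central_support :: "('a \<Rightarrow>\<^sub>L 'a) \<Rightarrow> 'a \<Rightarrow>\<^sub>L 'a" where
  "central_support e = proj_on (closed_hull {blinfun_apply x (e \<xi>) |x \<xi>. x \<in> M})"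

lemma central_support_center:
  assumes e: "e \<in> M" shows "central_support e \<in> projections (center M)"
  unfolding central_support_def
proof (rule center_proj_on)
  let ?X = "{blinfun_apply x (e \<xi>) |x \<xi>. x \<in> M}"
  fix y \<xi> assume \<xi>: "\<xi> \<in> closed_hull ?X"
  show "y \<xi> \<in> closed_hull ?X" if y: "y \<in> commutant M"
  proof (rule closed_hull_invariant[OF commutantD(1)[OF y] _ \<xi>])
    fix \<eta> assume "\<eta> \<in> ?X"
    then obtain x \<zeta> where "x \<in> M" "\<eta> = x (e \<zeta>)" by blast
    then have "y \<eta> = x (e (y \<zeta>))" using comm[OF y] e by simp
    then have "y \<eta> \<in> ?X" using \<open>x \<in> M\<close> by blast
    then show "y \<eta> \<in> closed_hull ?X" by (rule subsetD[OF closed_hull_superset])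
  qed
  show "y \<xi> \<in> closed_hull ?X" if y: "y \<in> M"
  proof (rule closed_hull_invariant[OF bdd[OF y] _ \<xi>])
    fix \<eta> assume "\<eta> \<in> ?X"
    then obtain x \<zeta> where "x \<in> M" "\<eta> = x (e \<zeta>)" by blast
    then have "y \<eta> = (y o\<^sub>L x) (e \<zeta>)" "y o\<^sub>L x \<in> M" using compose[OF y] by simp_all
    then have "y \<eta> \<in> ?X" by blast
    then show "y \<eta> \<in> closed_hull ?X" by (rule subsetD[OF closed_hull_superset])
  qed
qed simp_all

lemma central_support_upper: "proj_le e (central_support e)"
proof -
  have "e \<xi> \<in> closed_hull {blinfun_apply x (e \<xi>) |x \<xi>. x \<in> M}" for \<xi>
    by (rule subsetD[OF closed_hull_superset]) (use id in \<open>force intro: exI[of _ id_blinfun]\<close>)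
  then show ?thesis by (simp add: proj_le_iff central_support_def proj_on_fix_iff)
qed

text \<open>The vectors annihilated by \<open>q\<close> form a closed subspace.\<close>

lemma central_support_annihilate:
  fixes q e :: "'a \<Rightarrow>\<^sub>L 'a"
  assumes q: "q \<in> bounded_ops" "\<And>x \<xi>. x \<in> M \<Longrightarrow> q (x (e \<xi>)) = 0" shows "q (central_support e \<xi>) = 0"
proof -
  have "csubspace {\<zeta>. q \<zeta> = 0}" using q(1) by (simp add: csubspace_def blinfun_simps bounded_opsD)
  moreover have "closed {\<zeta>. q \<zeta> = 0}"
    by (intro closed_Collect_eq) (auto intro!: linear_continuous_on blinfun.bounded_linear_right)
  ultimately have "closed_hull {blinfun_apply x (e \<xi>) |x \<xi>. x \<in> M} \<subseteq> {\<zeta>. q \<zeta> = 0}"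
    by (rule closed_hull_least) (use q(2) in auto)
  moreover have "central_support e \<xi> \<in> closed_hull {blinfun_apply x (e \<xi>) |x \<xi>. x \<in> M}"
    unfolding central_support_def by (rule proj_on_in) simp_all
  ultimately show ?thesis by blast
qed

lemma abelian_projection_iff:
  "abelian_projection M e \<longleftrightarrow> e \<in> projections M \<and>
    (\<forall>x\<in>M. \<forall>y\<in>M. \<forall>\<xi>. e (x (e (e (y (e \<xi>))))) = e (y (e (e (x (e \<xi>))))))"
  unfolding abelian_projection_def blinfun_ext_iff by simp

text \<open>A projection below an abelian one is cut out by its central support, since the abelian
  corner has no off-diagonal part to connect it with its complement.\<close>

lemma abelian_subprojection:
  assumes e: "abelian_projection M e" and f: "f \<in> projections M" "proj_le f e"
  shows "f = central_support f o\<^sub>L e"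
proof -
  have eP: "e \<in> projections M" and ab: "\<And>x y \<xi>. x \<in> M \<Longrightarrow> y \<in> M \<Longrightarrow> e (x (e (e (y (e \<xi>))))) = e (y (e (e (x (e \<xi>)))))"
    using e unfolding abelian_projection_iff by blast+
  note pe = projectionsD(1)[OF eP] and pf = projectionsD(1)[OF f(1)] and fM = projectionsD(2)[OF f(1)]
  note cs = central_support_center[OF fM]
  have ef: "e (f \<xi>) = f \<xi>" "f (e \<xi>) = f \<xi>" for \<xi>
    using f(2) proj_le_absorb_right[OF pf pe f(2)] by (simp_all add: proj_le_iff)
  have "(e - f) (central_support f \<xi>) = 0" for \<xi>
  proof (rule central_support_annihilate)
    show "e - f \<in> bounded_ops" by (intro bounded_ops_diff is_projD pe pf)
    fix x \<xi> assume x: "x \<in> M"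
    have "e (x (f \<xi>)) = f (e (x (e \<xi>)))" for \<xi>
      using ab[OF x fM, of \<xi>] by (simp add: ef is_projD(2)[OF pe])
    then have "e (x (f \<xi>)) = f (x (f \<xi>))"
      using is_projD(2)[OF pf, of \<xi>] by (metis ef(1) ef(2))
    then show "(e - f) (x (f \<xi>)) = 0" by (simp add: blinfun_simps)
  qed
  then have "e (central_support f \<xi>) = f (central_support f \<xi>)" for \<xi> by (simp add: blinfun_simps)
  then have "central_support f (e \<xi>) = central_support f (f \<xi>)" for \<xi>
    using center_projD(6)[OF cs projectionsD(2)[OF eP]] center_projD(6)[OF cs fM] by simp
  then show ?thesis
    using central_support_upper[of f] by (intro blinfun_eqI) (simp add: proj_le_iff)
qed

text \<open>The definition of a type II summand speaks about the summand as an algebra of its own. The following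
  equivalences turn it into a statement about projections of the whole algebra below \<open>v\<close>.\<close>

context
  fixes v assumes v: "v \<in> projections (center M)"
begin

lemma direct_summand_iff: "x \<in> direct_summand M v \<longleftrightarrow> x \<in> M \<and> (\<forall>\<xi>. v (x \<xi>) = x \<xi>)"
proof
  assume "x \<in> direct_summand M v"
  then obtain y where "y \<in> M" "x = v o\<^sub>L y" by (auto simp: direct_summand_def)
  then show "x \<in> M \<and> (\<forall>\<xi>. v (x \<xi>) = x \<xi>)"
    using compose[OF center_projD(2)[OF v]] is_projD(2)[OF center_projD(1)[OF v]] by simp
next
  assume "x \<in> M \<and> (\<forall>\<xi>. v (x \<xi>) = x \<xi>)"
  moreover from this have "x = v o\<^sub>L x" by (intro blinfun_eqI) simp
  ultimately show "x \<in> direct_summand M v" unfolding direct_summand_def by blast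
qed

lemma summand_projections_iff: "p \<in> projections (direct_summand M v) \<longleftrightarrow> p \<in> projections M \<and> proj_le p v"
  by (auto simp: projections_def direct_summand_iff proj_le_iff)

lemma summand_abelian_iff: "abelian_projection (direct_summand M v) e \<longleftrightarrow> abelian_projection M e \<and> proj_le e v"
proof -
  have "e (v (x \<xi>)) = e (x \<xi>)" if "e \<in> projections M" "proj_le e v" for x \<xi>
    by (rule proj_le_absorb_right[OF projectionsD(1)[OF that(1)] center_projD(1)[OF v] that(2)])
  then have ev: "(e o\<^sub>L (v o\<^sub>L x)) o\<^sub>L e = (e o\<^sub>L x) o\<^sub>L e" if "e \<in> projections M" "proj_le e v" for x
    using that by (intro blinfun_eqI) simp
  show ?thesis
    unfolding abelian_projection_def summand_projections_iff
    by (auto simp: direct_summand_def ev)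
qed

lemma summand_finite_iff: "finite_projection (direct_summand M v) e \<longleftrightarrow> finite_projection M e \<and> proj_le e v"
proof -
  have equiv: "proj_equiv (direct_summand M v) e q \<longleftrightarrow> proj_equiv M e q" if e: "proj_le e v" for q
  proof
    assume "proj_equiv M e q"
    then obtain u where u: "u \<in> M" "adj u o\<^sub>L u = e" "u o\<^sub>L adj u = q" by (auto simp: proj_equiv_def)
    have "v (u \<xi>) = u \<xi>" for \<xi>
    proof -
      let ?w = "perp v"
      have wc: "?w \<in> projections (center M)" by (rule center_proj_perp[OF v])
      have "adj u (u (?w \<xi>)) = e (?w \<xi>)" using u(2) by (metis blinfun_apply_blinfun_compose)
      also have "e (?w \<xi>) = ?w (e \<xi>)"
        using center_projD(6)[OF wc, of e \<xi>] u compose adj by metis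
      also have "\<dots> = 0" using e by (simp add: blinfun_simps proj_le_iff)
      finally have "adj u (u (?w \<xi>)) = 0" .
      then have "cinner (u (?w \<xi>)) (u (?w \<xi>)) = 0" by (simp add: adj_cinner[OF bdd[OF u(1)]])
      then have "?w (u \<xi>) = 0" using center_projD(6)[OF wc u(1)] by simp
      then show ?thesis by (simp add: blinfun_simps)
    qed
    then show "proj_equiv (direct_summand M v) e q"
      unfolding proj_equiv_def using u direct_summand_iff by blast
  qed (auto simp: proj_equiv_def direct_summand_iff)
  show ?thesis
  proof (cases "proj_le e v")
    case True
    then have "proj_le q v" if "proj_le q e" for q using that proj_le_trans[of q e v] by simp
    then show ?thesis
      unfolding finite_projection_def Ball_def summand_projections_iff using True equiv[OF True] by auto
  qed (simp add: finite_projection_def summand_projections_iff)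
qed

lemma summand_center_iff:
  "z \<in> projections (center (direct_summand M v)) \<longleftrightarrow> z \<in> projections (center M) \<and> proj_le z v"
proof
  assume z: "z \<in> projections (center (direct_summand M v))"
  then have zs: "z \<in> projections (direct_summand M v)" and
    c: "\<And>y. y \<in> direct_summand M v \<Longrightarrow> z o\<^sub>L y = y o\<^sub>L z" by (auto simp: projections_def center_def)
  then have zM: "z \<in> projections M" and le: "proj_le z v" by (simp_all add: summand_projections_iff)
  have "z (x \<xi>) = x (z \<xi>)" if x: "x \<in> M" for x \<xi>
  proof -
    have "z o\<^sub>L (v o\<^sub>L x) = (v o\<^sub>L x) o\<^sub>L z" by (rule c) (use x in \<open>auto simp: direct_summand_def\<close>)
    then have "z (v (x \<xi>)) = v (x (z \<xi>))" by (metis blinfun_apply_blinfun_compose)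
    moreover have "z (v (x \<xi>)) = z (x \<xi>)"
      by (rule proj_le_absorb_right[OF projectionsD(1)[OF zM] center_projD(1)[OF v] le])
    moreover have "v (x (z \<xi>)) = x (z \<xi>)" using center_projD(6)[OF v x, of "z \<xi>"] le by (simp add: proj_le_iff)
    ultimately show ?thesis by simp
  qed
  then show "z \<in> projections (center M) \<and> proj_le z v"
    using zM le by (simp add: center_proj_iff projectionsD centerI)
next
  assume z: "z \<in> projections (center M) \<and> proj_le z v"
  then have "z o\<^sub>L y = y o\<^sub>L z" if "y \<in> direct_summand M v" for y
    using that center_projD(6) by (intro blinfun_eqI) (simp add: direct_summand_iff)
  then show "z \<in> projections (center (direct_summand M v))"
    using z center_projD(4) by (auto simp: projections_def center_def direct_summand_iff proj_le_iff)
qed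

end

end

section \<open>The dimension function\<close>

locale dimension_algebra = represented_center M \<mu> \<Phi>
  for M :: "('a::complex_hilbert_space \<Rightarrow>\<^sub>L 'a) set" and \<mu> :: "'b measure" and \<Phi> +
  fixes d :: "('a \<Rightarrow>\<^sub>L 'a) \<Rightarrow> 'b \<Rightarrow> ennreal"
  assumes dim: "dimension_function M \<mu> \<Phi> d"
begin

lemma d_measurable: "e \<in> projections M \<Longrightarrow> d e \<in> borel_measurable \<mu>"
  and d_finite: "e \<in> projections M \<Longrightarrow> (AE \<omega> in \<mu>. d e \<omega> < \<infinity>) \<longleftrightarrow> finite_projection M e"
  and d_add: "e \<in> projections M \<Longrightarrow> q \<in> projections M \<Longrightarrow> e o\<^sub>L q = 0 \<Longrightarrow> AE \<omega> in \<mu>. d (e + q) \<omega> = d e \<omega> + d q \<omega>"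
  and d_equiv: "u \<in> M \<Longrightarrow> u o\<^sub>L adj u o\<^sub>L u = u \<Longrightarrow> AE \<omega> in \<mu>. d (u o\<^sub>L adj u) \<omega> = d (adj u o\<^sub>L u) \<omega>"
  and d_chi: "E \<in> sets \<mu> \<Longrightarrow> e \<in> projections M \<Longrightarrow> AE \<omega> in \<mu>. d (chi E o\<^sub>L e) \<omega> = indicator E \<omega> * d e \<omega>"
  and d_eq_0D: "e \<in> projections M \<Longrightarrow> AE \<omega> in \<mu>. d e \<omega> = 0 \<Longrightarrow> e = 0"
proof -
  note d0 = dim[unfolded dimension_function_def, folded chi_def]
  note d1 = conjunct2[OF d0]
  note d2 = conjunct2[OF d1]
  note d3 = conjunct2[OF d2]
  note d4 = conjunct2[OF d3]
  note d5 = conjunct2[OF d4]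
  show "e \<in> projections M \<Longrightarrow> d e \<in> borel_measurable \<mu>" using conjunct1[OF d0] by blast
  show "e \<in> projections M \<Longrightarrow> (AE \<omega> in \<mu>. d e \<omega> < \<infinity>) \<longleftrightarrow> finite_projection M e" using conjunct1[OF d1] by blast
  show "e \<in> projections M \<Longrightarrow> q \<in> projections M \<Longrightarrow> e o\<^sub>L q = 0 \<Longrightarrow> AE \<omega> in \<mu>. d (e + q) \<omega> = d e \<omega> + d q \<omega>"
    using conjunct1[OF d2] by blast
  show "u \<in> M \<Longrightarrow> u o\<^sub>L adj u o\<^sub>L u = u \<Longrightarrow> AE \<omega> in \<mu>. d (u o\<^sub>L adj u) \<omega> = d (adj u o\<^sub>L u) \<omega>"
    using conjunct1[OF d3] by blast
  show "E \<in> sets \<mu> \<Longrightarrow> e \<in> projections M \<Longrightarrow> AE \<omega> in \<mu>. d (chi E o\<^sub>L e) \<omega> = indicator E \<omega> * d e \<omega>"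
    using conjunct1[OF d4] by blast
  show "e \<in> projections M \<Longrightarrow> AE \<omega> in \<mu>. d e \<omega> = 0 \<Longrightarrow> e = 0" using conjunct2[OF d5] by blast
qed

lemma d_sup:
  assumes "D \<subseteq> projections M" "D \<noteq> {}" "\<And>a b. a \<in> D \<Longrightarrow> b \<in> D \<Longrightarrow> \<exists>c\<in>D. proj_le a c \<and> proj_le b c"
    and "is_proj_sup M D e" "g \<in> borel_measurable \<mu>" "\<And>a. a \<in> D \<Longrightarrow> AE \<omega> in \<mu>. d a \<omega> \<le> g \<omega>"
  shows "AE \<omega> in \<mu>. d e \<omega> \<le> g \<omega>"
proof -
  note d5 = dim[unfolded dimension_function_def, THEN conjunct2, THEN conjunct2, THEN conjunct2,
      THEN conjunct2, THEN conjunct2, THEN conjunct1]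
  have "\<forall>a\<in>D. \<forall>b\<in>D. \<exists>c\<in>D. proj_le a c \<and> proj_le b c" using assms(3) by blast
  note d5[THEN spec, THEN spec, THEN mp, OF assms(1), THEN mp, OF assms(2), THEN mp, OF this, THEN mp, OF assms(4),
      THEN conjunct2, THEN bspec, OF assms(5), THEN mp]
  then show ?thesis using assms(6) by simp
qed

lemma center_proj_cut:
  assumes "z \<in> projections (center M)" "e \<in> projections M" shows "z o\<^sub>L e \<in> projections M" "proj_le (z o\<^sub>L e) e"
proof -
  have c: "z (e \<xi>) = e (z \<xi>)" for \<xi> using center_projD(6)[OF assms(1)] projectionsD(2)[OF assms(2)] by blast
  have "is_proj (z o\<^sub>L e)"
    by (intro proj_comm_compose center_projD(1)[OF assms(1)] projectionsD(1)[OF assms(2)] blinfun_eqI) (simp add: c)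
  then show "z o\<^sub>L e \<in> projections M"
    using compose center_projD(2)[OF assms(1)] projectionsD(2)[OF assms(2)] projectionsI by blast
  show "proj_le (z o\<^sub>L e) e" by (simp add: proj_le_iff c is_projD(2)[OF projectionsD(1)[OF assms(2)]])
qed

lemma d_zero: "AE \<omega> in \<mu>. d 0 \<omega> = 0"
  using d_chi[of "{}" 0] by (simp add: projectionsI)

lemma d_mono:
  assumes "p \<in> projections M" "q \<in> projections M" "proj_le p q" shows "AE \<omega> in \<mu>. d p \<omega> \<le> d q \<omega>"
proof -
  note pp = projectionsD(1)[OF assms(1)] and pq = projectionsD(1)[OF assms(2)]
  have qp: "q - p \<in> projections M"
    by (intro projectionsI is_proj_diff[OF pp pq assms(3)] diff projectionsD(2)[OF assms(1)] projectionsD(2)[OF assms(2)])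
  have "p o\<^sub>L (q - p) = 0"
    by (rule blinfun_eqI) (simp add: blinfun_simps proj_le_absorb_right[OF pp pq assms(3)] is_projD(2)[OF pp])
  from d_add[OF assms(1) qp this] show ?thesis by eventually_elim simp
qed

lemma chi_cut_eq_0_iff:
  assumes "E \<in> sets \<mu>" "e \<in> projections M" shows "chi E o\<^sub>L e = 0 \<longleftrightarrow> (AE \<omega> in \<mu>. \<omega> \<in> E \<longrightarrow> d e \<omega> = 0)"
proof
  assume z: "chi E o\<^sub>L e = 0"
  show "AE \<omega> in \<mu>. \<omega> \<in> E \<longrightarrow> d e \<omega> = 0"
    using d_chi[OF assms] d_zero unfolding z by eventually_elim (auto simp: indicator_def)
next
  assume "AE \<omega> in \<mu>. \<omega> \<in> E \<longrightarrow> d e \<omega> = 0"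
  then have "AE \<omega> in \<mu>. d (chi E o\<^sub>L e) \<omega> = 0"
    using d_chi[OF assms] by eventually_elim (auto simp: indicator_def)
  then show "chi E o\<^sub>L e = 0" by (rule d_eq_0D[OF center_proj_cut(1)[OF chi_center_proj[OF assms(1)] assms(2)]])
qed

text \<open>Every non-zero projection under the central support of an abelian projection \<open>e\<close> contains a copy
  of a central piece of \<open>e\<close>; on that piece its dimension is therefore at least that of \<open>e\<close>.\<close>

lemma abelian_dimension_le:
  assumes e: "abelian_projection M e" and q: "q \<in> projections M" "q \<noteq> 0" "proj_le q (central_support e)"
  obtains W where "W \<in> sets \<mu>" "chi W o\<^sub>L e \<noteq> 0" "AE \<omega> in \<mu>. \<omega> \<in> W \<longrightarrow> d e \<omega> \<le> d q \<omega>"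
proof -
  have eP: "e \<in> projections M" using e by (simp add: abelian_projection_def)
  note pq = projectionsD(1)[OF q(1)] and pe = projectionsD(1)[OF eP] and eM = projectionsD(2)[OF eP]
    and qM = projectionsD(2)[OF q(1)]
  obtain x where x: "x \<in> M" "q o\<^sub>L x o\<^sub>L e \<noteq> 0"
  proof (rule ccontr)
    assume "\<not> thesis"
    then have z: "q o\<^sub>L x o\<^sub>L e = 0" if "x \<in> M" for x using that \<open>\<And>x. x \<in> M \<Longrightarrow> q o\<^sub>L x o\<^sub>L e \<noteq> 0 \<Longrightarrow> thesis\<close> by blast
    have "q (central_support e \<xi>) = 0" for \<xi>
    proof (rule central_support_annihilate[OF is_projD(1)[OF pq]])
      fix x \<xi> assume "x \<in> M"
      then show "q (x (e \<xi>)) = 0" using z[of x] by (metis blinfun.zero_left blinfun_apply_blinfun_compose)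
    qed
    then have "q \<xi> = 0" for \<xi>
      using proj_le_absorb_right[OF pq center_projD(1)[OF central_support_center[OF eM]] q(3), of \<xi>] by simp
    then show False using q(2) by (metis blinfun.zero_left blinfun_eqI)
  qed
  obtain u where u: "u \<in> M" "u \<noteq> 0" "u o\<^sub>L adj u o\<^sub>L u = u" "adj u o\<^sub>L u \<in> projections M" "u o\<^sub>L adj u \<in> projections M"
    "proj_le (adj u o\<^sub>L u) e" "proj_le (u o\<^sub>L adj u) q"
  proof (rule polar_decomposition[of "q o\<^sub>L x o\<^sub>L e" q e])
    show "q o\<^sub>L x o\<^sub>L e \<in> M" by (intro compose qM x eM)
  qed (use x(2) is_projD(2)[OF pq] is_projD(2)[OF pe] pe in auto)
  define e' where "e' = adj u o\<^sub>L u"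
  have e'P: "e' \<in> projections M" and e'e: "e' = central_support e' o\<^sub>L e"
    using u(4) abelian_subprojection[OF e u(4) u(6)] by (auto simp: e'_def)
  obtain W where W: "W \<in> sets \<mu>" "central_support e' = chi W"
    using center_proj_chi[OF central_support_center[OF projectionsD(2)[OF e'P]]] by blast
  have "e' \<noteq> 0"
  proof
    assume "e' = 0"
    then have "adj u (u \<xi>) = 0" for \<xi> unfolding e'_def by (metis blinfun.zero_left blinfun_apply_blinfun_compose)
    then have "cinner (u \<xi>) (u \<xi>) = 0" for \<xi> by (simp add: adj_cinner[OF bdd[OF u(1)]])
    then show False using u(2) by (metis blinfun.zero_left blinfun_eqI cinner_self_eq_0)
  qed
  moreover have "AE \<omega> in \<mu>. \<omega> \<in> W \<longrightarrow> d e \<omega> \<le> d q \<omega>"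
    using d_equiv[OF u(1,3)] d_mono[OF u(5) q(1) u(7)] d_chi[OF W(1) eP]
    unfolding e'_def[symmetric] W(2)[symmetric] e'e[symmetric] by eventually_elim (auto simp: indicator_def)
  ultimately show ?thesis using that W e'e by metis
qed

text \<open>The place where the absence of type II enters: every non-zero central projection has a part on
  which there are no non-zero projections of small dimension. Under an abelian projection \<open>e\<close> small means
  smaller than \<open>d e\<close>, and where there are no finite projections any bound will do.\<close>

lemma small_projections_vanish:
  assumes II: "\<not> has_type_II_summand M" and v: "v \<in> projections (center M)" "v \<noteq> 0"
  obtains v' \<epsilon> where "v' \<in> projections (center M)" "v' \<noteq> 0" "proj_le v' v" "(0::real) < \<epsilon>"
    "\<And>q. q \<in> projections M \<Longrightarrow> AE \<omega> in \<mu>. d q \<omega> \<le> ennreal \<epsilon> \<Longrightarrow> v' o\<^sub>L q = 0"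
proof -
  have "\<not> type_II (direct_summand M v)" using II v unfolding has_type_II_summand_def by blast
  then consider (ab) e where "abelian_projection M e" "proj_le e v" "e \<noteq> 0"
    | (inf) z where "z \<in> projections (center M)" "proj_le z v" "z \<noteq> 0"
        "\<And>e. finite_projection M e \<Longrightarrow> proj_le e z \<Longrightarrow> e = 0"
    unfolding type_II_def Ball_def summand_abelian_iff[OF v(1)] summand_center_iff[OF v(1)] summand_finite_iff[OF v(1)]
    using proj_le_trans by blast
  then show ?thesis
  proof cases
    case inf
    show ?thesis
    proof (rule that[OF inf(1,3,2), of 1])
      fix q assume q: "q \<in> projections M" "AE \<omega> in \<mu>. d q \<omega> \<le> ennreal 1"
      note zq = center_proj_cut[OF inf(1) q(1)]
      have "AE \<omega> in \<mu>. d (z o\<^sub>L q) \<omega> < \<infinity>"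
        using d_mono[OF zq(1) q(1) zq(2)] q(2) by eventually_elim (simp add: le_less_trans)
      then have "finite_projection M (z o\<^sub>L q)" using d_finite[OF zq(1)] by blast
      moreover have "proj_le (z o\<^sub>L q) z" by (simp add: proj_le_iff is_projD(2)[OF center_projD(1)[OF inf(1)]])
      ultimately show "z o\<^sub>L q = 0" by (rule inf(4))
    qed simp
  next
    case ab
    then have eP: "e \<in> projections M" by (simp add: abelian_projection_def)
    note de[measurable] = d_measurable[OF eP]
    \<comment> \<open>A part of the central support of \<open>e\<close> on which its dimension is bounded away from \<open>0\<close>.\<close>
    define G where "G n = {\<omega> \<in> space \<mu>. ennreal (1 / real (Suc n)) < d e \<omega>}" for n
    have G: "G n \<in> sets \<mu>" for n unfolding G_def by measurable
    have "\<exists>n. chi (G n) \<noteq> 0"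
    proof (rule ccontr)
      assume "\<nexists>n. chi (G n) \<noteq> 0"
      then have "AE \<omega> in \<mu>. \<forall>n. \<omega> \<notin> G n" using G by (subst AE_all_countable) (auto simp flip: chi_eq_0_iff)
      then have "AE \<omega> in \<mu>. d e \<omega> = 0"
        using AE_space
      proof eventually_elim
        case (elim \<omega>)
        then have le: "d e \<omega> \<le> ennreal (1 / real (Suc n))" for n by (auto simp: G_def not_less)
        show ?case
        proof (rule ccontr)
          assume "d e \<omega> \<noteq> 0"
          have "d e \<omega> < \<infinity>" using le[of 0] by (simp add: le_less_trans)
          then have "0 < enn2real (d e \<omega>)" using \<open>d e \<omega> \<noteq> 0\<close> by (simp add: enn2real_positive_iff zero_less_iff_neq_zero)
          then obtain n where "inverse (real (Suc n)) < enn2real (d e \<omega>)" using reals_Archimedean by blast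
          moreover have "enn2real (d e \<omega>) \<le> 1 / real (Suc n)" by (rule enn2real_leI) (use le in simp_all)
          ultimately show False by (simp add: inverse_eq_divide)
        qed
      qed
      then show False using d_eq_0D[OF eP] ab(3) by blast
    qed
    then obtain n where n: "chi (G n) \<noteq> 0" by blast
    have below: "proj_le (chi (G n)) z" if z: "z \<in> projections (center M)" "proj_le e z" for z
    proof -
      obtain C where C: "C \<in> sets \<mu>" "z = chi C" using center_proj_chi[OF z(1)] by blast
      have "chi (space \<mu> - C) o\<^sub>L e = 0"
        using z(2) C by (intro blinfun_eqI) (simp add: chi_compl blinfun_simps proj_le_iff)
      then have "AE \<omega> in \<mu>. \<omega> \<in> space \<mu> - C \<longrightarrow> d e \<omega> = 0" using chi_cut_eq_0_iff[of "space \<mu> - C" e] C(1) eP by auto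
      then have "AE \<omega> in \<mu>. \<omega> \<in> G n \<longrightarrow> \<omega> \<in> C" by eventually_elim (auto simp: G_def)
      then show ?thesis unfolding C(2) using C(1) G by (simp add: chi_le_iff)
    qed
    show ?thesis
    proof (rule that[OF chi_center_proj[OF G[of n]] n below[OF v(1) ab(2)], of "1 / real (Suc n)"])
      fix q assume q: "q \<in> projections M" "AE \<omega> in \<mu>. d q \<omega> \<le> ennreal (1 / real (Suc n))"
      note Gq = center_proj_cut[OF chi_center_proj[OF G[of n]] q(1)]
      show "chi (G n) o\<^sub>L q = 0"
      proof (rule ccontr)
        assume ne: "chi (G n) o\<^sub>L q \<noteq> 0"
        have "proj_le (chi (G n) o\<^sub>L q) (chi (G n))" by (simp add: proj_le_iff is_projD(2)[OF chi_proj[OF G]])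
        then have "proj_le (chi (G n) o\<^sub>L q) (central_support e)"
          using below[OF central_support_center[OF projectionsD(2)[OF eP]] central_support_upper] proj_le_trans by blast
        from abelian_dimension_le[OF ab(1) Gq(1) ne this] obtain W where W: "W \<in> sets \<mu>" "chi W o\<^sub>L e \<noteq> 0"
          "AE \<omega> in \<mu>. \<omega> \<in> W \<longrightarrow> d e \<omega> \<le> d (chi (G n) o\<^sub>L q) \<omega>" by metis
        have "AE \<omega> in \<mu>. \<omega> \<in> W \<longrightarrow> d e \<omega> = 0"
          using W(3) d_chi[OF G[of n] q(1)] q(2) AE_space
        proof eventually_elim
          case (elim \<omega>)
          show ?case
          proof (rule impI, cases "\<omega> \<in> G n")
            assume "\<omega> \<in> W" "\<omega> \<in> G n"
            then have "d e \<omega> \<le> ennreal (1 / real (Suc n))" using elim by (auto intro: order_trans)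
            then show "d e \<omega> = 0" using \<open>\<omega> \<in> G n\<close> by (auto simp: G_def not_less[symmetric])
          qed (use elim in auto)
        qed
        then show False using W(2) chi_cut_eq_0_iff[OF W(1) eP] by blast
      qed
    qed simp
  qed
qed

end

section \<open>Algebras without type II summand\<close>

context represented_center
begin

lemma represents_chi:
  assumes E: "E \<in> sets \<mu>" shows "represents M \<mu> \<Phi> (indicator E) (op_graph (chi E))"
  unfolding represents_def
proof (intro conjI ballI impI)
  show "indicator E \<in> borel_measurable \<mu>" using E by measurable
  have cE: "chi E \<in> center M" by (rule center_projD(3)[OF chi_center_proj[OF E]])
  show "op_graph (chi E) \<in> measurable_ops (center M)"
    by (rule von_neumann.op_graph_measurable[OF von_neumann_center cE])
  fix F assume F: "F \<in> sets \<mu>"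
  show "strong_prod (op_graph (chi E)) (op_graph (\<Phi> (indicator F))) = op_graph (\<Phi> (\<lambda>\<omega>. indicator E \<omega> * indicator F \<omega>))"
  proof (rule strong_prod_right)
    show "closed_operator (op_graph (chi E))" by (rule closed_operator_op_graph[OF is_projD(1)[OF chi_proj[OF E]]])
    show "(\<Phi> (indicator F) \<xi>, \<Phi> (\<lambda>\<omega>. indicator E \<omega> * indicator F \<omega>) \<xi>) \<in> op_graph (chi E)" for \<xi>
      using E F by (simp add: op_graph_iff Phi_mult chi_def)
  qed
qed

lemma center_extension_LS: "central_extension M \<subseteq> loc_measurable_ops M"
  by (auto simp: central_extension_def)

lemma central_extension_closed:
  assumes "x \<in> central_extension M" shows "closed_operator x" "affiliated M x"
  using assms by (auto simp: central_extension_def loc_measurable_ops_def)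

lemma bounded_on_strong_prod:
  assumes x: "closed_operator x" "affiliated M x" and r: "0 \<le> r"
    and w: "w \<in> projections (center M)" "bounded_on x w r"
  obtains T where "T \<in> M" "norm T \<le> r" "strong_prod x (op_graph w) = op_graph T"
proof -
  note pw = center_projD(1)[OF w(1)]
  have "range (blinfun_apply w) \<subseteq> Domain x"
    using w(2) is_projD(2)[OF pw] unfolding bounded_on_def by blast
  then obtain T where T: "T \<in> bounded_ops" "\<And>\<xi>. (w \<xi>, T \<xi>) \<in> x"
    using closed_operator_bounded_part[OF x(1) is_projD(1)[OF pw]] by blast
  have "T \<in> M"
  proof (rule memI[OF T(1)])
    fix y \<xi> assume y: "y \<in> commutant M"
    have "(y (w \<xi>), y (T \<xi>)) \<in> x" using x(2) y T(2) unfolding affiliated_def by blast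
    then have "(w (y \<xi>), y (T \<xi>)) \<in> x" by (simp add: comm[OF y center_projD(2)[OF w(1)]])
    then show "T (y \<xi>) = y (T \<xi>)" by (rule closed_operatorD(4)[OF x(1) T(2)])
  qed
  moreover have "norm T \<le> r"
  proof (rule norm_blinfun_bound[OF r])
    fix \<xi>
    have "norm (T \<xi>) \<le> r * norm (w \<xi>)" by (rule bounded_on_norm[OF x(1) w(2) pw T(2)])
    also have "\<dots> \<le> r * norm \<xi>" by (intro mult_left_mono proj_norm_le pw r)
    finally show "norm (T \<xi>) \<le> r * norm \<xi>" .
  qed
  ultimately show ?thesis using that strong_prod_right[OF x(1) T(2)] by blast
qed

end

context dimension_algebra
begin

text \<open>The central projection \<open>\<chi>\<^sub>B\<close> may serve both as \<open>p\<close> and as \<open>z\<close>; then \<open>z (1 - p) = 0\<close>.\<close>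

lemma O_nbhd_subset_V_nbhd:
  assumes e: "0 \<le> \<epsilon>" shows "O_nbhd M \<mu> \<Phi> A \<epsilon> \<delta> \<subseteq> V_nbhd M \<mu> \<Phi> d A \<epsilon> \<delta>"
proof
  fix x assume "x \<in> O_nbhd M \<mu> \<Phi> A \<epsilon> \<delta>"
  then obtain B where x: "x \<in> central_extension M" and B: "B \<in> sets \<mu>" "B \<subseteq> A" "emeasure \<mu> (A - B) \<le> ennreal \<delta>"
    and b: "bounded_on x (chi B) \<epsilon>" unfolding O_nbhd_iff[OF e] by blast
  note Bc = chi_center_proj[OF B(1)]
  obtain T where T: "T \<in> M" "norm T \<le> \<epsilon>" "strong_prod x (op_graph (chi B)) = op_graph T"
    using bounded_on_strong_prod[OF central_extension_closed[OF x] e Bc b] by blast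
  have cB: "space \<mu> - B \<in> sets \<mu>" using B(1) by auto
  have "indicator (space \<mu> - B) \<in> W_nbhd \<mu> A \<epsilon> \<delta>"
    unfolding W_nbhd_iff[OF e]
  proof (intro conjI bexI[OF _ B(1)])
    show "indicator (space \<mu> - B) \<in> borel_measurable \<mu>" using cB by measurable
    show "AE \<omega> in \<mu>. \<omega> \<in> B \<longrightarrow> cmod (indicator (space \<mu> - B) \<omega>) \<le> \<epsilon>" using e by (auto intro!: AE_I2 simp: indicator_def)
  qed (use B in auto)
  moreover have "represents M \<mu> \<Phi> (indicator (space \<mu> - B)) (op_graph (perp (chi B)))"
    using represents_chi[OF cB] by (simp add: chi_compl[OF B(1)])
  moreover have z0: "chi B o\<^sub>L perp (chi B) = 0"
    by (rule blinfun_eqI) (simp add: blinfun_simps is_projD(2)[OF chi_proj[OF B(1)]])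
  have "AE \<omega> in \<mu>. d (chi B o\<^sub>L perp (chi B)) \<omega> \<le> ennreal \<epsilon> * indicator B \<omega>"
    unfolding z0 using d_zero by eventually_elim simp
  ultimately show "x \<in> V_nbhd M \<mu> \<Phi> d A \<epsilon> \<delta>"
    unfolding V_nbhd_def using x center_extension_LS T Bc center_projD(4)[OF Bc] B(1) chi_def by blast
qed

text \<open>Normality of the dimension gives \<open>d(p\<^sub>n - p\<^sub>0) \<up> d(1 - p\<^sub>0)\<close>; as the limit is finite it may be
  subtracted, so \<open>d(1 - p\<^sub>n)\<close> decreases to \<open>0\<close>.\<close>

lemma d_decreasing:
  assumes p: "\<And>n. p n \<in> projections M" "increases_to_one M p" "finite_projection M (perp (p 0))"
    and \<epsilon>: "(0::real) < \<epsilon>"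
  shows "AE \<omega> in \<mu>. \<exists>n. d (perp (p n)) \<omega> \<le> ennreal \<epsilon>"
proof -
  note pp = projectionsD(1)[OF p(1)] and pM = projectionsD(2)[OF p(1)]
  have inc: "proj_le (p n) (p (Suc n))" and lim: "(\<lambda>n. p n \<xi>) \<longlonglongrightarrow> \<xi>" for n \<xi>
    using p(2) increases_to_one_iff[of p] p(1) by auto
  have le: "proj_le (p m) (p n)" if "m \<le> n" for m n
    by (rule proj_incseq[where p = p]) (use inc pp that in auto)
  define r where "r n = p n - p 0" for n
  have r: "r n \<in> projections M" for n
    unfolding r_def by (intro projectionsI is_proj_diff[OF pp pp le] diff pM) simp
  have q: "perp (p n) \<in> projections M" for n by (rule perp_projection[OF p(1)])
  have p0: "p n (p 0 \<xi>) = p 0 \<xi>" "p 0 (p n \<xi>) = p 0 \<xi>" for n \<xi>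
    using le[of 0 n] proj_le_absorb_right[OF pp pp le[of 0 n]] by (simp_all add: proj_le_iff)
  have rle: "proj_le (r m) (r n)" if "m \<le> n" for m n
  proof -
    have "p n (p m \<xi>) = p m \<xi>" for \<xi> using le[OF that] by (simp add: proj_le_iff)
    then show ?thesis by (simp add: proj_le_iff r_def blinfun_simps p0 is_projD(2)[OF pp])
  qed
  have split: "AE \<omega> in \<mu>. d (perp (p 0)) \<omega> = d (r n) \<omega> + d (perp (p n)) \<omega>" for n
  proof -
    have "r n o\<^sub>L perp (p n) = 0"
      by (rule blinfun_eqI) (simp add: r_def blinfun_simps p0 is_projD(2)[OF pp])
    from d_add[OF r q this] show ?thesis by (simp add: r_def)
  qed
  have sup: "is_proj_sup M (range r) (perp (p 0))"
    unfolding is_proj_sup_def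
  proof (intro conjI ballI impI q)
    fix a assume "a \<in> range r"
    then obtain n where "a = r n" by blast
    then show "proj_le a (perp (p 0))" by (simp add: proj_le_iff r_def blinfun_simps p0 is_projD(2)[OF pp])
  next
    fix s assume s: "s \<in> projections M" "\<forall>a\<in>range r. proj_le a s"
    show "proj_le (perp (p 0)) s"
    proof (rule proj_le_fixI[OF is_proj_perp[OF pp]])
      fix \<xi> assume "perp (p 0) \<xi> = \<xi>"
      then have "p 0 \<xi> = 0" by (simp add: blinfun_simps)
      then have rp: "r n \<xi> = p n \<xi>" for n by (simp add: r_def blinfun_simps)
      have "s (p n \<xi>) = p n \<xi>" for n using s(2) by (auto simp: proj_le_iff simp flip: rp)
      moreover have "(\<lambda>n. s (p n \<xi>)) \<longlonglongrightarrow> s \<xi>" by (intro blinfun.tendsto lim tendsto_const)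
      ultimately have "(\<lambda>n. p n \<xi>) \<longlonglongrightarrow> s \<xi>" by simp
      then show "s \<xi> = \<xi>" using lim by (rule LIMSEQ_unique)
    qed
  qed
  define g where "g \<omega> = (SUP n. d (r n) \<omega>)" for \<omega>
  have [measurable]: "d (r n) \<in> borel_measurable \<mu>" for n by (rule d_measurable[OF r])
  have "AE \<omega> in \<mu>. d (perp (p 0)) \<omega> \<le> g \<omega>"
  proof (rule d_sup[OF _ _ _ sup])
    show "g \<in> borel_measurable \<mu>" unfolding g_def by measurable
    show "\<exists>c\<in>range r. proj_le a c \<and> proj_le b c" if ab: "a \<in> range r" "b \<in> range r" for a b
    proof -
      obtain m n where "a = r m" "b = r n" using ab by blast
      then show ?thesis using rle[of m "max m n"] rle[of n "max m n"] by (intro bexI[of _ "r (max m n)"]) auto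
    qed
    show "AE \<omega> in \<mu>. d a \<omega> \<le> g \<omega>" if "a \<in> range r" for a
      using that unfolding g_def by (auto intro!: AE_I2 SUP_upper)
  qed (use r in auto)
  moreover have "AE \<omega> in \<mu>. d (perp (p 0)) \<omega> < \<infinity>" using d_finite[OF q] p(3) by blast
  moreover have "AE \<omega> in \<mu>. \<forall>n. d (perp (p 0)) \<omega> = d (r n) \<omega> + d (perp (p n)) \<omega>"
    using split by (subst AE_all_countable) blast
  ultimately show ?thesis
  proof eventually_elim
    case (elim \<omega>)
    show ?case
    proof (rule ccontr)
      assume "\<not> ?case"
      then have gt: "ennreal \<epsilon> \<le> d (perp (p n)) \<omega>" for n by (auto simp: not_le less_imp_le)
      have "d (r n) \<omega> \<le> d (perp (p 0)) \<omega> - ennreal \<epsilon>" for n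
      proof -
        have "d (r n) \<omega> + ennreal \<epsilon> \<le> d (perp (p 0)) \<omega>" using elim(3) gt[of n] by (metis add_left_mono)
        then show ?thesis by (simp add: ennreal_le_minus_iff add.commute)
      qed
      then have "g \<omega> \<le> d (perp (p 0)) \<omega> - ennreal \<epsilon>" unfolding g_def by (intro SUP_least)
      then have "d (perp (p 0)) \<omega> \<le> d (perp (p 0)) \<omega> - ennreal \<epsilon>" using elim(1) order_trans by blast
      moreover have "ennreal \<epsilon> \<le> d (perp (p 0)) \<omega>" using gt[of 0] .
      then have "d (perp (p 0)) \<omega> - ennreal \<epsilon> < d (perp (p 0)) \<omega>"
        using elim(2) \<epsilon> by (intro ennreal_between) (auto simp: zero_less_iff_neq_zero)
      ultimately show False by simp
    qed
  qed
qed

context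
  assumes II: "\<not> has_type_II_summand M"
begin

text \<open>Without type II summand every locally measurable operator is locally bounded: on a central
  projection where small projections vanish, the exceptional projections of \<open>x\<close> are eventually zero.\<close>

theorem loc_measurable_eq_central_extension: "loc_measurable_ops M = central_extension M"
proof (intro subset_antisym center_extension_LS subsetI)
  fix x assume "x \<in> loc_measurable_ops M"
  then obtain z where x: "closed_operator x" "affiliated M x" and z: "\<And>n. z n \<in> projections (center M)"
    "increases_to_one M z" "\<And>n. strong_prod (op_graph (z n)) x \<in> measurable_ops M"
    unfolding loc_measurable_ops_def by blast
  have zlim: "(\<lambda>n. z n \<xi>) \<longlonglongrightarrow> \<xi>" for \<xi>
    using z(2) increases_to_one_iff[of z] center_projD(4)[OF z(1)] by blast
  define W where "W = {w \<in> projections (center M). range (blinfun_apply w) \<subseteq> Domain x}"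
  have Wsub: "W \<subseteq> projections (center M)" by (auto simp: W_def)
  define v where "v = perp (proj_sup W)"
  have v: "v \<in> projections (center M)" unfolding v_def by (intro center_proj_perp center_proj_sup Wsub)
  have Wv: "w = 0" if "w \<in> W" "proj_le w v" for w
  proof (rule blinfun_eqI)
    fix \<xi>
    have "proj_sup W (w \<xi>) = w \<xi>" using proj_sup_upper[OF that(1)] by (simp add: proj_le_iff)
    moreover have "w \<xi> - proj_sup W (w \<xi>) = w \<xi>" using that(2) by (simp add: proj_le_iff v_def blinfun_simps)
    ultimately show "w \<xi> = blinfun_apply 0 \<xi>" by simp
  qed
  have "v = 0"
  proof (rule ccontr)
    assume "v \<noteq> 0"
    have "\<exists>m. z m o\<^sub>L v \<noteq> 0"
    proof (rule ccontr)
      assume "\<nexists>m. z m o\<^sub>L v \<noteq> 0"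
      then have "z m (v \<xi>) = 0" for m \<xi> by (metis blinfun.zero_left blinfun_apply_blinfun_compose)
      then have "v \<xi> = 0" for \<xi> using zlim[of "v \<xi>"] LIMSEQ_unique[OF _ tendsto_const] by simp
      then have "v = 0" by (intro blinfun_eqI) simp
      then show False using \<open>v \<noteq> 0\<close> by simp
    qed
    then obtain m where m: "z m o\<^sub>L v \<noteq> 0" by blast
    note zv = center_proj_compose(1)[OF z(1)[of m] v]
    obtain v' \<epsilon> where v': "v' \<in> projections (center M)" "v' \<noteq> 0" "proj_le v' (z m o\<^sub>L v)" "(0::real) < \<epsilon>"
      "\<And>q. q \<in> projections M \<Longrightarrow> AE \<omega> in \<mu>. d q \<omega> \<le> ennreal \<epsilon> \<Longrightarrow> v' o\<^sub>L q = 0"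
      by (rule small_projections_vanish[OF II zv m]) (rule that)
    define y where "y = strong_prod (op_graph (z m)) x"
    obtain p where p: "\<And>n. p n \<in> projections M" "increases_to_one M p"
      "\<And>n. range (blinfun_apply (p n)) \<subseteq> Domain y" "\<And>n. finite_projection M (perp (p n))"
      using z(3)[of m] unfolding measurable_ops_def y_def by blast
    have q: "perp (p n) \<in> projections M" for n by (rule perp_projection[OF p(1)])
    define G where "G n = {\<omega> \<in> space \<mu>. d (perp (p n)) \<omega> \<le> ennreal \<epsilon>}" for n
    have [measurable]: "d (perp (p n)) \<in> borel_measurable \<mu>" for n by (rule d_measurable[OF q])
    have G: "G n \<in> sets \<mu>" for n unfolding G_def by measurable
    have ex: "AE \<omega> in \<mu>. \<exists>n. \<omega> \<in> G n"
      using d_decreasing[OF p(1,2,4) v'(4)] AE_space by eventually_elim (simp add: G_def)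
    obtain V where V: "V \<in> sets \<mu>" "v' = chi V" using center_proj_chi[OF v'(1)] by blast
    have "AE \<omega> in \<mu>. \<omega> \<notin> V \<inter> G n" for n
    proof -
      define u where "u = chi (V \<inter> G n)"
      have ueq: "u \<xi> = v' (chi (G n) \<xi>)" "u \<xi> = chi (G n) (v' \<xi>)" for \<xi>
        using chi_Int[OF V(1) G[of n]] center_proj_compose(2)[OF v'(1) chi_center_proj[OF G[of n]]]
        by (simp_all add: u_def V(2))
      have u: "u \<in> projections (center M)" unfolding u_def by (rule chi_center_proj) (use V G in auto)
      have uv: "proj_le u v'" by (simp add: proj_le_iff ueq(1) is_projD(2)[OF center_projD(1)[OF v'(1)]])
      have uz: "z m (u \<xi>) = u \<xi>" "v (u \<xi>) = u \<xi>" for \<xi>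
      proof -
        have "z m (v (u \<xi>)) = u \<xi>" using proj_le_trans[OF uv v'(3)] by (simp add: proj_le_iff)
        then show "z m (u \<xi>) = u \<xi>" "v (u \<xi>) = u \<xi>"
          using is_projD(2)[OF center_projD(1)[OF z(1)], of m "v (u \<xi>)"]
            is_projD(2)[OF center_projD(1)[OF v], of "z m (u \<xi>)"] center_proj_compose(2)[OF z(1)[of m] v, of "u \<xi>"]
          by simp_all
      qed
      note Gq = center_proj_cut[OF chi_center_proj[OF G[of n]] q[of n]]
      have "AE \<omega> in \<mu>. d (chi (G n) o\<^sub>L perp (p n)) \<omega> \<le> ennreal \<epsilon>"
        using d_chi[OF G[of n] q[of n]] by eventually_elim (auto simp: indicator_def G_def)
      then have "v' o\<^sub>L (chi (G n) o\<^sub>L perp (p n)) = 0" by (rule v'(5)[OF Gq(1)])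
      then have uq: "u (perp (p n) \<xi>) = 0" for \<xi>
        unfolding ueq(1) by (metis blinfun.zero_left blinfun_apply_blinfun_compose)
      have "u \<xi> \<in> Domain x" for \<xi>
      proof -
        have "perp (p n) (u \<xi>) = 0" using uq[of \<xi>] center_projD(6)[OF u projectionsD(2)[OF q]] by simp
        then have "p n (u \<xi>) = u \<xi>" by (simp add: blinfun_simps)
        then have "u \<xi> \<in> Domain y" using p(3)[of n] by (metis rangeI subsetD)
        then obtain \<eta> where "(u \<xi>, \<eta>) \<in> strong_prod (op_graph (z m)) x" unfolding y_def by blast
        from strong_prod_leftD[OF x(1) affiliated_commute[OF x(2) z(1)] this is_projD(6)[OF center_projD(1)[OF z(1)]]]
        show ?thesis by (auto simp: uz)
      qed
      then have "u \<in> W" unfolding W_def using u by blast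
      moreover have "proj_le u v" by (simp add: proj_le_iff uz)
      ultimately have "u = 0" by (rule Wv)
      then show ?thesis unfolding u_def by (subst (asm) chi_eq_0_iff) (use V G in auto)
    qed
    then have "AE \<omega> in \<mu>. \<forall>n. \<omega> \<notin> V \<inter> G n" by (subst AE_all_countable) blast
    then have "AE \<omega> in \<mu>. \<omega> \<notin> V" using ex by eventually_elim blast
    then show False using v'(2) V by (simp add: chi_eq_0_iff)
  qed
  then have "proj_sup W = id_blinfun" by (simp add: v_def)
  then obtain T where "central_glue M (\<lambda>n. bound_proj x (real n)) T" "x = glue (\<lambda>n. bound_proj x (real n)) T"
    by (rule locally_bounded_glue[OF x Wsub]) (auto simp: W_def)
  then show "x \<in> central_extension M" using glue_central_extension by metis
qed

text \<open>Let \<open>w\<^sub>n\<close> be the largest central projection under which projections of dimension at most \<open>1/(n + 1)\<close> vanish. The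
  complement of the supremum of the \<open>w\<^sub>n\<close> would have a part of the same kind, so it is \<open>0\<close>.\<close>

lemma small_projections_exhaust:
  obtains F where "\<And>n. F n \<in> sets \<mu>" "incseq F" "AE \<omega> in \<mu>. \<exists>n. \<omega> \<in> F n"
    "\<And>n q. q \<in> projections M \<Longrightarrow> AE \<omega> in \<mu>. d q \<omega> \<le> ennreal (1 / real (Suc n)) \<Longrightarrow> chi (F n) o\<^sub>L q = 0"
proof -
  define D where "D n = {w \<in> projections (center M).
    \<forall>q\<in>projections M. (AE \<omega> in \<mu>. d q \<omega> \<le> ennreal (1 / real (Suc n))) \<longrightarrow> w o\<^sub>L q = 0}" for n
  define w where "w n = proj_sup (D n)" for n
  have Dc: "D n \<subseteq> projections (center M)" for n by (auto simp: D_def)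
  have wc: "w n \<in> projections (center M)" for n unfolding w_def by (rule center_proj_sup[OF Dc])
  have wq: "w n o\<^sub>L q = 0" if q: "q \<in> projections M" "AE \<omega> in \<mu>. d q \<omega> \<le> ennreal (1 / real (Suc n))" for n q
  proof (rule blinfun_eqI)
    fix \<xi>
    note qM = projectionsD(2)[OF q(1)]
    have "csubspace {\<zeta>. q \<zeta> = 0}" using bdd[OF qM] by (simp add: csubspace_def blinfun_simps bounded_opsD)
    moreover have "closed {\<zeta>. q \<zeta> = 0}"
      by (intro closed_Collect_eq) (auto intro!: linear_continuous_on blinfun.bounded_linear_right)
    moreover have "u \<zeta> \<in> {\<zeta>. q \<zeta> = 0}" if "u \<in> D n" for u \<zeta>
    proof -
      have uq: "u o\<^sub>L q = 0" and u: "u \<in> projections (center M)" using that q by (auto simp: D_def)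
      have "u (q \<zeta>) = 0" using blinfun_compose_eqD[OF uq, of \<zeta>] by simp
      then show ?thesis using center_projD(6)[OF u qM, of \<zeta>] by simp
    qed
    moreover have "proj_sup (D n) (w n \<xi>) = w n \<xi>" unfolding w_def by (rule is_projD(2)[OF is_proj_proj_sup])
    ultimately have "w n \<xi> \<in> {\<zeta>. q \<zeta> = 0}" by (rule proj_sup_fix_least)
    then show "(w n o\<^sub>L q) \<xi> = blinfun_apply 0 \<xi>" using center_projD(6)[OF wc qM] by simp
  qed
  have "\<exists>E. E \<in> sets \<mu> \<and> w n = chi E" for n using center_proj_chi[OF wc] by metis
  then obtain E where E: "\<And>n. E n \<in> sets \<mu>" "\<And>n. w n = chi (E n)" by metis
  define F where "F n = (\<Union>k\<le>n. E k)" for n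
  have F: "F n \<in> sets \<mu>" for n unfolding F_def using E by auto
  have "chi (F n) = w n" for n
    unfolding E(2)
  proof (rule chi_cong[OF F E(1)])
    have "AE \<omega> in \<mu>. k \<le> n \<longrightarrow> \<omega> \<in> E k \<longrightarrow> \<omega> \<in> E n" for k
    proof (cases "k \<le> n")
      case True
      have "D k \<subseteq> D n"
      proof -
        have le: "ennreal (1 / real (Suc n)) \<le> ennreal (1 / real (Suc k))"
          using True by (intro ennreal_leI) (simp add: frac_le)
        have "AE \<omega> in \<mu>. d q \<omega> \<le> ennreal (1 / real (Suc k))" if "AE \<omega> in \<mu>. d q \<omega> \<le> ennreal (1 / real (Suc n))" for q
          using that by eventually_elim (rule order_trans[OF _ le])
        then show ?thesis unfolding D_def by blast
      qed
      then have "proj_le (w k) (w n)"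
        unfolding w_def by (intro proj_sup_least is_proj_proj_sup proj_sup_upper) blast
      then show ?thesis using E by (simp add: chi_le_iff)
    qed simp
    then have "AE \<omega> in \<mu>. \<forall>k. k \<le> n \<longrightarrow> \<omega> \<in> E k \<longrightarrow> \<omega> \<in> E n" by (subst AE_all_countable) blast
    then show "AE \<omega> in \<mu>. \<omega> \<in> F n \<longleftrightarrow> \<omega> \<in> E n" by eventually_elim (auto simp: F_def)
  qed
  moreover have "AE \<omega> in \<mu>. \<exists>n. \<omega> \<in> F n"
  proof -
    let ?C = "space \<mu> - (\<Union>n. F n)"
    have C: "?C \<in> sets \<mu>" using F by auto
    have "chi ?C = 0"
    proof (rule ccontr)
      assume "chi ?C \<noteq> 0"
      then obtain v' \<epsilon> where v': "v' \<in> projections (center M)" "v' \<noteq> 0" "proj_le v' (chi ?C)" "(0::real) < \<epsilon>"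
        "\<And>q. q \<in> projections M \<Longrightarrow> AE \<omega> in \<mu>. d q \<omega> \<le> ennreal \<epsilon> \<Longrightarrow> v' o\<^sub>L q = 0"
        by (rule small_projections_vanish[OF II chi_center_proj[OF C]]) (rule that)
      obtain n where n: "inverse (real (Suc n)) < \<epsilon>" using reals_Archimedean[OF v'(4)] by blast
      have "v' \<in> D n"
      proof -
        have le: "ennreal (1 / real (Suc n)) \<le> ennreal \<epsilon>"
          using n by (intro ennreal_leI) (simp add: inverse_eq_divide)
        have "AE \<omega> in \<mu>. d q \<omega> \<le> ennreal \<epsilon>" if "AE \<omega> in \<mu>. d q \<omega> \<le> ennreal (1 / real (Suc n))" for q
          using that by eventually_elim (rule order_trans[OF _ le])
        then show ?thesis unfolding D_def using v'(1,5) by blast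
      qed
      then have "proj_le v' (chi (F n))" unfolding \<open>chi (F n) = w n\<close> w_def by (rule proj_sup_upper)
      obtain V where V: "V \<in> sets \<mu>" "v' = chi V" using center_proj_chi[OF v'(1)] by blast
      have "AE \<omega> in \<mu>. \<omega> \<in> V \<longrightarrow> \<omega> \<in> F n" "AE \<omega> in \<mu>. \<omega> \<in> V \<longrightarrow> \<omega> \<in> ?C"
        using \<open>proj_le v' (chi (F n))\<close> v'(3) V C F by (simp_all add: chi_le_iff)
      then have "AE \<omega> in \<mu>. \<omega> \<notin> V" by eventually_elim blast
      then show False using v'(2) V by (simp add: chi_eq_0_iff)
    qed
    then have "AE \<omega> in \<mu>. \<omega> \<notin> ?C" using chi_eq_0_iff[OF C] by blast
    then show ?thesis using AE_space by eventually_elim auto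
  qed
  moreover have "incseq F" unfolding F_def by (rule incseq_SucI) (auto simp: atMost_Suc)
  ultimately show ?thesis using that[of F] F wq by metis
qed

text \<open>Choose \<open>n\<close> such that \<open>F\<^sub>n\<close> covers \<open>A\<close> up to \<open>\<delta> / 2\<close>, and \<open>\<epsilon>' \<le> 1/(n + 1)\<close>. On \<open>F\<^sub>n\<close> the projection \<open>z (1 - p)\<close> of a
  member of \<open>V\<close> vanishes, so there \<open>x z = x p z\<close> is small. The bound \<open>\<epsilon>' \<le> 1/2\<close> excludes the value \<open>1\<close> of
  the indicator function that represents \<open>1 - z\<close>.\<close>

lemma V_nbhd_subset_O_nbhd:
  assumes A: "A \<in> sets \<mu>" "emeasure \<mu> A < \<infinity>" and e: "0 < \<epsilon>" and \<delta>: "0 < \<delta>"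
  obtains \<epsilon>' \<delta>' where "0 < \<epsilon>'" "0 < \<delta>'" "V_nbhd M \<mu> \<Phi> d A \<epsilon>' \<delta>' \<subseteq> O_nbhd M \<mu> \<Phi> A \<epsilon> \<delta>"
proof -
  obtain F where F: "\<And>n. F n \<in> sets \<mu>" "incseq F" "AE \<omega> in \<mu>. \<exists>n. \<omega> \<in> F n"
    "\<And>n q. q \<in> projections M \<Longrightarrow> AE \<omega> in \<mu>. d q \<omega> \<le> ennreal (1 / real (Suc n)) \<Longrightarrow> chi (F n) o\<^sub>L q = 0"
    by (rule small_projections_exhaust) (rule that)
  have "(\<lambda>n. emeasure \<mu> (A - F n)) \<longlonglongrightarrow> emeasure \<mu> (\<Inter>n. A - F n)"
  proof (rule Lim_emeasure_decseq)
    show "range (\<lambda>n. A - F n) \<subseteq> sets \<mu>" using A F by auto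
    show "decseq (\<lambda>n. A - F n)" using F(2) by (auto simp: incseq_def decseq_def)
    show "emeasure \<mu> (A - F n) \<noteq> \<infinity>" for n
      using emeasure_mono[of "A - F n" A \<mu>] A by (auto simp: top_unique less_top)
  qed
  moreover have "emeasure \<mu> (\<Inter>n. A - F n) = 0"
  proof -
    have "AE \<omega> in \<mu>. \<omega> \<notin> (\<Inter>n. A - F n)" using F(3) by eventually_elim auto
    moreover have "(\<Inter>n. A - F n) \<in> sets \<mu>" using A F by auto
    ultimately show ?thesis using AE_iff_null_sets null_setsD1 by blast
  qed
  ultimately have "\<forall>\<^sub>F n in sequentially. emeasure \<mu> (A - F n) < ennreal (\<delta> / 2)"
    using \<delta> by (intro order_tendstoD) auto
  then obtain n where n: "emeasure \<mu> (A - F n) < ennreal (\<delta> / 2)" using eventually_happens sequentially_bot by blast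
  define \<epsilon>' where "\<epsilon>' = min \<epsilon> (min (1/2) (1 / real (Suc n)))"
  have e': "0 < \<epsilon>'" "\<epsilon>' \<le> \<epsilon>" "\<epsilon>' \<le> 1/2" "\<epsilon>' \<le> 1 / real (Suc n)" using e by (simp_all add: \<epsilon>'_def)
  show ?thesis
  proof (rule that[OF e'(1), of "\<delta> / 2"])
    show "V_nbhd M \<mu> \<Phi> d A \<epsilon>' (\<delta> / 2) \<subseteq> O_nbhd M \<mu> \<Phi> A \<epsilon> \<delta>"
    proof
      fix x assume "x \<in> V_nbhd M \<mu> \<Phi> d A \<epsilon>' (\<delta> / 2)"
      then obtain p z E T f where xL: "x \<in> loc_measurable_ops M" and p: "p \<in> projections M"
        and z: "z \<in> projections (center M)" "E \<in> sets \<mu>" "z = chi E"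
        and T: "strong_prod x (op_graph p) = op_graph T" "norm T \<le> \<epsilon>'"
        and f: "f \<in> W_nbhd \<mu> A \<epsilon>' (\<delta> / 2)" "represents M \<mu> \<Phi> f (op_graph (perp z))"
        and dz: "AE \<omega> in \<mu>. d (z o\<^sub>L perp p) \<omega> \<le> ennreal \<epsilon>' * indicator E \<omega>"
        unfolding V_nbhd_def chi_def by blast
      have x: "x \<in> central_extension M" using xL loc_measurable_eq_central_extension by simp
      note cl = central_extension_closed(1)[OF x]
      have e0: "0 \<le> \<epsilon>'" using e'(1) by simp
      obtain B1 where B1: "B1 \<in> sets \<mu>" "B1 \<subseteq> A" "emeasure \<mu> (A - B1) \<le> ennreal (\<delta> / 2)"
        "AE \<omega> in \<mu>. \<omega> \<in> B1 \<longrightarrow> cmod (f \<omega>) \<le> \<epsilon>'" using f(1) unfolding W_nbhd_iff[OF e0] by blast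
      have cE: "space \<mu> - E \<in> sets \<mu>" using z(2) by auto
      have "AE \<omega> in \<mu>. f \<omega> = indicator (space \<mu> - E) \<omega>"
        using represents_chi[OF cE] unfolding chi_compl[OF z(2)] z(3)[symmetric]
        by (intro represents_unique[OF f(2)])
      then have B1E: "AE \<omega> in \<mu>. \<omega> \<in> B1 \<longrightarrow> \<omega> \<in> E"
        using B1(4) AE_space by eventually_elim (use e'(3) in \<open>auto split: split_indicator_asm\<close>)
      have q: "z o\<^sub>L perp p \<in> projections M" by (rule center_proj_cut(1)[OF z(1) perp_projection[OF p]])
      have "AE \<omega> in \<mu>. d (z o\<^sub>L perp p) \<omega> \<le> ennreal (1 / real (Suc n))"
        using dz
      proof eventually_elim
        case (elim \<omega>)
        have "ennreal \<epsilon>' * indicator E \<omega> \<le> ennreal (1 / real (Suc n))"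
          using e'(4) by (auto simp: indicator_def intro: ennreal_leI)
        then show ?case using elim order_trans by blast
      qed
      from F(4)[OF q this] have Fq: "chi (F n) (z (perp p \<xi>)) = 0" for \<xi>
        by (metis blinfun.zero_left blinfun_apply_blinfun_compose)
      define B where "B = B1 \<inter> F n"
      have B: "B \<in> sets \<mu>" unfolding B_def using B1 F by auto
      have "AE \<omega> in \<mu>. \<omega> \<in> B \<longrightarrow> \<omega> \<in> F n \<inter> E" using B1E by eventually_elim (auto simp: B_def)
      then have "proj_le (chi B) (chi (F n \<inter> E))" using B F z(2) by (simp add: chi_le_iff)
      then have "chi B (chi (F n \<inter> E) \<xi>) = chi B \<xi>" for \<xi>
        using F z(2) by (intro proj_le_absorb_right[OF chi_proj[OF B] chi_proj]) auto
      then have Bq: "chi B (perp p \<xi>) = 0" for \<xi>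
        using Fq[of \<xi>] chi_Int[OF F(1)[of n] z(2)] z(3) by (metis blinfun.zero_right blinfun_apply_blinfun_compose)
      have "bounded_on x (chi B) \<epsilon>"
        unfolding bounded_on_def
      proof (intro allI impI)
        fix \<xi> assume \<xi>: "chi B \<xi> = \<xi>"
        have "perp p \<xi> = 0"
          using Bq[of \<xi>] chi_commute[OF B projectionsD(2)[OF perp_projection[OF p]], of \<xi>] \<xi> by simp
        then have "p \<xi> = \<xi>" by (simp add: blinfun_simps)
        then have "(\<xi>, T \<xi>) \<in> x" using strong_prod_rightD[OF cl T(1), of \<xi>] by simp
        moreover have "norm (T \<xi>) \<le> \<epsilon> * norm \<xi>"
          by (rule order_trans[OF norm_blinfun]) (use T(2) e'(2) in \<open>intro mult_right_mono, auto\<close>)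
        ultimately show "\<exists>\<eta>. (\<xi>, \<eta>) \<in> x \<and> norm \<eta> \<le> \<epsilon> * norm \<xi>" by blast
      qed
      moreover have "emeasure \<mu> (A - B) \<le> ennreal \<delta>"
      proof -
        have "emeasure \<mu> (A - B) \<le> emeasure \<mu> ((A - B1) \<union> (A - F n))"
          using A B1 F by (intro emeasure_mono) (auto simp: B_def)
        also have "\<dots> \<le> emeasure \<mu> (A - B1) + emeasure \<mu> (A - F n)"
          using A B1 F by (intro emeasure_subadditive) auto
        also have "\<dots> \<le> ennreal (\<delta> / 2) + ennreal (\<delta> / 2)" using B1(3) n by (intro add_mono) auto
        also have "\<dots> = ennreal \<delta>" using \<delta> by (simp flip: ennreal_plus)
        finally show ?thesis .
      qed
      moreover have "B \<subseteq> A" using B1(2) by (auto simp: B_def)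
      ultimately show "x \<in> O_nbhd M \<mu> \<Phi> A \<epsilon> \<delta>"
        using O_nbhd_iff[OF less_imp_le[OF e]] x B by blast
    qed
  qed (use \<delta> in simp)
qed

end

lemma openin_loc_measure_Int:
  assumes "openin (loc_measure_topology M \<mu> \<Phi> d) U"
  shows "openin (center_norm_topology M \<mu> \<Phi>) (U \<inter> central_extension M)"
  unfolding openin_center_norm_topology
proof (intro conjI ballI)
  fix x assume x: "x \<in> U \<inter> central_extension M"
  then obtain A \<epsilon> \<delta> where A: "A \<in> sets \<mu>" "\<epsilon> > 0" "\<delta> > 0" "emeasure \<mu> A < \<infinity>" "strong_sum x ` V_nbhd M \<mu> \<Phi> d A \<epsilon> \<delta> \<subseteq> U"
    using assms unfolding openin_loc_measure_topology by blast
  have "strong_sum x y \<in> U \<inter> central_extension M" if y: "y \<in> O_nbhd M \<mu> \<Phi> A \<epsilon> \<delta>" for y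
  proof -
    have "y \<in> central_extension M" using y by (simp add: O_nbhd_def)
    then have "strong_sum x y \<in> central_extension M" using x central_extension_sum by blast
    moreover have "y \<in> V_nbhd M \<mu> \<Phi> d A \<epsilon> \<delta>" using O_nbhd_subset_V_nbhd[of \<epsilon> A \<delta>] A(2) y by auto
    ultimately show ?thesis using A(5) by blast
  qed
  then show "\<exists>A\<in>sets \<mu>. \<exists>\<epsilon>>0. \<exists>\<delta>>0. emeasure \<mu> A < \<infinity> \<and> strong_sum x ` O_nbhd M \<mu> \<Phi> A \<epsilon> \<delta> \<subseteq> U \<inter> central_extension M"
    using A by blast
qed simp

theorem topologies_agree_if_no_type_II:
  assumes II: "\<not> has_type_II_summand M"
  shows "subtopology (loc_measure_topology M \<mu> \<Phi> d) (central_extension M) = center_norm_topology M \<mu> \<Phi>"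
  unfolding topology_eq
proof
  fix U
  show "openin (subtopology (loc_measure_topology M \<mu> \<Phi> d) (central_extension M)) U
    \<longleftrightarrow> openin (center_norm_topology M \<mu> \<Phi>) U"
  proof
    assume "openin (subtopology (loc_measure_topology M \<mu> \<Phi> d) (central_extension M)) U"
    then show "openin (center_norm_topology M \<mu> \<Phi>) U"
      unfolding openin_subtopology using openin_loc_measure_Int by auto
  next
    assume U: "openin (center_norm_topology M \<mu> \<Phi>) U"
    then have sub: "U \<subseteq> central_extension M" unfolding openin_center_norm_topology by blast
    have "openin (loc_measure_topology M \<mu> \<Phi> d) U"
      unfolding openin_loc_measure_topology
    proof (intro conjI ballI)
      show "U \<subseteq> loc_measurable_ops M" using sub center_extension_LS by blast
      fix x assume "x \<in> U"
      then obtain A \<epsilon> \<delta> where A: "A \<in> sets \<mu>" "\<epsilon> > 0" "\<delta> > 0" "emeasure \<mu> A < \<infinity>" "strong_sum x ` O_nbhd M \<mu> \<Phi> A \<epsilon> \<delta> \<subseteq> U"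
        using U unfolding openin_center_norm_topology by blast
      obtain \<epsilon>' \<delta>' where "0 < \<epsilon>'" "0 < \<delta>'" "V_nbhd M \<mu> \<Phi> d A \<epsilon>' \<delta>' \<subseteq> O_nbhd M \<mu> \<Phi> A \<epsilon> \<delta>"
        by (rule V_nbhd_subset_O_nbhd[OF II A(1,4,2,3)]) (rule that)
      then have "strong_sum x ` V_nbhd M \<mu> \<Phi> d A \<epsilon>' \<delta>' \<subseteq> U" using A(5) by blast
      then show "\<exists>A\<in>sets \<mu>. \<exists>\<epsilon>>0. \<exists>\<delta>>0. emeasure \<mu> A < \<infinity> \<and> strong_sum x ` V_nbhd M \<mu> \<Phi> d A \<epsilon> \<delta> \<subseteq> U"
        using A(1,4) \<open>0 < \<epsilon>'\<close> \<open>0 < \<delta>'\<close> by blast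
    qed
    then show "openin (subtopology (loc_measure_topology M \<mu> \<Phi> d) (central_extension M)) U"
      using sub unfolding openin_subtopology by blast
  qed
qed

end

section \<open>Algebras with a type II summand\<close>

text \<open>A self-adjoint operator is bounded in norm by its form. With \<open>a = h + s\<close> and \<open>0 \<le> a \<le> 2 h\<close>, the inequality of
  Cauchy and Schwarz gives \<open>a\<^sup>2 \<le> 2 h a\<close>, that is \<open>s\<^sup>2 \<le> h\<^sup>2\<close>.\<close>

lemma norm_le_if_form_le:
  assumes "0 \<le> h" "pos_op (h *\<^sub>R id_blinfun + s)" "pos_op (h *\<^sub>R id_blinfun - s)"
  shows "norm (s \<xi>) \<le> h * norm \<xi>"
proof (rule power2_le_imp_le)
  define a where "a = h *\<^sub>R id_blinfun + s"
  have a: "pos_op a" using assms(2) by (simp add: a_def)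
  have ale: "Re (cinner (a \<zeta>) \<zeta>) \<le> 2 * h * (norm \<zeta>)\<^sup>2" for \<zeta>
    using pos_op_Re[OF assms(3), of \<zeta>] by (simp add: a_def blinfun_simps cinner_simps Re_cinner_self)
  have "(norm (a \<xi>))\<^sup>2 \<le> 2 * h * Re (cinner (a \<xi>) \<xi>)"
  proof (cases "a \<xi> = 0")
    case False
    have "((norm (a \<xi>))\<^sup>2)\<^sup>2 = (cmod (cinner (a \<xi>) (a \<xi>)))\<^sup>2"
      unfolding cinner_norm by (simp only: norm_of_real abs_power2)
    also have "\<dots> \<le> Re (cinner (a \<xi>) \<xi>) * Re (cinner (a (a \<xi>)) (a \<xi>))"
      by (rule pos_op_cauchy_schwarz[OF a])
    also have "\<dots> \<le> Re (cinner (a \<xi>) \<xi>) * (2 * h * (norm (a \<xi>))\<^sup>2)"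
      by (intro mult_left_mono ale pos_op_Re[OF a])
    finally show ?thesis using False by (simp add: power2_eq_square mult.assoc mult.left_commute)
  qed (use assms(1) pos_op_Re[OF a] in simp)
  moreover have "s \<xi> = a \<xi> - h *\<^sub>R \<xi>" by (simp add: a_def blinfun_simps)
  then have "(norm (s \<xi>))\<^sup>2 = (norm (a \<xi>))\<^sup>2 + (h * norm \<xi>)\<^sup>2 - 2 * h * Re (cinner (a \<xi>) \<xi>)"
    by (simp add: norm_diff_square cinner_simps power_mult_distrib)
  ultimately show "(norm (s \<xi>))\<^sup>2 \<le> (h * norm \<xi>)\<^sup>2" by simp
qed (use assms(1) in simp)

context von_neumann
begin

text \<open>The spectral projection of a self-adjoint \<open>s\<close> for the positive half-line: the range projection of
  \<open>s + |s|\<close>. It splits \<open>s\<close> into a positive and a negative part.\<close>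

lemma positive_spectral_projection:
  assumes s: "s \<in> M" "adj s = s" and g: "g \<in> projections M" "\<And>\<xi>. g (s \<xi>) = s \<xi>"
  obtains f where "f \<in> projections M" "proj_le f g"
    "\<And>\<xi>. 0 \<le> Re (cinner (s (f \<xi>)) (f \<xi>))" "\<And>\<xi>. f \<xi> = 0 \<Longrightarrow> Re (cinner (s \<xi>) \<xi>) \<le> 0"
proof -
  note sb = bdd[OF s(1)] and pg = projectionsD(1)[OF g(1)]
  have ssym: "cinner (s \<xi>) \<eta> = cinner \<xi> (s \<eta>)" for \<xi> \<eta> using adj_cinner[OF sb] s(2) by simp
  define a where "a = op_abs s"
  have a: "pos_op a" "a \<in> M" unfolding a_def by (rule pos_op_abs[OF sb], rule abs_mem[OF s(1)])
  have aa: "a (a \<xi>) = s (s \<xi>)" for \<xi> using abs_square[OF sb, of \<xi>] s(2) by (simp add: a_def)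
  have as: "s (a \<xi>) = a (s \<xi>)" for \<xi>
    unfolding a_def op_abs_def by (rule sqrt_commute[OF pos_op_adj_compose[OF sb]]) (simp add: blinfun_eqI s(2))
  have sg: "s (g \<xi>) = s \<xi>" for \<xi>
    by (rule cinner_eqI) (simp add: ssym is_projD(3)[OF pg] g(2))
  have ag: "a (g \<xi>) = a \<xi>" for \<xi>
    using norm_op_abs[OF sb, of "g \<xi> - \<xi>"] by (simp add: a_def blinfun_simps sg)
  have ga: "g (a \<xi>) = a \<xi>" for \<xi>
    by (rule cinner_eqI) (simp add: pos_op_hermitian[OF a(1)] is_projD(3)[OF pg] ag)
  define b where "b = a + s"
  have b: "b \<in> M" unfolding b_def by (intro add a s)
  have bsym: "cinner (b \<xi>) \<eta> = cinner \<xi> (b \<eta>)" for \<xi> \<eta>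
    by (simp add: b_def blinfun_simps cinner_simps ssym pos_op_hermitian[OF a(1)])
  define S where "S = closed_hull (range (blinfun_apply b))"
  have S: "csubspace S" "closed S" unfolding S_def by simp_all
  have bS: "b \<xi> \<in> S" for \<xi> unfolding S_def by (rule subsetD[OF closed_hull_superset]) simp
  define f where "f = proj_on S"
  have f: "f \<in> projections M"
    unfolding f_def
  proof (rule proj_on_mem[OF S])
    fix y \<xi> assume y: "y \<in> commutant M" and \<xi>: "\<xi> \<in> S"
    show "y \<xi> \<in> S"
      unfolding S_def
    proof (rule closed_hull_invariant[OF commutantD(1)[OF y] _ \<xi>[unfolded S_def]])
      fix \<eta> assume "\<eta> \<in> range (blinfun_apply b)"
      then obtain \<zeta> where "\<eta> = b \<zeta>" by auto
      then show "y \<eta> \<in> closed_hull (range (blinfun_apply b))" using bS comm[OF y b] by (simp add: S_def)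
    qed
  qed
  note pf = projectionsD(1)[OF f]
  have least: "P \<zeta>" if "csubspace {\<zeta>. P \<zeta>}" "closed {\<zeta>. P \<zeta>}" "\<And>\<xi>. P (b \<xi>)" "\<zeta> \<in> S" for P \<zeta>
    using closed_hull_least[OF that(1,2), of "range (blinfun_apply b)"] that(3,4) unfolding S_def by blast
  have fS: "f \<xi> \<in> S" for \<xi> unfolding f_def by (rule proj_on_in[OF S])
  have "g \<zeta> = \<zeta>" if "\<zeta> \<in> S" for \<zeta>
    by (rule least[OF fix_csubspace[OF is_projD(1)[OF pg]] _ that]) (simp add: b_def blinfun_simps ga g(2))
  then have fg: "proj_le f g" using fS by (simp add: proj_le_iff)
  have b2a: "b \<zeta> = a \<zeta> + a \<zeta>" if "\<zeta> \<in> S" for \<zeta>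
  proof (rule least[OF _ _ _ that])
    show "csubspace {\<zeta>. b \<zeta> = a \<zeta> + a \<zeta>}"
      using bdd[OF b] bdd[OF a(2)] by (simp add: csubspace_def blinfun_simps bounded_opsD scaleC_add_right)
    show "closed {\<zeta>. b \<zeta> = a \<zeta> + a \<zeta>}"
      by (intro closed_Collect_eq continuous_intros)
    show "b (b \<xi>) = a (b \<xi>) + a (b \<xi>)" for \<xi> by (simp add: b_def blinfun_simps as aa)
  qed
  have b0: "b \<xi> = 0" if "f \<xi> = 0" for \<xi>
  proof -
    have "cinner (b \<xi>) (b \<xi>) = cinner \<xi> (b (b \<xi>))" by (rule bsym)
    also have "\<dots> = cinner (\<xi> - f \<xi>) (b (b \<xi>))" by (simp add: that)
    also have "\<dots> = 0" unfolding f_def by (rule proj_on_orth[OF S bS])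
    finally show ?thesis by simp
  qed
  show ?thesis
  proof (rule that[OF f fg])
    fix \<xi>
    have "s (f \<xi>) = a (f \<xi>)" using b2a[OF fS, of \<xi>] by (simp add: b_def blinfun_simps)
    then show "0 \<le> Re (cinner (s (f \<xi>)) (f \<xi>))" using pos_op_Re[OF a(1)] by simp
  next
    fix \<xi> assume "f \<xi> = 0"
    then have "s \<xi> = - a \<xi>" using b0[of \<xi>] by (simp add: b_def blinfun_simps eq_neg_iff_add_eq_0 add.commute)
    then show "Re (cinner (s \<xi>) \<xi>) \<le> 0" using pos_op_Re[OF a(1), of \<xi>] by (simp add: cinner_minus_left)
  qed
qed

text \<open>If all projections below \<open>r\<close> are central in the corner of \<open>r\<close>, the corner is commutative: bisecting
  the spectrum of a self-adjoint element by central projections bounds its commutators by an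
  arbitrarily small multiple of the length of the spectral interval.\<close>

lemma commutator_bisection:
  assumes r: "r \<in> projections M"
    and central: "\<And>f x \<xi>. f \<in> projections M \<Longrightarrow> proj_le f r \<Longrightarrow> x \<in> M \<Longrightarrow> f (x (r \<xi> - f \<xi>)) = 0"
    and t: "t \<in> M" "adj t = t" "\<And>\<xi>. r (t \<xi>) = t \<xi>" "\<And>\<xi>. t (r \<xi>) = t \<xi>"
    and y: "y \<in> M" "\<And>\<xi>. r (y \<xi>) = y \<xi>" "\<And>\<xi>. y (r \<xi>) = y \<xi>"
    and g: "g \<in> projections M" "proj_le g r" and ab: "\<alpha> \<le> \<beta>"
    and bounds: "\<And>\<xi>. g \<xi> = \<xi> \<Longrightarrow> \<alpha> * (norm \<xi>)\<^sup>2 \<le> Re (cinner (t \<xi>) \<xi>) \<and> Re (cinner (t \<xi>) \<xi>) \<le> \<beta> * (norm \<xi>)\<^sup>2"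
  shows "norm (t (y (g \<xi>)) - y (t (g \<xi>))) \<le> (\<beta> - \<alpha>) / 2 ^ k * norm y * norm \<xi>"
  using g ab bounds
proof (induction k arbitrary: g \<alpha> \<beta> \<xi>)
  note pr = projectionsD(1)[OF r] and tb = bdd[OF t(1)]
  have tsym: "cinner (t \<xi>) \<eta> = cinner \<xi> (t \<eta>)" for \<xi> \<eta> using adj_cinner[OF tb] t(2) by simp
  have cen: "f (x \<xi>) = x (f \<xi>)"
    if f: "f \<in> projections M" "proj_le f r" and x: "x \<in> M" "\<And>\<xi>. r (x \<xi>) = x \<xi>" "\<And>\<xi>. x (r \<xi>) = x \<xi>" for f x \<xi>
  proof -
    note pf = projectionsD(1)[OF f(1)]
    have fr: "f (r \<xi>) = f \<xi>" "r (f \<xi>) = f \<xi>" for \<xi>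
      using f(2) proj_le_absorb_right[OF pf pr f(2)] by (simp_all add: proj_le_iff)
    have rf: "r - f \<in> projections M" "proj_le (r - f) r"
      by (intro projectionsI is_proj_diff[OF pf pr f(2)] diff projectionsD(2)[OF r] projectionsD(2)[OF f(1)])
        (simp add: proj_le_iff blinfun_simps is_projD(2)[OF pr] fr)
    have "f (x (r \<xi>)) = f (x (f \<xi>))" using central[OF f x(1), of \<xi>] by (simp add: blinfun_simps)
    moreover have "r (x (f \<xi>)) = f (x (f \<xi>))"
      using central[OF rf x(1), of \<xi>] by (simp add: blinfun_simps)
    ultimately show ?thesis by (simp add: x)
  qed
  {
    case 0
    note pg = projectionsD(1)[OF 0(1)]
    define \<gamma> where "\<gamma> = (\<alpha> + \<beta>) / 2"
    define h where "h = (\<beta> - \<alpha>) / 2"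
    define s where "s = (t o\<^sub>L g) - \<gamma> *\<^sub>R g"
    have gt: "g (t \<xi>) = t (g \<xi>)" and gy: "g (y \<xi>) = y (g \<xi>)" for \<xi>
      using cen[OF 0(1,2) t(1,3,4)] cen[OF 0(1,2) y] by auto
    have h: "0 \<le> h" using 0(3) by (simp add: h_def)
    have form: "Re (cinner (s \<xi>) \<xi>) = Re (cinner (t (g \<xi>)) (g \<xi>)) - \<gamma> * (norm (g \<xi>))\<^sup>2" for \<xi>
    proof -
      have "s \<xi> = g (t (g \<xi>) - \<gamma> *\<^sub>R g \<xi>)"
        by (simp add: s_def blinfun_simps gt is_projD(2)[OF pg])
      then have "cinner (s \<xi>) \<xi> = cinner (t (g \<xi>) - \<gamma> *\<^sub>R g \<xi>) (g \<xi>)" by (simp only: is_projD(3)[OF pg])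
      then show ?thesis by (simp add: cinner_simps cinner_norm)
    qed
    have bd: "Re (cinner (s \<xi>) \<xi>) \<le> h * (norm \<xi>)\<^sup>2 \<and> - (h * (norm \<xi>)\<^sup>2) \<le> Re (cinner (s \<xi>) \<xi>)" for \<xi>
    proof -
      have b: "\<alpha> * (norm (g \<xi>))\<^sup>2 \<le> Re (cinner (t (g \<xi>)) (g \<xi>)) \<and> Re (cinner (t (g \<xi>)) (g \<xi>)) \<le> \<beta> * (norm (g \<xi>))\<^sup>2"
        by (rule 0(4)) (rule is_projD(2)[OF pg])
      have "Re (cinner (s \<xi>) \<xi>) \<le> h * (norm (g \<xi>))\<^sup>2 \<and> - (h * (norm (g \<xi>))\<^sup>2) \<le> Re (cinner (s \<xi>) \<xi>)"
        using b by (simp add: form h_def \<gamma>_def field_simps)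
      moreover have "h * (norm (g \<xi>))\<^sup>2 \<le> h * (norm \<xi>)\<^sup>2"
        using h by (intro mult_left_mono power_mono proj_norm_le pg) auto
      ultimately show ?thesis by linarith
    qed
    have sM: "s \<in> M" unfolding s_def by (intro diff compose scaleR t(1) projectionsD(2)[OF 0(1)])
    have ssym: "cinner (s \<xi>) \<eta> = cinner \<xi> (s \<eta>)" for \<xi> \<eta>
      by (simp add: s_def blinfun_simps cinner_simps tsym is_projD(3)[OF pg] gt)
    have ns: "norm (s \<xi>) \<le> h * norm \<xi>" for \<xi>
    proof (rule norm_le_if_form_le[OF h])
      show "pos_op (h *\<^sub>R id_blinfun + s)" "pos_op (h *\<^sub>R id_blinfun - s)"
        using bd by (auto intro!: pos_opI bounded_ops_intros bdd[OF sM]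
            simp: blinfun_simps cinner_simps ssym Re_cinner_self) (smt (verit))
    qed
    have "t (y (g \<xi>)) - y (t (g \<xi>)) = s (y \<xi>) - y (s \<xi>)"
      by (simp add: s_def blinfun_simps gy)
    also have "norm \<dots> \<le> norm (s (y \<xi>)) + norm (y (s \<xi>))" by (rule norm_triangle_ineq4)
    also have "\<dots> \<le> h * (norm y * norm \<xi>) + norm y * (h * norm \<xi>)"
      by (intro add_mono order_trans[OF ns] order_trans[OF norm_blinfun] mult_left_mono norm_blinfun ns h) simp
    also have "\<dots> = (\<beta> - \<alpha>) / 2 ^ 0 * norm y * norm \<xi>" by (simp add: h_def field_simps)
    finally show ?case .
  next
    case (Suc k)
    note pg = projectionsD(1)[OF Suc.prems(1)] and gM = projectionsD(2)[OF Suc.prems(1)]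
    have gt: "g (t \<xi>) = t (g \<xi>)" for \<xi> by (rule cen[OF Suc.prems(1,2) t(1,3,4)])
    define \<gamma> where "\<gamma> = (\<alpha> + \<beta>) / 2"
    define s where "s = (t o\<^sub>L g) - \<gamma> *\<^sub>R g"
    have sM: "s \<in> M" unfolding s_def by (intro diff compose scaleR t(1) gM)
    have "adj s = s"
      by (rule adj_eqI[OF bdd[OF sM]]) (simp add: s_def blinfun_simps cinner_simps tsym is_projD(3)[OF pg] gt)
    moreover have "g (s \<xi>) = s \<xi>" for \<xi> by (simp add: s_def blinfun_simps gt is_projD(2)[OF pg])
    ultimately obtain f where f: "f \<in> projections M" "proj_le f g"
      "\<And>\<xi>. 0 \<le> Re (cinner (s (f \<xi>)) (f \<xi>))" "\<And>\<xi>. f \<xi> = 0 \<Longrightarrow> Re (cinner (s \<xi>) \<xi>) \<le> 0"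
      by (rule positive_spectral_projection[OF sM _ Suc.prems(1)]) (rule that)
    note pf = projectionsD(1)[OF f(1)]
    have fr: "proj_le f r" by (rule proj_le_trans[OF f(2) Suc.prems(2)])
    have gf: "g (f \<xi>) = f \<xi>" "f (g \<xi>) = f \<xi>" for \<xi>
      using f(2) proj_le_absorb_right[OF pf pg f(2)] by (simp_all add: proj_le_iff)
    have g': "g - f \<in> projections M" "proj_le (g - f) r"
    proof -
      show "g - f \<in> projections M"
        by (intro projectionsI is_proj_diff[OF pf pg f(2)] diff gM projectionsD(2)[OF f(1)])
      have "r (g \<xi>) = g \<xi>" "r (f \<xi>) = f \<xi>" for \<xi> using Suc.prems(2) fr by (simp_all add: proj_le_iff)
      then show "proj_le (g - f) r" by (simp add: proj_le_iff blinfun_simps)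
    qed
    let ?c = "\<lambda>\<xi>. t (y \<xi>) - y (t \<xi>)"
    have sform: "Re (cinner (s \<xi>) \<xi>) = Re (cinner (t \<xi>) \<xi>) - \<gamma> * (norm \<xi>)\<^sup>2" if "g \<xi> = \<xi>" for \<xi>
      using that by (simp add: s_def blinfun_simps cinner_simps cinner_norm)
    have 1: "norm (?c (f \<xi>)) \<le> (\<beta> - \<alpha>) / 2 ^ Suc k * norm y * norm \<xi>" for \<xi>
    proof -
      have "norm (?c (f \<xi>)) \<le> (\<beta> - \<gamma>) / 2 ^ k * norm y * norm \<xi>"
      proof (rule Suc.IH[OF f(1) fr])
        show "\<gamma> \<le> \<beta>" using Suc.prems(3) by (simp add: \<gamma>_def)
        fix \<zeta> assume \<zeta>: "f \<zeta> = \<zeta>"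
        then have "g \<zeta> = \<zeta>" using gf(1)[of \<zeta>] by simp
        then show "\<gamma> * (norm \<zeta>)\<^sup>2 \<le> Re (cinner (t \<zeta>) \<zeta>) \<and> Re (cinner (t \<zeta>) \<zeta>) \<le> \<beta> * (norm \<zeta>)\<^sup>2"
          using f(3)[of \<zeta>] sform[of \<zeta>] Suc.prems(4)[of \<zeta>] by (simp add: \<zeta>)
      qed
      also have "(\<beta> - \<gamma>) / 2 ^ k = (\<beta> - \<alpha>) / 2 ^ Suc k" by (simp add: \<gamma>_def field_simps)
      finally show ?thesis .
    qed
    have 2: "norm (?c ((g - f) \<xi>)) \<le> (\<beta> - \<alpha>) / 2 ^ Suc k * norm y * norm \<xi>" for \<xi>
    proof -
      have "norm (?c ((g - f) \<xi>)) \<le> (\<gamma> - \<alpha>) / 2 ^ k * norm y * norm \<xi>"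
      proof (rule Suc.IH[OF g'])
        show "\<alpha> \<le> \<gamma>" using Suc.prems(3) by (simp add: \<gamma>_def)
        fix \<zeta> assume \<zeta>: "(g - f) \<zeta> = \<zeta>"
        then have e: "g \<zeta> - f \<zeta> = \<zeta>" by (simp add: blinfun_simps)
        from arg_cong[OF e, of "blinfun_apply g"] have "f \<zeta> = 0"
          by (simp add: blinfun.diff_right gf is_projD(2)[OF pg])
        moreover from this e have "g \<zeta> = \<zeta>" by simp
        ultimately have "f \<zeta> = 0" "g \<zeta> = \<zeta>" by simp_all
        then show "\<alpha> * (norm \<zeta>)\<^sup>2 \<le> Re (cinner (t \<zeta>) \<zeta>) \<and> Re (cinner (t \<zeta>) \<zeta>) \<le> \<gamma> * (norm \<zeta>)\<^sup>2"
          using f(4)[of \<zeta>] sform[of \<zeta>] Suc.prems(4)[of \<zeta>] by simp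
      qed
      also have "(\<gamma> - \<alpha>) / 2 ^ k = (\<beta> - \<alpha>) / 2 ^ Suc k" by (simp add: \<gamma>_def field_simps)
      finally show ?thesis .
    qed
    define K where "K = (\<beta> - \<alpha>) / 2 ^ Suc k * norm y"
    have K: "0 \<le> K" using Suc.prems(3) by (simp add: K_def)
    have cf: "?c (f \<xi>) = f (?c \<xi>)" for \<xi>
      by (simp add: blinfun_simps cen[OF f(1) fr t(1,3,4)] cen[OF f(1) fr y])
    have cg: "?c (g \<xi>) = g (?c \<xi>)" for \<xi>
      by (simp add: blinfun_simps gt cen[OF Suc.prems(1,2) y])
    have split: "?c (g \<xi>) = ?c (f \<xi>) + ?c ((g - f) \<xi>)" by (simp add: blinfun_simps)
    have "cinner (?c (f \<xi>)) (?c ((g - f) \<xi>)) = 0"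
    proof -
      have "?c ((g - f) \<xi>) = ?c (g \<xi>) - ?c (f \<xi>)" by (simp add: blinfun_simps)
      also have "\<dots> = g (?c \<xi>) - f (?c \<xi>)" unfolding cf cg ..
      finally have "f (?c ((g - f) \<xi>)) = 0" by (simp add: blinfun.diff_right gf is_projD(2)[OF pf])
      then show ?thesis unfolding cf by (simp add: is_projD(3)[OF pf])
    qed
    then have "(norm (?c (g \<xi>)))\<^sup>2 = (norm (?c (f \<xi>)))\<^sup>2 + (norm (?c ((g - f) \<xi>)))\<^sup>2"
      unfolding split by (rule pythagoras)
    also have "\<dots> \<le> (K * norm (f \<xi>))\<^sup>2 + (K * norm ((g - f) \<xi>))\<^sup>2"
      using 1[of "f \<xi>"] 2[of "(g - f) \<xi>"] is_projD(2)[OF pf, of \<xi>] is_projD(2)[OF projectionsD(1)[OF g'(1)], of \<xi>]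
      by (intro add_mono power_mono) (simp_all add: K_def)
    also have "\<dots> = K\<^sup>2 * ((norm (f \<xi>))\<^sup>2 + (norm ((g - f) \<xi>))\<^sup>2)" by (simp add: power_mult_distrib distrib_left)
    also have "(norm (f \<xi>))\<^sup>2 + (norm ((g - f) \<xi>))\<^sup>2 = (norm (g \<xi>))\<^sup>2"
      using proj_pythagoras[OF pf, of "g \<xi>"] by (simp add: gf blinfun_simps)
    also have "K\<^sup>2 * (norm (g \<xi>))\<^sup>2 \<le> K\<^sup>2 * (norm \<xi>)\<^sup>2" by (intro mult_left_mono power_mono proj_norm_le pg) auto
    also have "\<dots> = (K * norm \<xi>)\<^sup>2" by (simp add: power_mult_distrib)
    finally have "norm (?c (g \<xi>)) \<le> K * norm \<xi>" by (rule power2_le_imp_le) (simp add: K)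
    then show ?case by (simp add: K_def)
  }
qed

text \<open>Self-adjoint elements of the corner commute with everything by bisection; the general element is a combination of
  two self-adjoint ones.\<close>

lemma abelian_if_central_projections:
  assumes r: "r \<in> projections M"
    and central: "\<And>f x \<xi>. f \<in> projections M \<Longrightarrow> proj_le f r \<Longrightarrow> x \<in> M \<Longrightarrow> f (x (r \<xi> - f \<xi>)) = 0"
  shows "abelian_projection M r"
proof -
  note pr = projectionsD(1)[OF r] and rM = projectionsD(2)[OF r]
  have sa: "t (y \<xi>) = y (t \<xi>)"
    if t: "t \<in> M" "adj t = t" "\<And>\<xi>. r (t \<xi>) = t \<xi>" "\<And>\<xi>. t (r \<xi>) = t \<xi>"
    and y: "y \<in> M" "\<And>\<xi>. r (y \<xi>) = y \<xi>" "\<And>\<xi>. y (r \<xi>) = y \<xi>" for t y \<xi>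
  proof -
    have b: "- norm t * (norm \<xi>)\<^sup>2 \<le> Re (cinner (t \<xi>) \<xi>) \<and> Re (cinner (t \<xi>) \<xi>) \<le> norm t * (norm \<xi>)\<^sup>2" for \<xi>
    proof -
      have "\<bar>Re (cinner (t \<xi>) \<xi>)\<bar> \<le> norm (t \<xi>) * norm \<xi>"
        using abs_Re_le_cmod cauchy_schwarz order_trans by blast
      also have "\<dots> \<le> (norm t * norm \<xi>) * norm \<xi>" by (intro mult_right_mono norm_blinfun) simp
      finally show ?thesis by (simp add: power2_eq_square abs_le_iff)
    qed
    have "norm (t (y (r \<xi>)) - y (t (r \<xi>))) \<le> (norm t - - norm t) / 2 ^ k * norm y * norm \<xi>" for k
      by (rule commutator_bisection[OF r central t y r proj_le_refl[OF pr]]) (use b in auto)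
    then have le: "norm (t (y \<xi>) - y (t \<xi>)) \<le> (2 * norm t * norm y * norm \<xi>) * (1/2) ^ k" for k
      by (simp add: t y power_one_over field_simps)
    have "(\<lambda>k. (2 * norm t * norm y * norm \<xi>) * (1/2) ^ k) \<longlonglongrightarrow> 0"
      by (intro tendsto_mult_right_zero LIMSEQ_realpow_zero) auto
    then have "norm (t (y \<xi>) - y (t \<xi>)) \<le> 0" using le by (intro LIMSEQ_le_const) auto
    then show ?thesis by simp
  qed
  show ?thesis
    unfolding abelian_projection_iff
  proof (intro conjI ballI allI r)
    fix x y \<xi> assume x: "x \<in> M" and y: "y \<in> M"
    define X where "X = r o\<^sub>L x o\<^sub>L r"
    define Y where "Y = r o\<^sub>L y o\<^sub>L r"
    have X: "X \<in> M" "\<And>\<xi>. r (X \<xi>) = X \<xi>" "\<And>\<xi>. X (r \<xi>) = X \<xi>"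
      and Y: "Y \<in> M" "\<And>\<xi>. r (Y \<xi>) = Y \<xi>" "\<And>\<xi>. Y (r \<xi>) = Y \<xi>"
      by (simp_all add: X_def Y_def compose rM x y is_projD(2)[OF pr])
    note Xb = bdd[OF X(1)]
    have X': "adj X \<in> M" "\<And>\<xi>. r (adj X \<xi>) = adj X \<xi>" "\<And>\<xi>. adj X (r \<xi>) = adj X \<xi>"
    proof -
      show "r (adj X \<xi>) = adj X \<xi>" for \<xi>
        by (rule cinner_eqI) (simp add: is_projD(3)[OF pr] adj_cinner'[OF Xb] X)
      show "adj X (r \<xi>) = adj X \<xi>" for \<xi>
        by (rule cinner_eqI) (simp add: is_projD(3)[OF pr] adj_cinner'[OF Xb] X)
    qed (rule adj[OF X(1)])
    define t1 where "t1 = X + adj X"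
    define t2 where "t2 = imag_unit o\<^sub>L (X - adj X)"
    have 1: "t1 (Y \<xi>) = Y (t1 \<xi>)" for \<xi>
    proof (rule sa[OF _ _ _ _ Y])
      show "t1 \<in> M" by (simp add: t1_def add X X')
      show "adj t1 = t1" by (simp add: t1_def adj_add Xb add.commute)
    qed (simp_all add: t1_def blinfun_simps X X')
    have 2: "t2 (Y \<xi>) = Y (t2 \<xi>)" for \<xi>
    proof (rule sa[OF _ _ _ _ Y])
      show t2M: "t2 \<in> M" unfolding t2_def by (intro imag diff X X')
      show "adj t2 = t2"
        by (rule adj_eqI[OF bdd[OF t2M]])
          (simp add: t2_def cinner_scaleC_left cinner_scaleC_right blinfun_simps cinner_simps adj_cinner'[OF Xb] adj_cinner[OF Xb] algebra_simps)
      show "r (t2 \<xi>) = t2 \<xi>" for \<xi> by (simp add: t2_def bounded_opsD[OF is_projD(1)[OF pr]] blinfun_simps X X')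
      show "t2 (r \<xi>) = t2 \<xi>" for \<xi> by (simp add: t2_def blinfun_simps X X')
    qed
    have XY: "X (Y \<xi>) = Y (X \<xi>)" for \<xi>
    proof -
      have "\<i> *\<^sub>C (X (Y \<xi>) - adj X (Y \<xi>)) = \<i> *\<^sub>C Y (X \<xi> - adj X \<xi>)"
        using 2[of \<xi>] by (simp add: t2_def blinfun_simps bounded_opsD[OF bdd[OF Y(1)]] scaleC_diff_right)
      then have "(- \<i>) *\<^sub>C (\<i> *\<^sub>C (X (Y \<xi>) - adj X (Y \<xi>))) = (- \<i>) *\<^sub>C (\<i> *\<^sub>C Y (X \<xi> - adj X \<xi>))" by simp
      then have "X (Y \<xi>) - adj X (Y \<xi>) = Y (X \<xi>) - Y (adj X \<xi>)" by (simp add: scaleC_scaleC blinfun_simps)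
      moreover have "X (Y \<xi>) + adj X (Y \<xi>) = Y (X \<xi>) + Y (adj X \<xi>)" using 1[of \<xi>] by (simp add: t1_def blinfun_simps)
      ultimately have "(X (Y \<xi>) - adj X (Y \<xi>)) + (X (Y \<xi>) + adj X (Y \<xi>)) = (Y (X \<xi>) - Y (adj X \<xi>)) + (Y (X \<xi>) + Y (adj X \<xi>))" by simp
      then have "2 *\<^sub>R X (Y \<xi>) = 2 *\<^sub>R Y (X \<xi>)" by (simp add: scaleR_2)
      then show ?thesis by simp
    qed
    show "r (x (r (r (y (r \<xi>))))) = r (y (r (r (x (r \<xi>)))))" using XY[of \<xi>] by (simp add: X_def Y_def)
  qed
qed

text \<open>Some \<open>f \<le> r\<close> is not central in the corner of \<open>r\<close>, so \<open>f x (r - f)\<close> is non-zero for some \<open>x\<close>. The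
  initial and final projections of its polar decomposition are equivalent, and lie under the orthogonal
  projections \<open>r - f\<close> and \<open>f\<close>.\<close>

lemma nonabelian_split:
  assumes r: "r \<in> projections M" "\<not> abelian_projection M r"
  obtains u where "u \<in> M" "u \<noteq> 0" "u o\<^sub>L adj u o\<^sub>L u = u" "adj u o\<^sub>L u \<in> projections M" "u o\<^sub>L adj u \<in> projections M"
    "proj_le (adj u o\<^sub>L u) r" "proj_le (u o\<^sub>L adj u) r" "(u o\<^sub>L adj u) o\<^sub>L (adj u o\<^sub>L u) = 0"
proof -
  obtain f x \<xi> where f: "f \<in> projections M" "proj_le f r" and x: "x \<in> M" "f (x (r \<xi> - f \<xi>)) \<noteq> 0"
    using abelian_if_central_projections[OF r(1)] r(2) by blast
  note pf = projectionsD(1)[OF f(1)] and pr = projectionsD(1)[OF r(1)]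
  have rf: "is_proj (r - f)" by (rule is_proj_diff[OF pf pr f(2)])
  have fr: "f (r \<xi>) = f \<xi>" for \<xi> by (rule proj_le_absorb_right[OF pf pr f(2)])
  have rfr: "r ((r - f) \<xi>) = (r - f) \<xi>" for \<xi> using f(2) by (simp add: blinfun_simps proj_le_iff is_projD(2)[OF pr])
  define w where "w = f o\<^sub>L x o\<^sub>L (r - f)"
  have w0: "w \<noteq> 0"
  proof
    assume "w = 0"
    then have "w \<xi> = 0" by simp
    then show False using x(2) by (simp add: w_def blinfun_simps)
  qed
  have wM: "w \<in> M" unfolding w_def by (intro compose diff x(1) projectionsD(2)[OF f(1)] projectionsD(2)[OF r(1)])
  have fw: "f (w \<zeta>) = w \<zeta>" and wrf: "w ((r - f) \<zeta>) = w \<zeta>" for \<zeta>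
    by (simp_all add: w_def is_projD(2)[OF pf] is_projD(2)[OF rf])
  obtain u where u: "u \<in> M" "u \<noteq> 0" "u o\<^sub>L adj u o\<^sub>L u = u" "adj u o\<^sub>L u \<in> projections M" "u o\<^sub>L adj u \<in> projections M"
    "proj_le (adj u o\<^sub>L u) (r - f)" "proj_le (u o\<^sub>L adj u) f"
    by (rule polar_decomposition[OF wM w0 fw rf wrf]) (rule that)
  have "proj_le (adj u o\<^sub>L u) r" by (rule proj_le_trans[OF u(6)]) (simp add: proj_le_iff rfr)
  moreover have "proj_le (u o\<^sub>L adj u) r" by (rule proj_le_trans[OF u(7) f(2)])
  moreover have "(u o\<^sub>L adj u) o\<^sub>L (adj u o\<^sub>L u) = 0"
  proof (rule blinfun_eqI)
    fix \<zeta>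
    let ?\<eta> = "(adj u o\<^sub>L u) \<zeta>"
    have "(r - f) ?\<eta> = ?\<eta>" using u(6) by (simp add: proj_le_iff)
    then have "f ?\<eta> = f (r ?\<eta> - f ?\<eta>)" by (metis blinfun.diff_left)
    then have "f ?\<eta> = 0" by (simp only: blinfun.diff_right fr is_projD(2)[OF pf]) simp
    moreover have "(u o\<^sub>L adj u) (f ?\<eta>) = (u o\<^sub>L adj u) ?\<eta>"
      by (rule proj_le_absorb_right[OF projectionsD(1)[OF u(5)] pf u(7)])
    ultimately show "((u o\<^sub>L adj u) o\<^sub>L (adj u o\<^sub>L u)) \<zeta> = blinfun_apply 0 \<zeta>" by simp
  qed
  ultimately show ?thesis using that u by blast
qed

end

context dimension_algebra
begin

text \<open>By Zorn's lemma there is a maximal subprojection of at most half the dimension. Where it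
  vanishes, \<open>e\<close> must vanish too, since otherwise one of two orthogonal equivalent parts of \<open>e\<close> could
  be added there.\<close>

lemma halving:
  assumes e: "e \<in> projections M" and na: "\<And>r. r \<in> projections M \<Longrightarrow> proj_le r e \<Longrightarrow> abelian_projection M r \<Longrightarrow> r = 0"
  obtains f where "f \<in> projections M" "proj_le f e" "AE \<omega> in \<mu>. d f \<omega> \<le> d e \<omega> / 2"
    "\<And>E. E \<in> sets \<mu> \<Longrightarrow> chi E o\<^sub>L f = 0 \<Longrightarrow> chi E o\<^sub>L e = 0"
proof -
  note pe = projectionsD(1)[OF e] and [measurable] = d_measurable[OF e]
  define S where "S = {f \<in> projections M. proj_le f e \<and> (AE \<omega> in \<mu>. d f \<omega> \<le> d e \<omega> / 2)}"
  have "\<exists>m\<in>S. \<forall>a\<in>S. proj_le m a \<longrightarrow> a = m"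
  proof (rule predicate_Zorn)
    show "partial_order_on S (relation_of proj_le S)"
      by (rule partial_order_on_relation_ofI)
        (auto simp: S_def intro: proj_le_refl projectionsD proj_le_trans proj_le_antisym)
    fix C assume C: "C \<in> Chains (relation_of proj_le S)"
    then have CS: "C \<subseteq> S" by (rule Chains_relation_of)
    show "\<exists>u\<in>S. \<forall>a\<in>C. proj_le a u"
    proof (cases "C = {}")
      case True
      have "AE \<omega> in \<mu>. d 0 \<omega> \<le> d e \<omega> / 2" using d_zero by eventually_elim simp
      then have "0 \<in> S" by (simp add: S_def projectionsI proj_le_iff)
      then show ?thesis using True by blast
    next
      case False
      have CP: "C \<subseteq> projections M" using CS by (auto simp: S_def)
      have "AE \<omega> in \<mu>. d (proj_sup C) \<omega> \<le> d e \<omega> / 2"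
      proof (rule d_sup[OF CP False])
        show "\<exists>c\<in>C. proj_le a c \<and> proj_le b c" if "a \<in> C" "b \<in> C" for a b
          using C that CP proj_le_refl projectionsD(1) unfolding Chains_def relation_of_def by blast
        show "is_proj_sup M C (proj_sup C)" using is_proj_sup_iff[OF CP] by simp
        show "(\<lambda>\<omega>. d e \<omega> / 2) \<in> borel_measurable \<mu>" by measurable
      qed (use CS in \<open>auto simp: S_def\<close>)
      moreover have "proj_le (proj_sup C) e" by (rule proj_sup_least[OF pe]) (use CS in \<open>auto simp: S_def\<close>)
      ultimately have "proj_sup C \<in> S" using proj_sup_mem[OF CP] by (simp add: S_def)
      then show ?thesis using proj_sup_upper by blast
    qed
  qed
  then obtain m where m: "m \<in> projections M" "proj_le m e" "AE \<omega> in \<mu>. d m \<omega> \<le> d e \<omega> / 2"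
    and max: "\<And>a. a \<in> S \<Longrightarrow> proj_le m a \<Longrightarrow> a = m" by (auto simp: S_def)
  note pm = projectionsD(1)[OF m(1)]
  show ?thesis
  proof (rule that[OF m])
    fix E assume E: "E \<in> sets \<mu>" and Em: "chi E o\<^sub>L m = 0"
    note Ec = chi_center_proj[OF E]
    note r = center_proj_cut[OF Ec e]
    show "chi E o\<^sub>L e = 0"
    proof (rule ccontr)
      assume "chi E o\<^sub>L e \<noteq> 0"
      then have "\<not> abelian_projection M (chi E o\<^sub>L e)" using na r by blast
      from nonabelian_split[OF r(1) this] obtain u where u: "u \<in> M" "u \<noteq> 0" "u o\<^sub>L adj u o\<^sub>L u = u"
        "adj u o\<^sub>L u \<in> projections M" "u o\<^sub>L adj u \<in> projections M"
        "proj_le (adj u o\<^sub>L u) (chi E o\<^sub>L e)" "proj_le (u o\<^sub>L adj u) (chi E o\<^sub>L e)"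
        "(u o\<^sub>L adj u) o\<^sub>L (adj u o\<^sub>L u) = 0" by metis
      define p where "p = adj u o\<^sub>L u"
      define q where "q = u o\<^sub>L adj u"
      have p: "p \<in> projections M" "proj_le p (chi E o\<^sub>L e)" and q: "q \<in> projections M" "proj_le q (chi E o\<^sub>L e)"
        and qp: "q o\<^sub>L p = 0" using u by (simp_all add: p_def q_def)
      note pp = projectionsD(1)[OF p(1)] and pq = projectionsD(1)[OF q(1)]
      have pe': "proj_le p e" by (rule proj_le_trans[OF p(2) r(2)])
      have chip: "chi E (p \<xi>) = p \<xi>" for \<xi>
      proof -
        have "p \<xi> = chi E (e (p \<xi>))" using p(2) by (simp add: proj_le_iff)
        then show ?thesis by (metis is_projD(2) chi_proj[OF E])
      qed
      have qpP: "q + p \<in> projections M"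
        by (intro projectionsI is_proj_orth_sum(1)[OF pq pp qp] add projectionsD(2)[OF p(1)] projectionsD(2)[OF q(1)])
      have "proj_le (q + p) (chi E o\<^sub>L e)" using p(2) q(2) by (simp add: proj_le_iff blinfun_simps)
      then have "proj_le (q + p) e" using proj_le_trans r(2) by blast
      from d_mono[OF qpP e this] d_add[OF q(1) p(1) qp] d_equiv[OF u(1,3)]
      have half: "AE \<omega> in \<mu>. d p \<omega> \<le> d e \<omega> / 2"
        unfolding p_def[symmetric] q_def[symmetric]
      proof eventually_elim
        case (elim \<omega>)
        then have "d p \<omega> * 2 \<le> d e \<omega>" by (simp add: mult_2_right)
        then have "d p \<omega> * 2 / 2 \<le> d e \<omega> / 2" by (rule divide_right_mono_ennreal)
        then show ?case by (simp add: ennreal_mult_divide_eq)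
      qed
      have mp: "m o\<^sub>L p = 0"
      proof (rule blinfun_eqI)
        fix \<xi>
        have "m (chi E (p \<xi>)) = chi E (m (p \<xi>))" using chi_commute[OF E projectionsD(2)[OF m(1)]] by simp
        also have "\<dots> = 0" using blinfun_compose_eqD[OF Em, of "p \<xi>"] by simp
        finally show "(m o\<^sub>L p) \<xi> = blinfun_apply 0 \<xi>" by (simp add: chip)
      qed
      have mpP: "m + p \<in> projections M"
        by (intro projectionsI is_proj_orth_sum(1)[OF pm pp mp] add projectionsD(2)[OF p(1)] projectionsD(2)[OF m(1)])
      have pc: "chi E o\<^sub>L p = p" by (rule blinfun_eqI) (simp add: chip)
      have dm: "AE \<omega> in \<mu>. \<omega> \<in> E \<longrightarrow> d m \<omega> = 0" using Em chi_cut_eq_0_iff[OF E m(1)] by blast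
      have "AE \<omega> in \<mu>. d (m + p) \<omega> \<le> d e \<omega> / 2"
        using d_add[OF m(1) p(1) mp] d_chi[OF E p(1)] dm m(3) half unfolding pc
        by eventually_elim (auto simp: indicator_def split: if_splits)
      then have "m + p \<in> S"
        using mpP m(2) pe' by (simp add: S_def proj_le_iff blinfun_simps)
      moreover have "proj_le m (m + p)"
        using is_proj_orth_sum(2)[OF pm pp mp] blinfun_compose_eqD[of p m 0]
        by (simp add: proj_le_iff blinfun_simps is_projD(2)[OF pm])
      ultimately have "m + p = m" by (rule max)
      then have "adj u o\<^sub>L u = 0" by (simp add: p_def)
      then have "adj u (u \<xi>) = 0" for \<xi> using blinfun_compose_eqD[of "adj u" u 0 \<xi>] by simp
      then have "cinner (u \<xi>) (u \<xi>) = 0" for \<xi> by (simp add: adj_cinner[OF bdd[OF u(1)]])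
      then have "u = 0" by (intro blinfun_eqI) simp
      then show False using u(2) by simp
    qed
  qed
qed

lemma halving_sequence:
  assumes e: "e \<in> projections M" and na: "\<And>r. r \<in> projections M \<Longrightarrow> proj_le r e \<Longrightarrow> abelian_projection M r \<Longrightarrow> r = 0"
  obtains f where "\<And>n::nat. f n \<in> projections M" "\<And>n. AE \<omega> in \<mu>. d (f n) \<omega> \<le> d e \<omega> / 2 ^ n"
    "\<And>n E. E \<in> sets \<mu> \<Longrightarrow> chi E o\<^sub>L f n = 0 \<Longrightarrow> chi E o\<^sub>L e = 0"
proof -
  define P where "P n f \<longleftrightarrow> f \<in> projections M \<and> proj_le f e \<and> (AE \<omega> in \<mu>. d f \<omega> \<le> d e \<omega> / 2 ^ n) \<and>
    (\<forall>E\<in>sets \<mu>. chi E o\<^sub>L f = 0 \<longrightarrow> chi E o\<^sub>L e = 0)" for n :: nat and f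
  have "\<exists>f. \<forall>n. P n (f n) \<and> True"
  proof (rule dependent_nat_choice)
    show "\<exists>f. P 0 f" using e proj_le_refl[OF projectionsD(1)[OF e]] by (intro exI[of _ e]) (simp add: P_def divide_ennreal_def)
    fix f n assume f: "P n f"
    then have fe: "proj_le f e" "f \<in> projections M" by (simp_all add: P_def)
    have "r = 0" if "r \<in> projections M" "proj_le r f" "abelian_projection M r" for r
      using na[OF that(1) _ that(3)] proj_le_trans[OF that(2) fe(1)] by blast
    note na_f = this
    obtain g where g: "g \<in> projections M" "proj_le g f"
      "AE \<omega> in \<mu>. d g \<omega> \<le> d f \<omega> / 2" "\<And>E. E \<in> sets \<mu> \<Longrightarrow> chi E o\<^sub>L g = 0 \<Longrightarrow> chi E o\<^sub>L f = 0"
      by (rule halving[OF fe(2) na_f]) (assumption+, rule that)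
    have "AE \<omega> in \<mu>. d f \<omega> \<le> d e \<omega> / 2 ^ n" using f by (simp add: P_def)
    with g(3) have "AE \<omega> in \<mu>. d g \<omega> \<le> d e \<omega> / 2 ^ Suc n"
    proof eventually_elim
      case (elim \<omega>)
      have "d f \<omega> / 2 \<le> (d e \<omega> / 2 ^ n) / 2" by (rule divide_right_mono_ennreal[OF elim(2)])
      also have "\<dots> = d e \<omega> / 2 ^ Suc n"
        by (simp add: divide_ennreal_def ennreal_inverse_mult power_less_top_ennreal ac_simps)
      finally show ?case using elim(1) order_trans by blast
    qed
    then show "\<exists>g. P (Suc n) g \<and> True"
      using g f proj_le_trans[OF g(2) fe(1)] by (intro exI[of _ g]) (auto simp: P_def)
  qed
  then show ?thesis using that unfolding P_def by metis
qed

text \<open>In the presence of a type II summand the halved projections \<open>f\<^sub>n\<close> tend to \<open>0\<close> locally in measure.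
  They stay outside the \<open>t\<^sub>c(M)\<close>-open set of all \<open>x\<close> whose center-valued norm is at most some \<open>r < 1/2\<close> on more
  than half of a fixed set \<open>A\<close>, on which their central supports are \<open>1\<close>.\<close>

theorem topologies_differ_if_type_II:
  assumes II: "has_type_II_summand M" and semi: "semifinite \<mu>"
  shows "subtopology (loc_measure_topology M \<mu> \<Phi> d) (central_extension M) \<noteq> center_norm_topology M \<mu> \<Phi>"
proof
  assume eq: "subtopology (loc_measure_topology M \<mu> \<Phi> d) (central_extension M) = center_norm_topology M \<mu> \<Phi>"
  obtain v where v: "v \<in> projections (center M)" "v \<noteq> 0" "type_II (direct_summand M v)"
    using II unfolding has_type_II_summand_def by blast
  have "v \<in> projections (center (direct_summand M v))"
    using v(1) proj_le_refl[OF center_projD(1)[OF v(1)]] by (simp add: summand_center_iff[OF v(1)])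
  then obtain e where e: "finite_projection M e" "e \<noteq> 0" "proj_le e v"
    using v(2,3) unfolding type_II_def summand_finite_iff[OF v(1)] by blast
  have ab: "r = 0" if "abelian_projection M r" "proj_le r v" for r
    using v(3) that unfolding type_II_def summand_abelian_iff[OF v(1)] by blast
  have eP: "e \<in> projections M" using e(1) by (simp add: finite_projection_def)
  obtain f where f: "\<And>n::nat. f n \<in> projections M" "\<And>n. AE \<omega> in \<mu>. d (f n) \<omega> \<le> d e \<omega> / 2 ^ n"
    "\<And>n E. E \<in> sets \<mu> \<Longrightarrow> chi E o\<^sub>L f n = 0 \<Longrightarrow> chi E o\<^sub>L e = 0"
  proof (rule halving_sequence[OF eP])
    show "r = 0" if "proj_le r e" "abelian_projection M r" for r
      using ab that proj_le_trans[OF _ e(3)] by blast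
  qed (rule that)
  note [measurable] = d_measurable[OF eP] d_measurable[OF f(1)]
  define P where "P = {\<omega> \<in> space \<mu>. 0 < d e \<omega>}"
  have P: "P \<in> sets \<mu>" unfolding P_def by measurable
  have "0 < emeasure \<mu> P"
  proof (rule ccontr)
    assume "\<not> 0 < emeasure \<mu> P"
    then have "P \<in> null_sets \<mu>" using P by (auto simp: null_sets_def zero_less_iff_neq_zero)
    then have "AE \<omega> in \<mu>. \<omega> \<notin> P" by (rule AE_not_in)
    then have "AE \<omega> in \<mu>. d e \<omega> = 0" using AE_space by eventually_elim (auto simp: P_def zero_less_iff_neq_zero)
    then show False using d_eq_0D[OF eP] e(2) by blast
  qed
  \<comment> \<open>Neighborhoods refer to sets of finite measure only.\<close>
  then obtain A where A: "A \<in> sets \<mu>" "A \<subseteq> P" "0 < emeasure \<mu> A" "emeasure \<mu> A < \<infinity>"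
    using semi P unfolding semifinite_def by blast
  have fin: "emeasure \<mu> B \<noteq> \<infinity>" if "B \<subseteq> A" for B
    using emeasure_mono[OF that A(1)] A(4) by (auto simp: top_unique less_top)
  have mA: "0 < measure \<mu> A" using A(3,4) by (simp add: measure_def enn2real_positive_iff)
  \<comment> \<open>The strict inequalities for \<open>r\<close> and for the measure of \<open>B\<close> leave room for the small perturbations that
    openness asks for.\<close>
  define U where "U = {x \<in> central_extension M. \<exists>B\<in>sets \<mu>. B \<subseteq> A \<and> measure \<mu> A / 2 < measure \<mu> B \<and>
    (\<exists>r\<in>{0..<1/2}. bounded_on x (chi B) r)}"
  have "openin (center_norm_topology M \<mu> \<Phi>) U"
    unfolding openin_center_norm_topology
  proof (intro conjI ballI)
    fix x assume "x \<in> U"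
    then obtain B r where x: "x \<in> central_extension M" and B: "B \<in> sets \<mu>" "B \<subseteq> A" "measure \<mu> A / 2 < measure \<mu> B"
      and r: "0 \<le> r" "r < 1/2" "bounded_on x (chi B) r" unfolding U_def by auto
    define \<epsilon> where "\<epsilon> = (1/2 - r) / 2"
    define \<delta> where "\<delta> = (measure \<mu> B - measure \<mu> A / 2) / 2"
    have e: "0 < \<epsilon>" "r + \<epsilon> < 1/2" and \<delta>: "0 < \<delta>" using r B(3) by (simp_all add: \<epsilon>_def \<delta>_def field_simps)
    have "strong_sum x y \<in> U" if y: "y \<in> O_nbhd M \<mu> \<Phi> A \<epsilon> \<delta>" for y
    proof -
      obtain B' where yE: "y \<in> central_extension M" and B': "B' \<in> sets \<mu>" "B' \<subseteq> A" "emeasure \<mu> (A - B') \<le> ennreal \<delta>"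
        "bounded_on y (chi B') \<epsilon>" using y unfolding O_nbhd_iff[OF less_imp_le[OF e(1)]] by blast
      have BB: "B \<inter> B' \<in> sets \<mu>" using B B' by auto
      have "bounded_on (strong_sum x y) (chi (B \<inter> B')) (r + \<epsilon>)"
        by (intro bounded_on_sum bounded_on_le[OF r(3)] bounded_on_le[OF B'(4)])
          (use B B' BB in \<open>auto simp: chi_le_iff\<close>)
      moreover have "measure \<mu> A / 2 < measure \<mu> (B \<inter> B')"
      proof -
        have "measure \<mu> (A - B') \<le> \<delta>"
          using B'(3) \<delta> by (simp add: measure_def enn2real_leI)
        moreover have "measure \<mu> B \<le> measure \<mu> ((B \<inter> B') \<union> (A - B'))"
          using B B' A fin[of "(B \<inter> B') \<union> (A - B')"] by (intro measure_mono_fmeasurable) (auto simp: fmeasurable_def less_top)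
        moreover have "measure \<mu> ((B \<inter> B') \<union> (A - B')) \<le> measure \<mu> (B \<inter> B') + measure \<mu> (A - B')"
          using B B' A by (intro measure_Un_le) auto
        ultimately show ?thesis using B(3) by (simp add: \<delta>_def field_simps)
      qed
      ultimately show ?thesis
        unfolding U_def using central_extension_sum[OF x yE] BB B(2) e r(1)
        by (intro CollectI conjI bexI[of _ "B \<inter> B'"] bexI[of _ "r + \<epsilon>"]) auto
    qed
    then show "\<exists>A\<in>sets \<mu>. \<exists>\<epsilon>>0. \<exists>\<delta>>0. emeasure \<mu> A < \<infinity> \<and> strong_sum x ` O_nbhd M \<mu> \<Phi> A \<epsilon> \<delta> \<subseteq> U"
      using A(1,4) e(1) \<delta> by blast
  qed (auto simp: U_def)
  then obtain S where S: "openin (loc_measure_topology M \<mu> \<Phi> d) S" "U = S \<inter> central_extension M"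
    unfolding eq[symmetric] openin_subtopology by blast
  have "op_graph 0 \<in> U"
  proof -
    have "bounded_on (op_graph 0) (chi A) 0" by (simp add: bounded_on_def op_graph_iff)
    then show ?thesis
      unfolding U_def using op_graph_central_extension[OF zero] A(1) mA
      by (intro CollectI conjI bexI[of _ A] bexI[of _ 0]) auto
  qed
  then obtain A' \<epsilon> \<delta> where A': "A' \<in> sets \<mu>" "emeasure \<mu> A' < \<infinity>" "0 < \<epsilon>" "0 < \<delta>"
    "strong_sum (op_graph 0) ` V_nbhd M \<mu> \<Phi> d A' \<epsilon> \<delta> \<subseteq> S"
    using S unfolding openin_loc_measure_topology by blast
  obtain n E where E: "E \<in> sets \<mu>" "AE \<omega> in \<mu>. \<omega> \<in> E \<longrightarrow> d (f n) \<omega> \<le> ennreal \<epsilon>" "emeasure \<mu> (A' - E) \<le> ennreal \<delta>"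
  proof -
    \<comment> \<open>These sets exhaust \<open>A'\<close> because \<open>d e\<close> is finite, and \<open>d (f n) \<le> \<epsilon>\<close> on \<open>G n\<close>.\<close>
    define G where "G n = {\<omega> \<in> space \<mu>. d e \<omega> \<le> ennreal \<epsilon> * 2 ^ n}" for n :: nat
    have G: "G n \<in> sets \<mu>" for n unfolding G_def by measurable
    have "(\<lambda>n. emeasure \<mu> (A' - G n)) \<longlonglongrightarrow> emeasure \<mu> (\<Inter>n. A' - G n)"
    proof (rule Lim_emeasure_decseq)
      show "range (\<lambda>n. A' - G n) \<subseteq> sets \<mu>" using A'(1) G by auto
      have "G m \<subseteq> G n" if "m \<le> n" for m n
      proof -
        have "ennreal \<epsilon> * 2 ^ m \<le> ennreal \<epsilon> * 2 ^ n"
          using that by (intro mult_left_mono power_increasing) auto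
        then show ?thesis by (auto simp: G_def intro: order_trans)
      qed
      then show "decseq (\<lambda>n. A' - G n)" by (auto simp: decseq_def)
      show "emeasure \<mu> (A' - G n) \<noteq> \<infinity>" for n
        using emeasure_mono[of "A' - G n" A' \<mu>] A' by (auto simp: top_unique less_top)
    qed
    moreover have "emeasure \<mu> (\<Inter>n. A' - G n) = 0"
    proof -
      have "AE \<omega> in \<mu>. d e \<omega> < \<infinity>" using d_finite[OF eP] e(1) by blast
      then have "AE \<omega> in \<mu>. \<omega> \<notin> (\<Inter>n. A' - G n)"
        using AE_space
      proof eventually_elim
        case (elim \<omega>)
        obtain n where n: "enn2real (d e \<omega>) / \<epsilon> < 2 ^ n" using real_arch_pow[of 2 "enn2real (d e \<omega>) / \<epsilon>"] by auto
        then have "enn2real (d e \<omega>) \<le> \<epsilon> * 2 ^ n" using A'(3) by (simp add: field_simps)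
        then have "ennreal (enn2real (d e \<omega>)) \<le> ennreal (\<epsilon> * 2 ^ n)" by (rule ennreal_leI)
        then have "d e \<omega> \<le> ennreal \<epsilon> * 2 ^ n"
          using elim(1) A'(3) by (simp add: ennreal_mult' flip: ennreal_power)
        then show ?case using elim(2) by (auto simp: G_def)
      qed
      moreover have "(\<Inter>n. A' - G n) \<in> sets \<mu>" using A' G by auto
      ultimately show ?thesis using AE_iff_null_sets null_setsD1 by blast
    qed
    ultimately have "\<forall>\<^sub>F n in sequentially. emeasure \<mu> (A' - G n) < ennreal \<delta>"
      using A'(4) by (intro order_tendstoD) auto
    then obtain n where n: "emeasure \<mu> (A' - G n) < ennreal \<delta>" using eventually_happens sequentially_bot by blast
    have "AE \<omega> in \<mu>. \<omega> \<in> G n \<longrightarrow> d (f n) \<omega> \<le> ennreal \<epsilon>"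
      using f(2)[of n]
    proof eventually_elim
      case (elim \<omega>)
      show ?case
      proof
        assume "\<omega> \<in> G n"
        then have "d e \<omega> / 2 ^ n \<le> (ennreal \<epsilon> * 2 ^ n) / 2 ^ n" by (intro divide_right_mono_ennreal) (simp add: G_def)
        also have "\<dots> = ennreal \<epsilon>" by (rule ennreal_mult_divide_eq) (simp_all add: power_eq_top_ennreal)
        finally show "d (f n) \<omega> \<le> ennreal \<epsilon>" using elim order_trans by blast
      qed
    qed
    then show ?thesis using that[OF G] n less_imp_le by blast
  qed
  note fP = f(1)[of n] and pf = projectionsD(1)[OF f(1)[of n]] and fM = projectionsD(2)[OF f(1)[of n]]
  have "op_graph (f n) \<in> V_nbhd M \<mu> \<Phi> d A' \<epsilon> \<delta>"
  proof -
    have cE: "space \<mu> - E \<in> sets \<mu>" using E(1) by auto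
    have "indicator (space \<mu> - E) \<in> W_nbhd \<mu> A' \<epsilon> \<delta>"
      unfolding W_nbhd_iff[OF less_imp_le[OF A'(3)]]
    proof (intro conjI bexI[of _ "A' \<inter> E"])
      show "indicator (space \<mu> - E) \<in> borel_measurable \<mu>" using cE by measurable
      show "AE \<omega> in \<mu>. \<omega> \<in> A' \<inter> E \<longrightarrow> cmod (indicator (space \<mu> - E) \<omega>) \<le> \<epsilon>"
        using A'(3) by (auto intro!: AE_I2 simp: indicator_def)
      have "A' - A' \<inter> E = A' - E" by auto
      then show "emeasure \<mu> (A' - A' \<inter> E) \<le> ennreal \<delta>" using E(3) by simp
    qed (use E A' in auto)
    moreover have "represents M \<mu> \<Phi> (indicator (space \<mu> - E)) (op_graph (perp (chi E)))"
      using represents_chi[OF cE] by (simp add: chi_compl[OF E(1)])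
    moreover have "strong_prod (op_graph (f n)) (op_graph (perp (f n))) = op_graph 0"
      by (rule strong_prod_right[OF closed_operator_op_graph[OF is_projD(1)[OF pf]]])
        (simp add: op_graph_iff blinfun_simps is_projD(2)[OF pf])
    moreover have "AE \<omega> in \<mu>. d (chi E o\<^sub>L perp (perp (f n))) \<omega> \<le> ennreal \<epsilon> * indicator E \<omega>"
      using d_chi[OF E(1) fP] E(2) by eventually_elim (auto simp: indicator_def)
    moreover have "op_graph (f n) \<in> loc_measurable_ops M"
      using op_graph_central_extension[OF fM] center_extension_LS by blast
    moreover have "norm (0 :: 'a \<Rightarrow>\<^sub>L 'a) \<le> \<epsilon>" using A'(3) by simp
    ultimately show ?thesis
      unfolding V_nbhd_def chi_def[symmetric]
      using perp_projection[OF fP] chi_center_proj[OF E(1)] E(1) zero by blast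
  qed
  moreover have "strong_sum (op_graph 0) (op_graph (f n)) = op_graph (f n)"
  proof -
    have "{(\<xi>, \<eta> + \<zeta>) |\<xi> \<eta> \<zeta>. (\<xi>, \<eta>) \<in> op_graph 0 \<and> (\<xi>, \<zeta>) \<in> op_graph (f n)} = op_graph (f n)"
      by (auto simp: op_graph_iff op_graph_def)
    then show ?thesis
      using closed_operator_op_graph[OF is_projD(1)[OF pf]] by (simp add: strong_sum_def closed_operator_def)
  qed
  ultimately have "op_graph (f n) \<in> U"
    using A'(5) S(2) op_graph_central_extension[OF fM] by (metis IntI image_eqI subsetD)
  then obtain B r where B: "B \<in> sets \<mu>" "B \<subseteq> A" "measure \<mu> A / 2 < measure \<mu> B"
    and r: "r < 1/2" "bounded_on (op_graph (f n)) (chi B) r" unfolding U_def by auto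
  have "chi B o\<^sub>L f n = 0"
  proof (rule blinfun_eqI)
    fix \<xi>
    let ?\<zeta> = "chi B (f n \<xi>)"
    have "f n ?\<zeta> = ?\<zeta>" using chi_commute[OF B(1) fM, of "f n \<xi>"] by (simp add: is_projD(2)[OF pf])
    moreover have "norm (f n ?\<zeta>) \<le> r * norm ?\<zeta>"
      using r(2) is_projD(2)[OF chi_proj[OF B(1)]] unfolding bounded_on_def op_graph_iff by blast
    ultimately have "norm ?\<zeta> \<le> r * norm ?\<zeta>" by simp
    then have "(1 - r) * norm ?\<zeta> \<le> 0" by (simp add: algebra_simps)
    then have "norm ?\<zeta> \<le> 0" using r(1) by (simp add: mult_le_0_iff)
    then show "(chi B o\<^sub>L f n) \<xi> = blinfun_apply 0 \<xi>" by simp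
  qed
  then have "chi B o\<^sub>L e = 0" by (rule f(3)[OF B(1)])
  then have "AE \<omega> in \<mu>. \<omega> \<in> B \<longrightarrow> d e \<omega> = 0" using chi_cut_eq_0_iff[OF B(1) eP] by blast
  then have "AE \<omega> in \<mu>. \<omega> \<notin> B" by eventually_elim (use B(2) A(2) in \<open>auto simp: P_def\<close>)
  then have "emeasure \<mu> B = 0" using AE_iff_null_sets[OF B(1)] null_setsD1 by blast
  then have "measure \<mu> B = 0" by (simp add: measure_def)
  then show False using B(3) mA by simp
qed

end

theorem theorem3p9:
  fixes M :: "('a::complex_hilbert_space \<Rightarrow>\<^sub>L 'a) set"
    and \<mu> :: "'b measure"
    and \<Phi> :: "('b \<Rightarrow> complex) \<Rightarrow> 'a \<Rightarrow>\<^sub>L 'a"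
    and d :: "('a \<Rightarrow>\<^sub>L 'a) \<Rightarrow> 'b \<Rightarrow> ennreal"
  assumes "von_neumann_algebra M"
    and "direct_sum_property \<mu>"
    and "semifinite \<mu>"
    and "center_iso M \<mu> \<Phi>"
    and "dimension_function M \<mu> \<Phi> d"
  shows "subtopology (loc_measure_topology M \<mu> \<Phi> d) (central_extension M)
           = center_norm_topology M \<mu> \<Phi>
         \<longleftrightarrow> \<not> has_type_II_summand M"
proof -
  interpret dimension_algebra M \<mu> \<Phi> d
    by unfold_locales (rule assms)+
  show ?thesis
    using topologies_agree_if_no_type_II topologies_differ_if_type_II[OF _ assms(3)] by blast
qed

end
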